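(* The contraction principle for transport inequalities (stated in the context), applied to the map evaluating a path at time 1, (i) gives the implication $$\mu\in\mathcal T_2(\Omega,c_{\mathcal H},\alpha)\ \Longrightarrow\ \mu_1\in\mathcal T_2(\mathbb R^d,|\cdot-\cdot|,\alpha),$$ where $\mu$ is Wiener measure on $\Omega=C_0([0,1],\mathbb R^d)$, $\mu_1$ is its time-1 marginal, and $c_{\mathcal H}$ is the Cameron–Martin cost $\|\cdot-\cdot\|_{\mathcal H}$; (ii) does not give the implication $$\boldsymbol\mu\in\mathcal T_2(\boldsymbol\Omega_{\mathbb G},C_{\mathcal H},\alpha)\ \Longrightarrow\ \boldsymbol\mu_1\in\mathcal T_2(\mathbb G,d_{cc},\alpha'),$$ no matter $\alpha,\alpha'>0$, where $\mathbb G$ is a step-2 Carnot group, $\boldsymbol\mu$ is the law of Brownian motion on $\mathbb G$, regarded as a measure on $\boldsymbol\Omega_{\mathbb G}=C_0([0,1],\mathbb G)$, and $\boldsymbol\mu_1$ is its time-1 marginal; (iii) gives the weak implication $$\boldsymbol\mu^\varepsilon\in\mathcal T_2(\boldsymbol\Omega_{\mathbb H_\varepsilon},C^\varepsilon_{\mathcal H},\alpha)\ \Longrightarrow\ \boldsymbol\mu^\varepsilon_1\in\mathcal T_p(\mathbb H_\varepsilon,d_\varepsilon,\tilde\alpha(\varepsilon,p))\qquad\text{for }p\in[1,2),$$ with some constant $\tilde\alpha(\varepsilon,p)>0$, where $(\mathbb H_\varepsilon,d_\varepsilon)$, $\varepsilon>0$, is a Riemannian approximation to the $(2+1)$-dimensional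 Heisenberg group, $\boldsymbol\mu^\varepsilon$ is the law of Brownian motion $\boldsymbol B^\varepsilon$ on it, and $\boldsymbol\mu^\varepsilon_1$ is the law of $\boldsymbol B^\varepsilon_1$.
   Context: Transport inequalities: $\Pi(\mu,\nu)$ is the set of couplings; $H(\nu\|\mu)=\int\log\frac{d\nu}{d\mu}d\nu$ if $\nu\ll\mu$, $+\infty$ otherwise. For a Polish space $E$ and measurable $c:E\times E\to[0,\infty]$, $\mu\in\mathcal T_p(E,c,\alpha)$ (with $\alpha>0$, $p\in[1,\infty)$) means $\big(\inf_{\lambda\in\Pi(\mu,\nu)}\int c^p d\lambda\big)^{1/p}\le\sqrt{\tfrac2\alpha H(\nu\|\mu)}$ for all Borel probability measures $\nu$ on $E$. Contraction principle: let $E$ be a Polish metric space, $S$ a metric space, $c:E\times E\to[0,\infty]$ and $\tilde c:S\times S\to[0,\infty]$ Borel measurable, $\eta$ a Borel probability measure on $E$, and $\psi:E\to S$, $L:E\to[0,\infty]$ measurable with $\tilde c(\psi(x),\psi(\bar x))\le L(x)\,c(x,\bar x)$ for all $x,\bar x\in E_0$, where $E_0\subseteq E$ has $\eta(E_0)=1$. If $\eta\in\mathcal T_2(E,c,\alpha)$ for some $\alpha\in(0,\infty)$, then for every $p\in[1,2]$ such that $L\in L^q(\eta)$ with $q=\tfrac{2p}{2-p}\in[2,\infty]$ one has $\psi_\sharp\eta\in\mathcal T_p(S,\tilde c,\alpha\|L\|_{L^q(\eta)}^{-2})$. That the contraction principle "gives" (or "does not give") a $\mathcal T_p$ inequality for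 the time-1 marginal means that its hypotheses can (or cannot) be satisfied, for this $p$, with $\psi$ the evaluation of paths at time 1, with $c$ the indicated cost on path space and $\tilde c$ the indicated distance on the state space, for some function $L$. $C_0$ denotes continuous paths started at the origin, with the uniform topology. For a Euclidean space $\mathbb R^k$, $\mathcal H=W^{1,2}_0([0,1],\mathbb R^k)$ (the functions in $W^{1,2}$ vanishing at $0$), $\|h\|_{\mathcal H}^2=\int_0^1|\dot h_t|^2dt$. For (i): $k=d$; $c_{\mathcal H}(x,y)=\|y-x\|_{\mathcal H}$ if $y-x\in\mathcal H$, $+\infty$ otherwise; $|\cdot|$ is the Euclidean norm. For (ii): $k=d_1$. A step-2 Carnot group is identified via exponential coordinates with $\mathbb R^{d_1}\oplus\mathbb R^{d_2}$, $d_2\ge1$, elements $x=(x^{(1)},x^{(2)})$, with structure constants $w_{ij}=-w_{ji}\in\mathbb R^{d_2}$ ($1\le i,j\le d_1$) spanning $\mathbb R^{d_2}$; $\mathcal W A=\sum_{i,j}w_{ij}A_{ij}$; group law $xy=(x^{(1)}+y^{(1)},x^{(2)}+y^{(2)}+\tfrac12\mathcal W(x^{(1)}\otimes y^{(1)}))$. A horizontal curve is an absolutely continuous $\gamma:[0,1]\to\mathbb G$ with $\dot\gamma^{(2)}=\tfrac12\mathcal W(\gamma^{(1)}\otimes\dot\gamma^{(1)})$ a.e., of length $\int_0^1|\dot\gamma^{(1)}_t|dt$; $d_{cc}(x,y)$ is the infimum of lengths of horizontal curves from $x$ to $y$. Brownian motion on $\mathbb G$: $\boldsymbol B_t=(B_t,\tfrac12\int_0^t\mathcal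 W(B_s\otimes dB_s))$ with $B$ a standard $d_1$-dimensional Brownian motion. Shift: $(T_h\boldsymbol X)^{(1)}_t=\boldsymbol X^{(1)}_t+h_t$, $(T_h\boldsymbol X)^{(2)}_t=\boldsymbol X^{(2)}_t+\tfrac12\mathcal W\big(\int_0^t\boldsymbol X^{(1)}_s\otimes dh_s+\int_0^t h_s\otimes d\boldsymbol X^{(1)}_s+\int_0^t h_s\otimes dh_s\big)$. $C_{\mathcal H}(\boldsymbol X,\boldsymbol Y)=\|h\|_{\mathcal H}$ if $\boldsymbol Y=T_h\boldsymbol X$ for some (necessarily unique) $h\in\mathcal H$, $+\infty$ otherwise. For (iii): $k=3$. $\mathbb H_\varepsilon$ is $\mathbb R^3$ with group law $(x,y,z)(x',y',z')=(x+x',y+y',z+z'+\tfrac12(xy'-x'y))$ and the left-invariant Riemannian metric for which $\partial_x-\tfrac12y\partial_z,\ \partial_y+\tfrac12x\partial_z,\ \varepsilon\partial_z$ are orthonormal. Its distance is $d_\varepsilon(a,b)=\inf_\gamma\int_0^1\sqrt{|\dot\gamma^1_t|^2+|\dot\gamma^2_t|^2+\varepsilon^{-2}|\dot\gamma^3_t-\tfrac12(\gamma^1_t\dot\gamma^2_t-\dot\gamma^1_t\gamma^2_t)|^2}\,dt$ over absolutely continuous $\gamma$ from $a$ to $b$. $\boldsymbol\Omega_{\mathbb H_\varepsilon}=C_0([0,1],\mathbb H_\varepsilon)$. With $B$ a standard Brownian motion in $\mathbb R^3$, $\boldsymbol B^\varepsilon_t=(B^1_t,B^2_t,\tfrac12\int_0^t(B^1_sdB^2_s-B^2_sdB^1_s)+\varepsilon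 B^3_t)$. For $h=(h^1,h^2,h^3)\in\mathcal H$, $T^\varepsilon_h\boldsymbol\omega$ has components $\boldsymbol\omega^1+h^1$, $\boldsymbol\omega^2+h^2$ and $\boldsymbol\omega^3_t+\varepsilon h^3_t+\tfrac12\int_0^t(\boldsymbol\omega^1dh^2-\boldsymbol\omega^2dh^1)+\tfrac12\int_0^t(h^1d\boldsymbol\omega^2-h^2d\boldsymbol\omega^1)+\tfrac12\int_0^t(h^1dh^2-h^2dh^1)$. $C^\varepsilon_{\mathcal H}(\boldsymbol\omega,\tilde{\boldsymbol\omega})=\|h\|_{\mathcal H}$ if $\tilde{\boldsymbol\omega}=T^\varepsilon_h\boldsymbol\omega$ for some (necessarily unique) $h\in\mathcal H$, $+\infty$ otherwise. Pathwise integrals in the definitions of the shifts are Riemann–Stieltjes. *)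

theory Defs
  imports "HOL-Probability.Probability"
begin

section \<open>Transport inequalities\<close>

definition borel_of :: "'a topology \<Rightarrow> 'a measure" where
  "borel_of X = sigma (topspace X) {U. openin X U}"

definition polish :: "'a topology \<Rightarrow> bool" where
  "polish X \<longleftrightarrow> completely_metrizable_space X \<and> second_countable X"

text \<open>Real powers with exponent \<open>r > 0\<close> on \<open>[0,\<infinity>]\<close>.\<close>

definition epowr :: "ennreal \<Rightarrow> real \<Rightarrow> ennreal" where
  "epowr x r = (if x = \<infinity> then \<infinity> else ennreal (enn2real x powr r))"

text \<open>\<open>H(\<nu>\<parallel>\<mu>)\<close>. For probability measures the negative part of \<open>log (d\<nu>/d\<mu>)\<close> is always
  \<open>\<nu>\<close>-integrable and the integral is nonnegative, so if the density of \<open>\<nu> \<lless> \<mu>\<close> has a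
  non-integrable logarithm then the integral is \<open>+\<infinity>\<close>, and \<open>ennreal\<close> truncates nothing.\<close>

definition rel_entropy :: "'a measure \<Rightarrow> 'a measure \<Rightarrow> ennreal" where
  "rel_entropy \<nu> \<mu> =
     (if absolutely_continuous \<mu> \<nu> \<and> integrable \<nu> (entropy_density (exp 1) \<mu> \<nu>)
      then ennreal (KL_divergence (exp 1) \<mu> \<nu>) else \<infinity>)"

definition couplings :: "'a measure \<Rightarrow> 'b measure \<Rightarrow> ('a \<times> 'b) measure set" where
  "couplings \<mu> \<nu> = {\<pi>. sets \<pi> = sets (\<mu> \<Otimes>\<^sub>M \<nu>) \<and> distr \<pi> \<mu> fst = \<mu> \<and> distr \<pi> \<nu> snd = \<nu>}"

definition transport_cost ::
    "('a \<Rightarrow> 'a \<Rightarrow> ennreal) \<Rightarrow> real \<Rightarrow> 'a measure \<Rightarrow> 'a measure \<Rightarrow> ennreal" where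
  "transport_cost c p \<mu> \<nu> =
     epowr (INF \<pi>\<in>couplings \<mu> \<nu>. \<integral>\<^sup>+ z. epowr (c (fst z) (snd z)) p \<partial>\<pi>) (1 / p)"

text \<open>\<open>\<mu> \<in> T\<^sub>p(E, c, \<alpha>)\<close>\<close>

definition transport_ineq ::
    "'a topology \<Rightarrow> ('a \<Rightarrow> 'a \<Rightarrow> ennreal) \<Rightarrow> real \<Rightarrow> real \<Rightarrow> 'a measure \<Rightarrow> bool" where
  "transport_ineq E c p \<alpha> \<mu> \<longleftrightarrow>
     (\<forall>\<nu>. prob_space \<nu> \<and> sets \<nu> = sets (borel_of E) \<longrightarrow>
        transport_cost c p \<mu> \<nu> \<le> epowr (ennreal (2 / \<alpha>) * rel_entropy \<nu> \<mu>) (1 / 2))"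


section \<open>The contraction principle\<close>

definition Lq_norm :: "'a measure \<Rightarrow> ennreal \<Rightarrow> ('a \<Rightarrow> ennreal) \<Rightarrow> ennreal" where
  "Lq_norm M q f =
     (if q = \<infinity> then esssup M f
      else epowr (\<integral>\<^sup>+ x. epowr (f x) (enn2real q) \<partial>M) (1 / enn2real q))"

text \<open>\<open>q = 2p / (2 - p)\<close>; division in \<^typ>\<open>ennreal\<close> gives \<open>q = \<infinity>\<close> for \<open>p = 2\<close>.\<close>

definition contraction_exponent :: "real \<Rightarrow> ennreal" where
  "contraction_exponent p = ennreal (2 * p) / ennreal (2 - p)"

text \<open>The standing hypotheses on spaces, costs, the measure and the map. Only the topologies of
  the two metric spaces matter. The product sigma-algebra is the Borel sigma-algebra of
  the product for second countable spaces, which are the only ones occurring below.\<close>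

definition contraction_setting ::
    "'a topology \<Rightarrow> ('a \<Rightarrow> 'a \<Rightarrow> ennreal) \<Rightarrow> 'b topology \<Rightarrow> ('b \<Rightarrow> 'b \<Rightarrow> ennreal) \<Rightarrow>
     'a measure \<Rightarrow> ('a \<Rightarrow> 'b) \<Rightarrow> bool" where
  "contraction_setting E c S c' \<eta> \<psi> \<longleftrightarrow>
     polish E \<and> metrizable_space S \<and>
     (\<lambda>(x, y). c x y) \<in> borel_measurable (borel_of E \<Otimes>\<^sub>M borel_of E) \<and>
     (\<lambda>(x, y). c' x y) \<in> borel_measurable (borel_of S \<Otimes>\<^sub>M borel_of S) \<and>
     prob_space \<eta> \<and> sets \<eta> = sets (borel_of E) \<and>
     \<psi> \<in> borel_of E \<rightarrow>\<^sub>M borel_of S"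

text \<open>The hypotheses on \<open>L\<close>: \<open>c'(\<psi>(x), \<psi>(x')) \<le> L(x) c(x, x')\<close> on a set of full measure, and
  \<open>L \<in> L\<^sup>q(\<eta>)\<close>. The convention \<open>0 \<cdot> \<infinity> = 0\<close> is immaterial for solvability, as \<open>L\<close> may be
  replaced by \<open>max 1 L\<close>.\<close>

definition contraction_weight ::
    "('a \<Rightarrow> 'a \<Rightarrow> ennreal) \<Rightarrow> ('b \<Rightarrow> 'b \<Rightarrow> ennreal) \<Rightarrow> 'a measure \<Rightarrow> ('a \<Rightarrow> 'b) \<Rightarrow> real \<Rightarrow>
     ('a \<Rightarrow> ennreal) \<Rightarrow> bool" where
  "contraction_weight c c' \<eta> \<psi> p L \<longleftrightarrow>
     L \<in> borel_measurable \<eta> \<and>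
     (\<exists>E0\<in>sets \<eta>. emeasure \<eta> E0 = 1 \<and> (\<forall>x\<in>E0. \<forall>x'\<in>E0. c' (\<psi> x) (\<psi> x') \<le> L x * c x x')) \<and>
     Lq_norm \<eta> (contraction_exponent p) L < \<infinity>"

text \<open>The hypotheses, apart from the antecedent \<open>\<eta> \<in> T\<^sub>2(E, c, \<alpha>)\<close>, can be satisfied for \<open>p\<close>
  by some \<open>L\<close>, so that the principle turns \<open>T\<^sub>2(E, c, \<alpha>)\<close> for \<open>\<eta>\<close> into
  \<open>T\<^sub>p(S, c', \<alpha> \<kappa>)\<close> for the image measure, where \<open>\<kappa>\<close> is \<open>\<parallel>L\<parallel>\<^sup>-\<^sup>2\<close> with the norm of \<open>L\<^sup>q(\<eta>)\<close>.\<close>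

definition contraction_gives ::
    "'a topology \<Rightarrow> ('a \<Rightarrow> 'a \<Rightarrow> ennreal) \<Rightarrow> 'b topology \<Rightarrow> ('b \<Rightarrow> 'b \<Rightarrow> ennreal) \<Rightarrow>
     'a measure \<Rightarrow> ('a \<Rightarrow> 'b) \<Rightarrow> real \<Rightarrow> real \<Rightarrow> bool" where
  "contraction_gives E c S c' \<eta> \<psi> p \<kappa> \<longleftrightarrow>
     contraction_setting E c S c' \<eta> \<psi> \<and> 0 < \<kappa> \<and>
     (\<exists>L. contraction_weight c c' \<eta> \<psi> p L \<and>
          ennreal \<kappa> = inverse ((Lq_norm \<eta> (contraction_exponent p) L)\<^sup>2))"


section \<open>Path space and the Cameron--Martin space\<close>

text \<open>\<open>C\<^sub>0([0,1], V)\<close> with the uniform metric; paths are extensional functions on \<open>[0,1]\<close>. Carnot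
  groups and their Riemannian approximations carry the Euclidean topology in exponential
  coordinates, and since \<open>[0,1]\<close> is compact the topology of uniform convergence on path space
  depends only on that topology.\<close>

definition path_space :: "(real \<Rightarrow> 'v::euclidean_space) topology" where
  "path_space =
     mtopology_of (submetric (cfunspace (top_of_set {0..1}) euclidean_metric) {x. x 0 = 0})"

definition path_law ::
    "'w measure \<Rightarrow> (real \<Rightarrow> 'w \<Rightarrow> 'v::euclidean_space) \<Rightarrow> (real \<Rightarrow> 'v) measure" where
  "path_law M X = distr M (borel_of path_space) (\<lambda>\<omega>. \<lambda>t\<in>{0..1}. X t \<omega>)"

definition time1 :: "(real \<Rightarrow> 'v) \<Rightarrow> 'v" where
  "time1 x = x 1"

text \<open>\<open>\<gamma>\<close> is absolutely continuous on \<open>[0,1]\<close> with a.e. derivative \<open>g\<close>. Absolute continuity is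
  taken in the form ``\<open>\<gamma>\<close> is the integral of an \<open>L\<^sup>1\<close> function''; that function is then a.e.
  unique.\<close>

definition has_ac_derivative :: "(real \<Rightarrow> 'v::euclidean_space) \<Rightarrow> (real \<Rightarrow> 'v) \<Rightarrow> bool" where
  "has_ac_derivative \<gamma> g \<longleftrightarrow>
     set_integrable lborel {0..1} g \<and> (\<forall>t\<in>{0..1}. \<gamma> t = \<gamma> 0 + (LINT s:{0..t}|lborel. g s))"

definition cameron_martin :: "(real \<Rightarrow> 'v::euclidean_space) set" where
  "cameron_martin =
     {h. h 0 = 0 \<and>
         (\<exists>g. has_ac_derivative h g \<and> set_integrable lborel {0..1} (\<lambda>t. (norm (g t))\<^sup>2))}"

definition cm_norm :: "(real \<Rightarrow> 'v::euclidean_space) \<Rightarrow> real" where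
  "cm_norm h =
     sqrt (LINT t:{0..1}|lborel. (norm ((SOME g. has_ac_derivative h g) t))\<^sup>2)"

definition cm_cost :: "(real \<Rightarrow> 'v::euclidean_space) \<Rightarrow> (real \<Rightarrow> 'v) \<Rightarrow> ennreal" where
  "cm_cost x y =
     (if (\<lambda>t. y t - x t) \<in> cameron_martin then ennreal (cm_norm (\<lambda>t. y t - x t)) else \<infinity>)"

text \<open>The cost induced by a family of shifts \<open>T h\<close>; for the shifts below at most one \<open>h\<close>
  (as a function on \<open>[0,1]\<close>) satisfies \<open>Y = T h X\<close>, so the choice does not matter.\<close>

definition shift_cost ::
    "((real \<Rightarrow> 'u::euclidean_space) \<Rightarrow> (real \<Rightarrow> 'v) \<Rightarrow> (real \<Rightarrow> 'v)) \<Rightarrow>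
     (real \<Rightarrow> 'v) \<Rightarrow> (real \<Rightarrow> 'v) \<Rightarrow> ennreal" where
  "shift_cost T X Y =
     (if \<exists>h\<in>cameron_martin. Y = T h X
      then ennreal (cm_norm (SOME h. h \<in> cameron_martin \<and> Y = T h X)) else \<infinity>)"

text \<open>Riemann--Stieltjes integral \<open>\<integral>\<^sub>a\<^sup>b f dg\<close>: the gauge is constant, so fineness is a condition
  on the mesh only.\<close>

definition has_rs_integral ::
    "(real \<Rightarrow> real) \<Rightarrow> (real \<Rightarrow> real) \<Rightarrow> real \<Rightarrow> real \<Rightarrow> real \<Rightarrow> bool" where
  "has_rs_integral f g a b I \<longleftrightarrow>
     (\<forall>e>0. \<exists>\<delta>>0. \<forall>p. p tagged_division_of {a..b} \<and> (\<lambda>x. ball x \<delta>) fine p \<longrightarrow>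
        \<bar>(\<Sum>(x, K)\<in>p. f x * (g (Sup K) - g (Inf K))) - I\<bar> < e)"

definition rs_integral :: "(real \<Rightarrow> real) \<Rightarrow> (real \<Rightarrow> real) \<Rightarrow> real \<Rightarrow> real \<Rightarrow> real" where
  "rs_integral f g a b = (THE I. has_rs_integral f g a b I)"


section \<open>Brownian motion and Ito integrals\<close>

definition standard_BM :: "'w measure \<Rightarrow> (real \<Rightarrow> 'w \<Rightarrow> real ^ 'k) \<Rightarrow> bool" where
  "standard_BM M B \<longleftrightarrow>
     prob_space M \<and>
     (\<forall>t\<in>{0..1}. B t \<in> borel_measurable M) \<and>
     (\<forall>\<omega>\<in>space M. B 0 \<omega> = 0 \<and> continuous_on {0..1} (\<lambda>t. B t \<omega>)) \<and>
     (\<forall>s t i. 0 \<le> s \<and> s < t \<and> t \<le> 1 \<longrightarrow>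
        distributed M lborel (\<lambda>\<omega>. B t \<omega> $ i - B s \<omega> $ i) (normal_density 0 (sqrt (t - s)))) \<and>
     (\<forall>n (t :: nat \<Rightarrow> real). 0 \<le> t 0 \<and> (\<forall>k<n. t k < t (Suc k)) \<and> t n \<le> 1 \<longrightarrow>
        prob_space.indep_vars M (\<lambda>_. borel)
          (\<lambda>(k, i) \<omega>. B (t (Suc k)) \<omega> $ i - B (t k) \<omega> $ i) ({..<n} \<times> UNIV))"

text \<open>\<open>I = \<integral>\<^sub>0\<^sup>t X dY\<close> in the sense of Ito, for continuous adapted integrands: the limit in
  probability of the left-point sums along every sequence of partitions \<open>\<tau> j\<close> (with \<open>n j\<close>
  intervals) of \<open>[0,t]\<close> with mesh tending to \<open>0\<close>.\<close>

definition ito_integral ::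
    "'w measure \<Rightarrow> (real \<Rightarrow> 'w \<Rightarrow> real) \<Rightarrow> (real \<Rightarrow> 'w \<Rightarrow> real) \<Rightarrow> real \<Rightarrow> ('w \<Rightarrow> real) \<Rightarrow> bool" where
  "ito_integral M X Y t I \<longleftrightarrow>
     I \<in> borel_measurable M \<and>
     (\<forall>(n :: nat \<Rightarrow> nat) (\<tau> :: nat \<Rightarrow> nat \<Rightarrow> real).
        (\<forall>j. \<tau> j 0 = 0 \<and> \<tau> j (n j) = t \<and> (\<forall>k<n j. \<tau> j k \<le> \<tau> j (Suc k))) \<and>
        (\<forall>\<delta>>0. \<forall>\<^sub>F j in sequentially. \<forall>k<n j. \<tau> j (Suc k) - \<tau> j k < \<delta>) \<longrightarrow>
        (\<forall>e>0. (\<lambda>j. measure M {\<omega> \<in> space M.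
             e < \<bar>(\<Sum>k<n j. X (\<tau> j k) \<omega> * (Y (\<tau> j (Suc k)) \<omega> - Y (\<tau> j k) \<omega>)) - I \<omega>\<bar>})
           \<longlonglongrightarrow> 0))"


section \<open>Step-2 Carnot groups\<close>

definition carnot_constants :: "('m::finite \<Rightarrow> 'm \<Rightarrow> real ^ 'n) \<Rightarrow> bool" where
  "carnot_constants w \<longleftrightarrow>
     (\<forall>i j. w i j = - w j i) \<and> span (range (\<lambda>(i, j). w i j)) = UNIV"

definition carnot_W :: "('m::finite \<Rightarrow> 'm \<Rightarrow> real ^ 'n) \<Rightarrow> ('m \<Rightarrow> 'm \<Rightarrow> real) \<Rightarrow> real ^ 'n" where
  "carnot_W w A = (\<Sum>i\<in>UNIV. \<Sum>j\<in>UNIV. A i j *\<^sub>R w i j)"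

text \<open>\<open>\<gamma>\<close> is a horizontal curve with a.e. derivative \<open>g\<close>.\<close>

definition horizontal ::
    "('m::finite \<Rightarrow> 'm \<Rightarrow> real ^ 'n) \<Rightarrow> (real \<Rightarrow> (real ^ 'm) \<times> (real ^ 'n)) \<Rightarrow>
     (real \<Rightarrow> (real ^ 'm) \<times> (real ^ 'n)) \<Rightarrow> bool" where
  "horizontal w \<gamma> g \<longleftrightarrow>
     has_ac_derivative \<gamma> g \<and>
     (AE t in lborel. t \<in> {0..1} \<longrightarrow>
        snd (g t) = (1/2) *\<^sub>R carnot_W w (\<lambda>i j. fst (\<gamma> t) $ i * fst (g t) $ j))"

definition d_cc ::
    "('m::finite \<Rightarrow> 'm \<Rightarrow> real ^ 'n) \<Rightarrow> (real ^ 'm) \<times> (real ^ 'n) \<Rightarrow> (real ^ 'm) \<times> (real ^ 'n) \<Rightarrow>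
     ennreal" where
  "d_cc w x y =
     (INF (\<gamma>, g)\<in>{(\<gamma>, g). horizontal w \<gamma> g \<and> \<gamma> 0 = x \<and> \<gamma> 1 = y}.
        \<integral>\<^sup>+ t\<in>{0..1}. ennreal (norm (fst (g t))) \<partial>lborel)"

text \<open>\<open>X\<^sub>t = (B\<^sub>t, 1/2 \<integral>\<^sub>0\<^sup>t W(B\<^sub>s \<otimes> dB\<^sub>s))\<close>, in a version with continuous paths.\<close>

definition carnot_BM ::
    "('m::finite \<Rightarrow> 'm \<Rightarrow> real ^ 'n) \<Rightarrow> 'w measure \<Rightarrow>
     (real \<Rightarrow> 'w \<Rightarrow> (real ^ 'm) \<times> (real ^ 'n)) \<Rightarrow> bool" where
  "carnot_BM w M X \<longleftrightarrow>
     standard_BM M (\<lambda>t \<omega>. fst (X t \<omega>)) \<and>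
     (\<forall>t\<in>{0..1}. X t \<in> borel_measurable M) \<and>
     (\<forall>\<omega>\<in>space M. X 0 \<omega> = 0 \<and> continuous_on {0..1} (\<lambda>t. X t \<omega>)) \<and>
     (\<forall>t\<in>{0..1}. \<exists>A.
        (\<forall>i j. ito_integral M (\<lambda>s \<omega>. fst (X s \<omega>) $ i) (\<lambda>s \<omega>. fst (X s \<omega>) $ j) t (A i j)) \<and>
        (AE \<omega> in M. snd (X t \<omega>) = (1/2) *\<^sub>R carnot_W w (\<lambda>i j. A i j \<omega>)))"

definition carnot_shift ::
    "('m::finite \<Rightarrow> 'm \<Rightarrow> real ^ 'n) \<Rightarrow> (real \<Rightarrow> real ^ 'm) \<Rightarrow>
     (real \<Rightarrow> (real ^ 'm) \<times> (real ^ 'n)) \<Rightarrow> (real \<Rightarrow> (real ^ 'm) \<times> (real ^ 'n))" where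
  "carnot_shift w h X = (\<lambda>t\<in>{0..1}.
     (fst (X t) + h t,
      snd (X t) + (1/2) *\<^sub>R carnot_W w (\<lambda>i j.
          rs_integral (\<lambda>s. fst (X s) $ i) (\<lambda>s. h s $ j) 0 t
        + rs_integral (\<lambda>s. h s $ i) (\<lambda>s. fst (X s) $ j) 0 t
        + rs_integral (\<lambda>s. h s $ i) (\<lambda>s. h s $ j) 0 t)))"


section \<open>Riemannian approximations of the Heisenberg group\<close>

definition heis_speed :: "real \<Rightarrow> real ^ 3 \<Rightarrow> real ^ 3 \<Rightarrow> real" where
  "heis_speed \<epsilon> x v =
     sqrt ((v $ 1)\<^sup>2 + (v $ 2)\<^sup>2 + (v $ 3 - (x $ 1 * v $ 2 - v $ 1 * x $ 2) / 2)\<^sup>2 / \<epsilon>\<^sup>2)"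

definition d_heis :: "real \<Rightarrow> real ^ 3 \<Rightarrow> real ^ 3 \<Rightarrow> ennreal" where
  "d_heis \<epsilon> a b =
     (INF (\<gamma>, g)\<in>{(\<gamma>, g). has_ac_derivative \<gamma> g \<and> \<gamma> 0 = a \<and> \<gamma> 1 = b}.
        \<integral>\<^sup>+ t\<in>{0..1}. ennreal (heis_speed \<epsilon> (\<gamma> t) (g t)) \<partial>lborel)"

definition heis_BM ::
    "real \<Rightarrow> 'w measure \<Rightarrow> (real \<Rightarrow> 'w \<Rightarrow> real ^ 3) \<Rightarrow> (real \<Rightarrow> 'w \<Rightarrow> real ^ 3) \<Rightarrow> bool" where
  "heis_BM \<epsilon> M B X \<longleftrightarrow>
     standard_BM M B \<and>
     (\<forall>t\<in>{0..1}. X t \<in> borel_measurable M) \<and>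
     (\<forall>\<omega>\<in>space M. X 0 \<omega> = 0 \<and> continuous_on {0..1} (\<lambda>t. X t \<omega>)) \<and>
     (\<forall>t\<in>{0..1}. \<forall>\<omega>\<in>space M. X t \<omega> $ 1 = B t \<omega> $ 1 \<and> X t \<omega> $ 2 = B t \<omega> $ 2) \<and>
     (\<forall>t\<in>{0..1}. \<exists>I J.
        ito_integral M (\<lambda>s \<omega>. B s \<omega> $ 1) (\<lambda>s \<omega>. B s \<omega> $ 2) t I \<and>
        ito_integral M (\<lambda>s \<omega>. B s \<omega> $ 2) (\<lambda>s \<omega>. B s \<omega> $ 1) t J \<and>
        (AE \<omega> in M. X t \<omega> $ 3 = (I \<omega> - J \<omega>) / 2 + \<epsilon> * B t \<omega> $ 3))"

definition heis_shift ::
    "real \<Rightarrow> (real \<Rightarrow> real ^ 3) \<Rightarrow> (real \<Rightarrow> real ^ 3) \<Rightarrow> (real \<Rightarrow> real ^ 3)" where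
  "heis_shift \<epsilon> h x = (\<lambda>t\<in>{0..1}. vector
     [x t $ 1 + h t $ 1,
      x t $ 2 + h t $ 2,
      x t $ 3 + \<epsilon> * h t $ 3
        + (rs_integral (\<lambda>s. x s $ 1) (\<lambda>s. h s $ 2) 0 t - rs_integral (\<lambda>s. x s $ 2) (\<lambda>s. h s $ 1) 0 t) / 2
        + (rs_integral (\<lambda>s. h s $ 1) (\<lambda>s. x s $ 2) 0 t - rs_integral (\<lambda>s. h s $ 2) (\<lambda>s. x s $ 1) 0 t) / 2
        + (rs_integral (\<lambda>s. h s $ 1) (\<lambda>s. h s $ 2) 0 t - rs_integral (\<lambda>s. h s $ 2) (\<lambda>s. h s $ 1) 0 t) / 2])"

end

theory Submission
  imports Defs
begin

text \<open>
  The contraction principle reduces all three claims to the question which weights \<open>L\<close> exist. It holds because a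
  probability measure \<open>\<nu>\<close> with density \<open>f\<close> with respect to an image measure lifts to the measure with density
  \<open>f \<circ> \<psi>\<close> upstairs, which has the same relative entropy (\<open>rel_entropy_lift\<close>). The transport inequality
  upstairs provides couplings, and Hoelder's inequality separates the weight from the cost when these are pushed down
  (\<open>coupling_cost_bound\<close>).

  Wiener measure. A Cameron--Martin path satisfies \<open>norm (h 1) \<le> cm_norm h\<close>, so the weight \<open>1\<close> works with the
  exponent \<open>\<infinity>\<close>, that is, with \<open>p = 2\<close>.

  Riemannian approximations. Let \<open>y\<close> be the shift of \<open>x\<close> by \<open>h\<close>. The end points of \<open>x\<close> and \<open>y\<close> are joined by a curve
  whose velocity, in the left-invariant frame, is the derivative of \<open>h\<close> plus a vertical part; the latter is caused by
  the difference between \<open>x t\<close> and \<open>x 1\<close> and carries a factor \<open>1 / \<epsilon>\<close> (\<open>d_heis_shift_le\<close>). The Cauchy--Schwarz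
  inequality yields a weight that is controlled by the increments \<open>x 1 - x t\<close> of the first two coordinates. These are
  Gaussian, so the weight has moments of all orders, with values that depend on \<open>\<epsilon>\<close> and \<open>p\<close> only
  (\<open>heis_weight_bound\<close>, \<open>heis_weight_mean\<close>). All finite exponents \<open>2 * p / (2 - p)\<close> are admissible, that is, all
  \<open>p < 2\<close>.

  Carnot groups. For \<open>p = 2\<close> a weight would be essentially bounded. Shifting a path \<open>x\<close> along the straight line
  \<open>\<lambda>t. t *\<^sub>R v\<close> costs \<open>norm v\<close> and moves the end point, relative to \<open>x 1\<close>, by \<open>(v, [a, v])\<close>, where \<open>a\<close> is the time average
  of the first layer of \<open>x\<close> minus its final value. The distance is at least a multiple of the square root of the size of \<open>[a, v]\<close>
  (\<open>d_cc_lower_bound\<close>), which for small \<open>v\<close> is much larger than \<open>norm v\<close>, unless \<open>[a, v] = 0\<close>. The shift along a line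
  is quasi-invariant (\<open>carnot_quasi_invariance\<close>), so \<open>[a, v] = 0\<close> would hold almost surely for \<open>x\<close> and for its
  shifts, whose \<open>a\<close> differ by multiples of arbitrary vectors. Then all structure constants would vanish.

  The hypotheses of the contraction principle also ask for measurable costs on a Polish path space. The
  Cameron--Martin norm is a supremum of energies of dyadic interpolations (\<open>cm_ext_eq_energy\<close>), the
  Riemann--Stieltjes integrals in the shifts are limits of Riemann sums, and the Riemannian distance is upper
  semicontinuous (\<open>open_d_heis_less\<close>).
\<close>

section \<open>Powers of extended nonnegative reals\<close>

lemma epowr_ennreal: "0 \<le> a \<Longrightarrow> epowr (ennreal a) r = ennreal (a powr r)"
  by (simp add: epowr_def)

lemma epowr_top [simp]: "epowr \<top> r = \<top>"
  by (simp add: epowr_def)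

lemma epowr_0 [simp]: "epowr 0 r = 0"
  by (simp add: epowr_def)

lemma epowr_1 [simp]: "epowr 1 r = 1"
  by (simp add: epowr_def)

lemma epowr_exponent_1 [simp]: "epowr x 1 = x"
  by (cases x) (auto simp: epowr_ennreal)

lemma epowr_eq_0_iff [simp]: "epowr x r = 0 \<longleftrightarrow> x = 0"
  by (cases x) (auto simp: epowr_ennreal)

lemma epowr_eq_top_iff [simp]: "epowr x r = \<top> \<longleftrightarrow> x = \<top>"
  by (cases x) (auto simp: epowr_ennreal)

lemma epowr_mono:
  assumes "x \<le> y" "0 \<le> r"
  shows "epowr x r \<le> epowr y r"
  using assms by (cases x; cases y) (auto simp: epowr_ennreal intro!: ennreal_leI powr_mono2 simp: top_unique)

lemma epowr_epowr: "epowr (epowr x r) s = epowr x (r * s)"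
  by (cases x) (auto simp: epowr_ennreal powr_powr)

lemma epowr_mult: "epowr (x * y) r = epowr x r * epowr y r"
proof (cases "x = \<top> \<or> y = \<top>")
  case True
  then show ?thesis by (auto simp: ennreal_top_mult ennreal_mult_top)
next
  case False
  then obtain a b where "x = ennreal a" "y = ennreal b" "0 \<le> a" "0 \<le> b"
    by (metis ennreal_cases infinity_ennreal_def)
  then show ?thesis
    by (simp add: epowr_ennreal powr_mult flip: ennreal_mult)
qed

lemma epowr_of_nat: "0 < n \<Longrightarrow> epowr x (real n) = x ^ n"
proof (cases x)
  case (real r)
  assume "0 < n"
  with real show ?thesis
    by (cases "r = 0") (auto simp: epowr_ennreal powr_realpow ennreal_power power_0_left)
qed simp

lemma epowr_numeral: "epowr x (numeral n) = x ^ numeral n"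
  using epowr_of_nat[of "numeral n" x] by simp

lemma epowr_mono_exponent:
  assumes "1 \<le> x" "a \<le> b"
  shows "epowr x a \<le> epowr x b"
proof (cases x)
  case (real r)
  then have "1 \<le> r" using assms(1) by (simp add: ennreal_1[symmetric] ennreal_le_iff del: ennreal_1)
  then show ?thesis using real assms(2) by (simp add: epowr_ennreal ennreal_leI powr_mono)
qed simp

lemma measurable_epowr [measurable]:
  assumes [measurable]: "f \<in> borel_measurable M"
  shows "(\<lambda>x. epowr (f x) r) \<in> borel_measurable M"
  unfolding epowr_def by measurable

text \<open>Young's inequality, applied to the integrands divided by their integrals. Integrals equal to \<open>0\<close> or
  \<open>\<infinity>\<close> cannot be normalised and are treated separately.\<close>

lemma nn_integral_Hoelder:
  fixes f g :: "'a \<Rightarrow> ennreal"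
  assumes [measurable]: "f \<in> borel_measurable M" "g \<in> borel_measurable M"
    and ab: "0 < a" "0 < b" "a + b = 1"
  shows "(\<integral>\<^sup>+x. epowr (f x) a * epowr (g x) b \<partial>M)
           \<le> epowr (\<integral>\<^sup>+x. f x \<partial>M) a * epowr (\<integral>\<^sup>+x. g x \<partial>M) b"
proof -
  define A where "A = (\<integral>\<^sup>+x. f x \<partial>M)"
  define B where "B = (\<integral>\<^sup>+x. g x \<partial>M)"
  consider "A = 0" | "B = 0" | "A \<noteq> 0" "B \<noteq> 0" "A = \<top> \<or> B = \<top>" | "A \<noteq> 0" "B \<noteq> 0" "A \<noteq> \<top>" "B \<noteq> \<top>"
    by auto
  then show ?thesis
  proof cases
    case 1
    then have "AE x in M. f x = 0"
      unfolding A_def by (subst (asm) nn_integral_0_iff_AE) auto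
    then have "(\<integral>\<^sup>+x. epowr (f x) a * epowr (g x) b \<partial>M) = (\<integral>\<^sup>+x. 0 \<partial>M)"
      by (intro nn_integral_cong_AE) auto
    then show ?thesis by simp
  next
    case 2
    then have "AE x in M. g x = 0"
      unfolding B_def by (subst (asm) nn_integral_0_iff_AE) auto
    then have "(\<integral>\<^sup>+x. epowr (f x) a * epowr (g x) b \<partial>M) = (\<integral>\<^sup>+x. 0 \<partial>M)"
      by (intro nn_integral_cong_AE) auto
    then show ?thesis by simp
  next
    case 3
    then have "epowr A a * epowr B b = \<top>"
      by (auto simp: ennreal_mult_top ennreal_top_mult)
    then show ?thesis by (simp add: A_def B_def)
  next
    case 4
    obtain r where r: "A = ennreal r" "0 < r"
      using 4 by (cases A) (auto simp: less_le)
    obtain s where s: "B = ennreal s" "0 < s"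
      using 4 by (cases B) (auto simp: less_le)
    define C where "C = r powr a * s powr b"
    have C: "0 < C" using r s by (simp add: C_def)
    have pt: "epowr (f x) a * epowr (g x) b
        \<le> ennreal (C * a / r) * f x + ennreal (C * b / s) * g x" for x
    proof (cases "f x = \<top> \<or> g x = \<top>")
      case True
      have "0 < C * a / r" "0 < C * b / s" using C ab r s by auto
      with True show ?thesis
        by (auto simp: ennreal_mult_top ennreal_top_mult)
    next
      case False
      then obtain u v where uv: "f x = ennreal u" "g x = ennreal v" "0 \<le> u" "0 \<le> v"
        by (metis ennreal_cases infinity_ennreal_def)
      have "u powr a * v powr b \<le> C * a / r * u + C * b / s * v"
      proof (cases "u = 0 \<or> v = 0")
        case True
        then show ?thesis using uv C ab r s by auto
      next
        case False
        then have "0 < u / r" "0 < v / s" using uv r s by auto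
        from Youngs_inequality_0[OF _ _ ab(3) this] ab
        have "(u / r) powr a * (v / s) powr b \<le> a * (u / r) + b * (v / s)" by auto
        then have "C * ((u / r) powr a * (v / s) powr b) \<le> C * (a * (u / r) + b * (v / s))"
          using C by simp
        moreover have "C * ((u / r) powr a * (v / s) powr b) = u powr a * v powr b"
          using uv r s by (simp add: C_def powr_divide)
        ultimately show ?thesis by (simp add: field_simps)
      qed
      then show ?thesis
        using uv C ab r s
        by (simp add: epowr_ennreal flip: ennreal_mult ennreal_plus)
    qed
    have "(\<integral>\<^sup>+x. epowr (f x) a * epowr (g x) b \<partial>M)
        \<le> (\<integral>\<^sup>+x. ennreal (C * a / r) * f x + ennreal (C * b / s) * g x \<partial>M)"
      by (intro nn_integral_mono pt)
    also have "\<dots> = ennreal (C * a / r) * A + ennreal (C * b / s) * B"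
      by (simp add: nn_integral_add nn_integral_cmult A_def B_def)
    also have "\<dots> = ennreal (C * a + C * b)"
      using C ab r s by (simp flip: ennreal_mult ennreal_plus)
    also have "\<dots> = epowr A a * epowr B b"
      using r s ab by (simp add: C_def epowr_ennreal flip: ennreal_mult distrib_left)
    finally show ?thesis by (simp add: A_def B_def)
  qed
qed

section \<open>The contraction principle\<close>

lemma space_borel_of [simp]: "space (borel_of X) = topspace X"
  unfolding borel_of_def by (rule space_measure_of) (use openin_subset in blast)

lemma sets_borel_of: "sets (borel_of X) = sigma_sets (topspace X) {U. openin X U}"
  unfolding borel_of_def by (rule sets_measure_of) (use openin_subset in blast)

lemma sets_borel_of_euclidean [simp]: "sets (borel_of euclidean) = sets borel"
  by (simp add: sets_borel_of borel_def)

text \<open>If \<open>f\<close> is the density of \<open>\<nu>\<close>, the lift has the density \<open>f \<circ> \<psi>\<close>. The relative entropy is the integral of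
  \<open>ln f\<close>, evaluated at a point with law \<open>\<nu>\<close>, and \<open>\<psi>\<close> maps the lift to \<open>\<nu>\<close>; so no entropy is lost.\<close>

lemma rel_entropy_lift:
  assumes \<eta>: "prob_space \<eta>" and [measurable]: "\<psi> \<in> \<eta> \<rightarrow>\<^sub>M S"
    and \<nu>: "prob_space \<nu>" "sets \<nu> = sets S" and ac: "absolutely_continuous (distr \<eta> S \<psi>) \<nu>"
  obtains \<nu>' where "prob_space \<nu>'" "sets \<nu>' = sets \<eta>" "absolutely_continuous \<eta> \<nu>'"
    "distr \<nu>' S \<psi> = \<nu>" "rel_entropy \<nu>' \<eta> = rel_entropy \<nu> (distr \<eta> S \<psi>)"
proof -
  interpret \<eta>: prob_space \<eta> by fact
  define \<mu> where "\<mu> = distr \<eta> S \<psi>"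
  interpret \<mu>: prob_space \<mu> unfolding \<mu>_def by (rule \<eta>.prob_space_distr) measurable
  interpret \<nu>: prob_space \<nu> by fact
  have sets_\<mu>: "sets \<mu> = sets S" by (simp add: \<mu>_def)
  define f where "f = RN_deriv \<mu> \<nu>"
  have f[measurable]: "f \<in> borel_measurable S"
    using borel_measurable_RN_deriv[of \<mu> \<nu>] by (simp add: f_def measurable_cong_sets[OF sets_\<mu> refl])
  have dens: "density \<mu> f = \<nu>"
    unfolding f_def using ac \<nu> by (intro \<mu>.density_RN_deriv) (auto simp: \<mu>_def)
  define \<nu>' where "\<nu>' = density \<eta> (\<lambda>x. f (\<psi> x))"
  have d: "distr \<nu>' S \<psi> = \<nu>"
    unfolding \<nu>'_def by (subst density_distr[symmetric]) (auto simp: dens[unfolded \<mu>_def])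
  have sets': "sets \<nu>' = sets \<eta>" by (simp add: \<nu>'_def)
  have m'[measurable]: "\<psi> \<in> \<nu>' \<rightarrow>\<^sub>M S" by (simp add: \<nu>'_def)
  have prob': "prob_space \<nu>'"
  proof
    have "emeasure \<nu>' (space \<nu>') = emeasure (distr \<nu>' S \<psi>) (space S)"
      by (subst emeasure_distr) (auto simp: measurable_space[OF m'] intro!: arg_cong[where f="emeasure \<nu>'"])
    also have "\<dots> = 1"
      using \<nu>.emeasure_space_1 sets_eq_imp_space_eq[OF \<nu>(2)] by (simp add: d)
    finally show "emeasure \<nu>' (space \<nu>') = 1" .
  qed
  interpret \<nu>': prob_space \<nu>' by fact
  have ac': "absolutely_continuous \<eta> \<nu>'"
    unfolding \<nu>'_def by (rule absolutely_continuousI_density) measurable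
  have "AE x in \<eta>. f (\<psi> x) = RN_deriv \<eta> \<nu>' x"
    by (rule \<eta>.RN_deriv_unique) (auto simp: \<nu>'_def)
  then have ae: "AE x in \<nu>'. f (\<psi> x) = RN_deriv \<eta> \<nu>' x"
    using ac' sets' by (intro absolutely_continuous_AE[of \<nu>' \<eta>]) auto
  have ed: "AE x in \<nu>'. entropy_density (exp 1) \<eta> \<nu>' x = entropy_density (exp 1) \<mu> \<nu> (\<psi> x)"
    using ae by eventually_elim (simp add: entropy_density_def f_def)
  have m1[measurable]: "entropy_density (exp 1) \<mu> \<nu> \<in> borel_measurable S"
    unfolding entropy_density_def comp_def f_def[symmetric] by measurable
  have m2[measurable]: "entropy_density (exp 1) \<eta> \<nu>' \<in> borel_measurable \<nu>'"
    unfolding entropy_density_def comp_def using borel_measurable_RN_deriv[of \<eta> \<nu>']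
    by (simp add: measurable_cong_sets[OF sets' refl])
  have "integrable \<nu>' (entropy_density (exp 1) \<eta> \<nu>')
      \<longleftrightarrow> integrable \<nu>' (\<lambda>x. entropy_density (exp 1) \<mu> \<nu> (\<psi> x))"
    by (rule integrable_cong_AE) (use ed in auto)
  also have "\<dots> \<longleftrightarrow> integrable (distr \<nu>' S \<psi>) (entropy_density (exp 1) \<mu> \<nu>)"
    by (rule integrable_distr_eq[symmetric]) auto
  finally have i: "integrable \<nu>' (entropy_density (exp 1) \<eta> \<nu>') \<longleftrightarrow> integrable \<nu> (entropy_density (exp 1) \<mu> \<nu>)"
    by (simp add: d)
  have "integral\<^sup>L \<nu>' (entropy_density (exp 1) \<eta> \<nu>')
      = integral\<^sup>L \<nu>' (\<lambda>x. entropy_density (exp 1) \<mu> \<nu> (\<psi> x))"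
    by (rule integral_cong_AE) (use ed in auto)
  also have "\<dots> = integral\<^sup>L (distr \<nu>' S \<psi>) (entropy_density (exp 1) \<mu> \<nu>)"
    by (rule integral_distr[symmetric]) auto
  finally have "KL_divergence (exp 1) \<eta> \<nu>' = KL_divergence (exp 1) \<mu> \<nu>"
    by (simp add: KL_divergence_def d)
  then have "rel_entropy \<nu>' \<eta> = rel_entropy \<nu> \<mu>"
    using i ac ac' by (simp add: rel_entropy_def \<mu>_def)
  then show thesis
    using that prob' sets' ac' d by (simp add: \<mu>_def)
qed

lemma couplingsD:
  assumes "\<pi> \<in> couplings \<mu> \<nu>"
  shows "fst \<in> \<pi> \<rightarrow>\<^sub>M \<mu>" "snd \<in> \<pi> \<rightarrow>\<^sub>M \<nu>" "sets \<pi> = sets (\<mu> \<Otimes>\<^sub>M \<nu>)"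
    "distr \<pi> \<mu> fst = \<mu>" "distr \<pi> \<nu> snd = \<nu>"
proof -
  show s: "sets \<pi> = sets (\<mu> \<Otimes>\<^sub>M \<nu>)" and "distr \<pi> \<mu> fst = \<mu>" "distr \<pi> \<nu> snd = \<nu>"
    using assms by (auto simp: couplings_def)
  show "fst \<in> \<pi> \<rightarrow>\<^sub>M \<mu>" "snd \<in> \<pi> \<rightarrow>\<^sub>M \<nu>"
    by (simp_all add: measurable_cong_sets[OF s refl])
qed

text \<open>Both marginals of \<open>\<pi>\<close> are absolutely continuous with respect to \<open>\<eta>\<close>, so the pointwise bound, which is
  assumed on a set of full \<open>\<eta>\<close>-measure only, holds for \<open>\<pi>\<close>-almost every pair. Hoelder's inequality with
  exponents \<open>2 / (2 - p)\<close> and \<open>2 / p\<close> then separates the weight from the cost; the weight depends on the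
  first point only, whose law is \<open>\<eta>\<close>. For \<open>p = 2\<close> the weight is bounded by its essential supremum.\<close>

lemma coupling_cost_bound:
  assumes cset: "contraction_setting E c S c' \<eta> \<psi>" and w: "contraction_weight c c' \<eta> \<psi> p L"
    and p: "1 \<le> p" "p \<le> 2" and \<nu>: "sets \<nu> = sets \<eta>" "absolutely_continuous \<eta> \<nu>"
    and \<pi>: "\<pi> \<in> couplings \<eta> \<nu>"
  shows "(\<integral>\<^sup>+ z. epowr (c' (\<psi> (fst z)) (\<psi> (snd z))) p \<partial>\<pi>)
      \<le> epowr (Lq_norm \<eta> (contraction_exponent p) L) p
        * epowr (\<integral>\<^sup>+ z. epowr (c (fst z) (snd z)) 2 \<partial>\<pi>) (p / 2)"
proof -
  note [measurable] = couplingsD(1,2)[OF \<pi>]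
  have sE: "sets \<eta> = sets (borel_of E)"
    using cset by (auto simp: contraction_setting_def)
  have L[measurable]: "L \<in> borel_measurable \<eta>" using w by (auto simp: contraction_weight_def)
  have "(\<lambda>(x, y). c x y) \<in> borel_measurable (borel_of E \<Otimes>\<^sub>M borel_of E)"
    using cset by (auto simp: contraction_setting_def)
  moreover have "sets \<pi> = sets (borel_of E \<Otimes>\<^sub>M borel_of E)"
    using couplingsD(3)[OF \<pi>] \<nu>(1) sE sets_pair_measure_cong by metis
  ultimately have c[measurable]: "(\<lambda>z. c (fst z) (snd z)) \<in> borel_measurable \<pi>"
    by (simp add: measurable_cong_sets[of \<pi> "borel_of E \<Otimes>\<^sub>M borel_of E"] case_prod_unfold)
  obtain E0 where E0: "E0 \<in> sets \<eta>" "emeasure \<eta> E0 = 1"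
    and le: "\<And>x x'. x \<in> E0 \<Longrightarrow> x' \<in> E0 \<Longrightarrow> c' (\<psi> x) (\<psi> x') \<le> L x * c x x'"
    using w by (auto simp: contraction_weight_def)
  interpret \<eta>: prob_space \<eta> using cset by (auto simp: contraction_setting_def)
  have "AE x in \<eta>. x \<in> E0"
    using E0 by (intro \<eta>.AE_prob_1) (auto simp: \<eta>.emeasure_eq_measure)
  note ae1 = this
  have ae2: "AE x in \<nu>. x \<in> E0"
    using ae1 \<nu> by (intro absolutely_continuous_AE[of \<nu> \<eta>]) auto
  have ae_fst: "AE z in \<pi>. P (fst z)" if "AE x in \<eta>. P x" for P
    by (rule AE_distrD[of fst \<pi> \<eta>], fact, subst couplingsD(4)[OF \<pi>], fact)
  have ae_snd: "AE z in \<pi>. P (snd z)" if "AE x in \<nu>. P x" for P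
    by (rule AE_distrD[of snd \<pi> \<nu>], fact, subst couplingsD(5)[OF \<pi>], fact)
  have step1: "(\<integral>\<^sup>+ z. epowr (c' (\<psi> (fst z)) (\<psi> (snd z))) p \<partial>\<pi>)
      \<le> (\<integral>\<^sup>+ z. epowr (L (fst z)) p * epowr (c (fst z) (snd z)) p \<partial>\<pi>)"
  proof (rule nn_integral_mono_AE)
    show "AE z in \<pi>. epowr (c' (\<psi> (fst z)) (\<psi> (snd z))) p
        \<le> epowr (L (fst z)) p * epowr (c (fst z) (snd z)) p"
      using ae_fst[OF ae1] ae_snd[OF ae2]
    proof eventually_elim
      case (elim z)
      show ?case using le[OF elim] p by (simp flip: epowr_mult add: epowr_mono)
    qed
  qed
  define N where "N = Lq_norm \<eta> (contraction_exponent p) L"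
  define D where "D = (\<integral>\<^sup>+ z. epowr (c (fst z) (snd z)) 2 \<partial>\<pi>)"
  have "(\<integral>\<^sup>+ z. epowr (L (fst z)) p * epowr (c (fst z) (snd z)) p \<partial>\<pi>) \<le> epowr N p * epowr D (p / 2)"
  proof (cases "p = 2")
    case True
    then have N: "N = esssup \<eta> L"
      by (simp add: N_def Lq_norm_def contraction_exponent_def ennreal_divide_zero)
    have "AE x in \<eta>. L x \<le> N" unfolding N by (rule esssup_AE) 
    then have "(\<integral>\<^sup>+ z. epowr (L (fst z)) p * epowr (c (fst z) (snd z)) p \<partial>\<pi>)
        \<le> (\<integral>\<^sup>+ z. epowr N p * epowr (c (fst z) (snd z)) p \<partial>\<pi>)"
      using p ae_fst[of "\<lambda>x. L x \<le> N"]
      by (intro nn_integral_mono_AE) (auto elim!: eventually_mono intro!: mult_right_mono epowr_mono)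
    also have "\<dots> = epowr N p * D"
      using True by (simp add: D_def nn_integral_cmult)
    finally show ?thesis using True by simp
  next
    case False
    then have p2: "p < 2" using p by simp
    define q where "q = 2 * p / (2 - p)"
    have q: "0 < q" using p p2 by (simp add: q_def)
    have ce: "contraction_exponent p = ennreal q"
      using p p2 by (simp add: contraction_exponent_def q_def divide_ennreal)
    have N: "N = epowr (\<integral>\<^sup>+ x. epowr (L x) q \<partial>\<eta>) (1 / q)"
      using q by (simp add: N_def Lq_norm_def ce)
    have qp: "q * (1 - p / 2) = p" using p p2 by (simp add: q_def field_simps)
    have "(\<integral>\<^sup>+ z. epowr (L (fst z)) p * epowr (c (fst z) (snd z)) p \<partial>\<pi>)
        = (\<integral>\<^sup>+ z. epowr (epowr (L (fst z)) q) (1 - p / 2) * epowr (epowr (c (fst z) (snd z)) 2) (p / 2) \<partial>\<pi>)"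
      by (simp add: epowr_epowr qp)
    also have "\<dots> \<le> epowr (\<integral>\<^sup>+ z. epowr (L (fst z)) q \<partial>\<pi>) (1 - p / 2) * epowr D (p / 2)"
      unfolding D_def using p p2 by (intro nn_integral_Hoelder) auto
    also have "(\<integral>\<^sup>+ z. epowr (L (fst z)) q \<partial>\<pi>) = (\<integral>\<^sup>+ x. epowr (L x) q \<partial>distr \<pi> \<eta> fst)"
      by (rule nn_integral_distr[symmetric]) auto
    also have "\<dots> = (\<integral>\<^sup>+ x. epowr (L x) q \<partial>\<eta>)" by (simp add: couplingsD(4)[OF \<pi>])
    also have "epowr \<dots> (1 - p / 2) = epowr N p"
    proof -
      have "1 / q * p = 1 - p / 2" using p p2 by (simp add: q_def field_simps)
      then show ?thesis by (simp add: N epowr_epowr)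
    qed
    finally show ?thesis .
  qed
  with step1 show ?thesis unfolding N_def D_def by (rule order_trans)
qed

text \<open>The map \<open>\<psi> \<times> \<psi>\<close> sends couplings of \<open>\<eta>\<close> and \<open>\<nu>\<close> to couplings of their images. The bound for a single
  coupling is raised to the power \<open>2 / p\<close>: then its right-hand side is linear in the cost and the infimum
  over all couplings can be taken.\<close>

lemma transport_cost_contraction:
  assumes cset: "contraction_setting E c S c' \<eta> \<psi>" and w: "contraction_weight c c' \<eta> \<psi> p L"
    and p: "1 \<le> p" "p \<le> 2" and \<nu>: "prob_space \<nu>" "sets \<nu> = sets \<eta>" "absolutely_continuous \<eta> \<nu>"
    and N: "Lq_norm \<eta> (contraction_exponent p) L = ennreal N" "0 < N"
  shows "transport_cost c' p (distr \<eta> (borel_of S) \<psi>) (distr \<nu> (borel_of S) \<psi>)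
      \<le> ennreal N * transport_cost c 2 \<eta> \<nu>"
proof -
  have sE: "sets \<eta> = sets (borel_of E)" and "\<psi> \<in> borel_of E \<rightarrow>\<^sub>M borel_of S"
    using cset by (auto simp: contraction_setting_def)
  then have [measurable]: "\<psi> \<in> \<eta> \<rightarrow>\<^sub>M borel_of S" "\<psi> \<in> \<nu> \<rightarrow>\<^sub>M borel_of S"
    using \<nu>(2) by (simp_all add: measurable_cong_sets[OF sE] measurable_cong_sets[OF \<nu>(2)])
  let ?\<mu> = "distr \<eta> (borel_of S) \<psi>" and ?\<nu> = "distr \<nu> (borel_of S) \<psi>"
  have c': "(\<lambda>z. c' (fst z) (snd z)) \<in> borel_measurable (borel_of S \<Otimes>\<^sub>M borel_of S)"
    using cset by (auto simp: contraction_setting_def case_prod_unfold)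
  define A where "A = (INF \<pi>\<in>couplings ?\<mu> ?\<nu>. \<integral>\<^sup>+ z. epowr (c' (fst z) (snd z)) p \<partial>\<pi>)"
  have A_le: "epowr A (2 / p) \<le> ennreal (N\<^sup>2) * (\<integral>\<^sup>+ z. epowr (c (fst z) (snd z)) 2 \<partial>\<pi>)"
    if \<pi>: "\<pi> \<in> couplings \<eta> \<nu>" for \<pi>
  proof -
    note [measurable] = couplingsD(1,2)[OF \<pi>]
    let ?f = "\<lambda>z. (\<psi> (fst z), \<psi> (snd z))"
    let ?\<pi> = "distr \<pi> (borel_of S \<Otimes>\<^sub>M borel_of S) ?f"
    have [measurable]: "?f \<in> \<pi> \<rightarrow>\<^sub>M borel_of S \<Otimes>\<^sub>M borel_of S" by measurable
    have "distr ?\<pi> ?\<mu> fst = distr \<pi> (borel_of S) (\<lambda>z. \<psi> (fst z))"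
      by (subst distr_distr) (auto simp: comp_def intro!: distr_cong)
    also have "\<dots> = distr (distr \<pi> \<eta> fst) (borel_of S) \<psi>"
      by (subst distr_distr) (auto simp: comp_def)
    finally have 1: "distr ?\<pi> ?\<mu> fst = ?\<mu>" using couplingsD[OF \<pi>] by simp
    have "distr ?\<pi> ?\<nu> snd = distr \<pi> (borel_of S) (\<lambda>z. \<psi> (snd z))"
      by (subst distr_distr) (auto simp: comp_def intro!: distr_cong)
    also have "\<dots> = distr (distr \<pi> \<nu> snd) (borel_of S) \<psi>"
      by (subst distr_distr) (auto simp: comp_def)
    finally have 2: "distr ?\<pi> ?\<nu> snd = ?\<nu>" using couplingsD[OF \<pi>] by simp
    have "?\<pi> \<in> couplings ?\<mu> ?\<nu>"
      using 1 2 by (auto simp: couplings_def intro!: sets_pair_measure_cong)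
    then have "A \<le> (\<integral>\<^sup>+ z. epowr (c' (fst z) (snd z)) p \<partial>?\<pi>)"
      unfolding A_def by (rule INF_lower)
    also have "\<dots> = (\<integral>\<^sup>+ z. epowr (c' (\<psi> (fst z)) (\<psi> (snd z))) p \<partial>\<pi>)"
      using c' by (subst nn_integral_distr) auto
    also have "\<dots> \<le> epowr (ennreal N) p * epowr (\<integral>\<^sup>+ z. epowr (c (fst z) (snd z)) 2 \<partial>\<pi>) (p / 2)"
      using coupling_cost_bound[OF cset w p \<nu>(2,3) \<pi>] by (simp add: N)
    finally have "epowr A (2 / p) \<le> epowr (epowr (ennreal N) p * epowr (\<integral>\<^sup>+ z. epowr (c (fst z) (snd z)) 2 \<partial>\<pi>) (p / 2)) (2 / p)"
      using p by (intro epowr_mono) auto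
    also have "\<dots> = ennreal (N\<^sup>2) * (\<integral>\<^sup>+ z. epowr (c (fst z) (snd z)) 2 \<partial>\<pi>)"
      using p N by (simp add: epowr_mult epowr_epowr epowr_numeral ennreal_power)
    finally show ?thesis .
  qed
  have cancel: "ennreal (1 / N\<^sup>2) * (ennreal (N\<^sup>2) * x) = x" for x
    using N by (simp add: mult.assoc[symmetric] flip: ennreal_mult)
  have cancel': "ennreal (N\<^sup>2) * (ennreal (1 / N\<^sup>2) * x) = x" for x
    using N by (simp add: mult.assoc[symmetric] flip: ennreal_mult)
  have "ennreal (1 / N\<^sup>2) * epowr A (2 / p) \<le> (INF \<pi>\<in>couplings \<eta> \<nu>. \<integral>\<^sup>+ z. epowr (c (fst z) (snd z)) 2 \<partial>\<pi>)"
  proof (rule INF_greatest)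
    fix \<pi> assume "\<pi> \<in> couplings \<eta> \<nu>"
    from mult_left_mono[OF A_le[OF this], of "ennreal (1 / N\<^sup>2)"]
    show "ennreal (1 / N\<^sup>2) * epowr A (2 / p) \<le> (\<integral>\<^sup>+ z. epowr (c (fst z) (snd z)) 2 \<partial>\<pi>)"
      by (simp add: cancel)
  qed
  from mult_left_mono[OF this, of "ennreal (N\<^sup>2)"]
  have "epowr A (2 / p) \<le> ennreal (N\<^sup>2) * (INF \<pi>\<in>couplings \<eta> \<nu>. \<integral>\<^sup>+ z. epowr (c (fst z) (snd z)) 2 \<partial>\<pi>)"
    by (simp add: cancel')
  then have "epowr (epowr A (2 / p)) (1 / 2)
      \<le> epowr (ennreal (N\<^sup>2) * (INF \<pi>\<in>couplings \<eta> \<nu>. \<integral>\<^sup>+ z. epowr (c (fst z) (snd z)) 2 \<partial>\<pi>)) (1 / 2)"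
    by (intro epowr_mono) auto
  moreover have "epowr (ennreal (N\<^sup>2)) (1 / 2) = ennreal N"
    using N by (simp add: epowr_ennreal powr_half_sqrt)
  ultimately show ?thesis
    using p by (simp add: transport_cost_def A_def epowr_mult epowr_epowr)
qed

text \<open>Measures that are not absolutely continuous with respect to the image of \<open>\<eta>\<close> have infinite entropy; the others lift
  to \<open>E\<close> with the same entropy.\<close>

theorem contraction_principle:
  assumes gives: "contraction_gives E c S c' \<eta> \<psi> p \<kappa>" and p: "1 \<le> p" "p \<le> 2" and "0 < \<alpha>"
    and T2: "transport_ineq E c 2 \<alpha> \<eta>"
  shows "transport_ineq S c' p (\<alpha> * \<kappa>) (distr \<eta> (borel_of S) \<psi>)"
  unfolding transport_ineq_def
proof (intro allI impI, elim conjE)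
  fix \<nu> :: "'b measure" assume \<nu>: "prob_space \<nu>" "sets \<nu> = sets (borel_of S)"
  have cset: "contraction_setting E c S c' \<eta> \<psi>" and \<kappa>: "0 < \<kappa>"
    using gives by (auto simp: contraction_gives_def)
  obtain L where w: "contraction_weight c c' \<eta> \<psi> p L"
    and L\<kappa>: "ennreal \<kappa> = inverse ((Lq_norm \<eta> (contraction_exponent p) L)\<^sup>2)"
    using gives by (auto simp: contraction_gives_def)
  have fin: "Lq_norm \<eta> (contraction_exponent p) L < \<top>"
    using w by (simp add: contraction_weight_def)
  have "Lq_norm \<eta> (contraction_exponent p) L \<noteq> 0"
    using L\<kappa> by auto
  with fin obtain N where N: "Lq_norm \<eta> (contraction_exponent p) L = ennreal N" "0 < N"
    by (cases "Lq_norm \<eta> (contraction_exponent p) L") (auto simp: less_le)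
  have \<kappa>N: "\<kappa> = 1 / N\<^sup>2"
    using L\<kappa> N \<kappa> by (simp add: ennreal_power inverse_ennreal inverse_eq_divide)
  let ?\<mu> = "distr \<eta> (borel_of S) \<psi>"
  show "transport_cost c' p ?\<mu> \<nu> \<le> epowr (ennreal (2 / (\<alpha> * \<kappa>)) * rel_entropy \<nu> ?\<mu>) (1 / 2)"
  proof (cases "absolutely_continuous ?\<mu> \<nu>")
    case False
    then have "rel_entropy \<nu> ?\<mu> = \<top>" by (simp add: rel_entropy_def)
    then show ?thesis using \<kappa> \<open>0 < \<alpha>\<close> by (simp add: ennreal_mult_top)
  next
    case True
    have \<eta>: "prob_space \<eta>" and sE: "sets \<eta> = sets (borel_of E)" and "\<psi> \<in> borel_of E \<rightarrow>\<^sub>M borel_of S"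
      using cset by (auto simp: contraction_setting_def)
    then have m: "\<psi> \<in> \<eta> \<rightarrow>\<^sub>M borel_of S"
      by (simp add: measurable_cong_sets[OF sE])
    obtain \<nu>' where \<nu>': "prob_space \<nu>'" "sets \<nu>' = sets \<eta>" "absolutely_continuous \<eta> \<nu>'"
        "distr \<nu>' (borel_of S) \<psi> = \<nu>" "rel_entropy \<nu>' \<eta> = rel_entropy \<nu> ?\<mu>"
      using rel_entropy_lift[OF \<eta> m \<nu> True] by blast
    have "transport_cost c' p ?\<mu> \<nu> \<le> ennreal N * transport_cost c 2 \<eta> \<nu>'"
      using transport_cost_contraction[OF cset w p \<nu>'(1-3) N] by (simp add: \<nu>'(4))
    also have "\<dots> \<le> ennreal N * epowr (ennreal (2 / \<alpha>) * rel_entropy \<nu> ?\<mu>) (1 / 2)"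
      using T2 \<nu>' sE by (intro mult_left_mono) (auto simp: transport_ineq_def)
    also have "\<dots> = epowr (ennreal (N\<^sup>2) * (ennreal (2 / \<alpha>) * rel_entropy \<nu> ?\<mu>)) (1 / 2)"
      using N by (simp add: epowr_mult epowr_ennreal powr_half_sqrt)
    also have "ennreal (N\<^sup>2) * (ennreal (2 / \<alpha>) * rel_entropy \<nu> ?\<mu>) = ennreal (2 / (\<alpha> * \<kappa>)) * rel_entropy \<nu> ?\<mu>"
      using N \<open>0 < \<alpha>\<close> by (simp add: mult.assoc[symmetric] \<kappa>N field_simps flip: ennreal_mult)
    finally show ?thesis .
  qed
qed

section \<open>The space of continuous paths\<close>

definition path_metric :: "(real \<Rightarrow> 'v::euclidean_space) metric" where
  "path_metric = submetric (cfunspace (top_of_set {0..1}) euclidean_metric) {x. x 0 = 0}"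

lemma path_space_eq: "path_space = mtopology_of path_metric"
  by (simp add: path_space_def path_metric_def)

lemma mspace_cfunspace_unit:
  "mspace (cfunspace (top_of_set {0..1::real}) (euclidean_metric :: 'v::euclidean_space metric))
     = {x. x \<in> extensional {0..1} \<and> continuous_on {0..1} x}"
  by (subst compactin_mspace_cfunspace) (auto simp: compactin_subtopology compactin_euclidean_iff)

lemma mspace_path_metric:
  "mspace path_metric
     = {x :: real \<Rightarrow> 'v::euclidean_space. x \<in> extensional {0..1} \<and> continuous_on {0..1} x \<and> x 0 = 0}"
  unfolding path_metric_def by (auto simp: mspace_cfunspace_unit simp del: mspace_cfunspace)

lemma topspace_path_space:
  "topspace path_space
     = {x :: real \<Rightarrow> 'v::euclidean_space. x \<in> extensional {0..1} \<and> continuous_on {0..1} x \<and> x 0 = 0}"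
  by (simp add: path_space_eq mspace_path_metric)

lemma mdist_path_metric_le_iff:
  fixes x y :: "real \<Rightarrow> 'v::euclidean_space"
  assumes "x \<in> mspace path_metric" "y \<in> mspace path_metric"
  shows "mdist path_metric x y \<le> a \<longleftrightarrow> (\<forall>t\<in>{0..1}. dist (x t) (y t) \<le> a)"
  using assms cfunspace_mdist_le[of x "top_of_set {0..1}" euclidean_metric y a]
  by (simp add: path_metric_def mspace_cfunspace_unit del: mspace_cfunspace)

lemma completely_metrizable_path_space:
  "completely_metrizable_space (path_space :: (real \<Rightarrow> 'v::euclidean_space) topology)"
proof -
  define C where "C = cfunspace (top_of_set {0..1::real}) (euclidean_metric :: 'v metric)"
  have mspace_C: "mspace C = {x. x \<in> extensional {0..1} \<and> continuous_on {0..1} x}"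
    unfolding C_def by (rule mspace_cfunspace_unit)
  have dist_le: "dist (x t) (y t) \<le> mdist C x y"
    if "x \<in> mspace C" "y \<in> mspace C" "t \<in> {0..1}" for x y t
    using that mdist_cfunspace_imp_mdist_le[of x "top_of_set {0..1}" euclidean_metric y "mdist C x y" t]
    unfolding C_def by simp
  have path_space_C: "path_space = subtopology (mtopology_of C) {x. x 0 = 0}"
    unfolding path_space_def mtopology_of_submetric C_def ..
  have "mcomplete_of C"
    using Met_TC.mcomplete_cfunspace[of "top_of_set {0..1::real}", where 'a='v] complete_UNIV
    by (simp add: C_def Met_TC.Self_def euclidean_metric_def)
  then have compl: "completely_metrizable_space (mtopology_of C)"
    unfolding mcomplete_of_def mtopology_of_def
    by (rule Metric_space.completely_metrizable_space_mtopology[OF Metric_space_mspace_mdist])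
  interpret Metric_space "mspace C" "mdist C" by (rule Metric_space_mspace_mdist)
  have mt: "mtopology_of C = mtopology" by (simp add: mtopology_of_def)
  have "openin mtopology {x \<in> mspace C. x 0 \<noteq> 0}"
    unfolding openin_mtopology
  proof (intro conjI allI impI)
    fix x assume x: "x \<in> {x \<in> mspace C. x 0 \<noteq> 0}"
    have "mball x (norm (x 0)) \<subseteq> {x \<in> mspace C. x 0 \<noteq> 0}"
    proof
      fix y assume y: "y \<in> mball x (norm (x 0))"
      then have "dist (x 0) (y 0) < norm (x 0)"
        using dist_le[of x y 0] by simp
      then show "y \<in> {x \<in> mspace C. x 0 \<noteq> 0}"
        using y by (auto simp: dist_norm)
    qed
    then show "\<exists>r>0. mball x r \<subseteq> {x \<in> mspace C. x 0 \<noteq> 0}"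
      using x by (intro exI[of _ "norm (x 0)"]) simp
  qed blast
  moreover have "mspace C - {x \<in> mspace C. x 0 = 0} = {x \<in> mspace C. x 0 \<noteq> 0}"
    by auto
  ultimately have "closedin mtopology {x \<in> mspace C. x 0 = 0}"
    by (auto simp: closedin_def)
  then have "completely_metrizable_space (subtopology mtopology {x \<in> mspace C. x 0 = 0})"
    using compl unfolding mt by (intro completely_metrizable_space_closedin)
  also have "subtopology mtopology {x \<in> mspace C. x 0 = 0} = subtopology mtopology (mspace C \<inter> {x. x 0 = 0})"
    by (rule arg_cong[of _ _ "subtopology mtopology"]) blast
  also have "\<dots> = path_space"
    using subtopology_restrict[of mtopology "{x. x 0 = 0}"] by (simp add: path_space_C mt)
  finally show ?thesis .
qed

text \<open>Rounding to a countable dense set; it encodes a path by a finite list with entries in a countable set.\<close>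

lemma quantizer:
  "\<exists>(K :: 'v::euclidean_space set) (q :: real \<Rightarrow> 'v \<Rightarrow> 'v).
     countable K \<and> (\<forall>e v. 0 < e \<longrightarrow> q e v \<in> K \<and> dist (q e v) v < e)"
proof -
  obtain K :: "'v set" where K: "countable K" "\<And>X. open X \<Longrightarrow> X \<noteq> {} \<Longrightarrow> \<exists>d\<in>K. d \<in> X"
    using countable_dense_setE by metis
  have "\<exists>k. k \<in> K \<and> dist k v < e" if "0 < e" for e v
    using K(2)[of "ball v e"] that by (auto simp: dist_commute)
  then have "\<forall>e v. \<exists>k. 0 < e \<longrightarrow> k \<in> K \<and> dist k v < e" by blast
  then obtain q where "\<forall>e v. 0 < e \<longrightarrow> q e v \<in> K \<and> dist (q e v) v < e" by metis
  then show ?thesis using K by blast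
qed

text \<open>The set \<open>A n m\<close> collects the paths that oscillate by at most \<open>1 / (n + 1)\<close> over times of distance
  \<open>1 / (m + 1)\<close>, and \<open>cod n m\<close> lists the rounded values at the multiples of \<open>1 / (m + 1)\<close>. Two paths in
  \<open>A n m\<close> with the same list differ by at most \<open>4 / (n + 1)\<close>. There are countably many lists, so one
  representative for each of them gives a countable dense set.\<close>

lemma path_space_separable:
  "\<exists>D :: (real \<Rightarrow> 'v::euclidean_space) set. countable D \<and> D \<subseteq> mspace path_metric \<and>
     (\<forall>x\<in>mspace path_metric. \<forall>e>0. \<exists>d\<in>D. mdist path_metric d x < e)"
proof -
  obtain K :: "'v set" and q where Kq: "countable K \<and> (\<forall>e v. 0 < e \<longrightarrow> q e v \<in> K \<and> dist (q e v) v < e)"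
    using quantizer by (elim exE)
  then have K: "countable K" and q: "\<And>e v. 0 < e \<Longrightarrow> q e v \<in> K \<and> dist (q e v) v < e"
    by simp_all
  define A where "A n m = {x \<in> mspace path_metric. \<forall>s\<in>{0..1}. \<forall>t\<in>{0..1}.
      \<bar>s - t\<bar> \<le> 1 / real (Suc m) \<longrightarrow> dist (x s) (x t :: 'v) \<le> 1 / real (Suc n)}" for n m
  define cod where "cod n m x = map (\<lambda>k. q (1 / real (Suc n)) (x (real k / real (Suc m)))) [0..<Suc (Suc m)]"
    for n m :: nat and x :: "real \<Rightarrow> 'v"
  define rep where "rep n m l = (SOME x. x \<in> A n m \<and> cod n m x = l)" for n m l
  define D where "D = (\<Union>n. \<Union>m. rep n m ` lists K) \<inter> mspace path_metric"
  have "countable D"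
    unfolding D_def using K by (intro countable_Int1 countable_UN countable_image countable_lists) auto
  moreover have "D \<subseteq> mspace path_metric" by (auto simp: D_def)
  moreover have "\<exists>d\<in>D. mdist path_metric d x < e" if x: "x \<in> mspace path_metric" and e: "0 < e" for x e
  proof -
    obtain n where n: "4 / real (Suc n) < e"
    proof -
      obtain n where "inverse (real (Suc n)) < e / 4"
        using reals_Archimedean[of "e / 4"] e by auto
      then have "4 / real (Suc n) < e" by (simp add: field_simps)
      then show thesis by (rule that)
    qed
    have "uniformly_continuous_on {0..1} x"
      using x by (intro compact_uniformly_continuous) (auto simp: mspace_path_metric)
    then obtain d where d: "0 < d" "\<And>s t. s \<in> {0..1} \<Longrightarrow> t \<in> {0..1} \<Longrightarrow> dist t s < d \<Longrightarrow> dist (x t) (x s) < 1 / real (Suc n)"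
      unfolding uniformly_continuous_on_def by (metis of_nat_0_less_iff zero_less_Suc zero_less_divide_1_iff)
    obtain m where m: "1 / real (Suc m) < d"
      using reals_Archimedean[OF d(1)] by (auto simp: inverse_eq_divide)
    have xA: "x \<in> A n m"
      unfolding A_def using x m d(2) by (auto simp: dist_real_def intro!: less_imp_le)
    define y where "y = rep n m (cod n m x)"
    have y: "y \<in> A n m" "cod n m y = cod n m x"
      unfolding y_def rep_def using someI[of "\<lambda>z. z \<in> A n m \<and> cod n m z = cod n m x" x] xA by auto
    have "cod n m x \<in> lists K"
      using q[of "1 / real (Suc n)"] by (auto simp: cod_def)
    then have yD: "y \<in> D"
      using y(1) unfolding D_def y_def A_def by auto
    have "dist (y t) (x t) \<le> 4 / real (Suc n)" if t: "t \<in> {0..1}" for t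
    proof -
      define k where "k = nat \<lfloor>t * real (Suc m)\<rfloor>"
      have k1: "real k \<le> t * real (Suc m)" "t * real (Suc m) < real k + 1"
        using t unfolding k_def by auto
      have tm: "t * real (Suc m) \<le> 1 * real (Suc m)" using t by (intro mult_right_mono) auto
      from order_trans[OF k1(1) tm] have k: "k < Suc (Suc m)" by simp
      define s where "s = real k / real (Suc m)"
      define M where "M = real (Suc m)"
      have M: "0 < M" by (simp add: M_def)
      have k2: "real k \<le> t * M" "t * M < real k + 1" "t * M \<le> M"
        using k1 tm by (simp_all only: M_def mult_1)
      have s_M: "s = real k / M" by (simp add: s_def M_def)
      have s: "s \<in> {0..1}"
        using order_trans[OF k2(1) k2(3)] M by (auto simp: s_M divide_le_eq)
      have "s - t = (real k - t * M) / M"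
        using M by (simp add: s_M diff_divide_distrib)
      moreover have "\<bar>real k - t * M\<bar> \<le> 1" using k2 by linarith
      ultimately have "\<bar>s - t\<bar> \<le> 1 / M"
        using M by (simp only: abs_divide abs_of_pos divide_right_mono less_imp_le)
      then have st: "\<bar>s - t\<bar> \<le> 1 / real (Suc m)" by (simp add: M_def)
      have "cod n m x ! k = cod n m y ! k" using y by simp
      then have eq: "q (1 / real (Suc n)) (x s) = q (1 / real (Suc n)) (y s)"
        using k by (simp add: cod_def s_def nth_append del: upt_Suc)
      have "dist (x s) (x t) \<le> 1 / real (Suc n)" "dist (y s) (y t) \<le> 1 / real (Suc n)"
        using xA y(1) s t st unfolding A_def by blast+
      moreover have "dist (q (1 / real (Suc n)) (x s)) (x s) < 1 / real (Suc n)"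
          "dist (q (1 / real (Suc n)) (y s)) (y s) < 1 / real (Suc n)"
        using q[of "1 / real (Suc n)"] by auto
      ultimately have "dist (y t) (x t) \<le> 1 / real (Suc n) + 1 / real (Suc n) + 1 / real (Suc n) + 1 / real (Suc n)"
        unfolding eq using dist_triangle[of "y t" "x t" "y s"] dist_triangle2[of "y s" "x t" "q (1 / real (Suc n)) (y s)"]
          dist_triangle[of "q (1 / real (Suc n)) (y s)" "x t" "x s"] dist_commute[of "y t" "y s"]
          dist_commute[of "y s" "q (1 / real (Suc n)) (y s)"] dist_commute[of "x t" "q (1 / real (Suc n)) (y s)"]
        by linarith
      then show ?thesis by simp
    qed
    then have "mdist path_metric y x \<le> 4 / real (Suc n)"
      using x y(1) by (subst mdist_path_metric_le_iff) (auto simp: A_def)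
    then show ?thesis using yD n by (intro bexI[of _ y]) auto
  qed
  ultimately show ?thesis by (intro exI[of _ D] conjI ballI allI impI)
qed

text \<open>A countable base of closed balls. Closed balls are used because membership in them is a condition on
  the values at rational times, hence an event for every process.\<close>

lemma path_space_open_countable_Union:
  "\<exists>D :: (real \<Rightarrow> 'v::euclidean_space) set. countable D \<and> D \<subseteq> mspace path_metric \<and>
     (\<forall>U x. openin path_space U \<longrightarrow> x \<in> U \<longrightarrow>
       (\<exists>d\<in>D. \<exists>r\<in>\<rat>. 0 < r \<and> mdist path_metric d x < r \<and> {y \<in> mspace path_metric. mdist path_metric d y \<le> r} \<subseteq> U))"
proof -
  interpret Metric_space "mspace path_metric" "mdist path_metric :: (real \<Rightarrow> 'v) \<Rightarrow> _"
    by (rule Metric_space_mspace_mdist)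
  obtain D :: "(real \<Rightarrow> 'v) set" where D: "countable D" "D \<subseteq> mspace path_metric"
    "\<forall>x\<in>mspace path_metric. \<forall>e>0. \<exists>d\<in>D. mdist path_metric d x < e"
    using path_space_separable by (elim exE conjE)
  have "\<exists>d\<in>D. \<exists>r\<in>\<rat>. 0 < r \<and> mdist path_metric d x < r \<and> {y \<in> mspace path_metric. mdist path_metric d y \<le> r} \<subseteq> U"
    if U: "openin path_space U" "x \<in> U" for U x
  proof -
    have "openin mtopology U" using U by (simp add: path_space_eq mtopology_of_def)
    then obtain r where r: "0 < r" "mball x r \<subseteq> U" and x: "x \<in> mspace path_metric"
      using U(2) unfolding openin_mtopology by blast
    obtain s where s: "s \<in> \<rat>" "0 < s" "s < r / 2"
      using Rats_dense_in_real[of 0 "r / 2"] r by auto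
    obtain d where d: "d \<in> D" "mdist path_metric d x < s" using D(3) x s(2) by blast
    have "{y \<in> mspace path_metric. mdist path_metric d y \<le> s} \<subseteq> mball x r"
    proof clarify
      fix y assume y: "y \<in> mspace path_metric" "mdist path_metric d y \<le> s"
      have "mdist path_metric x y \<le> mdist path_metric x d + mdist path_metric d y"
        using x y d D by (intro triangle) auto
      then have "mdist path_metric x y < r" using y d s by (simp add: commute)
      then show "y \<in> mball x r" using x y by auto
    qed
    then have sub: "{y \<in> mspace path_metric. mdist path_metric d y \<le> s} \<subseteq> U"
      using r(2) by (rule order_trans)
    show ?thesis by (rule bexI[OF _ d(1)], rule bexI[OF _ s(1)]) (intro conjI s(2) d(2) sub)
  qed
  then show ?thesis by (intro exI[of _ D] conjI D) blast
qed

lemma polish_path_space: "polish (path_space :: (real \<Rightarrow> 'v::euclidean_space) topology)"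
proof -
  interpret Metric_space "mspace path_metric" "mdist path_metric :: (real \<Rightarrow> 'v) \<Rightarrow> _"
    by (rule Metric_space_mspace_mdist)
  obtain D :: "(real \<Rightarrow> 'v) set" where D: "countable D" "D \<subseteq> mspace path_metric"
    and U: "\<forall>U (x :: real \<Rightarrow> 'v). openin path_space U \<longrightarrow> x \<in> U \<longrightarrow>
       (\<exists>d\<in>D. \<exists>r\<in>\<rat>. 0 < r \<and> mdist path_metric d x < r \<and> {y \<in> mspace path_metric. mdist path_metric d y \<le> r} \<subseteq> U)"
    using path_space_open_countable_Union by (elim exE conjE)
  have "second_countable (path_space :: (real \<Rightarrow> 'v) topology)"
    unfolding second_countable_def
  proof (intro exI[of _ "(\<lambda>(d, r). mball d r) ` (D \<times> \<rat>)"] conjI ballI allI impI)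
    show "countable ((\<lambda>(d, r). mball d r) ` (D \<times> \<rat>))"
      using D countable_rat by auto
    show "openin path_space V" if "V \<in> (\<lambda>(d, r). mball d r) ` (D \<times> \<rat>)" for V
      using that by (auto simp: path_space_eq mtopology_of_def)
    fix V :: "(real \<Rightarrow> 'v) set" and x assume V: "openin path_space V \<and> x \<in> V"
    then have x: "x \<in> mspace path_metric"
      using openin_subset[of path_space V] by (auto simp: path_space_eq)
    obtain d r where dr: "d \<in> D" "r \<in> \<rat>" "0 < r" "mdist path_metric d x < r"
        "{y \<in> mspace path_metric. mdist path_metric d y \<le> r} \<subseteq> V"
      using U V by blast
    then have "x \<in> mball d r" "mball d r \<subseteq> V" using x D by auto
    then show "\<exists>W\<in>(\<lambda>(d, r). mball d r) ` (D \<times> \<rat>). x \<in> W \<and> W \<subseteq> V"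
      using dr by auto
  qed
  then show ?thesis using completely_metrizable_path_space by (simp add: polish_def)
qed

lemma dense_Rats_unit: "closure (\<rat> \<inter> {0..1}) = {0..1::real}"
proof
  have "{0..1} = closure {0<..<1::real}" by simp
  also have "\<dots> = closure ({0<..<1} \<inter> \<rat>)"
    by (rule closure_open_Int_superset[symmetric]) (simp_all add: Rats_closure_real)
  also have "\<dots> \<subseteq> closure (\<rat> \<inter> {0..1})" by (rule closure_mono) auto
  finally show "{0..1} \<subseteq> closure (\<rat> \<inter> {0..1::real})" .
  show "closure (\<rat> \<inter> {0..1}) \<subseteq> {0..1::real}" by (intro closure_minimal) auto
qed

text \<open>The evaluations generate the Borel sets of path space: an open set is a countable union of closed
  balls, and a closed ball is a countable intersection of conditions on values at rational times.\<close>

lemma measurable_into_path_space: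
  fixes X :: "'w \<Rightarrow> real \<Rightarrow> 'v::euclidean_space"
  assumes X: "\<And>\<omega>. \<omega> \<in> space M \<Longrightarrow> X \<omega> \<in> topspace path_space"
    and [measurable]: "\<And>t. t \<in> {0..1} \<Longrightarrow> (\<lambda>\<omega>. X \<omega> t) \<in> borel_measurable M"
  shows "X \<in> M \<rightarrow>\<^sub>M borel_of path_space"
proof -
  obtain D :: "(real \<Rightarrow> 'v) set" where D: "countable D" "D \<subseteq> mspace path_metric"
    and U: "\<forall>U (x :: real \<Rightarrow> 'v). openin path_space U \<longrightarrow> x \<in> U \<longrightarrow>
       (\<exists>d\<in>D. \<exists>r\<in>\<rat>. 0 < r \<and> mdist path_metric d x < r \<and> {y \<in> mspace path_metric. mdist path_metric d y \<le> r} \<subseteq> U)"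
    using path_space_open_countable_Union by (elim exE conjE)
  have Xm: "X \<omega> \<in> mspace path_metric" if "\<omega> \<in> space M" for \<omega>
    using X[OF that] by (simp add: path_space_eq)
  have ball: "{\<omega> \<in> space M. mdist path_metric d (X \<omega>) \<le> r} \<in> sets M" if "d \<in> D" for d r
  proof -
    have d: "d \<in> mspace path_metric" using that D by auto
    have "mdist path_metric d (X \<omega>) \<le> r \<longleftrightarrow> (\<forall>t\<in>\<rat> \<inter> {0..1}. dist (d t) (X \<omega> t) \<le> r)"
      if \<omega>: "\<omega> \<in> space M" for \<omega>
    proof -
      have "continuous_on {0..1} (\<lambda>t. dist (d t) (X \<omega> t))"
        using d Xm[OF \<omega>] by (intro continuous_intros) (auto simp: mspace_path_metric)
      then have "dist (d t) (X \<omega> t) \<le> r" if "\<forall>t\<in>\<rat> \<inter> {0..1}. dist (d t) (X \<omega> t) \<le> r" "t \<in> {0..1}" for t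
        using continuous_le_on_closure[of "\<rat> \<inter> {0..1}" "\<lambda>t. dist (d t) (X \<omega> t)" t r] that
        by (simp add: dense_Rats_unit)
      then show ?thesis using mdist_path_metric_le_iff[OF d Xm[OF \<omega>]] by auto
    qed
    then have "{\<omega> \<in> space M. mdist path_metric d (X \<omega>) \<le> r}
        = {\<omega> \<in> space M. \<forall>t\<in>\<rat> \<inter> {0..1}. dist (d t) (X \<omega> t) \<le> r}" by auto
    also have "\<dots> \<in> sets M"
    proof -
      have "{\<omega> \<in> space M. \<not> dist (d t) (X \<omega> t) \<le> r} \<in> sets M" if "t \<in> \<rat> \<inter> {0..1}" for t
      proof -
        have [measurable]: "(\<lambda>\<omega>. X \<omega> t) \<in> borel_measurable M" using that by simp
        show ?thesis by measurable
      qed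
      then have "space M - (\<Union>t\<in>\<rat> \<inter> {0..1}. {\<omega> \<in> space M. \<not> dist (d t) (X \<omega> t) \<le> r}) \<in> sets M"
        using countable_Int1[OF countable_rat] by (intro sets.Diff sets.countable_UN' sets.top) auto
      also have "space M - (\<Union>t\<in>\<rat> \<inter> {0..1}. {\<omega> \<in> space M. \<not> dist (d t) (X \<omega> t) \<le> r})
          = {\<omega> \<in> space M. \<forall>t\<in>\<rat> \<inter> {0..1}. dist (d t) (X \<omega> t) \<le> r}" by auto
      finally show ?thesis .
    qed
    finally show ?thesis .
  qed
  show ?thesis
    unfolding borel_of_def
  proof (rule measurable_measure_of)
    show "{U. openin path_space U} \<subseteq> Pow (topspace path_space)"
      using openin_subset by blast
    show "X \<in> space M \<rightarrow> topspace path_space" using X by auto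
    fix V :: "(real \<Rightarrow> 'v) set" assume "V \<in> {U. openin path_space U}"
    then have V: "openin path_space V" by simp
    define I where "I = {(d, r) \<in> D \<times> \<rat>. {y \<in> mspace path_metric. mdist path_metric d y \<le> r} \<subseteq> V}"
    have "countable I"
      by (rule countable_subset[of _ "D \<times> \<rat>"]) (use D countable_rat in \<open>auto simp: I_def\<close>)
    have "X -` V \<inter> space M = (\<Union>(d, r)\<in>I. {\<omega> \<in> space M. mdist path_metric d (X \<omega>) \<le> r})"
    proof (intro equalityI subsetI)
      fix \<omega> assume "\<omega> \<in> X -` V \<inter> space M"
      then have \<omega>: "X \<omega> \<in> V" "\<omega> \<in> space M" by auto
      obtain d r where dr: "d \<in> D" "r \<in> \<rat>" "0 < r" "mdist path_metric d (X \<omega>) < r"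
          "{y \<in> mspace path_metric. mdist path_metric d y \<le> r} \<subseteq> V"
        using U V \<omega>(1) by blast
      then show "\<omega> \<in> (\<Union>(d, r)\<in>I. {\<omega> \<in> space M. mdist path_metric d (X \<omega>) \<le> r})"
        using \<omega> dr unfolding I_def by (intro UN_I[of "(d, r)"]) auto
    qed (use Xm in \<open>auto simp: I_def\<close>)
    also have "\<dots> \<in> sets M"
      using \<open>countable I\<close> by (intro sets.countable_UN') (auto simp: I_def intro: ball)
    finally show "X -` V \<inter> space M \<in> sets M" .
  qed
qed

lemma measurable_path_eval:
  assumes t: "t \<in> {0..1}"
  shows "(\<lambda>x. x t :: 'v::euclidean_space) \<in> borel_measurable (borel_of path_space)"
proof (rule borel_measurableI)
  fix V :: "'v set" assume V: "open V"
  interpret Metric_space "mspace path_metric" "mdist path_metric :: (real \<Rightarrow> 'v) \<Rightarrow> _"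
    by (rule Metric_space_mspace_mdist)
  have "openin mtopology {x \<in> mspace path_metric. x t \<in> V}"
    unfolding openin_mtopology
  proof (intro conjI allI impI)
    fix x assume x: "x \<in> {x \<in> mspace path_metric. x t \<in> V}"
    then obtain e where e: "0 < e" "ball (x t) e \<subseteq> V" using V by (auto simp: open_contains_ball)
    have "mball x e \<subseteq> {x \<in> mspace path_metric. x t \<in> V}"
    proof
      fix y assume y: "y \<in> mball x e"
      then have "dist (x t) (y t) \<le> mdist path_metric x y"
        using mdist_path_metric_le_iff[of x y "mdist path_metric x y"] t by auto
      with y e show "y \<in> {x \<in> mspace path_metric. x t \<in> V}" by auto
    qed
    then show "\<exists>r>0. mball x r \<subseteq> {x \<in> mspace path_metric. x t \<in> V}" using e by auto
  qed auto
  moreover have "(\<lambda>x. x t) -` V \<inter> space (borel_of path_space) = {x \<in> mspace path_metric. x t \<in> V}"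
    by (auto simp: path_space_eq)
  ultimately show "(\<lambda>x. x t) -` V \<inter> space (borel_of path_space) \<in> sets (borel_of path_space)"
    by (auto simp: sets_borel_of path_space_eq mtopology_of_def)
qed

text \<open>The real argument is rounded down to multiples of \<open>1 / (n + 1)\<close>, which leaves countably many measurable
  functions; continuity gives the limit.\<close>

lemma measurable_Caratheodory:
  fixes f :: "'a \<Rightarrow> real \<Rightarrow> 'v::euclidean_space"
  assumes [measurable]: "\<And>t. (\<lambda>x. f x t) \<in> borel_measurable N"
    and cont: "\<And>x. x \<in> space N \<Longrightarrow> continuous_on UNIV (f x)"
  shows "(\<lambda>z. f (fst z) (snd z)) \<in> borel_measurable (N \<Otimes>\<^sub>M borel)"
proof (rule borel_measurable_LIMSEQ_metric)
  show "(\<lambda>z. f (fst z) (real_of_int \<lfloor>real (Suc n) * snd z\<rfloor> / real (Suc n))) \<in> borel_measurable (N \<Otimes>\<^sub>M borel)" for n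
    by (rule measurable_compose_countable[where f="\<lambda>k z. f (fst z) (real_of_int k / real (Suc n))"]) measurable
  fix z assume "z \<in> space (N \<Otimes>\<^sub>M (borel :: real measure))"
  then have z: "fst z \<in> space N" by (auto simp: space_pair_measure)
  have "(\<lambda>n. real_of_int \<lfloor>real (Suc n) * snd z\<rfloor> / real (Suc n)) \<longlonglongrightarrow> snd z"
  proof (rule tendsto_sandwich[of "\<lambda>n. snd z - 1 / real (Suc n)" _ _ "\<lambda>n. snd z"])
    show "(\<lambda>n. snd z - 1 / real (Suc n)) \<longlonglongrightarrow> snd z"
      using tendsto_diff[OF tendsto_const LIMSEQ_inverse_real_of_nat, of "snd z"] by (simp add: inverse_eq_divide)
    show "\<forall>\<^sub>F n in sequentially. snd z - 1 / real (Suc n) \<le> real_of_int \<lfloor>real (Suc n) * snd z\<rfloor> / real (Suc n)"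
    proof (rule always_eventually, rule allI)
      fix n
      have "real (Suc n) * snd z - 1 \<le> real_of_int \<lfloor>real (Suc n) * snd z\<rfloor>" by linarith
      then have "(real (Suc n) * snd z - 1) / real (Suc n) \<le> real_of_int \<lfloor>real (Suc n) * snd z\<rfloor> / real (Suc n)"
        by (intro divide_right_mono) auto
      then show "snd z - 1 / real (Suc n) \<le> real_of_int \<lfloor>real (Suc n) * snd z\<rfloor> / real (Suc n)"
        by (simp add: diff_divide_distrib)
    qed
    show "\<forall>\<^sub>F n in sequentially. real_of_int \<lfloor>real (Suc n) * snd z\<rfloor> / real (Suc n) \<le> snd z"
    proof (rule always_eventually, rule allI)
      fix n
      have "real_of_int \<lfloor>real (Suc n) * snd z\<rfloor> / real (Suc n) \<le> real (Suc n) * snd z / real (Suc n)"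
        by (intro divide_right_mono) auto
      then show "real_of_int \<lfloor>real (Suc n) * snd z\<rfloor> / real (Suc n) \<le> snd z" by simp
    qed
  qed simp
  then show "(\<lambda>n. f (fst z) (real_of_int \<lfloor>real (Suc n) * snd z\<rfloor> / real (Suc n))) \<longlonglongrightarrow> f (fst z) (snd z)"
    using cont[OF z] by (intro continuous_on_tendsto_compose[of UNIV "f (fst z)"]) auto
qed

text \<open>Clamping the time to the unit interval extends the paths continuously to the real line.\<close>

lemma path_eval_jointly_measurable:
  "(\<lambda>z. fst z (max 0 (min 1 (snd z))) :: 'v::euclidean_space) \<in> borel_measurable (borel_of path_space \<Otimes>\<^sub>M borel)"
proof (rule measurable_Caratheodory[where f="\<lambda>x t. x (max 0 (min 1 t))"])
  show "(\<lambda>x. x (max 0 (min 1 t)) :: 'v) \<in> borel_measurable (borel_of path_space)" for t :: real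
    by (rule measurable_path_eval) auto
  fix x :: "real \<Rightarrow> 'v" assume "x \<in> space (borel_of path_space)"
  then have "continuous_on {0..1} x" by (simp add: topspace_path_space)
  moreover have "continuous_on UNIV (\<lambda>t :: real. max 0 (min 1 t))" by (intro continuous_intros)
  ultimately show "continuous_on UNIV (\<lambda>t. x (max 0 (min 1 t)))"
    by (rule continuous_on_compose2) auto
qed

lemma path_law_measurable:
  fixes X :: "real \<Rightarrow> 'w \<Rightarrow> 'v::euclidean_space"
  assumes "\<And>t. t \<in> {0..1} \<Longrightarrow> X t \<in> borel_measurable M"
    and "\<And>\<omega>. \<omega> \<in> space M \<Longrightarrow> X 0 \<omega> = 0 \<and> continuous_on {0..1} (\<lambda>t. X t \<omega>)"
  shows "(\<lambda>\<omega>. \<lambda>t\<in>{0..1}. X t \<omega>) \<in> M \<rightarrow>\<^sub>M borel_of path_space"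
proof (rule measurable_into_path_space)
  show "(\<lambda>t\<in>{0..1}. X t \<omega>) \<in> topspace path_space" if "\<omega> \<in> space M" for \<omega>
  proof -
    have "continuous_on {0..1} (\<lambda>t\<in>{0..1}. X t \<omega>) \<longleftrightarrow> continuous_on {0..1} (\<lambda>t. X t \<omega>)"
      by (rule continuous_on_cong) auto
    then show ?thesis
      using assms(2)[OF that] by (simp add: topspace_path_space)
  qed
qed (use assms(1) in simp)

section \<open>The Cameron--Martin norm and dyadic energies\<close>

lemma LINT_point: "(LINT s:{a..a :: real}|lborel. g s) = (0 :: 'v::euclidean_space)"
proof -
  have "AE s in lborel. indicat_real {a..a} s *\<^sub>R g s = 0"
    using AE_lborel_singleton[of a] by eventually_elim (auto simp: indicator_def dest: antisym)
  then show ?thesis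
    unfolding set_lebesgue_integral_def by (rule integral_eq_zero_AE)
qed

lemma LINT_diff:
  fixes g :: "real \<Rightarrow> 'v::euclidean_space"
  assumes g: "set_integrable lborel {0..1} g" and ab: "0 \<le> a" "a \<le> b" "b \<le> 1"
  shows "(LINT s:{0..b}|lborel. g s) - (LINT s:{0..a}|lborel. g s) = (LINT s:{a..b}|lborel. g s)"
proof -
  have 1: "set_integrable lborel {0..a} g" "set_integrable lborel {a<..b} g" "set_integrable lborel {a..b} g"
    using ab by (auto intro!: set_integrable_subset[OF g])
  have "{0..b} = {0..a} \<union> {a<..b}" using ab by auto
  then have "(LINT s:{0..b}|lborel. g s) = (LINT s:{0..a}|lborel. g s) + (LINT s:{a<..b}|lborel. g s)"
    using 1 by (simp only:) (intro set_integral_Un, auto)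
  also have "(LINT s:{a<..b}|lborel. g s) = (LINT s:{a..b}|lborel. g s)"
    using 1 AE_lborel_singleton[of a] unfolding set_lebesgue_integral_def set_integrable_def
    by (intro integral_cong_AE) (auto elim!: eventually_mono simp: indicator_def)
  finally show ?thesis by simp
qed

lemma ac_derivativeD:
  assumes "has_ac_derivative h g"
  shows "set_integrable lborel {0..1} g"
    and "t \<in> {0..1} \<Longrightarrow> h t = h 0 + (LINT s:{0..t}|lborel. g s)"
  using assms unfolding has_ac_derivative_def by blast+

lemma ac_derivative_increment:
  assumes "has_ac_derivative h g" "0 \<le> a" "a \<le> b" "b \<le> 1"
  shows "h b - h a = (LINT s:{a..b}|lborel. g s)"
proof -
  have "h b = h 0 + (LINT s:{0..b}|lborel. g s)" "h a = h 0 + (LINT s:{0..a}|lborel. g s)"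
    using assms(2-4) by (auto intro!: ac_derivativeD(2)[OF assms(1)])
  moreover have "(LINT s:{0..b}|lborel. g s) - (LINT s:{0..a}|lborel. g s) = (LINT s:{a..b}|lborel. g s)"
    using assms by (intro LINT_diff ac_derivativeD)
  ultimately show ?thesis by simp
qed

lemma continuous_on_LINT:
  fixes g :: "real \<Rightarrow> 'v::euclidean_space"
  assumes g: "set_integrable lborel {0..1} g"
  shows "continuous_on {0..1} (\<lambda>t. LINT s:{0..t}|lborel. g s)"
proof -
  have "continuous_on {0..1} (\<lambda>t. integral {0..t} g)"
    by (rule indefinite_integral_continuous_1) (rule set_borel_integral_eq_integral(1)[OF g])
  moreover have "(LINT s:{0..t}|lborel. g s) = integral {0..t} g" if "t \<in> {0..1}" for t
    using that by (intro set_borel_integral_eq_integral(2) set_integrable_subset[OF g]) auto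
  ultimately show ?thesis
    using continuous_on_cong[OF refl, of "{0..1}" "\<lambda>t. LINT s:{0..t}|lborel. g s" "\<lambda>t. integral {0..t} g"] by blast
qed

lemma ac_derivative_continuous:
  assumes "has_ac_derivative h g"
  shows "continuous_on {0..1} h"
proof -
  have "continuous_on {0..1} (\<lambda>t. h 0 + (LINT s:{0..t}|lborel. g s))"
    by (intro continuous_intros continuous_on_LINT ac_derivativeD(1)[OF assms])
  moreover have "h 0 + (LINT s:{0..t}|lborel. g s) = h t" if "t \<in> {0..1}" for t
    using ac_derivativeD(2)[OF assms that] by (rule sym)
  ultimately show ?thesis
    using continuous_on_cong[OF refl, of "{0..1}" "\<lambda>t. h 0 + (LINT s:{0..t}|lborel. g s)" h] by blast
qed

text \<open>The variance of the norm of the integrand is nonnegative.\<close>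

lemma norm_LINT_square_le:
  fixes g :: "real \<Rightarrow> 'v::euclidean_space"
  assumes g: "set_integrable lborel {a..b} g" and g2: "set_integrable lborel {a..b} (\<lambda>t. (norm (g t))\<^sup>2)"
    and ab: "a \<le> b"
  shows "(norm (LINT s:{a..b}|lborel. g s))\<^sup>2 \<le> (b - a) * (LINT s:{a..b}|lborel. (norm (g s))\<^sup>2)"
proof -
  define I where "I = (LINT s:{a..b}|lborel. norm (g s))"
  define J where "J = (LINT s:{a..b}|lborel. (norm (g s))\<^sup>2)"
  have ng: "set_integrable lborel {a..b} (\<lambda>s. norm (g s))"
    using g by (rule set_integrable_norm)
  have le: "norm (LINT s:{a..b}|lborel. g s) \<le> I"
    unfolding I_def using g by (rule set_integral_norm_bound)
  have const: "set_integrable lborel {a..b} (\<lambda>s. c)" for c :: real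
    by (simp add: set_integrable_def integrable_real_indicator emeasure_lborel_Icc_eq)
  have lconst: "(LINT s:{a..b}|lborel. c) = (b - a) * c" for c :: real
    using ab by (simp add: set_lebesgue_integral_def)
  have q: "0 \<le> J - 2 * m * I + m\<^sup>2 * (b - a)" for m
  proof -
    have eq: "(norm (g s) - m)\<^sup>2 = ((norm (g s))\<^sup>2 - 2 * m * norm (g s)) + m\<^sup>2" for s
      by (simp add: power2_diff algebra_simps)
    have i1: "set_integrable lborel {a..b} (\<lambda>s. 2 * m * norm (g s))"
      using ng by (intro set_integrable_mult_right) auto
    have "0 \<le> (LINT s:{a..b}|lborel. (norm (g s) - m)\<^sup>2)"
      unfolding set_lebesgue_integral_def by (intro integral_nonneg_AE) auto
    also have "\<dots> = (LINT s:{a..b}|lborel. (norm (g s))\<^sup>2 - 2 * m * norm (g s)) + (LINT s:{a..b}|lborel. m\<^sup>2)"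
      unfolding eq by (intro set_integral_add const set_integral_diff g2 i1)
    also have "(LINT s:{a..b}|lborel. (norm (g s))\<^sup>2 - 2 * m * norm (g s)) = J - 2 * m * I"
      using set_integral_diff(2)[OF g2 i1] by (simp add: I_def J_def)
    finally show ?thesis by (simp add: lconst mult.commute)
  qed
  have "I\<^sup>2 \<le> (b - a) * J"
  proof (cases "a = b")
    case True
    then have "I = 0"
      using LINT_point[of a "\<lambda>s. norm (g s)"] by (simp add: I_def)
    then show ?thesis using True by simp
  next
    case False
    then have d: "0 < b - a" using ab by simp
    have "0 \<le> (b - a) * (J - 2 * (I / (b - a)) * I + (I / (b - a))\<^sup>2 * (b - a))"
      using d by (intro mult_nonneg_nonneg q) simp_all
    also have "\<dots> = (b - a) * J - I\<^sup>2"
    proof -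
      define x where "x = I / (b - a)"
      have "I = x * (b - a)" using d by (simp add: x_def)
      show ?thesis
        unfolding x_def[symmetric] unfolding \<open>I = x * (b - a)\<close>
        by (simp add: power2_eq_square algebra_simps)
    qed
    finally show ?thesis by simp
  qed
  moreover have "(norm (LINT s:{a..b}|lborel. g s))\<^sup>2 \<le> I\<^sup>2"
    using le by (intro power_mono) auto
  ultimately show ?thesis by (simp add: J_def)
qed

subsection \<open>Uniqueness of the derivative\<close>

text \<open>The initial intervals are an intersection-stable generator of the Borel sets, so the integral of \<open>f\<close>
  over every Borel set vanishes.\<close>

lemma LINT_initial_zero_imp_AE_zero:
  fixes f :: "real \<Rightarrow> 'v::euclidean_space"
  assumes f: "set_integrable lborel {0..1} f"
    and z: "\<And>t. t \<in> {0..1} \<Longrightarrow> (LINT s:{0..t}|lborel. f s) = 0"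
  shows "AE t in lborel. t \<in> {0..1} \<longrightarrow> f t = 0"
proof -
  define F where "F t = indicator {0..1} t *\<^sub>R f t" for t :: real
  have F: "integrable lborel F" using f by (simp add: F_def[abs_def] set_integrable_def)
  have Fset: "set_integrable lborel A F" if "A \<in> sets borel" for A
    using F that by (simp add: set_integrable_def integrable_mult_indicator)
  have F_tot: "integral\<^sup>L lborel F = 0"
    using z[of 1] by (simp add: F_def[abs_def] set_lebesgue_integral_def)
  have "set_lebesgue_integral lborel A F = 0" if "A \<in> sets borel" for A
  proof -
    have "A \<in> sigma_sets UNIV (range (\<lambda>a::real. {..a}))"
      using that by (simp add: borel_eq_atMost)
    then show ?thesis
    proof (induction rule: sigma_sets_induct_disjoint[rotated 2, consumes 1, case_names basic empty compl union])
      case (basic A)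
      then obtain a where A: "A = {..a}" by auto
      have "set_lebesgue_integral lborel A F = (LINT s:{0..1} \<inter> {..a}|lborel. f s)"
        unfolding set_lebesgue_integral_def F_def A
        by (intro Bochner_Integration.integral_cong) (auto simp: indicator_def)
      also have "\<dots> = 0"
      proof (cases "0 \<le> a")
        case True
        then have "{0..1} \<inter> {..a} = {0..min 1 a}" by auto
        then show ?thesis using z[of "min 1 a"] True by simp
      next
        case False
        then have "{0..1} \<inter> {..a} = {}" by auto
        then show ?thesis by (simp add: set_lebesgue_integral_def)
      qed
      finally show ?case .
    next
      case empty
      show ?case by (simp add: set_lebesgue_integral_def)
    next
      case (compl A)
      then have A: "A \<in> sets borel" by (simp add: borel_eq_atMost)
      have "integral\<^sup>L lborel F = set_lebesgue_integral lborel (A \<union> (UNIV - A)) F"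
        by (simp add: set_lebesgue_integral_def)
      also have "\<dots> = set_lebesgue_integral lborel A F + set_lebesgue_integral lborel (UNIV - A) F"
        using A by (intro set_integral_Un Fset) auto
      finally show ?case using compl F_tot by simp
    next
      case (union A)
      then have A: "A i \<in> sets borel" for i by (auto simp: borel_eq_atMost)
      have "set_lebesgue_integral lborel (\<Union>i. A i) F = (\<Sum>i. set_lebesgue_integral lborel (A i) F)"
        using A union(1) by (intro lebesgue_integral_countable_add Fset) (auto simp: disjoint_family_on_def)
      then show ?case using union by simp
    qed (auto simp: Int_stable_def intro: exI[of _ "min _ _"])
  qed
  then have "AE t in lborel. F t = 0" using F by (intro sigma_finite_measure.density_zero[OF sigma_finite_lborel]) auto
  then show ?thesis by eventually_elim (auto simp: F_def)
qed

lemma ac_derivative_unique: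
  assumes "has_ac_derivative h g" "has_ac_derivative h g'"
  shows "AE t in lborel. t \<in> {0..1} \<longrightarrow> g t = g' t"
proof -
  have i: "set_integrable lborel {0..1} g" "set_integrable lborel {0..1} g'"
    using assms by (auto intro: ac_derivativeD(1))
  have "AE t in lborel. t \<in> {0..1} \<longrightarrow> g t - g' t = 0"
  proof (rule LINT_initial_zero_imp_AE_zero)
    show "set_integrable lborel {0..1} (\<lambda>t. g t - g' t)" using i by (rule set_integral_diff)
    fix t :: real assume t: "t \<in> {0..1}"
    have "set_integrable lborel {0..t} g" "set_integrable lborel {0..t} g'"
      using t by (auto intro!: set_integrable_subset[OF i(1)] set_integrable_subset[OF i(2)])
    then have "(LINT s:{0..t}|lborel. g s - g' s) = (LINT s:{0..t}|lborel. g s) - (LINT s:{0..t}|lborel. g' s)"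
      by (rule set_integral_diff)
    also have "h t = h 0 + (LINT s:{0..t}|lborel. g s)" "h t = h 0 + (LINT s:{0..t}|lborel. g' s)"
      using assms t by (auto intro!: ac_derivativeD(2))
    then have "(LINT s:{0..t}|lborel. g s) - (LINT s:{0..t}|lborel. g' s) = 0"
      by (metis add_left_cancel diff_self)
    finally show "(LINT s:{0..t}|lborel. g s - g' s) = 0" .
  qed
  then show ?thesis by eventually_elim auto
qed

subsection \<open>Dyadic energies\<close>

text \<open>The energy of the piecewise linear interpolation of \<open>h\<close> at the multiples of \<open>1 / 2 ^ n\<close>.\<close>

definition dyadic_energy :: "nat \<Rightarrow> (real \<Rightarrow> 'v::euclidean_space) \<Rightarrow> real" where
  "dyadic_energy n h = 2 ^ n * (\<Sum>k<2 ^ n. (norm (h (real (Suc k) / 2 ^ n) - h (real k / 2 ^ n)))\<^sup>2)"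

lemma dyadic_energy_nonneg: "0 \<le> dyadic_energy n h"
  by (simp add: dyadic_energy_def sum_nonneg)

lemma dyadic_point: "k \<le> 2 ^ n \<Longrightarrow> real k / 2 ^ n \<in> {0..1}"
proof -
  assume "k \<le> 2 ^ n"
  then have "real k \<le> real (2 ^ n)" by (rule of_nat_mono)
  then show ?thesis by simp
qed

lemma floor_dyadic_point:
  assumes t: "t \<in> {0..1}"
  shows "\<exists>k\<le>2 ^ n. real_of_int \<lfloor>2 ^ n * t\<rfloor> / 2 ^ n = real k / 2 ^ n"
proof (intro exI[of _ "nat \<lfloor>2 ^ n * t\<rfloor>"] conjI)
  have "2 ^ n * t \<le> 2 ^ n * 1" using t by (intro mult_left_mono) auto
  then have "2 ^ n * t < 2 ^ n + 1" by linarith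
  then have "\<lfloor>2 ^ n * t\<rfloor> \<le> 2 ^ n" by (simp add: floor_le_iff)
  then show "nat \<lfloor>2 ^ n * t\<rfloor> \<le> 2 ^ n" by (simp add: nat_le_iff)
  have "0 \<le> 2 ^ n * t" using t by simp
  then show "real_of_int \<lfloor>2 ^ n * t\<rfloor> / 2 ^ n = real (nat \<lfloor>2 ^ n * t\<rfloor>) / 2 ^ n" by simp
qed

lemma dyadic_point_mult:
  assumes "t \<in> {0..1}" "k \<le> 2 ^ n"
  shows "t * (real k / 2 ^ n) \<in> {0..1}"
proof -
  have "0 \<le> t" "t \<le> 1" "0 \<le> real k / 2 ^ n" "real k / 2 ^ n \<le> 1"
    using assms(1) dyadic_point[OF assms(2)] by simp_all
  then show ?thesis by (simp only: atLeastAtMost_iff mult_nonneg_nonneg mult_le_one)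
qed

text \<open>Jensen's inequality on each dyadic interval.\<close>

lemma dyadic_energy_le:
  assumes h: "has_ac_derivative h g" and g2: "set_integrable lborel {0..1} (\<lambda>t. (norm (g t))\<^sup>2)"
  shows "dyadic_energy n h \<le> (LINT t:{0..1}|lborel. (norm (g t))\<^sup>2)"
proof -
  define G where "G t = (LINT s:{0..t}|lborel. (norm (g s))\<^sup>2)" for t :: real
  have g: "set_integrable lborel {0..1} g" using h by (rule ac_derivativeD(1))
  have cell: "2 ^ n * (norm (h (real (Suc k) / 2 ^ n) - h (real k / 2 ^ n)))\<^sup>2
      \<le> G (real (Suc k) / 2 ^ n) - G (real k / 2 ^ n)" if k: "k < 2 ^ n" for k
  proof -
    let ?a = "real k / 2 ^ n" and ?b = "real (Suc k) / 2 ^ n"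
    have ab: "0 \<le> ?a" "?a \<le> ?b" "?b \<le> 1"
      using dyadic_point[of "Suc k" n] k by (auto intro!: divide_right_mono)
    have sub: "{?a..?b} \<subseteq> {0..1}" using ab by auto
    have "(norm (h ?b - h ?a))\<^sup>2 \<le> (?b - ?a) * (LINT s:{?a..?b}|lborel. (norm (g s))\<^sup>2)"
      unfolding ac_derivative_increment[OF h ab]
      by (intro norm_LINT_square_le set_integrable_subset[OF g _ sub] set_integrable_subset[OF g2 _ sub] ab(2)) auto
    also have "(LINT s:{?a..?b}|lborel. (norm (g s))\<^sup>2) = G ?b - G ?a"
      unfolding G_def using LINT_diff[OF g2 ab] by simp
    also have "?b - ?a = 1 / 2 ^ n" by (simp add: add_divide_distrib)
    finally have "2 ^ n * (norm (h ?b - h ?a))\<^sup>2 \<le> 2 ^ n * (1 / 2 ^ n * (G ?b - G ?a))"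
      by (intro mult_left_mono) auto
    then show ?thesis by simp
  qed
  have "dyadic_energy n h = (\<Sum>k<2 ^ n. 2 ^ n * (norm (h (real (Suc k) / 2 ^ n) - h (real k / 2 ^ n)))\<^sup>2)"
    by (simp add: dyadic_energy_def sum_distrib_left)
  also have "\<dots> \<le> (\<Sum>k<2 ^ n. G (real (Suc k) / 2 ^ n) - G (real k / 2 ^ n))"
    by (intro sum_mono cell) auto
  also have "\<dots> = G 1 - G 0"
    using sum_lessThan_telescope[of "\<lambda>k. G (real k / 2 ^ n)" "2 ^ n"] by simp
  also have "G 0 = 0"
    unfolding G_def by (rule LINT_point)
  finally show ?thesis by (simp add: G_def)
qed

subsection \<open>Paths of bounded energy have square integrable derivatives\<close>

definition dyadic_cell :: "nat \<Rightarrow> nat \<Rightarrow> real set" where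
  "dyadic_cell n k = {real k / 2 ^ n ..< real (Suc k) / 2 ^ n}"

definition dyadic_slope :: "(real \<Rightarrow> 'v::euclidean_space) \<Rightarrow> nat \<Rightarrow> nat \<Rightarrow> 'v" where
  "dyadic_slope h n k = 2 ^ n *\<^sub>R (h (real (Suc k) / 2 ^ n) - h (real k / 2 ^ n))"

text \<open>The derivative of the piecewise linear interpolation of \<open>h\<close> at level \<open>n\<close>.\<close>

definition dyadic_derivative :: "(real \<Rightarrow> 'v::euclidean_space) \<Rightarrow> nat \<Rightarrow> real \<Rightarrow> 'v" where
  "dyadic_derivative h n t = (\<Sum>k<2 ^ n. indicator (dyadic_cell n k) t *\<^sub>R dyadic_slope h n k)"

lemma dyadic_cell_sets [measurable, simp]: "dyadic_cell n k \<in> sets borel"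
  by (simp add: dyadic_cell_def)

lemma measure_dyadic_cell: "measure lborel (dyadic_cell n k) = 1 / 2 ^ n"
  by (simp add: dyadic_cell_def add_divide_distrib divide_right_mono)

lemma dyadic_cell_emeasure_finite: "emeasure lborel (dyadic_cell n k) < \<infinity>"
  by (simp add: dyadic_cell_def divide_right_mono)

lemma dyadic_derivative_measurable [measurable]: "dyadic_derivative h n \<in> borel_measurable borel"
  unfolding dyadic_derivative_def[abs_def] by measurable

lemma dyadic_cell_unit: "k < 2 ^ n \<Longrightarrow> dyadic_cell n k \<subseteq> {0..1}"
proof
  fix t assume "k < 2 ^ n" "t \<in> dyadic_cell n k"
  moreover have "0 \<le> real k / 2 ^ n" "real (Suc k) / 2 ^ n \<le> 1" if "k < 2 ^ n"
    using dyadic_point[of k n] dyadic_point[of "Suc k" n] that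
    by (simp_all only: atLeastAtMost_iff Suc_le_eq less_imp_le)
  ultimately show "t \<in> {0..1}"
    unfolding dyadic_cell_def atLeastAtMost_iff atLeastLessThan_iff by linarith
qed

lemma dyadic_derivative_outside: "t \<notin> {0..1} \<Longrightarrow> dyadic_derivative h n t = 0"
proof -
  assume t: "t \<notin> {0..1}"
  have "t \<notin> dyadic_cell n k" if "k < 2 ^ n" for k
    using dyadic_cell_unit[OF that] t by blast
  then show ?thesis
    unfolding dyadic_derivative_def by (intro sum.neutral) (simp add: indicator_def)
qed

lemma dyadic_derivative_integrable: "integrable lborel (dyadic_derivative h n)"
  unfolding dyadic_derivative_def[abs_def] using dyadic_cell_emeasure_finite
  by (intro Bochner_Integration.integrable_sum integrable_scaleR_left integrable_real_indicator) auto

lemma dyadic_cell_nested: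
  assumes "n \<le> m"
  shows "dyadic_cell m j \<inter> dyadic_cell n k
    = (if j \<in> {k * 2 ^ (m - n) ..< Suc k * 2 ^ (m - n)} then dyadic_cell m j else {})"
proof -
  define d where "d = m - n"
  have m: "m = n + d" using assms by (simp add: d_def)
  have cell_n: "t \<in> dyadic_cell n k \<longleftrightarrow> real (k * 2 ^ d) \<le> t * 2 ^ m \<and> t * 2 ^ m < real (Suc k * 2 ^ d)" for t
  proof -
    have "t * 2 ^ m = t * 2 ^ n * 2 ^ d" by (simp add: m power_add)
    then have "real (k * 2 ^ d) \<le> t * 2 ^ m \<longleftrightarrow> real k \<le> t * 2 ^ n"
      "t * 2 ^ m < real (Suc k * 2 ^ d) \<longleftrightarrow> t * 2 ^ n < real (Suc k)"
      by (simp_all only: of_nat_mult of_nat_power of_nat_numeral mult_le_cancel_right_pos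
          mult_less_cancel_right_pos zero_less_power zero_less_numeral)
    then show ?thesis by (simp only: dyadic_cell_def) (auto simp: field_simps)
  qed
  have cell_m: "t \<in> dyadic_cell m j \<longleftrightarrow> real j \<le> t * 2 ^ m \<and> t * 2 ^ m < real (Suc j)" for t
    by (auto simp: dyadic_cell_def field_simps)
  show ?thesis
  proof (cases "j \<in> {k * 2 ^ d ..< Suc k * 2 ^ d}")
    case True
    then have "real (k * 2 ^ d) \<le> real j" "real (Suc j) \<le> real (Suc k * 2 ^ d)"
      unfolding of_nat_le_iff by auto
    then have "t \<in> dyadic_cell n k" if "t \<in> dyadic_cell m j" for t
      using that unfolding cell_n cell_m by linarith
    then show ?thesis using True by (auto simp: d_def)
  next
    case False
    then have "Suc j \<le> k * 2 ^ d \<or> Suc k * 2 ^ d \<le> j" by auto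
    then have "real (Suc j) \<le> real (k * 2 ^ d) \<or> real (Suc k * 2 ^ d) \<le> real j"
      unfolding of_nat_le_iff .
    then have "t \<notin> dyadic_cell n k" if "t \<in> dyadic_cell m j" for t
      using that unfolding cell_n cell_m by linarith
    then show ?thesis using False by (auto simp: d_def)
  qed
qed

lemma integral_dyadic_derivative_cell:
  fixes h :: "real \<Rightarrow> 'v::euclidean_space"
  assumes nm: "n \<le> m" and k: "k < 2 ^ n"
  shows "(\<integral>t. indicator (dyadic_cell n k) t *\<^sub>R dyadic_derivative h m t \<partial>lborel)
    = h (real (Suc k) / 2 ^ n) - h (real k / 2 ^ n)"
proof -
  define d where "d = m - n"
  have m: "m = n + d" using nm by (simp add: d_def)
  have rng: "{k * 2 ^ d ..< Suc k * 2 ^ d} \<subseteq> {..<2 ^ m}"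
  proof -
    have "Suc k * 2 ^ d \<le> 2 ^ n * 2 ^ d" using k by (intro mult_right_mono) auto
    then show ?thesis by (auto simp: m power_add)
  qed
  have "(\<integral>t. indicator (dyadic_cell n k) t *\<^sub>R dyadic_derivative h m t \<partial>lborel)
      = (\<integral>t. (\<Sum>j<2 ^ m. indicator (dyadic_cell m j \<inter> dyadic_cell n k) t *\<^sub>R dyadic_slope h m j) \<partial>lborel)"
    unfolding dyadic_derivative_def scaleR_sum_right
    by (intro Bochner_Integration.integral_cong sum.cong refl) (auto simp: indicator_def)
  also have "\<dots> = (\<Sum>j<2 ^ m. \<integral>t. indicator (dyadic_cell m j \<inter> dyadic_cell n k) t *\<^sub>R dyadic_slope h m j \<partial>lborel)"
    using dyadic_cell_emeasure_finite
    by (intro Bochner_Integration.integral_sum integrable_scaleR_left integrable_real_indicator)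
       (auto simp: dyadic_cell_nested[OF nm])
  also have "\<dots> = (\<Sum>j<2 ^ m. if j \<in> {k * 2 ^ d ..< Suc k * 2 ^ d} then (1 / 2 ^ m) *\<^sub>R dyadic_slope h m j else 0)"
  proof -
    have "(\<integral>t. indicat_real (dyadic_cell m j) t *\<^sub>R c \<partial>lborel) = (1 / 2 ^ m) *\<^sub>R c" for j and c :: 'v
      using dyadic_cell_emeasure_finite[of m j]
      by (subst integral_scaleR_left) (simp_all add: measure_dyadic_cell integrable_real_indicator)
    then show ?thesis
      by (intro sum.cong) (auto simp: dyadic_cell_nested[OF nm] d_def[symmetric])
  qed
  also have "\<dots> = (\<Sum>j\<in>{k * 2 ^ d ..< Suc k * 2 ^ d}. (1 / 2 ^ m) *\<^sub>R dyadic_slope h m j)"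
    using rng by (subst sum.inter_restrict[symmetric]) (auto simp: Int_absorb1)
  also have "\<dots> = (\<Sum>j\<in>{k * 2 ^ d ..< Suc k * 2 ^ d}. h (real (Suc j) / 2 ^ m) - h (real j / 2 ^ m))"
    by (simp add: dyadic_slope_def)
  also have "\<dots> = h (real (Suc k * 2 ^ d) / 2 ^ m) - h (real (k * 2 ^ d) / 2 ^ m)"
    by (rule sum_Suc_diff') simp
  also have "real (Suc k * 2 ^ d) / 2 ^ m = real (Suc k) / 2 ^ n"
    by (simp add: m power_add field_simps)
  also have "real (k * 2 ^ d) / 2 ^ m = real k / 2 ^ n"
    by (simp add: m power_add)
  finally show ?thesis .
qed

text \<open>The dyadic derivatives form a martingale: averaging the finer one over a coarse interval gives the coarse
  one. So the inner product depends on the coarser level only.\<close>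

lemma integral_inner_dyadic_derivative:
  assumes nm: "n \<le> m"
  shows "integrable lborel (\<lambda>t. dyadic_derivative h n t \<bullet> dyadic_derivative h m t)"
    and "(\<integral>t. dyadic_derivative h n t \<bullet> dyadic_derivative h m t \<partial>lborel) = dyadic_energy n h"
proof -
  have eq: "dyadic_derivative h n t \<bullet> dyadic_derivative h m t
      = (\<Sum>k<2 ^ n. dyadic_slope h n k \<bullet> (indicator (dyadic_cell n k) t *\<^sub>R dyadic_derivative h m t))" for t
    unfolding dyadic_derivative_def[of h n] by (simp add: inner_sum_left)
  have i: "integrable lborel (\<lambda>t. indicator (dyadic_cell n k) t *\<^sub>R dyadic_derivative h m t)" for k
    by (intro integrable_mult_indicator dyadic_derivative_integrable) simp
  show "integrable lborel (\<lambda>t. dyadic_derivative h n t \<bullet> dyadic_derivative h m t)"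
    unfolding eq using i by (intro Bochner_Integration.integrable_sum integrable_inner_right) auto
  have "(\<integral>t. dyadic_derivative h n t \<bullet> dyadic_derivative h m t \<partial>lborel)
      = (\<Sum>k<2 ^ n. dyadic_slope h n k \<bullet> (\<integral>t. indicator (dyadic_cell n k) t *\<^sub>R dyadic_derivative h m t \<partial>lborel))"
    unfolding eq
  proof (subst Bochner_Integration.integral_sum)
    show "integrable lborel (\<lambda>t. dyadic_slope h n k \<bullet> (indicator (dyadic_cell n k) t *\<^sub>R dyadic_derivative h m t))" for k
      by (rule integrable_inner_right[OF i])
    show "(\<Sum>k<2 ^ n. \<integral>t. dyadic_slope h n k \<bullet> (indicator (dyadic_cell n k) t *\<^sub>R dyadic_derivative h m t) \<partial>lborel)
      = (\<Sum>k<2 ^ n. dyadic_slope h n k \<bullet> (\<integral>t. indicator (dyadic_cell n k) t *\<^sub>R dyadic_derivative h m t \<partial>lborel))"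
      by (intro sum.cong refl integral_inner_right i)
  qed
  also have "\<dots> = (\<Sum>k<2 ^ n. 2 ^ n * (norm (h (real (Suc k) / 2 ^ n) - h (real k / 2 ^ n)))\<^sup>2)"
    by (intro sum.cong) (auto simp: integral_dyadic_derivative_cell[OF nm] dyadic_slope_def power2_norm_eq_inner)
  finally show "(\<integral>t. dyadic_derivative h n t \<bullet> dyadic_derivative h m t \<partial>lborel) = dyadic_energy n h"
    by (simp add: dyadic_energy_def sum_distrib_left)
qed

text \<open>Pythagoras' theorem for martingale increments. Bounded energies therefore make the dyadic derivatives
  a Cauchy sequence.\<close>

lemma dyadic_derivative_distance:
  assumes nm: "n \<le> m"
  shows "integrable lborel (\<lambda>t. (norm (dyadic_derivative h m t - dyadic_derivative h n t))\<^sup>2)"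
    and "(\<integral>t. (norm (dyadic_derivative h m t - dyadic_derivative h n t))\<^sup>2 \<partial>lborel)
      = dyadic_energy m h - dyadic_energy n h"
proof -
  have eq: "(norm (dyadic_derivative h m t - dyadic_derivative h n t))\<^sup>2
      = dyadic_derivative h m t \<bullet> dyadic_derivative h m t
        - 2 * (dyadic_derivative h n t \<bullet> dyadic_derivative h m t)
        + dyadic_derivative h n t \<bullet> dyadic_derivative h n t" for t
    by (simp add: power2_norm_eq_inner inner_diff_left inner_diff_right inner_commute)
  note i = integral_inner_dyadic_derivative(1)[of m m h, OF order_refl]
    integral_inner_dyadic_derivative(1)[of n n h, OF order_refl]
    integral_inner_dyadic_derivative(1)[of n m h, OF nm]
  show "integrable lborel (\<lambda>t. (norm (dyadic_derivative h m t - dyadic_derivative h n t))\<^sup>2)"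
    unfolding eq using i by (intro Bochner_Integration.integrable_add Bochner_Integration.integrable_diff integrable_mult_right) auto
  show "(\<integral>t. (norm (dyadic_derivative h m t - dyadic_derivative h n t))\<^sup>2 \<partial>lborel)
      = dyadic_energy m h - dyadic_energy n h"
    unfolding eq using i
    by (simp add: integral_inner_dyadic_derivative(2) nm)
qed

lemma dyadic_energy_mono: "n \<le> m \<Longrightarrow> dyadic_energy n h \<le> dyadic_energy m h"
proof -
  assume "n \<le> m"
  have "0 \<le> (\<integral>t. (norm (dyadic_derivative h m t - dyadic_derivative h n t))\<^sup>2 \<partial>lborel)"
    by (intro integral_nonneg_AE) auto
  then show ?thesis by (simp add: dyadic_derivative_distance(2)[OF \<open>n \<le> m\<close>])
qed

lemma dyadic_derivative_L1_distance:
  assumes nm: "n \<le> m"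
  shows "(\<integral>t. norm (dyadic_derivative h m t - dyadic_derivative h n t) \<partial>lborel)
      \<le> sqrt (dyadic_energy m h - dyadic_energy n h)"
proof -
  let ?u = "\<lambda>t. dyadic_derivative h m t - dyadic_derivative h n t"
  have u0: "?u t = 0" if "t \<notin> {0..1}" for t
    by (simp add: dyadic_derivative_outside[OF that])
  have ind1: "indicator {0..1} t *\<^sub>R norm (?u t) = norm (?u t)" for t :: real
    using u0[of t] by (cases "t \<in> {0..1}") simp_all
  have ind2: "indicator {0..1} t *\<^sub>R (norm (norm (?u t)))\<^sup>2 = (norm (?u t))\<^sup>2" for t :: real
    using u0[of t] by (cases "t \<in> {0..1}") simp_all
  have i: "integrable lborel ?u" by (intro Bochner_Integration.integrable_diff dyadic_derivative_integrable)
  have i1: "set_integrable lborel {0..1} (\<lambda>t. norm (?u t))"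
    unfolding set_integrable_def ind1 using i by (rule integrable_norm)
  have i2: "set_integrable lborel {0..1} (\<lambda>t. (norm (norm (?u t)))\<^sup>2)"
    unfolding set_integrable_def ind2 by (rule dyadic_derivative_distance(1)[OF nm])
  have "(norm (LINT t:{0..1}|lborel. norm (?u t)))\<^sup>2 \<le> (1 - 0) * (LINT t:{0..1}|lborel. (norm (norm (?u t)))\<^sup>2)"
    by (intro norm_LINT_square_le i1 i2) auto
  also have "\<dots> = dyadic_energy m h - dyadic_energy n h"
    unfolding set_lebesgue_integral_def ind2 by (simp add: dyadic_derivative_distance(2)[OF nm])
  also have "(LINT t:{0..1}|lborel. norm (?u t)) = (\<integral>t. norm (?u t) \<partial>lborel)"
    unfolding set_lebesgue_integral_def ind1 ..
  finally show ?thesis by (intro real_le_rsqrt) simp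
qed

lemma LINT_dyadic_derivative:
  assumes "n \<le> m" "k \<le> 2 ^ n"
  shows "(LINT s:{0..real k / 2 ^ n}|lborel. dyadic_derivative h m s) = h (real k / 2 ^ n) - h 0"
  using assms(2)
proof (induction k)
  case 0
  show ?case
    using LINT_point[of 0 "dyadic_derivative h m"] by simp
next
  case (Suc k)
  let ?a = "real k / 2 ^ n" and ?b = "real (Suc k) / 2 ^ n"
  have ab: "0 \<le> ?a" "?a \<le> ?b" "?b \<le> 1"
    using dyadic_point[of "Suc k" n] Suc.prems by (auto intro!: divide_right_mono)
  have "(LINT s:{?a..?b}|lborel. dyadic_derivative h m s)
      = (\<integral>t. indicator (dyadic_cell n k) t *\<^sub>R dyadic_derivative h m t \<partial>lborel)"
    unfolding set_lebesgue_integral_def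
  proof (rule integral_cong_AE)
    show "AE t in lborel. indicat_real {?a..?b} t *\<^sub>R dyadic_derivative h m t
        = indicator (dyadic_cell n k) t *\<^sub>R dyadic_derivative h m t"
      using AE_lborel_singleton[of ?b]
    proof eventually_elim
      case (elim t)
      then have "t \<in> {?a..?b} \<longleftrightarrow> t \<in> dyadic_cell n k" unfolding dyadic_cell_def by auto
      then show ?case by (simp only: indicator_def)
    qed
  qed simp_all
  also have "\<dots> = h ?b - h ?a"
    using Suc.prems by (intro integral_dyadic_derivative_cell assms(1)) simp
  also have "(LINT s:{?a..?b}|lborel. dyadic_derivative h m s)
      = (LINT s:{0..?b}|lborel. dyadic_derivative h m s) - (LINT s:{0..?a}|lborel. dyadic_derivative h m s)"
  proof (rule LINT_diff[symmetric])
    show "set_integrable lborel {0..1} (dyadic_derivative h m)"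
      unfolding set_integrable_def by (intro integrable_mult_indicator dyadic_derivative_integrable) simp
  qed (fact ab)+
  finally show ?case using Suc.IH Suc.prems by (simp add: algebra_simps)
qed

lemma floor_dyadic_tendsto:
  "(\<lambda>n. real_of_int \<lfloor>2 ^ n * t\<rfloor> / 2 ^ n) \<longlonglongrightarrow> t"
proof (rule tendsto_sandwich[of "\<lambda>n. t - (1 / 2) ^ n" _ _ "\<lambda>n. t"])
  have "(\<lambda>n. t - (1 / 2) ^ n) \<longlonglongrightarrow> t - 0"
    by (intro tendsto_intros) simp
  then show "(\<lambda>n. t - (1 / 2) ^ n) \<longlonglongrightarrow> t" by simp
  have "t - (1 / 2) ^ n \<le> real_of_int \<lfloor>2 ^ n * t\<rfloor> / 2 ^ n" for n
  proof -
    have "2 ^ n * t - 1 \<le> real_of_int \<lfloor>2 ^ n * t\<rfloor>" by linarith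
    then have "(2 ^ n * t - 1) / 2 ^ n \<le> real_of_int \<lfloor>2 ^ n * t\<rfloor> / 2 ^ n"
      by (rule divide_right_mono) simp
    then show ?thesis by (simp add: diff_divide_distrib power_one_over)
  qed
  then show "\<forall>\<^sub>F n in sequentially. t - (1 / 2) ^ n \<le> real_of_int \<lfloor>2 ^ n * t\<rfloor> / 2 ^ n"
    by (intro always_eventually allI)
  have "real_of_int \<lfloor>2 ^ n * t\<rfloor> / 2 ^ n \<le> t" for n
  proof -
    have "real_of_int \<lfloor>2 ^ n * t\<rfloor> / 2 ^ n \<le> 2 ^ n * t / 2 ^ n"
      by (rule divide_right_mono) simp_all
    then show ?thesis by simp
  qed
  then show "\<forall>\<^sub>F n in sequentially. real_of_int \<lfloor>2 ^ n * t\<rfloor> / 2 ^ n \<le> t"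
    by (intro always_eventually allI)
qed simp

lemma continuous_eq_on_dyadics:
  fixes f g :: "real \<Rightarrow> 'v::euclidean_space"
  assumes f: "continuous_on {0..1} f" and g: "continuous_on {0..1} g"
    and eq: "\<And>n k. k \<le> 2 ^ n \<Longrightarrow> f (real k / 2 ^ n) = g (real k / 2 ^ n)" and t: "t \<in> {0..1}"
  shows "f t = g t"
proof -
  define s where "s n = real_of_int \<lfloor>2 ^ n * t\<rfloor> / 2 ^ n" for n
  have s: "\<exists>k\<le>2 ^ n. s n = real k / 2 ^ n" for n unfolding s_def by (rule floor_dyadic_point[OF t])
  have s01: "s n \<in> {0..1}" for n using s[of n] dyadic_point by auto
  have st: "s \<longlonglongrightarrow> t" unfolding s_def[abs_def] by (rule floor_dyadic_tendsto)
  have "(\<lambda>n. f (s n)) \<longlonglongrightarrow> f t"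
    by (rule continuous_on_tendsto_compose[OF f st t]) (use s01 in auto)
  moreover have "(\<lambda>n. g (s n)) \<longlonglongrightarrow> g t"
    by (rule continuous_on_tendsto_compose[OF g st t]) (use s01 in auto)
  moreover have "f (s n) = g (s n)" for n
    using s[of n] eq by auto
  ultimately show ?thesis using LIMSEQ_unique by simp
qed

text \<open>The energies increase to a finite limit, so the dyadic derivatives form a Cauchy sequence in \<open>L\<^sup>1\<close>. Along a
  subsequence \<open>R\<close> with summable distances they converge almost everywhere and in \<open>L\<^sup>1\<close> to a limit \<open>g\<close>, and
  Fatou's lemma bounds the energy of \<open>g\<close>. The integral of a dyadic derivative between coarser dyadic times
  is the increment of \<open>h\<close>; in the limit \<open>g\<close> is a derivative of \<open>h\<close>, first at dyadic times and then, by
  continuity, everywhere.\<close>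

lemma bounded_energy_imp_ac_derivative:
  fixes h :: "real \<Rightarrow> 'v::euclidean_space"
  assumes cont: "continuous_on {0..1} h" and bound: "\<And>n. dyadic_energy n h \<le> C"
  shows "\<exists>g. has_ac_derivative h g \<and> set_integrable lborel {0..1} (\<lambda>t. (norm (g t))\<^sup>2)
    \<and> (LINT t:{0..1}|lborel. (norm (g t))\<^sup>2) \<le> C"
proof -
  define E where "E n = dyadic_energy n h" for n
  define D where "D n = dyadic_derivative h n" for n
  have [measurable]: "D n \<in> borel_measurable borel" for n by (simp add: D_def)
  have D_int: "integrable lborel (D n)" for n by (simp add: D_def dyadic_derivative_integrable)
  have C: "0 \<le> C" using order_trans[OF dyadic_energy_nonneg bound[of 0]] .
  have "incseq E" by (intro incseq_SucI) (simp add: E_def dyadic_energy_mono)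
  then obtain e where e: "E \<longlonglongrightarrow> e" "\<And>i. E i \<le> e"
    using incseq_convergent[of E C] bound E_def by metis
  have "\<exists>N. e - E N < (1 / 4) ^ j" for j :: nat
  proof -
    have "\<forall>\<^sub>F n in sequentially. e - (1 / 4) ^ j < E n"
      using e(1) by (rule order_tendstoD) simp
    then obtain N where "e - (1 / 4) ^ j < E N" by (auto simp: eventually_sequentially)
    then show ?thesis by (intro exI[of _ N]) linarith
  qed
  then obtain N where N: "\<And>j :: nat. e - E (N j) < (1 / 4) ^ j" by metis
  \<comment> \<open>an increasing sequence of levels with \<open>N j \<le> R j\<close>\<close>
  define R where "R j = j + (\<Sum>i\<le>j. N i)" for j
  have R_mono: "R j \<le> R (Suc j)" for j by (simp add: R_def)
  have R_ge: "j \<le> R j" for j by (simp add: R_def)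
  have "N j \<le> R j" for j
  proof -
    have "N j \<le> (\<Sum>i\<le>j. N i)" by (rule member_le_sum) auto
    then show ?thesis by (simp add: R_def)
  qed
  then have ER: "E (N j) \<le> E (R j)" for j by (simp add: E_def dyadic_energy_mono)
  define u where "u j t = D (R (Suc j)) t - D (R j) t" for j t
  have u_int: "integrable lborel (u j)" for j
    unfolding u_def[abs_def] by (intro Bochner_Integration.integrable_diff D_int)
  have u_L1: "(\<integral>t. norm (u j t) \<partial>lborel) \<le> (1 / 2) ^ j" for j
  proof -
    have "(\<integral>t. norm (u j t) \<partial>lborel) \<le> sqrt (E (R (Suc j)) - E (R j))"
      unfolding u_def D_def E_def by (rule dyadic_derivative_L1_distance[OF R_mono])
    also have "\<dots> \<le> sqrt ((1 / 4) ^ j)"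
      using N[of j] e(2)[of "R (Suc j)"] ER[of j] by (intro real_sqrt_le_mono) linarith
    also have "(1 / 4 :: real) ^ j = ((1 / 2) ^ j)\<^sup>2"
      by (simp add: power2_eq_square flip: power_mult_distrib)
    finally show ?thesis by simp
  qed
  have sum_half: "summable (\<lambda>j. (1 / 2 :: real) ^ j)" by (rule summable_geometric) simp
  have "(\<integral>\<^sup>+t. (\<Sum>j. ennreal (norm (u j t))) \<partial>lborel) = (\<Sum>j. \<integral>\<^sup>+t. ennreal (norm (u j t)) \<partial>lborel)"
    using u_int by (intro nn_integral_suminf) auto
  also have "\<dots> = (\<Sum>j. ennreal (\<integral>t. norm (u j t) \<partial>lborel))"
    using u_int by (intro arg_cong[of _ _ suminf] ext nn_integral_eq_integral) auto
  also have "\<dots> \<le> (\<Sum>j. ennreal ((1 / 2) ^ j))"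
    by (intro suminf_le ennreal_leI u_L1) auto
  also have "\<dots> = ennreal (\<Sum>j. (1 / 2) ^ j)"
    using sum_half by (intro suminf_ennreal2) auto
  also have "\<dots> < \<infinity>" by simp
  finally have fin: "(\<integral>\<^sup>+t. (\<Sum>j. ennreal (norm (u j t))) \<partial>lborel) \<noteq> \<infinity>"
    by (rule less_imp_neq)
  have "AE t in lborel. (\<Sum>j. ennreal (norm (u j t))) \<noteq> \<infinity>"
    by (rule nn_integral_PInf_AE[OF _ fin]) (simp add: u_def)
  then have u_summable: "AE t in lborel. summable (\<lambda>j. norm (u j t))"
    by eventually_elim (rule summable_suminf_not_top, auto)
  define g where "g t = D (R 0) t + (\<Sum>j. u j t)" for t
  have g_meas[measurable]: "g \<in> borel_measurable borel"
    unfolding g_def[abs_def] u_def by measurable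
  have D_partial: "D (R n) t = D (R 0) t + (\<Sum>j<n. u j t)" for n t
    by (induction n) (auto simp: u_def)
  have D_lim: "AE t in lborel. (\<lambda>n. D (R n) t) \<longlonglongrightarrow> g t"
    using u_summable
  proof eventually_elim
    case (elim t)
    have "(\<lambda>n. \<Sum>j<n. u j t) \<longlonglongrightarrow> (\<Sum>j. u j t)"
      using summable_norm_cancel[OF elim] by (rule summable_LIMSEQ)
    then have "(\<lambda>n. D (R 0) t + (\<Sum>j<n. u j t)) \<longlonglongrightarrow> g t"
      unfolding g_def by (rule tendsto_add[OF tendsto_const])
    moreover have "(\<lambda>n. D (R n) t) = (\<lambda>n. D (R 0) t + (\<Sum>j<n. u j t))"
      by (rule ext) (rule D_partial)
    ultimately show ?case by (simp only:)
  qed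
  have sq: "(\<integral>\<^sup>+t. ennreal ((norm (D n t))\<^sup>2) \<partial>lborel) \<le> ennreal C" for n
  proof -
    have "(\<integral>\<^sup>+t. ennreal ((norm (D n t))\<^sup>2) \<partial>lborel) = ennreal (\<integral>t. (norm (D n t))\<^sup>2 \<partial>lborel)"
      using integral_inner_dyadic_derivative(1)[of n n h]
      by (intro nn_integral_eq_integral) (auto simp: D_def power2_norm_eq_inner)
    also have "(\<integral>t. (norm (D n t))\<^sup>2 \<partial>lborel) = E n"
      using integral_inner_dyadic_derivative(2)[of n n h] by (simp add: D_def E_def power2_norm_eq_inner)
    finally show ?thesis using bound[of n] by (simp add: E_def ennreal_leI)
  qed
  have "(\<integral>\<^sup>+t. ennreal ((norm (g t))\<^sup>2) \<partial>lborel) = (\<integral>\<^sup>+t. liminf (\<lambda>n. ennreal ((norm (D (R n) t))\<^sup>2)) \<partial>lborel)"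
  proof (rule nn_integral_cong_AE, use D_lim in eventually_elim)
    case (elim t)
    have lim: "(\<lambda>n. ennreal ((norm (D (R n) t))\<^sup>2)) \<longlonglongrightarrow> ennreal ((norm (g t))\<^sup>2)"
      by (intro tendsto_ennrealI tendsto_intros elim)
    show ?case by (rule lim_imp_Liminf[OF trivial_limit_sequentially lim, symmetric])
  qed
  also have "\<dots> \<le> liminf (\<lambda>n. \<integral>\<^sup>+t. ennreal ((norm (D (R n) t))\<^sup>2) \<partial>lborel)"
    by (rule nn_integral_liminf) measurable
  also have "\<dots> \<le> limsup (\<lambda>n. \<integral>\<^sup>+t. ennreal ((norm (D (R n) t))\<^sup>2) \<partial>lborel)"
    by (rule Liminf_le_Limsup) simp
  also have "\<dots> \<le> ennreal C"
    by (intro Limsup_bounded always_eventually allI sq)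
  finally have g2_nn: "(\<integral>\<^sup>+t. ennreal ((norm (g t))\<^sup>2) \<partial>lborel) \<le> ennreal C" .
  have g2: "integrable lborel (\<lambda>t. (norm (g t))\<^sup>2)"
    using g2_nn by (intro integrableI_bounded) (auto simp: le_less_trans)
  have "ennreal (\<integral>t. (norm (g t))\<^sup>2 \<partial>lborel) \<le> ennreal C"
    using nn_integral_eq_integral[OF g2] g2_nn by simp
  then have g2_le: "(\<integral>t. (norm (g t))\<^sup>2 \<partial>lborel) \<le> C"
    using C by (simp add: ennreal_le_iff)
  have sums: "integrable lborel (\<lambda>t. \<Sum>j. indicat_real A t *\<^sub>R u j t)"
     "(\<lambda>j. \<integral>t. indicat_real A t *\<^sub>R u j t \<partial>lborel) sums (\<integral>t. (\<Sum>j. indicat_real A t *\<^sub>R u j t) \<partial>lborel)"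
    if A: "A \<in> sets borel" for A
  proof -
    have 1: "integrable lborel (\<lambda>t. indicat_real A t *\<^sub>R u j t)" for j
      using A u_int by (intro integrable_mult_indicator) auto
    have 2: "AE t in lborel. summable (\<lambda>j. norm (indicat_real A t *\<^sub>R u j t))"
      using u_summable by eventually_elim (auto simp: summable_mult)
    have 3: "summable (\<lambda>j. \<integral>t. norm (indicat_real A t *\<^sub>R u j t) \<partial>lborel)"
    proof (rule summable_comparison_test'[OF sum_half])
      fix j :: nat
      have "(\<integral>t. norm (indicat_real A t *\<^sub>R u j t) \<partial>lborel) \<le> (\<integral>t. norm (u j t) \<partial>lborel)"
        using 1[of j] u_int[of j] by (intro integral_mono integrable_norm) (auto simp: indicator_def)
      also note u_L1[of j]
      finally have "(\<integral>t. norm (indicat_real A t *\<^sub>R u j t) \<partial>lborel) \<le> (1 / 2) ^ j" .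
      moreover have "0 \<le> (\<integral>t. norm (indicat_real A t *\<^sub>R u j t) \<partial>lborel)"
        by (intro integral_nonneg_AE) auto
      ultimately show "norm (\<integral>t. norm (indicat_real A t *\<^sub>R u j t) \<partial>lborel) \<le> (1 / 2) ^ j"
        by (metis real_norm_def abs_of_nonneg)
    qed
    show "integrable lborel (\<lambda>t. \<Sum>j. indicat_real A t *\<^sub>R u j t)"
      by (rule integrable_suminf[OF 1 2 3])
    show "(\<lambda>j. \<integral>t. indicat_real A t *\<^sub>R u j t \<partial>lborel) sums (\<integral>t. (\<Sum>j. indicat_real A t *\<^sub>R u j t) \<partial>lborel)"
      by (rule sums_integral[OF 1 2 3])
  qed
  have g_split: "AE t in lborel. indicat_real A t *\<^sub>R g t
      = indicat_real A t *\<^sub>R D (R 0) t + (\<Sum>j. indicat_real A t *\<^sub>R u j t)" for A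
    using u_summable
    by eventually_elim
       (simp add: g_def scaleR_add_right suminf_scaleR_right[OF summable_norm_cancel])
  have D_A: "integrable lborel (\<lambda>t. indicat_real A t *\<^sub>R D n t)" if "A \<in> sets borel" for A n
    using that by (intro integrable_mult_indicator D_int) auto
  have g_int: "set_integrable lborel A g" if A: "A \<in> sets borel" for A
    unfolding set_integrable_def
  proof (subst integrable_cong_AE[OF _ _ g_split])
    show "(\<lambda>t. indicat_real A t *\<^sub>R g t) \<in> borel_measurable lborel"
      "(\<lambda>t. indicat_real A t *\<^sub>R D (R 0) t + (\<Sum>j. indicat_real A t *\<^sub>R u j t)) \<in> borel_measurable lborel"
      using A unfolding u_def by measurable
    show "integrable lborel (\<lambda>t. indicat_real A t *\<^sub>R D (R 0) t + (\<Sum>j. indicat_real A t *\<^sub>R u j t))"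
      by (intro Bochner_Integration.integrable_add D_A sums A)
  qed
  have g_lim: "(\<lambda>n. set_lebesgue_integral lborel A (D (R n))) \<longlonglongrightarrow> set_lebesgue_integral lborel A g"
    if A: "A \<in> sets borel" for A
  proof -
    have "(\<lambda>n. \<Sum>j<n. \<integral>t. indicat_real A t *\<^sub>R u j t \<partial>lborel) \<longlonglongrightarrow> (\<integral>t. (\<Sum>j. indicat_real A t *\<^sub>R u j t) \<partial>lborel)"
      using sums(2)[OF A] by (simp add: sums_def)
    moreover have "(\<integral>t. indicat_real A t *\<^sub>R u j t \<partial>lborel)
        = set_lebesgue_integral lborel A (D (R (Suc j))) - set_lebesgue_integral lborel A (D (R j))" for j
      unfolding set_lebesgue_integral_def u_def scaleR_diff_right
      by (rule Bochner_Integration.integral_diff[OF D_A[OF A] D_A[OF A]])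
    moreover have "(\<Sum>j<n. set_lebesgue_integral lborel A (D (R (Suc j))) - set_lebesgue_integral lborel A (D (R j)))
        = set_lebesgue_integral lborel A (D (R n)) - set_lebesgue_integral lborel A (D (R 0))" for n
      by (rule sum_lessThan_telescope)
    ultimately have "(\<lambda>n. set_lebesgue_integral lborel A (D (R n)) - set_lebesgue_integral lborel A (D (R 0)))
        \<longlonglongrightarrow> (\<integral>t. (\<Sum>j. indicat_real A t *\<^sub>R u j t) \<partial>lborel)" by simp
    then have "(\<lambda>n. (set_lebesgue_integral lborel A (D (R n)) - set_lebesgue_integral lborel A (D (R 0)))
          + set_lebesgue_integral lborel A (D (R 0)))
        \<longlonglongrightarrow> (\<integral>t. (\<Sum>j. indicat_real A t *\<^sub>R u j t) \<partial>lborel) + set_lebesgue_integral lborel A (D (R 0))"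
      by (intro tendsto_intros)
    moreover have "(\<integral>t. (\<Sum>j. indicat_real A t *\<^sub>R u j t) \<partial>lborel) + set_lebesgue_integral lborel A (D (R 0))
        = set_lebesgue_integral lborel A g"
    proof -
      have "set_lebesgue_integral lborel A g
          = (\<integral>t. indicat_real A t *\<^sub>R D (R 0) t + (\<Sum>j. indicat_real A t *\<^sub>R u j t) \<partial>lborel)"
        unfolding set_lebesgue_integral_def
        using A by (intro integral_cong_AE g_split) (auto simp: u_def)
      also have "\<dots> = set_lebesgue_integral lborel A (D (R 0)) + (\<integral>t. (\<Sum>j. indicat_real A t *\<^sub>R u j t) \<partial>lborel)"
        unfolding set_lebesgue_integral_def
        by (intro Bochner_Integration.integral_add D_A A sums)
      finally show ?thesis by simp
    qed
    ultimately show ?thesis by simp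
  qed
  have dyad: "h (real k / 2 ^ n) = h 0 + (LINT s:{0..real k / 2 ^ n}|lborel. g s)" if k: "k \<le> 2 ^ n" for k n
  proof -
    have "(\<lambda>j. LINT s:{0..real k / 2 ^ n}|lborel. D (R j) s) \<longlonglongrightarrow> (LINT s:{0..real k / 2 ^ n}|lborel. g s)"
      by (rule g_lim) simp
    moreover have "\<forall>\<^sub>F j in sequentially. (LINT s:{0..real k / 2 ^ n}|lborel. D (R j) s) = h (real k / 2 ^ n) - h 0"
      using eventually_ge_at_top[of n]
    proof eventually_elim
      case (elim j)
      have "n \<le> R j" using elim R_ge[of j] by simp
      then show ?case unfolding D_def using k by (rule LINT_dyadic_derivative)
    qed
    ultimately have "(LINT s:{0..real k / 2 ^ n}|lborel. g s) = h (real k / 2 ^ n) - h 0"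
      by (rule LIMSEQ_unique[OF _ tendsto_eventually])
    then show ?thesis by simp
  qed
  have inc: "h t = h 0 + (LINT s:{0..t}|lborel. g s)" if "t \<in> {0..1}" for t
  proof (rule continuous_eq_on_dyadics[OF cont _ dyad that])
    show "continuous_on {0..1} (\<lambda>t. h 0 + (LINT s:{0..t}|lborel. g s))"
      by (intro continuous_intros continuous_on_LINT g_int) simp
  qed
  have "has_ac_derivative h g"
    unfolding has_ac_derivative_def
  proof (intro conjI ballI)
    show "set_integrable lborel {0..1} g" by (rule g_int) simp
  qed (rule inc)
  moreover have g2s: "set_integrable lborel {0..1} (\<lambda>t. (norm (g t))\<^sup>2)"
    unfolding set_integrable_def using g2 by (intro integrable_mult_indicator) auto
  moreover have "(LINT t:{0..1}|lborel. (norm (g t))\<^sup>2) \<le> (\<integral>t. (norm (g t))\<^sup>2 \<partial>lborel)"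
    unfolding set_lebesgue_integral_def using g2 g2s[unfolded set_integrable_def]
    by (intro integral_mono) (auto simp: indicator_def)
  ultimately show ?thesis using g2_le by (intro exI[of _ g]) auto
qed

subsection \<open>The Cameron--Martin norm as a supremum of dyadic energies\<close>

text \<open>Extended by \<open>\<infinity>\<close> outside the Cameron--Martin space, the norm becomes a measurable function of the path.\<close>

definition cm_ext :: "(real \<Rightarrow> 'v::euclidean_space) \<Rightarrow> ennreal" where
  "cm_ext h = (if h \<in> cameron_martin then ennreal (cm_norm h) else \<infinity>)"

lemma cm_cost_eq: "cm_cost x y = cm_ext (\<lambda>t. y t - x t)"
  by (simp add: cm_cost_def cm_ext_def)

text \<open>The norm is defined through an arbitrary choice of a derivative; all choices agree almost everywhere.\<close>

lemma cameron_martin_obtain: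
  assumes "h \<in> cameron_martin"
  shows "\<exists>g. has_ac_derivative h g \<and> set_integrable lborel {0..1} (\<lambda>t. (norm (g t))\<^sup>2)
    \<and> cm_norm h = sqrt (LINT t:{0..1}|lborel. (norm (g t))\<^sup>2)"
proof -
  obtain g where g: "has_ac_derivative h g" "set_integrable lborel {0..1} (\<lambda>t. (norm (g t))\<^sup>2)"
    using assms unfolding cameron_martin_def by blast
  define g' where "g' = (SOME g. has_ac_derivative h g)"
  have g': "has_ac_derivative h g'" unfolding g'_def using someI[of "has_ac_derivative h", OF g(1)] .
  have ae: "AE t in lborel. indicat_real {0..1} t *\<^sub>R (norm (g t))\<^sup>2 = indicat_real {0..1} t *\<^sub>R (norm (g' t))\<^sup>2"
    using ac_derivative_unique[OF g(1) g'] by eventually_elim (auto simp: indicator_def)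
  have m1: "(\<lambda>t. indicat_real {0..1} t *\<^sub>R (norm (g t))\<^sup>2) \<in> borel_measurable lborel"
    using borel_measurable_integrable[OF g(2)[unfolded set_integrable_def]] .
  have m2: "(\<lambda>t. indicat_real {0..1} t *\<^sub>R (norm (g' t))\<^sup>2) \<in> borel_measurable lborel"
  proof -
    have "(\<lambda>t. (norm (indicat_real {0..1} t *\<^sub>R g' t))\<^sup>2) \<in> borel_measurable lborel"
      using borel_measurable_integrable[OF ac_derivativeD(1)[OF g', unfolded set_integrable_def]]
      by measurable
    moreover have "(norm (indicat_real {0..1} t *\<^sub>R g' t))\<^sup>2 = indicat_real {0..1} t *\<^sub>R (norm (g' t))\<^sup>2" for t
      by (simp add: indicator_def)
    ultimately show ?thesis by simp
  qed
  have "(LINT t:{0..1}|lborel. (norm (g t))\<^sup>2) = (LINT t:{0..1}|lborel. (norm (g' t))\<^sup>2)"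
    unfolding set_lebesgue_integral_def by (rule integral_cong_AE[OF m1 m2 ae])
  then show ?thesis
    using g by (intro exI[of _ g]) (simp add: cm_norm_def g'_def[symmetric])
qed

lemma cameron_martin_0: "h \<in> cameron_martin \<Longrightarrow> h 0 = 0"
  by (simp add: cameron_martin_def)

lemma cm_norm_nonneg: "0 \<le> cm_norm h"
  unfolding cm_norm_def set_lebesgue_integral_def by (intro real_sqrt_ge_zero integral_nonneg_AE) auto

text \<open>Expresses the norm, together with the membership in the Cameron--Martin space, by countably many
  evaluations of \<open>h\<close>. All measurability statements about costs on path space rest on this formula.\<close>

theorem cm_ext_eq_energy:
  assumes cont: "continuous_on {0..1} h" and h0: "h 0 = 0"
  shows "cm_ext h = epowr (SUP n. ennreal (dyadic_energy n h)) (1 / 2)"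
proof (cases "h \<in> cameron_martin")
  case True
  obtain g where g: "has_ac_derivative h g" "set_integrable lborel {0..1} (\<lambda>t. (norm (g t))\<^sup>2)"
    and norm: "cm_norm h = sqrt (LINT t:{0..1}|lborel. (norm (g t))\<^sup>2)"
    using cameron_martin_obtain[OF True] by blast
  define I where "I = (LINT t:{0..1}|lborel. (norm (g t))\<^sup>2)"
  have I: "0 \<le> I" unfolding I_def set_lebesgue_integral_def by (intro integral_nonneg_AE) auto
  have le: "dyadic_energy n h \<le> I" for n unfolding I_def by (rule dyadic_energy_le[OF g])
  have "(SUP n. ennreal (dyadic_energy n h)) = ennreal I"
  proof (rule antisym)
    show "(SUP n. ennreal (dyadic_energy n h)) \<le> ennreal I"
      by (intro SUP_least ennreal_leI le)
    then obtain C where C: "(SUP n. ennreal (dyadic_energy n h)) = ennreal C" "0 \<le> C"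
      by (cases "SUP n. ennreal (dyadic_energy n h)") (auto simp: top_unique)
    have "dyadic_energy n h \<le> C" for n
      using SUP_upper[of n UNIV "\<lambda>n. ennreal (dyadic_energy n h)"] C by (simp add: ennreal_le_iff)
    from bounded_energy_imp_ac_derivative[OF cont this]
    obtain g' where g': "has_ac_derivative h g'" "set_integrable lborel {0..1} (\<lambda>t. (norm (g' t))\<^sup>2)"
      "(LINT t:{0..1}|lborel. (norm (g' t))\<^sup>2) \<le> C" by blast
    have "I = (LINT t:{0..1}|lborel. (norm (g' t))\<^sup>2)"
      unfolding I_def set_lebesgue_integral_def
    proof (rule integral_cong_AE)
      show "AE t in lborel. indicat_real {0..1} t *\<^sub>R (norm (g t))\<^sup>2 = indicat_real {0..1} t *\<^sub>R (norm (g' t))\<^sup>2"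
        using ac_derivative_unique[OF g(1) g'(1)] by eventually_elim (auto simp: indicator_def)
    qed (rule borel_measurable_integrable, rule g(2)[unfolded set_integrable_def],
        rule borel_measurable_integrable, rule g'(2)[unfolded set_integrable_def])
    then have "I \<le> C" using g'(3) by simp
    then show "ennreal I \<le> (SUP n. ennreal (dyadic_energy n h))"
      unfolding C(1) by (rule ennreal_leI)
  qed
  then show ?thesis
    using True I unfolding cm_ext_def norm I_def[symmetric] by (simp add: epowr_ennreal powr_half_sqrt)
next
  case False
  have sup: "(SUP n. ennreal (dyadic_energy n h)) = \<top>"
  proof (rule ccontr)
    assume "(SUP n. ennreal (dyadic_energy n h)) \<noteq> \<top>"
    then obtain C where C: "(SUP n. ennreal (dyadic_energy n h)) = ennreal C" "0 \<le> C"
      by (cases "SUP n. ennreal (dyadic_energy n h)") auto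
    have "dyadic_energy n h \<le> C" for n
      using SUP_upper[of n UNIV "\<lambda>n. ennreal (dyadic_energy n h)"] C by (simp add: ennreal_le_iff)
    from bounded_energy_imp_ac_derivative[OF cont this] h0 False
    show False unfolding cameron_martin_def by blast
  qed
  show ?thesis unfolding cm_ext_def sup using False by simp
qed

text \<open>The energy at level \<open>0\<close> is \<open>(norm (h 1))\<^sup>2\<close>.\<close>

lemma norm_endpoint_le_cm_ext:
  assumes "continuous_on {0..1} h" "h 0 = 0"
  shows "ennreal (norm (h 1)) \<le> cm_ext h"
proof -
  have "ennreal ((norm (h 1))\<^sup>2) \<le> (SUP n. ennreal (dyadic_energy n h))"
    by (rule SUP_upper2[of 0]) (simp_all add: dyadic_energy_def assms(2))
  then have "epowr (ennreal ((norm (h 1))\<^sup>2)) (1 / 2) \<le> cm_ext h"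
    unfolding cm_ext_eq_energy[OF assms] by (rule epowr_mono) simp
  then show ?thesis by (simp add: epowr_ennreal powr_half_sqrt)
qed

lemma measurable_cm_ext:
  fixes H :: "'a \<Rightarrow> real \<Rightarrow> 'v::euclidean_space"
  assumes H: "\<And>x. x \<in> space M \<Longrightarrow> continuous_on {0..1} (H x) \<and> H x 0 = 0"
    and m: "\<And>t. t \<in> {0..1} \<Longrightarrow> (\<lambda>x. H x t) \<in> borel_measurable M"
  shows "(\<lambda>x. cm_ext (H x)) \<in> borel_measurable M"
proof -
  have "(\<lambda>x. epowr (SUP n. ennreal (dyadic_energy n (H x))) (1 / 2)) \<in> borel_measurable M"
  proof (intro measurable_epowr borel_measurable_SUP)
    show "(\<lambda>x. ennreal (dyadic_energy n (H x))) \<in> borel_measurable M" for n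
    proof -
      have "(\<lambda>x. (norm (H x (real (Suc k) / 2 ^ n) - H x (real k / 2 ^ n)))\<^sup>2) \<in> borel_measurable M"
        if k: "k < 2 ^ n" for k
      proof -
        have [measurable]: "(\<lambda>x. H x (real (Suc k) / 2 ^ n)) \<in> borel_measurable M"
            "(\<lambda>x. H x (real k / 2 ^ n)) \<in> borel_measurable M"
          by (rule m[OF dyadic_point], use k in simp)+
        show ?thesis by measurable
      qed
      then have "(\<lambda>x. dyadic_energy n (H x)) \<in> borel_measurable M"
        unfolding dyadic_energy_def by (intro borel_measurable_times borel_measurable_const borel_measurable_sum) auto
      then show ?thesis by measurable
    qed
  qed simp
  then show ?thesis
    using H by (subst measurable_cong[of _ _ "\<lambda>x. epowr (SUP n. ennreal (dyadic_energy n (H x))) (1 / 2)"])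
       (auto simp: cm_ext_eq_energy)
qed

lemma path_space_fst_snd:
  assumes "z \<in> space (borel_of path_space \<Otimes>\<^sub>M borel_of path_space)"
  shows "fst z \<in> topspace path_space" "snd z \<in> topspace path_space"
  using assms by (auto simp: space_pair_measure)

lemma path_pair_eval_measurable:
  fixes M :: "(real \<Rightarrow> 'v::euclidean_space) measure"
  assumes "t \<in> {0..1}"
  shows "(\<lambda>z. fst z t :: 'v::euclidean_space) \<in> borel_measurable (borel_of path_space \<Otimes>\<^sub>M N)"
    "(\<lambda>z. snd z t :: 'v::euclidean_space) \<in> borel_measurable (N \<Otimes>\<^sub>M borel_of path_space)"
  using measurable_compose[OF measurable_fst measurable_path_eval[OF assms]]
    measurable_compose[OF measurable_snd measurable_path_eval[OF assms]] by auto

lemma measurable_cm_cost: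
  "(\<lambda>(x, y). cm_cost x (y :: real \<Rightarrow> 'v::euclidean_space))
     \<in> borel_measurable (borel_of path_space \<Otimes>\<^sub>M borel_of path_space)"
  unfolding case_prod_unfold cm_cost_eq
proof (rule measurable_cm_ext)
  fix z :: "(real \<Rightarrow> 'v) \<times> (real \<Rightarrow> 'v)"
  assume "z \<in> space (borel_of path_space \<Otimes>\<^sub>M borel_of path_space)"
  from path_space_fst_snd[OF this]
  show "continuous_on {0..1} (\<lambda>t. snd z t - fst z t) \<and> snd z 0 - fst z 0 = 0"
    by (auto simp: topspace_path_space intro!: continuous_intros)
next
  fix t :: real assume t: "t \<in> {0..1}"
  note [measurable] = path_pair_eval_measurable[OF t]
  show "(\<lambda>z. snd z t - fst z t :: 'v) \<in> borel_measurable (borel_of path_space \<Otimes>\<^sub>M borel_of path_space)"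
    by measurable
qed

section \<open>Riemann--Stieltjes integrals against absolutely continuous functions\<close>

text \<open>On every short interval \<open>f x * (h v - h u)\<close> is approximated by the increment of \<open>\<Phi>\<close>, up to a small multiple of
  the increment of one fixed function \<open>G\<close>. Summed over the intervals of a partition the errors telescope.
  This one estimate serves the tagged divisions in the definition of the Riemann--Stieltjes integral as well
  as the Riemann sums on a fixed grid.\<close>

definition rs_primitive :: "(real \<Rightarrow> real) \<Rightarrow> (real \<Rightarrow> real) \<Rightarrow> (real \<Rightarrow> real) \<Rightarrow> bool" where
  "rs_primitive f h \<Phi> \<longleftrightarrow> (\<exists>G. \<forall>e>0. \<exists>\<delta>>0. \<forall>u x v. 0 \<le> u \<and> u \<le> x \<and> x \<le> v \<and> v \<le> 1 \<and> v - u < \<delta> \<longrightarrow>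
     \<bar>f x * (h v - h u) - (\<Phi> v - \<Phi> u)\<bar> \<le> e * (G v - G u))"

lemma rs_primitiveE:
  assumes "rs_primitive f h \<Phi>" and t: "t \<in> {0..1}" and e: "0 < e"
  shows "\<exists>G \<delta>. 0 < \<delta> \<and> G t - G 0 < e \<and> (\<forall>u x v. 0 \<le> u \<and> u \<le> x \<and> x \<le> v \<and> v \<le> 1 \<and> v - u < \<delta> \<longrightarrow>
     \<bar>f x * (h v - h u) - (\<Phi> v - \<Phi> u)\<bar> \<le> G v - G u)"
proof -
  obtain G where G: "\<forall>e>0. \<exists>\<delta>>0. \<forall>u x v. 0 \<le> u \<and> u \<le> x \<and> x \<le> v \<and> v \<le> 1 \<and> v - u < \<delta> \<longrightarrow>
     \<bar>f x * (h v - h u) - (\<Phi> v - \<Phi> u)\<bar> \<le> e * (G v - G u)"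
    using assms(1) unfolding rs_primitive_def by (elim exE)
  define c where "c = e / (\<bar>G t - G 0\<bar> + 1)"
  have c: "0 < c" using e by (simp add: c_def add_nonneg_pos)
  obtain \<delta> where \<delta>: "0 < \<delta>" "\<forall>u x v. 0 \<le> u \<and> u \<le> x \<and> x \<le> v \<and> v \<le> 1 \<and> v - u < \<delta> \<longrightarrow>
     \<bar>f x * (h v - h u) - (\<Phi> v - \<Phi> u)\<bar> \<le> c * (G v - G u)"
    using G c by blast
  have "c * (G t - G 0) \<le> c * \<bar>G t - G 0\<bar>" using c by (intro mult_left_mono) auto
  also have "\<dots> < c * (\<bar>G t - G 0\<bar> + 1)" using c by simp
  also have "\<dots> = e" by (simp add: c_def add_nonneg_pos less_imp_neq[symmetric])
  finally have "c * G t - c * G 0 < e" by (simp add: right_diff_distrib)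
  then show ?thesis
    using \<delta> by (intro exI[of _ "\<lambda>s. c * G s"] exI[of _ \<delta>]) (simp add: right_diff_distrib)
qed

lemma rs_primitive_imp_has_rs_integral:
  assumes "rs_primitive f h \<Phi>" "t \<in> {0..1}"
  shows "has_rs_integral f h 0 t (\<Phi> t - \<Phi> 0)"
  unfolding has_rs_integral_def
proof (intro allI impI)
  fix e :: real assume e: "0 < e"
  obtain G \<delta> where \<delta>: "0 < \<delta>" and G: "G t - G 0 < e"
    and cell: "\<forall>u x v. 0 \<le> u \<and> u \<le> x \<and> x \<le> v \<and> v \<le> 1 \<and> v - u < \<delta> \<longrightarrow>
     \<bar>f x * (h v - h u) - (\<Phi> v - \<Phi> u)\<bar> \<le> G v - G u"
    using rs_primitiveE[OF assms e] by (elim exE conjE)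
  have t: "0 \<le> t" "t \<le> 1" using assms(2) by auto
  show "\<exists>\<delta>>0. \<forall>p. p tagged_division_of {0..t} \<and> (\<lambda>x. ball x \<delta>) fine p \<longrightarrow>
      \<bar>(\<Sum>(x, K)\<in>p. f x * (h (Sup K) - h (Inf K))) - (\<Phi> t - \<Phi> 0)\<bar> < e"
  proof (intro exI[of _ "\<delta> / 2"] conjI allI impI, use \<delta> in simp, elim conjE)
    fix p assume p: "p tagged_division_of {0..t}" and fine: "(\<lambda>x. ball x (\<delta> / 2)) fine p"
    have cell_p: "\<bar>f x * (h (Sup K) - h (Inf K)) - (\<Phi> (Sup K) - \<Phi> (Inf K))\<bar> \<le> G (Sup K) - G (Inf K)"
      if xK: "(x, K) \<in> p" for x K
    proof -
      obtain u v where K: "K = {u..v}" using tagged_division_ofD(4)[OF p xK] by auto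
      have x: "x \<in> K" and sub: "K \<subseteq> {0..t}" "K \<subseteq> ball x (\<delta> / 2)"
        using tagged_division_ofD(2,3)[OF p xK] fine xK unfolding fine_def by auto
      have uv: "u \<le> x" "x \<le> v" using x K by auto
      then have "u \<in> K" "v \<in> K" using K by auto
      then have 1: "0 \<le> u" "v \<le> t" "dist x u < \<delta> / 2" "dist x v < \<delta> / 2" using sub by auto
      then have "v - u < \<delta>" using uv by (simp add: dist_real_def)
      then have "\<bar>f x * (h v - h u) - (\<Phi> v - \<Phi> u)\<bar> \<le> G v - G u"
        using cell 1 uv t by auto
      then show ?thesis using K uv by simp
    qed
    have "\<Phi> t - \<Phi> 0 = (\<Sum>(x, K)\<in>p. \<Phi> (Sup K) - \<Phi> (Inf K))"
      by (rule additive_tagged_division_1[OF t(1) p, symmetric])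
    then have "\<bar>(\<Sum>(x, K)\<in>p. f x * (h (Sup K) - h (Inf K))) - (\<Phi> t - \<Phi> 0)\<bar>
        = \<bar>\<Sum>(x, K)\<in>p. f x * (h (Sup K) - h (Inf K)) - (\<Phi> (Sup K) - \<Phi> (Inf K))\<bar>"
      by (simp add: sum_subtractf case_prod_unfold)
    also have "\<dots> \<le> (\<Sum>(x, K)\<in>p. G (Sup K) - G (Inf K))"
      using cell_p by (intro sum_abs[THEN order_trans] sum_mono) auto
    also have "\<dots> = G t - G 0"
      by (rule additive_tagged_division_1[OF t(1) p])
    finally show "\<bar>(\<Sum>(x, K)\<in>p. f x * (h (Sup K) - h (Inf K))) - (\<Phi> t - \<Phi> 0)\<bar> < e"
      using G by linarith
  qed
qed

lemma has_rs_integral_unique: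
  assumes I: "has_rs_integral f h a b I" and J: "has_rs_integral f h a b J"
  shows "I = J"
proof (rule ccontr)
  assume "I \<noteq> J"
  then have e: "0 < \<bar>I - J\<bar> / 2" by simp
  obtain d1 where d1: "0 < d1" "\<forall>p. p tagged_division_of {a..b} \<and> (\<lambda>x. ball x d1) fine p \<longrightarrow>
      \<bar>(\<Sum>(x, K)\<in>p. f x * (h (Sup K) - h (Inf K))) - I\<bar> < \<bar>I - J\<bar> / 2"
    using I e unfolding has_rs_integral_def by blast
  obtain d2 where d2: "0 < d2" "\<forall>p. p tagged_division_of {a..b} \<and> (\<lambda>x. ball x d2) fine p \<longrightarrow>
      \<bar>(\<Sum>(x, K)\<in>p. f x * (h (Sup K) - h (Inf K))) - J\<bar> < \<bar>I - J\<bar> / 2"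
    using J e unfolding has_rs_integral_def by blast
  have "gauge (\<lambda>x::real. ball x (min d1 d2))" using d1(1) d2(1) by (intro gauge_ball) auto
  then obtain p where p: "p tagged_division_of {a..b}" "(\<lambda>x. ball x (min d1 d2)) fine p"
    using fine_division_exists_real by blast
  have "(\<lambda>x. ball x d1) fine p" "(\<lambda>x. ball x d2) fine p"
    using p(2) unfolding fine_def by (auto simp: subset_eq)
  then obtain S where "\<bar>S - I\<bar> < \<bar>I - J\<bar> / 2" "\<bar>S - J\<bar> < \<bar>I - J\<bar> / 2"
    using d1(2) d2(2) p(1) by blast
  then show False by (auto simp: abs_if split: if_splits)
qed

lemma rs_primitive_imp_rs_integral:
  assumes "rs_primitive f h \<Phi>" "t \<in> {0..1}"
  shows "rs_integral f h 0 t = \<Phi> t - \<Phi> 0"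
  unfolding rs_integral_def
  using rs_primitive_imp_has_rs_integral[OF assms] has_rs_integral_unique by (intro the_equality) blast+

lemma rs_primitive_Riemann_sums:
  assumes "rs_primitive f h \<Phi>" "t \<in> {0..1}"
  shows "(\<lambda>n. \<Sum>k<2 ^ n. f (t * (real k / 2 ^ n)) * (h (t * (real (Suc k) / 2 ^ n)) - h (t * (real k / 2 ^ n))))
    \<longlonglongrightarrow> \<Phi> t - \<Phi> 0"
proof (rule LIMSEQ_I)
  fix e :: real assume e: "0 < e"
  obtain G \<delta> where \<delta>: "0 < \<delta>" and G: "G t - G 0 < e"
    and cell: "\<forall>u x v. 0 \<le> u \<and> u \<le> x \<and> x \<le> v \<and> v \<le> 1 \<and> v - u < \<delta> \<longrightarrow>
     \<bar>f x * (h v - h u) - (\<Phi> v - \<Phi> u)\<bar> \<le> G v - G u"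
    using rs_primitiveE[OF assms e] by (elim exE conjE)
  have t: "0 \<le> t" "t \<le> 1" using assms(2) by auto
  obtain N where N: "(1 / 2) ^ N < \<delta>" using real_arch_pow_inv[of \<delta> "1 / 2"] \<delta> by auto
  show "\<exists>no. \<forall>n\<ge>no. norm ((\<Sum>k<2 ^ n. f (t * (real k / 2 ^ n)) * (h (t * (real (Suc k) / 2 ^ n)) - h (t * (real k / 2 ^ n))))
      - (\<Phi> t - \<Phi> 0)) < e"
  proof (intro exI[of _ N] allI impI)
    fix n assume n: "N \<le> n"
    define s where "s k = t * (real k / 2 ^ n)" for k
    have s0: "s 0 = 0" and s1: "s (2 ^ n) = t" by (simp_all add: s_def)
    have cell_s: "\<bar>f (s k) * (h (s (Suc k)) - h (s k)) - (\<Phi> (s (Suc k)) - \<Phi> (s k))\<bar> \<le> G (s (Suc k)) - G (s k)"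
      if k: "k < 2 ^ n" for k
    proof -
      have "real (Suc k) / 2 ^ n \<in> {0..1}" using k by (intro dyadic_point) simp
      then have "s (Suc k) \<le> t" using t unfolding s_def by (intro mult_left_le) auto
      moreover have "s (Suc k) - s k = t * (1 / 2 ^ n)"
        by (simp add: s_def algebra_simps add_divide_distrib)
      moreover have "t * (1 / 2 ^ n) \<le> 1 * (1 / 2 ^ n)" "0 \<le> t * (1 / 2 ^ n)"
        using t by (intro mult_right_mono mult_nonneg_nonneg; simp)+
      ultimately have "s (Suc k) \<le> t" "s (Suc k) - s k \<le> 1 / 2 ^ n" "s k \<le> s (Suc k)"
        by linarith+
      moreover have "1 / 2 ^ n \<le> (1 / 2 :: real) ^ N"
        using n by (simp add: power_one_over[symmetric] power_decreasing)
      moreover have "0 \<le> s k" using t by (simp add: s_def)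
      ultimately show ?thesis
        using cell N t by auto
    qed
    have "(\<Sum>k<2 ^ n. f (s k) * (h (s (Suc k)) - h (s k))) - (\<Phi> t - \<Phi> 0)
        = (\<Sum>k<2 ^ n. f (s k) * (h (s (Suc k)) - h (s k)) - (\<Phi> (s (Suc k)) - \<Phi> (s k)))"
      using sum_lessThan_telescope[of "\<lambda>k. \<Phi> (s k)" "2 ^ n"] by (simp add: sum_subtractf s0 s1)
    also have "\<bar>\<dots>\<bar> \<le> (\<Sum>k<2 ^ n. G (s (Suc k)) - G (s k))"
      using cell_s by (intro sum_abs[THEN order_trans] sum_mono) auto
    also have "\<dots> = G t - G 0"
      using sum_lessThan_telescope[of "\<lambda>k. G (s k)" "2 ^ n"] by (simp add: s0 s1)
    finally show "norm ((\<Sum>k<2 ^ n. f (t * (real k / 2 ^ n)) * (h (t * (real (Suc k) / 2 ^ n)) - h (t * (real k / 2 ^ n))))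
      - (\<Phi> t - \<Phi> 0)) < e"
      using G unfolding s_def[symmetric] real_norm_def by linarith
  qed
qed

lemma set_integrable_continuous_mult:
  fixes f g :: "real \<Rightarrow> real"
  assumes f: "continuous_on {0..1} f" and g: "set_integrable lborel {0..1} g"
  shows "set_integrable lborel {0..1} (\<lambda>s. f s * g s)"
proof -
  have "compact (f ` {0..1})" using f by (intro compact_continuous_image) auto
  then have "bounded (f ` {0..1})" by (rule compact_imp_bounded)
  then obtain B where B: "\<And>s. s \<in> {0..1} \<Longrightarrow> \<bar>f s\<bar> \<le> B" unfolding bounded_iff by (metis imageI real_norm_def)
  have "(\<lambda>s. (indicat_real {0..1} s *\<^sub>R f s) * (indicat_real {0..1} s *\<^sub>R g s)) \<in> borel_measurable lborel"
  proof (rule borel_measurable_times)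
    show "(\<lambda>s. indicat_real {0..1} s *\<^sub>R f s) \<in> borel_measurable lborel"
      using borel_measurable_continuous_on_indicator[OF _ f] by simp
    show "(\<lambda>s. indicat_real {0..1} s *\<^sub>R g s) \<in> borel_measurable lborel"
      using borel_measurable_integrable[OF g[unfolded set_integrable_def]] .
  qed
  moreover have "(indicat_real {0..1} s *\<^sub>R f s) * (indicat_real {0..1} s *\<^sub>R g s) = indicat_real {0..1} s *\<^sub>R (f s * g s)" for s
    by (simp add: indicator_def)
  ultimately have m: "(\<lambda>s. indicat_real {0..1} s *\<^sub>R (f s * g s)) \<in> borel_measurable lborel"
    by (simp only:)
  have i: "integrable lborel (\<lambda>s. B * (indicat_real {0..1} s *\<^sub>R g s))"
    using g unfolding set_integrable_def by (rule integrable_mult_right)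
  show ?thesis
    unfolding set_integrable_def
  proof (rule Bochner_Integration.integrable_bound[OF i m], rule AE_I2)
    fix s :: real
    show "norm (indicat_real {0..1} s *\<^sub>R (f s * g s)) \<le> norm (B * (indicat_real {0..1} s *\<^sub>R g s))"
    proof (cases "s \<in> {0..1}")
      case True
      have "\<bar>f s\<bar> \<le> \<bar>B\<bar>" using B[OF True] by linarith
      then show ?thesis using True by (simp add: abs_mult mult_right_mono)
    qed simp
  qed
qed

lemma continuous_unit_uniform:
  fixes f :: "real \<Rightarrow> real"
  assumes f: "continuous_on {0..1} f" and e: "0 < e"
  shows "\<exists>\<delta>>0. \<forall>r s. 0 \<le> r \<and> r \<le> s \<and> s \<le> 1 \<and> s - r < \<delta> \<longrightarrow> \<bar>f r - f s\<bar> \<le> e"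
proof -
  have "uniformly_continuous_on {0..1} f"
    using f by (intro compact_uniformly_continuous) auto
  then obtain d where d: "0 < d" "\<forall>x\<in>{0..1}. \<forall>x'\<in>{0..1}. dist x' x < d \<longrightarrow> dist (f x') (f x) < e"
    unfolding uniformly_continuous_on_def using e by blast
  have "\<bar>f r - f s\<bar> \<le> e" if "0 \<le> r \<and> r \<le> s \<and> s \<le> 1 \<and> s - r < d" for r s
  proof -
    have "dist (f r) (f s) < e" using that by (intro d(2)[rule_format]) (auto simp: dist_real_def)
    then show ?thesis by (simp add: dist_real_def)
  qed
  then show ?thesis using d(1) by blast
qed

lemma weighted_LINT_bound:
  fixes f g :: "real \<Rightarrow> real"
  assumes f: "continuous_on {0..1} f" and g: "set_integrable lborel {0..1} g"
    and ab: "0 \<le> a" "a \<le> b" "b \<le> 1" and osc: "\<And>s. s \<in> {a..b} \<Longrightarrow> \<bar>f s - c\<bar> \<le> e"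
  shows "\<bar>(LINT s:{a..b}|lborel. f s * g s) - c * (LINT s:{a..b}|lborel. g s)\<bar>
    \<le> e * (LINT s:{a..b}|lborel. \<bar>g s\<bar>)"
proof -
  have sub: "{a..b} \<subseteq> {0..1}" using ab by auto
  have i1: "set_integrable lborel {a..b} (\<lambda>s. f s * g s)"
    by (rule set_integrable_subset[OF set_integrable_continuous_mult[OF f g] _ sub]) simp
  have i2: "set_integrable lborel {a..b} g" by (rule set_integrable_subset[OF g _ sub]) simp
  have i3: "set_integrable lborel {a..b} (\<lambda>s. c * g s)" using i2 by (intro set_integrable_mult_right) auto
  have i4: "set_integrable lborel {a..b} (\<lambda>s. \<bar>g s\<bar>)" using set_integrable_norm[OF i2] by simp
  have i5: "set_integrable lborel {a..b} (\<lambda>s. e * \<bar>g s\<bar>)" using i4 by (intro set_integrable_mult_right) auto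
  have i6: "set_integrable lborel {a..b} (\<lambda>s. f s * g s - c * g s)" using i1 i3 by (rule set_integral_diff)
  have "\<bar>(LINT s:{a..b}|lborel. f s * g s) - c * (LINT s:{a..b}|lborel. g s)\<bar>
      = norm (LINT s:{a..b}|lborel. f s * g s - c * g s)"
    using set_integral_diff(2)[OF i1 i3] by simp
  also have "\<dots> \<le> (LINT s:{a..b}|lborel. norm (f s * g s - c * g s))"
    by (rule set_integral_norm_bound[OF i6])
  also have "\<dots> \<le> (LINT s:{a..b}|lborel. e * \<bar>g s\<bar>)"
  proof (rule set_integral_mono[OF set_integrable_norm[OF i6] i5])
    fix s assume "s \<in> {a..b}"
    from mult_right_mono[OF osc[OF this], of "\<bar>g s\<bar>"]
    show "norm (f s * g s - c * g s) \<le> e * \<bar>g s\<bar>"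
      by (simp add: left_diff_distrib[symmetric] abs_mult)
  qed
  also have "\<dots> = e * (LINT s:{a..b}|lborel. \<bar>g s\<bar>)" by simp
  finally show ?thesis .
qed

text \<open>The function \<open>f\<close> oscillates by at most \<open>e\<close> on a short interval, and the error is at most \<open>e\<close> times the
  integral of \<open>\<bar>g\<bar>\<close>.\<close>

lemma rs_primitive_ac:
  assumes f: "continuous_on {0..1} f" and h: "has_ac_derivative h g"
  shows "rs_primitive f h (\<lambda>t. LINT s:{0..t}|lborel. f s * g s)"
  unfolding rs_primitive_def
proof (intro exI[of _ "\<lambda>t. LINT s:{0..t}|lborel. \<bar>g s\<bar>"] allI impI)
  fix e :: real assume "0 < e"
  from continuous_unit_uniform[OF f this] obtain \<delta> where
    \<delta>: "0 < \<delta>" "\<forall>r s. 0 \<le> r \<and> r \<le> s \<and> s \<le> 1 \<and> s - r < \<delta> \<longrightarrow> \<bar>f r - f s\<bar> \<le> e" by (elim exE conjE)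
  have g: "set_integrable lborel {0..1} g" by (rule ac_derivativeD(1)[OF h])
  have ga: "set_integrable lborel {0..1} (\<lambda>s. \<bar>g s\<bar>)" using set_integrable_norm[OF g] by simp
  have "\<bar>f x * (h v - h u) - ((LINT s:{0..v}|lborel. f s * g s) - (LINT s:{0..u}|lborel. f s * g s))\<bar>
      \<le> e * ((LINT s:{0..v}|lborel. \<bar>g s\<bar>) - (LINT s:{0..u}|lborel. \<bar>g s\<bar>))"
    if "0 \<le> u \<and> u \<le> x \<and> x \<le> v \<and> v \<le> 1 \<and> v - u < \<delta>" for u x v
  proof -
    have uv: "0 \<le> u" "u \<le> v" "v \<le> 1" using that by auto
    have "\<bar>f s - f x\<bar> \<le> e" if "s \<in> {u..v}" for s
    proof (cases "s \<le> x")
      case True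
      then show ?thesis using \<delta>(2)[rule_format, of s x] that \<open>0 \<le> u \<and> u \<le> x \<and> x \<le> v \<and> v \<le> 1 \<and> v - u < \<delta>\<close> by auto
    next
      case False
      then have "\<bar>f x - f s\<bar> \<le> e"
        using \<delta>(2)[rule_format, of x s] that \<open>0 \<le> u \<and> u \<le> x \<and> x \<le> v \<and> v \<le> 1 \<and> v - u < \<delta>\<close> by auto
      then show ?thesis by linarith
    qed
    from weighted_LINT_bound[OF f g uv this]
    show ?thesis
      unfolding LINT_diff[OF set_integrable_continuous_mult[OF f g] uv] LINT_diff[OF ga uv]
        ac_derivative_increment[OF h uv] by linarith
  qed
  then show "\<exists>\<delta>>0. \<forall>u x v. 0 \<le> u \<and> u \<le> x \<and> x \<le> v \<and> v \<le> 1 \<and> v - u < \<delta> \<longrightarrow>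
      \<bar>f x * (h v - h u) - ((LINT s:{0..v}|lborel. f s * g s) - (LINT s:{0..u}|lborel. f s * g s))\<bar>
      \<le> e * ((LINT s:{0..v}|lborel. \<bar>g s\<bar>) - (LINT s:{0..u}|lborel. \<bar>g s\<bar>))"
    using \<delta>(1) by blast
qed

text \<open>Here the integrator \<open>f\<close> is merely continuous, so its primitive comes from integration by parts. The interval
  is split at the tag \<open>x\<close>: on the left part \<open>f\<close> is compared with \<open>f u\<close>, on the right part with \<open>f v\<close>.\<close>

lemma rs_primitive_by_parts:
  assumes f: "continuous_on {0..1} f" and h: "has_ac_derivative h g"
  shows "rs_primitive h f (\<lambda>t. h t * f t - (LINT s:{0..t}|lborel. f s * g s))"
  unfolding rs_primitive_def
proof (intro exI[of _ "\<lambda>t. LINT s:{0..t}|lborel. \<bar>g s\<bar>"] allI impI)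
  fix e :: real assume "0 < e"
  from continuous_unit_uniform[OF f this] obtain \<delta> where
    \<delta>: "0 < \<delta>" "\<forall>r s. 0 \<le> r \<and> r \<le> s \<and> s \<le> 1 \<and> s - r < \<delta> \<longrightarrow> \<bar>f r - f s\<bar> \<le> e" by (elim exE conjE)
  have g: "set_integrable lborel {0..1} g" by (rule ac_derivativeD(1)[OF h])
  have ga: "set_integrable lborel {0..1} (\<lambda>s. \<bar>g s\<bar>)" using set_integrable_norm[OF g] by simp
  let ?F = "\<lambda>t. LINT s:{0..t}|lborel. f s * g s" and ?G = "\<lambda>t. LINT s:{0..t}|lborel. \<bar>g s\<bar>"
  have "\<bar>h x * (f v - f u) - ((h v * f v - ?F v) - (h u * f u - ?F u))\<bar> \<le> e * (?G v - ?G u)"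
    if uxv: "0 \<le> u \<and> u \<le> x \<and> x \<le> v \<and> v \<le> 1 \<and> v - u < \<delta>" for u x v
  proof -
    have ux: "0 \<le> u" "u \<le> x" "x \<le> 1" and xv: "0 \<le> x" "x \<le> v" "v \<le> 1" using uxv by auto
    have 1: "\<bar>(?F x - ?F u) - f u * (h x - h u)\<bar> \<le> e * (?G x - ?G u)"
      unfolding LINT_diff[OF set_integrable_continuous_mult[OF f g] ux] LINT_diff[OF ga ux]
        ac_derivative_increment[OF h ux]
    proof (rule weighted_LINT_bound[OF f g ux])
      fix s assume "s \<in> {u..x}"
      then have "\<bar>f u - f s\<bar> \<le> e" using uxv by (intro \<delta>(2)[rule_format]) auto
      then show "\<bar>f s - f u\<bar> \<le> e" by linarith
    qed
    have 2: "\<bar>(?F v - ?F x) - f v * (h v - h x)\<bar> \<le> e * (?G v - ?G x)"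
      unfolding LINT_diff[OF set_integrable_continuous_mult[OF f g] xv] LINT_diff[OF ga xv]
        ac_derivative_increment[OF h xv]
    proof (rule weighted_LINT_bound[OF f g xv])
      fix s assume "s \<in> {x..v}"
      then show "\<bar>f s - f v\<bar> \<le> e" using uxv by (intro \<delta>(2)[rule_format]) auto
    qed
    have "h x * (f v - f u) - ((h v * f v - ?F v) - (h u * f u - ?F u))
        = ((?F x - ?F u) - f u * (h x - h u)) + ((?F v - ?F x) - f v * (h v - h x))"
      by (simp add: algebra_simps)
    moreover have "e * (?G v - ?G u) = e * (?G x - ?G u) + e * (?G v - ?G x)"
      by (simp add: algebra_simps)
    ultimately show ?thesis using 1 2 by linarith
  qed
  then show "\<exists>\<delta>>0. \<forall>u x v. 0 \<le> u \<and> u \<le> x \<and> x \<le> v \<and> v \<le> 1 \<and> v - u < \<delta> \<longrightarrow>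
      \<bar>h x * (f v - f u) - ((h v * f v - ?F v) - (h u * f u - ?F u))\<bar> \<le> e * (?G v - ?G u)"
    using \<delta>(1) by blast
qed

definition Riemann_sum :: "nat \<Rightarrow> (real \<Rightarrow> real) \<Rightarrow> (real \<Rightarrow> real) \<Rightarrow> real \<Rightarrow> real" where
  "Riemann_sum n f h t =
     (\<Sum>k<2 ^ n. f (t * (real k / 2 ^ n)) * (h (t * (real (Suc k) / 2 ^ n)) - h (t * (real k / 2 ^ n))))"

lemma Riemann_sum_cong:
  assumes "\<And>k. k \<le> 2 ^ n \<Longrightarrow> f (t * (real k / 2 ^ n)) = f' (t * (real k / 2 ^ n))"
    and "\<And>k. k \<le> 2 ^ n \<Longrightarrow> h (t * (real k / 2 ^ n)) = h' (t * (real k / 2 ^ n))"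
  shows "Riemann_sum n f h t = Riemann_sum n f' h' t"
  unfolding Riemann_sum_def
proof (rule sum.cong[OF refl])
  fix k assume "k \<in> {..<2 ^ n :: nat}"
  then have "k \<le> 2 ^ n" "Suc k \<le> 2 ^ n" by auto
  then show "f (t * (real k / 2 ^ n)) * (h (t * (real (Suc k) / 2 ^ n)) - h (t * (real k / 2 ^ n)))
      = f' (t * (real k / 2 ^ n)) * (h' (t * (real (Suc k) / 2 ^ n)) - h' (t * (real k / 2 ^ n)))"
    by (simp only: assms)
qed

lemma Riemann_sum_add:
  "Riemann_sum n (\<lambda>s. f s + f' s) (\<lambda>s. h s + h' s) t
    = Riemann_sum n f h t + Riemann_sum n f h' t + Riemann_sum n f' h t + Riemann_sum n f' h' t"
  unfolding Riemann_sum_def sum.distrib[symmetric] by (intro sum.cong refl) (simp add: algebra_simps)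

lemma rs_primitive_integral_and_sums:
  assumes "rs_primitive f h \<Phi>" "t \<in> {0..1}"
  shows "rs_integral f h 0 t = \<Phi> t - \<Phi> 0"
    and "(\<lambda>n. Riemann_sum n f h t) \<longlonglongrightarrow> rs_integral f h 0 t"
  using rs_primitive_imp_rs_integral[OF assms] rs_primitive_Riemann_sums[OF assms]
  by (simp_all only: Riemann_sum_def)

lemma rs_integral_ac:
  assumes f: "continuous_on {0..1} f" and h: "has_ac_derivative h g" and t: "t \<in> {0..1}"
  shows "rs_integral f h 0 t = (LINT s:{0..t}|lborel. f s * g s)"
    and "(\<lambda>n. Riemann_sum n f h t) \<longlonglongrightarrow> rs_integral f h 0 t"
  using rs_primitive_integral_and_sums[OF rs_primitive_ac[OF f h] t] LINT_point[of 0 "\<lambda>s. f s * g s"]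
  by simp_all

lemma rs_integral_by_parts:
  assumes f: "continuous_on {0..1} f" and h: "has_ac_derivative h g" and t: "t \<in> {0..1}"
    and h0: "h 0 = 0"
  shows "rs_integral h f 0 t = h t * f t - (LINT s:{0..t}|lborel. f s * g s)"
    and "(\<lambda>n. Riemann_sum n h f t) \<longlonglongrightarrow> rs_integral h f 0 t"
  using rs_primitive_integral_and_sums[OF rs_primitive_by_parts[OF f h] t] LINT_point[of 0 "\<lambda>s. f s * g s"] h0
  by simp_all

lemma LINT_bounded_linear:
  fixes g :: "real \<Rightarrow> 'v::euclidean_space" and T :: "'v \<Rightarrow> 'u::euclidean_space"
  assumes T: "bounded_linear T" and g: "set_integrable lborel A g"
  shows "set_integrable lborel A (\<lambda>s. T (g s))"
    and "(LINT s:A|lborel. T (g s)) = T (LINT s:A|lborel. g s)"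
proof -
  have eq: "indicat_real A s *\<^sub>R T (g s) = T (indicat_real A s *\<^sub>R g s)" for s
    using T by (simp add: linear_simps)
  show "set_integrable lborel A (\<lambda>s. T (g s))"
    using g unfolding set_integrable_def eq by (rule integrable_bounded_linear[OF T])
  show "(LINT s:A|lborel. T (g s)) = T (LINT s:A|lborel. g s)"
    using g unfolding set_integrable_def set_lebesgue_integral_def eq by (rule integral_bounded_linear[OF T])
qed

lemma ac_derivative_bounded_linear:
  fixes h :: "real \<Rightarrow> 'v::euclidean_space" and T :: "'v \<Rightarrow> 'u::euclidean_space"
  assumes T: "bounded_linear T" and h: "has_ac_derivative h g"
  shows "has_ac_derivative (\<lambda>t. T (h t)) (\<lambda>t. T (g t))"
  unfolding has_ac_derivative_def
proof (intro conjI ballI)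
  show "set_integrable lborel {0..1} (\<lambda>t. T (g t))"
    by (rule LINT_bounded_linear(1)[OF T ac_derivativeD(1)[OF h]])
  fix t :: real assume t: "t \<in> {0..1}"
  have "set_integrable lborel {0..t} g"
    by (rule set_integrable_subset[OF ac_derivativeD(1)[OF h]]) (use t in auto)
  then show "T (h t) = T (h 0) + (LINT s:{0..t}|lborel. T (g s))"
    using T unfolding LINT_bounded_linear(2)[OF T \<open>set_integrable lborel {0..t} g\<close>]
    by (subst ac_derivativeD(2)[OF h t]) (simp add: linear_simps)
qed

lemma ac_derivative_nth:
  fixes h :: "real \<Rightarrow> real ^ 'k"
  assumes "has_ac_derivative h g"
  shows "has_ac_derivative (\<lambda>t. h t $ i) (\<lambda>t. g t $ i)"
  using ac_derivative_bounded_linear[OF bounded_linear_vec_nth assms] .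

section \<open>Shifts of Heisenberg paths\<close>

lemma has_ac_derivative_cong:
  assumes "\<And>t. t \<in> {0..1} \<Longrightarrow> h t = h' t"
  shows "has_ac_derivative h g = has_ac_derivative h' g"
proof -
  have "h 0 = h' 0" using assms by simp
  then show ?thesis using assms unfolding has_ac_derivative_def by simp
qed

lemma cm_norm_cong:
  assumes "\<And>t. t \<in> {0..1} \<Longrightarrow> h t = h' t"
  shows "cm_norm h = cm_norm h'"
proof -
  have "has_ac_derivative h = has_ac_derivative h'"
    by (rule ext) (rule has_ac_derivative_cong[OF assms])
  then show ?thesis by (simp add: cm_norm_def)
qed

lemma cameron_martin_cong:
  assumes "\<And>t. t \<in> {0..1} \<Longrightarrow> h t = h' t"
  shows "h \<in> cameron_martin \<longleftrightarrow> h' \<in> cameron_martin"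
proof -
  have "has_ac_derivative h = has_ac_derivative h'"
    by (rule ext) (rule has_ac_derivative_cong[OF assms])
  moreover have "h 0 = h' 0" using assms by simp
  ultimately show ?thesis by (simp add: cameron_martin_def)
qed

lemma cm_ext_cong:
  assumes "\<And>t. t \<in> {0..1} \<Longrightarrow> h t = h' t"
  shows "cm_ext h = cm_ext h'"
  unfolding cm_ext_def using cm_norm_cong[OF assms] cameron_martin_cong[OF assms] by simp

lemma cameron_martin_nth:
  fixes h :: "real \<Rightarrow> real ^ 'k"
  assumes "h \<in> cameron_martin"
  shows "(\<lambda>t. h t $ i) \<in> cameron_martin"
proof -
  obtain g where g: "has_ac_derivative h g" and g2: "set_integrable lborel {0..1} (\<lambda>t. (norm (g t))\<^sup>2)"
    using assms unfolding cameron_martin_def by blast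
  have gi: "has_ac_derivative (\<lambda>t. h t $ i) (\<lambda>t. g t $ i)" using g by (rule ac_derivative_nth)
  have "set_integrable lborel {0..1} (\<lambda>t. (norm (g t $ i))\<^sup>2)"
    unfolding set_integrable_def
  proof (rule Bochner_Integration.integrable_bound[OF g2[unfolded set_integrable_def]])
    have [measurable]: "(\<lambda>t. indicat_real {0..1} t *\<^sub>R g t $ i) \<in> borel_measurable lborel"
      using borel_measurable_integrable[OF ac_derivativeD(1)[OF gi, unfolded set_integrable_def]] .
    have "(\<lambda>t. (norm (indicat_real {0..1} t *\<^sub>R g t $ i))\<^sup>2) \<in> borel_measurable lborel"
      by measurable
    moreover have "(norm (indicat_real {0..1} t *\<^sub>R g t $ i))\<^sup>2 = indicat_real {0..1} t *\<^sub>R (norm (g t $ i))\<^sup>2" for t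
      by (simp add: indicator_def)
    ultimately show "(\<lambda>t. indicat_real {0..1} t *\<^sub>R (norm (g t $ i))\<^sup>2) \<in> borel_measurable lborel" by simp
    have "(norm (g t $ i))\<^sup>2 \<le> (norm (g t))\<^sup>2" for t
      using component_le_norm_cart[of "g t" i] by (intro power_mono) auto
    then show "AE t in lborel. norm (indicat_real {0..1} t *\<^sub>R (norm (g t $ i))\<^sup>2)
        \<le> norm (indicat_real {0..1} t *\<^sub>R (norm (g t))\<^sup>2)"
      by (intro AE_I2) (simp add: indicator_def)
  qed
  then show ?thesis
    using gi cameron_martin_0[OF assms] unfolding cameron_martin_def by auto
qed

subsection \<open>The area term of the Heisenberg shift\<close>

definition heis_area :: "(real \<Rightarrow> real ^ 3) \<Rightarrow> (real \<Rightarrow> real ^ 3) \<Rightarrow> real \<Rightarrow> real" where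
  "heis_area x h t =
     (rs_integral (\<lambda>s. x s $ 1) (\<lambda>s. h s $ 2) 0 t - rs_integral (\<lambda>s. x s $ 2) (\<lambda>s. h s $ 1) 0 t) / 2
   + (rs_integral (\<lambda>s. h s $ 1) (\<lambda>s. x s $ 2) 0 t - rs_integral (\<lambda>s. h s $ 2) (\<lambda>s. x s $ 1) 0 t) / 2
   + (rs_integral (\<lambda>s. h s $ 1) (\<lambda>s. h s $ 2) 0 t - rs_integral (\<lambda>s. h s $ 2) (\<lambda>s. h s $ 1) 0 t) / 2"

lemma heis_shift_eq:
  "heis_shift \<epsilon> h x = (\<lambda>t\<in>{0..1}. vector [x t $ 1 + h t $ 1, x t $ 2 + h t $ 2,
     x t $ 3 + \<epsilon> * h t $ 3 + heis_area x h t])"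
  by (simp add: heis_shift_def heis_area_def add.assoc)

definition heis_area_sum :: "nat \<Rightarrow> (real \<Rightarrow> real ^ 3) \<Rightarrow> (real \<Rightarrow> real ^ 3) \<Rightarrow> real \<Rightarrow> real" where
  "heis_area_sum n x h t =
     (Riemann_sum n (\<lambda>s. x s $ 1) (\<lambda>s. h s $ 2) t - Riemann_sum n (\<lambda>s. x s $ 2) (\<lambda>s. h s $ 1) t) / 2
   + (Riemann_sum n (\<lambda>s. h s $ 1) (\<lambda>s. x s $ 2) t - Riemann_sum n (\<lambda>s. h s $ 2) (\<lambda>s. x s $ 1) t) / 2
   + (Riemann_sum n (\<lambda>s. h s $ 1) (\<lambda>s. h s $ 2) t - Riemann_sum n (\<lambda>s. h s $ 2) (\<lambda>s. h s $ 1) t) / 2"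

text \<open>The integrals against the rough path \<open>x\<close> are integrated by parts. They add up with the integrals of \<open>x\<close>
  against \<open>h\<close>, which removes the factors \<open>1 / 2\<close> there.\<close>

lemma heis_area_ac:
  assumes x: "continuous_on {0..1} x"
    and h: "has_ac_derivative (\<lambda>t. h t $ 1) g1" "has_ac_derivative (\<lambda>t. h t $ 2) g2" "h 0 $ 1 = 0" "h 0 $ 2 = 0"
    and t: "t \<in> {0..1}"
  shows "heis_area x h t =
      (LINT s:{0..t}|lborel. x s $ 1 * g2 s) - (LINT s:{0..t}|lborel. x s $ 2 * g1 s)
    + (h t $ 1 * x t $ 2 - h t $ 2 * x t $ 1) / 2
    + ((LINT s:{0..t}|lborel. h s $ 1 * g2 s) - (LINT s:{0..t}|lborel. h s $ 2 * g1 s)) / 2"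
    and "(\<lambda>n. heis_area_sum n x h t) \<longlonglongrightarrow> heis_area x h t"
proof -
  have c: "continuous_on {0..1} (\<lambda>s. x s $ i)" for i using x by (intro continuous_intros)
  have ch: "continuous_on {0..1} (\<lambda>s. h s $ 1)" "continuous_on {0..1} (\<lambda>s. h s $ 2)"
    using h by (auto intro: ac_derivative_continuous)
  note i1 = rs_integral_ac[OF c[of 1] h(2) t] and i2 = rs_integral_ac[OF c[of 2] h(1) t]
    and i3 = rs_integral_by_parts[OF c[of 2] h(1) t h(3)] and i4 = rs_integral_by_parts[OF c[of 1] h(2) t h(4)]
    and i5 = rs_integral_ac[OF ch(1) h(2) t] and i6 = rs_integral_ac[OF ch(2) h(1) t]
  show "heis_area x h t =
      (LINT s:{0..t}|lborel. x s $ 1 * g2 s) - (LINT s:{0..t}|lborel. x s $ 2 * g1 s)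
    + (h t $ 1 * x t $ 2 - h t $ 2 * x t $ 1) / 2
    + ((LINT s:{0..t}|lborel. h s $ 1 * g2 s) - (LINT s:{0..t}|lborel. h s $ 2 * g1 s)) / 2"
    unfolding heis_area_def i1(1) i2(1) i3(1) i4(1) i5(1) i6(1) by (simp add: field_simps)
  show "(\<lambda>n. heis_area_sum n x h t) \<longlonglongrightarrow> heis_area x h t"
    unfolding heis_area_sum_def heis_area_def
    by (intro tendsto_add tendsto_diff tendsto_divide tendsto_const i1(2) i2(2) i3(2) i4(2) i5(2) i6(2)) auto
qed

lemma heis_area_continuous:
  assumes x: "continuous_on {0..1} x"
    and h: "has_ac_derivative (\<lambda>t. h t $ 1) g1" "has_ac_derivative (\<lambda>t. h t $ 2) g2" "h 0 $ 1 = 0" "h 0 $ 2 = 0"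
  shows "continuous_on {0..1} (heis_area x h)" "heis_area x h 0 = 0"
proof -
  have c: "continuous_on {0..1} (\<lambda>s. x s $ i)" for i using x by (intro continuous_intros)
  have ch: "continuous_on {0..1} (\<lambda>s. h s $ 1)" "continuous_on {0..1} (\<lambda>s. h s $ 2)"
    using h by (auto intro: ac_derivative_continuous)
  have g: "set_integrable lborel {0..1} g1" "set_integrable lborel {0..1} g2"
    using h by (auto intro: ac_derivativeD(1))
  let ?F = "\<lambda>t. (LINT s:{0..t}|lborel. x s $ 1 * g2 s) - (LINT s:{0..t}|lborel. x s $ 2 * g1 s)
    + (h t $ 1 * x t $ 2 - h t $ 2 * x t $ 1) / 2
    + ((LINT s:{0..t}|lborel. h s $ 1 * g2 s) - (LINT s:{0..t}|lborel. h s $ 2 * g1 s)) / 2"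
  have "continuous_on {0..1} ?F"
    by (intro continuous_on_add continuous_on_diff continuous_on_mult continuous_on_divide continuous_on_const
        continuous_on_LINT set_integrable_continuous_mult c ch g) auto
  moreover have "heis_area x h t = ?F t" if "t \<in> {0..1}" for t
    by (rule heis_area_ac(1)[OF x h that])
  ultimately show "continuous_on {0..1} (heis_area x h)"
    using continuous_on_cong[OF refl, of "{0..1}" "heis_area x h" ?F] by blast
  show "heis_area x h 0 = 0"
    using heis_area_ac(1)[OF x h, of 0] h(3,4) LINT_point[of 0, where 'v=real] by simp
qed

text \<open>The area is a limit of Riemann sums, which see \<open>h\<close> in its first two coordinates on the unit interval only.\<close>

lemma heis_area_cong:
  assumes x: "continuous_on {0..1} x"
    and h: "has_ac_derivative (\<lambda>t. h t $ 1) g1" "has_ac_derivative (\<lambda>t. h t $ 2) g2" "h 0 $ 1 = 0" "h 0 $ 2 = 0"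
    and eq: "\<And>t. t \<in> {0..1} \<Longrightarrow> h t $ 1 = h' t $ 1 \<and> h t $ 2 = h' t $ 2" and t: "t \<in> {0..1}"
  shows "heis_area x h t = heis_area x h' t"
proof -
  have h': "has_ac_derivative (\<lambda>t. h' t $ 1) g1" "has_ac_derivative (\<lambda>t. h' t $ 2) g2" "h' 0 $ 1 = 0" "h' 0 $ 2 = 0"
    using has_ac_derivative_cong[of "\<lambda>t. h t $ 1" "\<lambda>t. h' t $ 1" g1]
      has_ac_derivative_cong[of "\<lambda>t. h t $ 2" "\<lambda>t. h' t $ 2" g2] eq[of 0] h eq by auto
  have "(\<lambda>n. heis_area_sum n x h t) = (\<lambda>n. heis_area_sum n x h' t)"
  proof
    fix n
    have R: "Riemann_sum n f p t = Riemann_sum n f' p' t"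
      if "\<And>t. t \<in> {0..1} \<Longrightarrow> f t = f' t" "\<And>t. t \<in> {0..1} \<Longrightarrow> p t = p' t" for f p f' p'
      by (rule Riemann_sum_cong) (rule that, erule dyadic_point_mult[OF t])+
    have e1: "h t $ 1 = h' t $ 1" and e2: "h t $ 2 = h' t $ 2" if "t \<in> {0..1}" for t
      using eq[OF that] by simp_all
    show "heis_area_sum n x h t = heis_area_sum n x h' t"
      unfolding heis_area_sum_def
      using R[of "\<lambda>s. x s $ 1" "\<lambda>s. x s $ 1" "\<lambda>s. h s $ 2" "\<lambda>s. h' s $ 2", OF refl e2]
        R[of "\<lambda>s. x s $ 2" "\<lambda>s. x s $ 2" "\<lambda>s. h s $ 1" "\<lambda>s. h' s $ 1", OF refl e1]
        R[of "\<lambda>s. h s $ 1" "\<lambda>s. h' s $ 1" "\<lambda>s. x s $ 2" "\<lambda>s. x s $ 2", OF e1 refl]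
        R[of "\<lambda>s. h s $ 2" "\<lambda>s. h' s $ 2" "\<lambda>s. x s $ 1" "\<lambda>s. x s $ 1", OF e2 refl]
        R[of "\<lambda>s. h s $ 1" "\<lambda>s. h' s $ 1" "\<lambda>s. h s $ 2" "\<lambda>s. h' s $ 2", OF e1 e2]
        R[of "\<lambda>s. h s $ 2" "\<lambda>s. h' s $ 2" "\<lambda>s. h s $ 1" "\<lambda>s. h' s $ 1", OF e2 e1]
      by (simp only:)
  qed
  then show ?thesis
    using heis_area_ac(2)[OF x h t] heis_area_ac(2)[OF x h' t] LIMSEQ_unique by (simp only:) blast
qed

subsection \<open>Measurability of the shift cost\<close>

text \<open>The only candidate for the \<open>h\<close> with \<open>Y = heis_shift \<epsilon> h X\<close>: the first two coordinates of \<open>h\<close> can be read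
  off directly and they determine the area term. A limit of Riemann sums stands for the area because it
  depends measurably on \<open>(X, Y)\<close>.\<close>

definition heis_diff :: "real \<Rightarrow> (real \<Rightarrow> real ^ 3) \<Rightarrow> (real \<Rightarrow> real ^ 3) \<Rightarrow> real \<Rightarrow> real ^ 3" where
  "heis_diff \<epsilon> X Y t = vector [Y t $ 1 - X t $ 1, Y t $ 2 - X t $ 2,
     (Y t $ 3 - X t $ 3 - lim (\<lambda>n. heis_area_sum n X (\<lambda>t. Y t - X t) t)) / \<epsilon>]"

text \<open>A condition under which the limit in \<open>heis_diff\<close> exists at all times.\<close>

definition heis_admissible :: "(real \<Rightarrow> real ^ 3) \<Rightarrow> (real \<Rightarrow> real ^ 3) \<Rightarrow> bool" where
  "heis_admissible X Y \<longleftrightarrow> cm_ext (\<lambda>t. Y t $ 1 - X t $ 1) < \<infinity> \<and> cm_ext (\<lambda>t. Y t $ 2 - X t $ 2) < \<infinity>"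

lemma cm_ext_finite_iff: "cm_ext h < \<infinity> \<longleftrightarrow> h \<in> cameron_martin"
  by (simp add: cm_ext_def)

lemma vector3_axis: "(vector [a, b, c] :: real ^ 3) = a *\<^sub>R axis 1 1 + b *\<^sub>R axis 2 1 + c *\<^sub>R axis 3 1"
  by (simp add: vec_eq_iff forall_3 axis_def)

lemma heis_diff_admissible:
  assumes X: "X \<in> topspace path_space" and Y: "Y \<in> topspace path_space" and adm: "heis_admissible X Y"
  shows "t \<in> {0..1} \<Longrightarrow> heis_diff \<epsilon> X Y t = vector [Y t $ 1 - X t $ 1, Y t $ 2 - X t $ 2,
      (Y t $ 3 - X t $ 3 - heis_area X (\<lambda>t. Y t - X t) t) / \<epsilon>]"
    and "continuous_on {0..1} (heis_diff \<epsilon> X Y)" "heis_diff \<epsilon> X Y 0 = 0"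
proof -
  obtain g1 g2 where g: "has_ac_derivative (\<lambda>t. Y t $ 1 - X t $ 1) g1" "has_ac_derivative (\<lambda>t. Y t $ 2 - X t $ 2) g2"
    using adm unfolding heis_admissible_def cm_ext_finite_iff cameron_martin_def by blast
  have cX: "continuous_on {0..1} X" "X 0 = 0" and cY: "continuous_on {0..1} Y" "Y 0 = 0"
    using X Y by (auto simp: topspace_path_space)
  have d: "has_ac_derivative (\<lambda>t. (Y t - X t) $ 1) g1" "has_ac_derivative (\<lambda>t. (Y t - X t) $ 2) g2"
    "(Y 0 - X 0) $ 1 = 0" "(Y 0 - X 0) $ 2 = 0"
    using g cX cY by simp_all
  note area = heis_area_ac(2)[where h="\<lambda>t. Y t - X t", OF cX(1) d]
  have eq: "heis_diff \<epsilon> X Y t = vector [Y t $ 1 - X t $ 1, Y t $ 2 - X t $ 2,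
      (Y t $ 3 - X t $ 3 - heis_area X (\<lambda>t. Y t - X t) t) / \<epsilon>]" if "t \<in> {0..1}" for t
    unfolding heis_diff_def limI[OF area[OF that]] ..
  then show "t \<in> {0..1} \<Longrightarrow> heis_diff \<epsilon> X Y t = vector [Y t $ 1 - X t $ 1, Y t $ 2 - X t $ 2,
      (Y t $ 3 - X t $ 3 - heis_area X (\<lambda>t. Y t - X t) t) / \<epsilon>]" .
  note cont = heis_area_continuous[where h="\<lambda>t. Y t - X t", OF cX(1) d]
  have "continuous_on {0..1} (\<lambda>t. vector [Y t $ 1 - X t $ 1, Y t $ 2 - X t $ 2,
      (Y t $ 3 - X t $ 3 - heis_area X (\<lambda>t. Y t - X t) t) / \<epsilon>] :: real ^ 3)"
    unfolding vector3_axis divide_inverse by (intro continuous_intros cX cY cont)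
  then show "continuous_on {0..1} (heis_diff \<epsilon> X Y)"
    by (rule continuous_on_eq) (rule eq[symmetric])
  show "heis_diff \<epsilon> X Y 0 = 0"
    using cX cY cont(2) by (subst eq) (simp_all add: vec_eq_iff forall_3)
qed

text \<open>If \<open>Y\<close> is a shift of \<open>X\<close> by \<open>h\<close>, then \<open>h = heis_diff \<epsilon> X Y\<close> on the unit interval. Conversely \<open>Y\<close> is the shift
  of \<open>X\<close> by \<open>heis_diff \<epsilon> X Y\<close> as soon as this path lies in the Cameron--Martin space.\<close>

lemma heis_shift_cost_eq:
  assumes X: "X \<in> topspace path_space" and Y: "Y \<in> topspace path_space" and \<epsilon>: "0 < \<epsilon>"
  shows "shift_cost (heis_shift \<epsilon>) X Y = (if heis_admissible X Y then cm_ext (heis_diff \<epsilon> X Y) else \<infinity>)"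
proof -
  have cX: "continuous_on {0..1} X" "X 0 = 0" and cY: "continuous_on {0..1} Y" "Y 0 = 0"
    and eY: "Y \<in> extensional {0..1}"
    using X Y by (auto simp: topspace_path_space)
  have fwd: "heis_admissible X Y \<and> (\<forall>t\<in>{0..1}. heis_diff \<epsilon> X Y t = h t)"
    if h: "h \<in> cameron_martin" and YT: "Y = heis_shift \<epsilon> h X" for h
  proof -
    have Yt: "Y t = vector [X t $ 1 + h t $ 1, X t $ 2 + h t $ 2, X t $ 3 + \<epsilon> * h t $ 3 + heis_area X h t]"
      if "t \<in> {0..1}" for t
      unfolding YT heis_shift_eq using that by simp
    have d1: "Y t $ 1 - X t $ 1 = h t $ 1" and d2: "Y t $ 2 - X t $ 2 = h t $ 2" if "t \<in> {0..1}" for t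
      using Yt[OF that] by simp_all
    have cm: "(\<lambda>t. Y t $ 1 - X t $ 1) \<in> cameron_martin" "(\<lambda>t. Y t $ 2 - X t $ 2) \<in> cameron_martin"
      using cameron_martin_nth[OF h, of 1] cameron_martin_nth[OF h, of 2]
        cameron_martin_cong[of "\<lambda>t. Y t $ 1 - X t $ 1" "\<lambda>t. h t $ 1", OF d1]
        cameron_martin_cong[of "\<lambda>t. Y t $ 2 - X t $ 2" "\<lambda>t. h t $ 2", OF d2] by blast+
    then have adm: "heis_admissible X Y"
      unfolding heis_admissible_def cm_ext_finite_iff by (rule conjI)
    obtain g where g: "has_ac_derivative h g" using h unfolding cameron_martin_def by blast
    have h0: "h 0 = 0" using h by (rule cameron_martin_0)
    have "heis_diff \<epsilon> X Y t = h t" if t: "t \<in> {0..1}" for t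
    proof -
      have "heis_area X h t = heis_area X (\<lambda>t. Y t - X t) t"
        using h0 d1 d2
        by (intro heis_area_cong[OF cX(1) ac_derivative_nth[OF g] ac_derivative_nth[OF g] _ _ _ t]) auto
      then show ?thesis
        unfolding heis_diff_admissible(1)[OF X Y adm t] using Yt[OF t] \<epsilon>
        by (simp add: vec_eq_iff forall_3)
    qed
    with adm show ?thesis by blast
  qed
  show ?thesis
  proof (cases "\<exists>h\<in>cameron_martin. Y = heis_shift \<epsilon> h X")
    case True
    define h where "h = (SOME h. h \<in> cameron_martin \<and> Y = heis_shift \<epsilon> h X)"
    have h: "h \<in> cameron_martin" "Y = heis_shift \<epsilon> h X"
      using someI_ex[of "\<lambda>h. h \<in> cameron_martin \<and> Y = heis_shift \<epsilon> h X"] True unfolding h_def by blast+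
    from fwd[OF h] have adm: "heis_admissible X Y"
      and e: "\<And>t. t \<in> {0..1} \<Longrightarrow> heis_diff \<epsilon> X Y t = h t" by blast+
    have "shift_cost (heis_shift \<epsilon>) X Y = ennreal (cm_norm h)"
      unfolding shift_cost_def if_P[OF True] h_def ..
    also have "\<dots> = cm_ext h" using h(1) by (simp add: cm_ext_def)
    also have "\<dots> = cm_ext (heis_diff \<epsilon> X Y)" by (rule cm_ext_cong[OF e, symmetric])
    finally show ?thesis using adm by (simp only: if_True)
  next
    case False
    have "heis_diff \<epsilon> X Y \<notin> cameron_martin" if adm: "heis_admissible X Y"
    proof
      assume H: "heis_diff \<epsilon> X Y \<in> cameron_martin"
      let ?h = "heis_diff \<epsilon> X Y"
      obtain g where g: "has_ac_derivative ?h g" using H unfolding cameron_martin_def by blast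
      have eq: "?h t = vector [Y t $ 1 - X t $ 1, Y t $ 2 - X t $ 2,
          (Y t $ 3 - X t $ 3 - heis_area X (\<lambda>t. Y t - X t) t) / \<epsilon>]" if "t \<in> {0..1}" for t
        by (rule heis_diff_admissible(1)[OF X Y adm that])
      have h0: "?h 0 = 0" by (rule heis_diff_admissible(3)[OF X Y adm])
      have "Y t = heis_shift \<epsilon> ?h X t" for t
      proof (cases "t \<in> {0..1}")
        case t: True
        have "heis_area X ?h t = heis_area X (\<lambda>t. Y t - X t) t"
          using h0 eq
          by (intro heis_area_cong[OF cX(1) ac_derivative_nth[OF g] ac_derivative_nth[OF g] _ _ _ t]) auto
        then show ?thesis
          using t \<epsilon> eq[OF t] by (simp add: heis_shift_eq vec_eq_iff forall_3)
      next
        case False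
        then show ?thesis using eY by (auto simp: heis_shift_eq extensional_def)
      qed
      then have "Y = heis_shift \<epsilon> ?h X" by (rule ext)
      with H False show False by blast
    qed
    then show ?thesis
      unfolding shift_cost_def if_not_P[OF False] by (simp add: cm_ext_def)
  qed
qed

lemma measurable_vec_nth [measurable]: "(\<lambda>x :: real ^ 'k. x $ i) \<in> borel_measurable borel"
  by (intro borel_measurable_continuous_onI continuous_intros)

lemma measurable_heis_shift_cost:
  assumes \<epsilon>: "0 < \<epsilon>"
  shows "(\<lambda>(X, Y). shift_cost (heis_shift \<epsilon>) X Y)
    \<in> borel_measurable (borel_of path_space \<Otimes>\<^sub>M borel_of path_space)"
proof -
  let ?P = "borel_of path_space \<Otimes>\<^sub>M borel_of path_space :: ((real \<Rightarrow> real ^ 3) \<times> (real \<Rightarrow> real ^ 3)) measure"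
  have ev: "(\<lambda>z. fst z t $ i) \<in> borel_measurable ?P" "(\<lambda>z. snd z t $ i) \<in> borel_measurable ?P"
    if "t \<in> {0..1}" for t i
    using measurable_compose[OF path_pair_eval_measurable(1)[OF that] measurable_vec_nth]
      measurable_compose[OF path_pair_eval_measurable(2)[OF that] measurable_vec_nth] by blast+
  have R: "(\<lambda>z. Riemann_sum n (f z) (p z) t) \<in> borel_measurable ?P"
    if f: "\<And>t. t \<in> {0..1} \<Longrightarrow> (\<lambda>z. f z t) \<in> borel_measurable ?P" "\<And>t. t \<in> {0..1} \<Longrightarrow> (\<lambda>z. p z t) \<in> borel_measurable ?P"
      and t: "t \<in> {0..1}" for f p n t
    unfolding Riemann_sum_def
  proof (rule borel_measurable_sum)
    fix k assume "k \<in> {..<2 ^ n :: nat}"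
    then have "t * (real k / 2 ^ n) \<in> {0..1}" "t * (real (Suc k) / 2 ^ n) \<in> {0..1}"
      by (intro dyadic_point_mult t; simp)+
    note [measurable] = f(1)[OF this(1)] f(2)[OF this(1)] f(2)[OF this(2)]
    show "(\<lambda>z. f z (t * (real k / 2 ^ n)) * (p z (t * (real (Suc k) / 2 ^ n)) - p z (t * (real k / 2 ^ n)))) \<in> borel_measurable ?P"
      by measurable
  qed
  have evd: "(\<lambda>z. (snd z t - fst z t) $ i) \<in> borel_measurable ?P" if "t \<in> {0..1}" for t i
    using ev[OF that, of i] by simp
  have area: "(\<lambda>z. heis_area_sum n (fst z) (\<lambda>t. snd z t - fst z t) t) \<in> borel_measurable ?P" if t: "t \<in> {0..1}" for n t
    unfolding heis_area_sum_def
    by (intro borel_measurable_add borel_measurable_diff borel_measurable_divide borel_measurable_const R ev evd t)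
  have diff: "(\<lambda>z. heis_diff \<epsilon> (fst z) (snd z) t) \<in> borel_measurable ?P" if t: "t \<in> {0..1}" for t
  proof -
    show ?thesis
      unfolding heis_diff_def vector3_axis
      by (intro borel_measurable_add borel_measurable_scaleR borel_measurable_diff borel_measurable_divide
          borel_measurable_const borel_measurable_lim_metric area ev t)
  qed
  have adm1: "(\<lambda>z. cm_ext (\<lambda>t. snd z t $ i - fst z t $ i)) \<in> borel_measurable ?P" for i
  proof (rule measurable_cm_ext)
    fix z assume "z \<in> space ?P"
    from path_space_fst_snd[OF this]
    show "continuous_on {0..1} (\<lambda>t. snd z t $ i - fst z t $ i) \<and> snd z 0 $ i - fst z 0 $ i = 0"
      by (auto simp: topspace_path_space intro!: continuous_intros)
  next
    show "(\<lambda>z. snd z t $ i - fst z t $ i) \<in> borel_measurable ?P" if "t \<in> {0..1}" for t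
      by (intro borel_measurable_diff ev that)
  qed
  have adm: "{z \<in> space ?P. heis_admissible (fst z) (snd z)} \<in> sets ?P"
    unfolding heis_admissible_def using adm1[of 1] adm1[of 2] by measurable
  \<comment> \<open>\<open>heis_diff\<close> is a continuous path for admissible pairs only; other pairs are sent to the zero path\<close>
  define H where "H z t = (if heis_admissible (fst z) (snd z) then heis_diff \<epsilon> (fst z) (snd z) t else 0)"
    for z :: "(real \<Rightarrow> real ^ 3) \<times> (real \<Rightarrow> real ^ 3)" and t
  have H: "(\<lambda>z. cm_ext (H z)) \<in> borel_measurable ?P"
  proof (rule measurable_cm_ext)
    fix z assume z: "z \<in> space ?P"
    show "continuous_on {0..1} (H z) \<and> H z 0 = 0"
    proof (cases "heis_admissible (fst z) (snd z)")
      case True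
      have "H z = heis_diff \<epsilon> (fst z) (snd z)" using True by (auto simp: H_def)
      then show ?thesis using heis_diff_admissible(2,3)[OF path_space_fst_snd[OF z] True] by simp
    next
      case False
      then have "H z = (\<lambda>_. 0)" by (auto simp: H_def)
      then show ?thesis by simp
    qed
  next
    show "(\<lambda>z. H z t) \<in> borel_measurable ?P" if "t \<in> {0..1}" for t
      unfolding H_def using diff[OF that] adm by (intro measurable_If) auto
  qed
  have "(\<lambda>z. if heis_admissible (fst z) (snd z) then cm_ext (H z) else \<infinity>) \<in> borel_measurable ?P"
    using H adm by (intro measurable_If) auto
  moreover have "(\<lambda>(X, Y). shift_cost (heis_shift \<epsilon>) X Y) z
      = (if heis_admissible (fst z) (snd z) then cm_ext (H z) else \<infinity>)" if "z \<in> space ?P" for z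
  proof -
    have "H z = heis_diff \<epsilon> (fst z) (snd z)" if "heis_admissible (fst z) (snd z)"
      using that by (auto simp: H_def)
    then show ?thesis
      using heis_shift_cost_eq[OF path_space_fst_snd[OF that] \<epsilon>] by (simp add: case_prod_unfold)
  qed
  ultimately show ?thesis by (subst measurable_cong) auto
qed

section \<open>The Riemannian distance on the Heisenberg group\<close>

lemma norm_vector3: "norm (x :: real ^ 3) = sqrt ((x $ 1)\<^sup>2 + (x $ 2)\<^sup>2 + (x $ 3)\<^sup>2)"
  by (simp add: norm_vec_def L2_set_def sum_3)

lemma ac_derivative_add:
  assumes "has_ac_derivative h g" "has_ac_derivative h' g'"
  shows "has_ac_derivative (\<lambda>t. h t + h' t) (\<lambda>t. g t + g' t)"
  unfolding has_ac_derivative_def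
proof (intro conjI ballI)
  note i = ac_derivativeD(1)[OF assms(1)] ac_derivativeD(1)[OF assms(2)]
  show "set_integrable lborel {0..1} (\<lambda>t. g t + g' t)" using i by (rule set_integral_add)
  fix t :: real assume t: "t \<in> {0..1}"
  have "set_integrable lborel {0..t} g" "set_integrable lborel {0..t} g'"
    using t by (auto intro!: set_integrable_subset[OF i(1)] set_integrable_subset[OF i(2)])
  from set_integral_add(2)[OF this]
  show "h t + h' t = h 0 + h' 0 + (LINT s:{0..t}|lborel. g s + g' s)"
    using ac_derivativeD(2)[OF assms(1) t] ac_derivativeD(2)[OF assms(2) t] by (simp only: add_ac)
qed

lemma ac_derivative_LINT:
  assumes "set_integrable lborel {0..1} g"
  shows "has_ac_derivative (\<lambda>t. c + (LINT s:{0..t}|lborel. g s)) g"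
  unfolding has_ac_derivative_def using assms LINT_point[of 0 g] by simp

lemma ac_derivative_const: "has_ac_derivative (\<lambda>t. c) (\<lambda>t. 0)"
  unfolding has_ac_derivative_def by (simp add: set_integrable_def set_lebesgue_integral_def)

lemma ac_derivative_affine: "has_ac_derivative (\<lambda>t. c + t *\<^sub>R v) (\<lambda>t. v)"
  unfolding has_ac_derivative_def
  by (auto simp: set_integrable_def set_lebesgue_integral_def emeasure_lborel_Icc_eq)

lemma ac_derivative_vector3:
  assumes "has_ac_derivative h1 g1" "has_ac_derivative h2 g2" "has_ac_derivative h3 g3"
  shows "has_ac_derivative (\<lambda>t. vector [h1 t, h2 t, h3 t] :: real ^ 3) (\<lambda>t. vector [g1 t, g2 t, g3 t])"
  unfolding vector3_axis
  by (intro ac_derivative_add ac_derivative_bounded_linear[OF bounded_linear_scaleR_left] assms)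

lemma continuous_indicator_measurable:
  fixes f :: "real \<Rightarrow> 'v::euclidean_space"
  assumes "continuous_on {0..1} f"
  shows "(\<lambda>t. indicat_real {0..1} t *\<^sub>R f t) \<in> borel_measurable lborel"
  using borel_measurable_continuous_on_indicator[OF _ assms] by simp

lemma set_integrable_indicator_measurable:
  assumes "set_integrable lborel A f"
  shows "(\<lambda>t. indicat_real A t *\<^sub>R f t) \<in> borel_measurable lborel"
  using borel_measurable_integrable[OF assms[unfolded set_integrable_def]] .

subsection \<open>The Riemannian distance is upper semicontinuous\<close>

text \<open>The coordinates of the tangent vector \<open>v\<close> at \<open>x\<close> in the orthonormal left-invariant frame.\<close>

definition heis_frame :: "real \<Rightarrow> real ^ 3 \<Rightarrow> real ^ 3 \<Rightarrow> real ^ 3" where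
  "heis_frame \<epsilon> x v = vector [v $ 1, v $ 2, (v $ 3 - (x $ 1 * v $ 2 - v $ 1 * x $ 2) / 2) / \<epsilon>]"

lemma heis_speed_eq_norm: "heis_speed \<epsilon> x v = norm (heis_frame \<epsilon> x v)"
  by (simp add: heis_speed_def heis_frame_def norm_vector3 power_divide)

lemma heis_speed_measurable:
  assumes \<gamma>: "has_ac_derivative \<gamma> g"
  shows "(\<lambda>t. ennreal (heis_speed \<epsilon> (\<gamma> t) (g t)) * indicator {0..1} t) \<in> borel_measurable lborel"
proof -
  have [measurable]: "(\<lambda>t. indicat_real {0..1} t *\<^sub>R \<gamma> t) \<in> borel_measurable lborel"
    by (rule continuous_indicator_measurable[OF ac_derivative_continuous[OF \<gamma>]])
  have [measurable]: "(\<lambda>t. indicat_real {0..1} t *\<^sub>R g t) \<in> borel_measurable lborel"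
    by (rule set_integrable_indicator_measurable[OF ac_derivativeD(1)[OF \<gamma>]])
  have "(\<lambda>t. ennreal (heis_speed \<epsilon> (indicat_real {0..1} t *\<^sub>R \<gamma> t) (indicat_real {0..1} t *\<^sub>R g t)) * indicator {0..1} t)
      \<in> borel_measurable lborel"
    unfolding heis_speed_def by measurable
  moreover have "ennreal (heis_speed \<epsilon> (indicat_real {0..1} t *\<^sub>R \<gamma> t) (indicat_real {0..1} t *\<^sub>R g t)) * indicator {0..1} t
      = ennreal (heis_speed \<epsilon> (\<gamma> t) (g t)) * indicator {0..1} t" for t :: real
    by (cases "t \<in> {0..1}") simp_all
  ultimately show ?thesis by simp
qed

text \<open>Integrated along a curve, this shows that adding a small affine function to the curve changes its length
  little.\<close>

lemma heis_speed_perturb: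
  assumes \<epsilon>: "0 < \<epsilon>" and p: "norm p \<le> \<eta>" "norm w \<le> \<eta>" "\<eta> \<le> 1"
  shows "heis_speed \<epsilon> (x + p) (v + w) \<le> heis_speed \<epsilon> x v + \<eta> * (2 + (2 + norm x + norm v) / \<epsilon>)"
proof -
  have \<eta>: "0 \<le> \<eta>" using norm_ge_zero[of p] p by linarith
  define d3 where "d3 = w $ 3 - (x $ 1 * w $ 2 + p $ 1 * v $ 2 + p $ 1 * w $ 2 - v $ 1 * p $ 2 - w $ 1 * x $ 2 - w $ 1 * p $ 2) / 2"
  have eq: "heis_frame \<epsilon> (x + p) (v + w) = heis_frame \<epsilon> x v + vector [w $ 1, w $ 2, d3 / \<epsilon>]"
    using \<epsilon> by (simp add: heis_frame_def vec_eq_iff forall_3 d3_def field_simps)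
  have c: "\<bar>w $ i\<bar> \<le> \<eta>" "\<bar>p $ i\<bar> \<le> \<eta>" "\<bar>x $ i\<bar> \<le> norm x" "\<bar>v $ i\<bar> \<le> norm v" for i
    using component_le_norm_cart[of w i] component_le_norm_cart[of p i] p
      component_le_norm_cart[of x i] component_le_norm_cart[of v i] by auto
  have prod: "\<bar>a * b\<bar> \<le> A * B" if "\<bar>a\<bar> \<le> A" "\<bar>b\<bar> \<le> B" for a b A B :: real
    unfolding abs_mult using that by (intro mult_mono) auto
  have tri: "\<bar>a1 - (a2 + a3 + a4 - a5 - a6 - a7) / 2\<bar> \<le> b1 + (b2 + b3 + b4 + b5 + b6 + b7) / 2"
    if "\<bar>a1\<bar> \<le> b1" "\<bar>a2\<bar> \<le> b2" "\<bar>a3\<bar> \<le> b3" "\<bar>a4\<bar> \<le> b4" "\<bar>a5\<bar> \<le> b5" "\<bar>a6\<bar> \<le> b6" "\<bar>a7\<bar> \<le> b7"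
    for a1 a2 a3 a4 a5 a6 a7 b1 b2 b3 b4 b5 b6 b7 :: real
  proof -
    have add: "\<bar>a + b\<bar> \<le> A + B" and sub: "\<bar>a - b\<bar> \<le> A + B"
      if "\<bar>a\<bar> \<le> A" "\<bar>b\<bar> \<le> B" for a b A B :: real
      using that by linarith+
    have half: "\<bar>a / 2\<bar> \<le> A / 2" if "\<bar>a\<bar> \<le> A" for a A :: real
      using that by simp
    show ?thesis
      by (rule sub[OF that(1) half[OF sub[OF sub[OF sub[OF add[OF add[OF that(2,3)] that(4)] that(5)] that(6)] that(7)]]])
  qed
  have ee: "\<eta> * \<eta> \<le> \<eta>" using \<eta> p(3) by (simp add: mult_left_le)
  have "\<bar>d3\<bar> \<le> \<eta> + (norm x * \<eta> + \<eta> * norm v + \<eta> * \<eta> + norm v * \<eta> + \<eta> * norm x + \<eta> * \<eta>) / 2"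
    unfolding d3_def
    by (rule tri[OF c(1)[of 3] prod[OF c(3)[of 1] c(1)[of 2]] prod[OF c(2)[of 1] c(4)[of 2]] prod[OF c(2)[of 1] c(1)[of 2]]
      prod[OF c(4)[of 1] c(2)[of 2]] prod[OF c(1)[of 1] c(3)[of 2]] prod[OF c(1)[of 1] c(2)[of 2]]])
  also have "\<dots> \<le> \<eta> * (2 + norm x + norm v)"
    using ee by (simp add: algebra_simps)
  finally have d3: "\<bar>d3 / \<epsilon>\<bar> \<le> \<eta> * (2 + norm x + norm v) / \<epsilon>"
    using \<epsilon> by (simp add: abs_divide divide_right_mono)
  have "norm (vector [w $ 1, w $ 2, d3 / \<epsilon>] :: real ^ 3) \<le> \<bar>w $ 1\<bar> + \<bar>w $ 2\<bar> + \<bar>d3 / \<epsilon>\<bar>"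
    using norm_le_l1_cart[of "vector [w $ 1, w $ 2, d3 / \<epsilon>] :: real ^ 3"] by (simp add: sum_3)
  also have "\<dots> \<le> \<eta> * (2 + (2 + norm x + norm v) / \<epsilon>)"
    using c(1)[of 1] c(1)[of 2] d3 by (simp add: algebra_simps add_divide_distrib)
  finally have "norm (vector [w $ 1, w $ 2, d3 / \<epsilon>] :: real ^ 3) \<le> \<eta> * (2 + (2 + norm x + norm v) / \<epsilon>)" .
  then show ?thesis
    unfolding heis_speed_eq_norm eq by (intro norm_triangle_mono) auto
qed

text \<open>An almost shortest curve between two points becomes a curve between nearby points, of almost the same length,
  when the affine function that interpolates the displacements of the end points is added.\<close>

lemma open_d_heis_less:
  assumes \<epsilon>: "0 < \<epsilon>"
  shows "open {z :: (real ^ 3) \<times> (real ^ 3). d_heis \<epsilon> (fst z) (snd z) < r}"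
  unfolding open_dist
proof (intro ballI)
  fix z assume "z \<in> {z. d_heis \<epsilon> (fst z) (snd z) < r}"
  then have "d_heis \<epsilon> (fst z) (snd z) < r" by simp
  then obtain \<gamma> g where \<gamma>: "has_ac_derivative \<gamma> g" "\<gamma> 0 = fst z" "\<gamma> 1 = snd z"
    and len: "(\<integral>\<^sup>+ t\<in>{0..1}. ennreal (heis_speed \<epsilon> (\<gamma> t) (g t)) \<partial>lborel) < r"
    unfolding d_heis_def INF_less_iff by auto
  define \<Lambda> where "\<Lambda> = (\<integral>\<^sup>+ t\<in>{0..1}. ennreal (heis_speed \<epsilon> (\<gamma> t) (g t)) \<partial>lborel)"
  have \<gamma>_cont: "continuous_on {0..1} \<gamma>" by (rule ac_derivative_continuous[OF \<gamma>(1)])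
  then have "bounded (\<gamma> ` {0..1})" by (intro compact_imp_bounded compact_continuous_image) auto
  then obtain B where B: "\<And>t. t \<in> {0..1} \<Longrightarrow> norm (\<gamma> t) \<le> B"
    unfolding bounded_iff by (metis imageI)
  have g: "set_integrable lborel {0..1} g" by (rule ac_derivativeD(1)[OF \<gamma>(1)])
  define c where "c t = 2 + (2 + B + norm (g t)) / \<epsilon>" for t
  have c_int: "set_integrable lborel {0..1} c"
    unfolding c_def divide_inverse
    by (intro set_integral_add set_integrable_mult_left set_integrable_norm[OF g])
       (auto simp: set_integrable_def emeasure_lborel_Icc_eq)
  have "0 \<le> B" using B[of 0] norm_ge_zero[of "\<gamma> 0"] by (simp del: norm_ge_zero)
  then have c_nn: "0 \<le> c t" for t using \<epsilon> by (simp add: c_def)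
  define \<Gamma> where "\<Gamma> = (LINT t:{0..1}|lborel. c t)"
  have \<Gamma>: "0 \<le> \<Gamma>"
    unfolding \<Gamma>_def set_lebesgue_integral_def using c_nn by (intro integral_nonneg_AE) (auto simp: indicator_def)
  have c_meas: "(\<lambda>t. ennreal (c t) * indicator {0..1} t) \<in> borel_measurable lborel"
  proof -
    have "(\<lambda>t. ennreal (indicat_real {0..1} t *\<^sub>R c t)) \<in> borel_measurable lborel"
      using set_integrable_indicator_measurable[OF c_int] by measurable
    moreover have "ennreal (indicat_real {0..1} t *\<^sub>R c t) = ennreal (c t) * indicator {0..1} t" for t :: real
      by (simp add: indicator_def)
    ultimately show ?thesis by simp
  qed
  have nn_c: "(\<integral>\<^sup>+ t\<in>{0..1}. ennreal (c t) \<partial>lborel) = ennreal \<Gamma>"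
  proof -
    have "(\<integral>\<^sup>+ t\<in>{0..1}. ennreal (c t) \<partial>lborel) = (\<integral>\<^sup>+ t. ennreal (indicat_real {0..1} t *\<^sub>R c t) \<partial>lborel)"
      by (intro nn_integral_cong) (auto simp: indicator_def)
    also have "\<dots> = ennreal (\<integral>t. indicat_real {0..1} t *\<^sub>R c t \<partial>lborel)"
      using c_int[unfolded set_integrable_def] c_nn by (intro nn_integral_eq_integral) (auto simp: indicator_def)
    finally show ?thesis by (simp add: \<Gamma>_def set_lebesgue_integral_def)
  qed
  have "\<Lambda> < r" using len by (simp add: \<Lambda>_def)
  moreover obtain l where l: "\<Lambda> = ennreal l" "0 \<le> l"
    using \<open>\<Lambda> < r\<close> by (cases \<Lambda>) auto
  ultimately obtain m where m: "ennreal l < ennreal m" "ennreal m < r" "0 \<le> m"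
    using dense[of \<Lambda> r] by (metis ennreal_cases infinity_ennreal_def not_less_iff_gr_or_eq top_greatest le_less_trans not_less)
  then have lm: "l < m" using l by (simp add: ennreal_less_iff)
  define \<eta> where "\<eta> = min 1 ((m - l) / (\<Gamma> + 1))"
  have \<eta>: "0 < \<eta>" "\<eta> \<le> 1" using lm \<Gamma> by (auto simp: \<eta>_def)
  have \<eta>\<Gamma>: "l + \<eta> * \<Gamma> \<le> m"
  proof -
    have "\<eta> * \<Gamma> \<le> (m - l) / (\<Gamma> + 1) * \<Gamma>" using \<Gamma> by (intro mult_right_mono) (auto simp: \<eta>_def)
    also have "\<dots> = (m - l) * (\<Gamma> / (\<Gamma> + 1))" by simp
    also have "\<dots> \<le> (m - l) * 1" using \<Gamma> lm by (intro mult_left_mono) auto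
    finally show ?thesis by simp
  qed
  show "\<exists>e>0. \<forall>y. dist y z < e \<longrightarrow> y \<in> {z. d_heis \<epsilon> (fst z) (snd z) < r}"
  proof (intro exI[of _ "\<eta> / 2"] conjI allI impI)
    show "0 < \<eta> / 2" using \<eta> by simp
    fix y :: "(real ^ 3) \<times> (real ^ 3)" assume y: "dist y z < \<eta> / 2"
    define a where "a = fst y - fst z"
    define b where "b = snd y - snd z"
    have ab: "norm a < \<eta> / 2" "norm b < \<eta> / 2"
      using y dist_fst_le[of y z] dist_snd_le[of y z] by (auto simp: a_def b_def dist_norm)
    define \<gamma>' where "\<gamma>' t = \<gamma> t + (a + t *\<^sub>R (b - a))" for t
    define g' where "g' t = g t + (b - a)" for t
    have ac': "has_ac_derivative \<gamma>' g'"
      unfolding \<gamma>'_def g'_def by (intro ac_derivative_add \<gamma> ac_derivative_affine)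
    have ends: "\<gamma>' 0 = fst y" "\<gamma>' 1 = snd y" by (simp_all add: \<gamma>'_def \<gamma> a_def b_def)
    have pt: "ennreal (heis_speed \<epsilon> (\<gamma>' t) (g' t)) * indicator {0..1} t
        \<le> ennreal (heis_speed \<epsilon> (\<gamma> t) (g t)) * indicator {0..1} t + ennreal \<eta> * (ennreal (c t) * indicator {0..1} t)" for t :: real
    proof (cases "t \<in> {0..1}")
      case t: True
      have "a + t *\<^sub>R (b - a) = (1 - t) *\<^sub>R a + t *\<^sub>R b" by (simp add: algebra_simps)
      also have "norm \<dots> \<le> (1 - t) * norm a + t * norm b"
        using t by (intro norm_triangle_le) simp
      also have "\<dots> \<le> (1 - t) * \<eta> + t * \<eta>"
      proof -
        have "norm a \<le> \<eta>" "norm b \<le> \<eta>"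
          using ab norm_ge_zero[of a] norm_ge_zero[of b] by linarith+
        then show ?thesis using t by (intro add_mono mult_left_mono) auto
      qed
      finally have 1: "norm (a + t *\<^sub>R (b - a)) \<le> \<eta>" by (simp add: algebra_simps)
      have 2: "norm (b - a) \<le> \<eta>" using norm_triangle_ineq4[of b a] ab by linarith
      have "heis_speed \<epsilon> (\<gamma>' t) (g' t) \<le> heis_speed \<epsilon> (\<gamma> t) (g t) + \<eta> * (2 + (2 + norm (\<gamma> t) + norm (g t)) / \<epsilon>)"
        unfolding \<gamma>'_def g'_def by (rule heis_speed_perturb[OF \<epsilon> 1 2 \<eta>(2)])
      also have "\<dots> \<le> heis_speed \<epsilon> (\<gamma> t) (g t) + \<eta> * c t"
        using B[OF t] \<eta> \<epsilon> unfolding c_def by (intro add_left_mono mult_left_mono divide_right_mono) auto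
      finally have "ennreal (heis_speed \<epsilon> (\<gamma>' t) (g' t)) \<le> ennreal (heis_speed \<epsilon> (\<gamma> t) (g t) + \<eta> * c t)"
        by (rule ennreal_leI)
      also have "\<dots> = ennreal (heis_speed \<epsilon> (\<gamma> t) (g t)) + ennreal \<eta> * ennreal (c t)"
        using \<eta> c_nn[of t] by (subst ennreal_plus) (auto simp: ennreal_mult heis_speed_eq_norm)
      finally show ?thesis using t by simp
    qed simp
    have "d_heis \<epsilon> (fst y) (snd y) \<le> (\<integral>\<^sup>+ t\<in>{0..1}. ennreal (heis_speed \<epsilon> (\<gamma>' t) (g' t)) \<partial>lborel)"
      unfolding d_heis_def using ac' ends
      by (intro INF_lower2[of "(\<gamma>', g')"]) auto
    also have "\<dots> \<le> (\<integral>\<^sup>+ t. ennreal (heis_speed \<epsilon> (\<gamma> t) (g t)) * indicator {0..1} t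
        + ennreal \<eta> * (ennreal (c t) * indicator {0..1} t) \<partial>lborel)"
      by (rule nn_integral_mono) (rule pt)
    also have "\<dots> = \<Lambda> + ennreal \<eta> * ennreal \<Gamma>"
      using heis_speed_measurable[OF \<gamma>(1)] c_meas
      by (subst nn_integral_add) (auto simp: nn_integral_cmult \<Lambda>_def nn_c)
    also have "\<dots> = ennreal (l + \<eta> * \<Gamma>)"
      using l \<eta> \<Gamma> by (simp add: ennreal_plus ennreal_mult)
    also have "\<dots> \<le> ennreal m" using \<eta>\<Gamma> by (rule ennreal_leI)
    also have "\<dots> < r" by (rule m)
    finally show "y \<in> {z. d_heis \<epsilon> (fst z) (snd z) < r}" by simp
  qed
qed

lemma measurable_d_heis:
  assumes "0 < \<epsilon>"
  shows "(\<lambda>(x, y). d_heis \<epsilon> x y) \<in> borel_measurable (borel_of euclidean \<Otimes>\<^sub>M borel_of euclidean)"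
proof -
  have "(\<lambda>z. d_heis \<epsilon> (fst z) (snd z)) \<in> borel_measurable (borel :: ((real ^ 3) \<times> (real ^ 3)) measure)"
    by (rule borel_measurableI_less) (use open_d_heis_less[OF assms] in simp)
  moreover have sets: "sets (borel_of euclidean \<Otimes>\<^sub>M borel_of euclidean :: ((real ^ 3) \<times> (real ^ 3)) measure) = sets borel"
    unfolding borel_prod[symmetric] by (intro sets_pair_measure_cong) auto
  ultimately show ?thesis
    unfolding case_prod_unfold measurable_cong_sets[OF sets refl] by blast
qed

subsection \<open>The distance between a path and its shift at time 1\<close>

text \<open>The curve \<open>\<gamma>\<close> from \<open>x 1\<close> has the first two coordinates of \<open>x 1 + h\<close>. Its vertical derivative \<open>f3\<close> is the integrand
  of the third coordinate of the shift, in the form given by \<open>heis_area_ac\<close> with the boundary term written as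
  an integral; so \<open>\<gamma>\<close> ends at the shifted end point. In the left-invariant frame its velocity is the derivative of
  \<open>h\<close> plus a vertical component that is linear in \<open>(x t - x 1) / \<epsilon>\<close>. It is the only term that
  grows with the oscillation of \<open>x\<close>.\<close>

lemma d_heis_shift_le:
  assumes \<epsilon>: "0 < \<epsilon>" and x: "x \<in> topspace path_space"
    and h: "h \<in> cameron_martin"
  shows "\<exists>g :: real \<Rightarrow> real ^ 3. (\<lambda>t. ennreal (norm (g t)) * indicator {0..1} t) \<in> borel_measurable lborel \<and>
    (\<integral>\<^sup>+ t\<in>{0..1}. (ennreal (norm (g t)))\<^sup>2 \<partial>lborel) = ennreal ((cm_norm h)\<^sup>2) \<and>
    d_heis \<epsilon> (x 1) (heis_shift \<epsilon> h x 1) \<le> (\<integral>\<^sup>+ t\<in>{0..1}.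
      ennreal (norm (g t)) * ennreal (1 + (\<bar>x t $ 1 - x 1 $ 1\<bar> + \<bar>x t $ 2 - x 1 $ 2\<bar>) / \<epsilon>) \<partial>lborel)"
proof -
  have cx: "continuous_on {0..1} x" and x0: "x 0 = 0" using x by (auto simp: topspace_path_space)
  obtain g where g: "has_ac_derivative h g" and g2: "set_integrable lborel {0..1} (\<lambda>t. (norm (g t))\<^sup>2)"
    and norm: "cm_norm h = sqrt (LINT t:{0..1}|lborel. (norm (g t))\<^sup>2)"
    using cameron_martin_obtain[OF h] by blast
  have h0: "h 0 = 0" by (rule cameron_martin_0[OF h])
  have gi: "has_ac_derivative (\<lambda>t. h t $ i) (\<lambda>t. g t $ i)" for i by (rule ac_derivative_nth[OF g])
  have gi_int: "set_integrable lborel {0..1} (\<lambda>t. g t $ i)" for i by (rule ac_derivativeD(1)[OF gi])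
  have cxi: "continuous_on {0..1} (\<lambda>s. x s $ i)" for i using cx by (intro continuous_intros)
  have chi: "continuous_on {0..1} (\<lambda>s. h s $ i)" for i by (rule ac_derivative_continuous[OF gi])
  let ?a = "x 1 $ 1" and ?b = "x 1 $ 2"
  \<comment> \<open>the summands with \<open>1/2 * ?a\<close> and \<open>1/2 * ?b\<close> are the boundary term of the integration by parts\<close>
  define f3 where "f3 t = ((\<epsilon> * g t $ 3 + (1/2) * (h t $ 1 * g t $ 2)) + (x t $ 1 * g t $ 2 + ((1/2) * ?b) * g t $ 1))
      - (((1/2) * (h t $ 2 * g t $ 1)) + (x t $ 2 * g t $ 1 + ((1/2) * ?a) * g t $ 2))" for t
  note I = set_integrable_continuous_mult[OF chi gi_int] set_integrable_continuous_mult[OF cxi gi_int] gi_int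
  have mI: "set_integrable lborel {0..1} (\<lambda>t. c * f t)" if "set_integrable lborel {0..1} f" for c and f :: "real \<Rightarrow> real"
    using that by (intro set_integrable_mult_right) auto
  have mL: "(LINT t:{0..1}|lborel. c * f t) = c * (LINT t:{0..1}|lborel. f t)" for c and f :: "real \<Rightarrow> real"
    by simp
  have f3_int: "set_integrable lborel {0..1} f3"
    unfolding f3_def by (intro set_integral_add(1) set_integral_diff(1) mI I)
  define \<gamma> where "\<gamma> t = (vector [?a + h t $ 1, ?b + h t $ 2, x 1 $ 3 + (LINT s:{0..t}|lborel. f3 s)] :: real ^ 3)" for t
  define \<gamma>' where "\<gamma>' t = (vector [g t $ 1, g t $ 2, f3 t] :: real ^ 3)" for t
  have ac: "has_ac_derivative \<gamma> \<gamma>'"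
    unfolding \<gamma>_def \<gamma>'_def
    using ac_derivative_add[OF ac_derivative_const gi]
    by (intro ac_derivative_vector3 ac_derivative_LINT f3_int) auto
  have start: "\<gamma> 0 = x 1"
    using h0 LINT_point[of 0 f3] by (simp add: \<gamma>_def vec_eq_iff forall_3)
  have h_end: "h 1 $ i = (LINT t:{0..1}|lborel. g t $ i)" for i
    using ac_derivativeD(2)[OF gi, of 1 i] h0 by simp
  have f3_total: "(LINT s:{0..1}|lborel. f3 s) =
      ((\<epsilon> * (LINT t:{0..1}|lborel. g t $ 3) + (1/2) * (LINT t:{0..1}|lborel. h t $ 1 * g t $ 2))
        + ((LINT t:{0..1}|lborel. x t $ 1 * g t $ 2) + ((1/2) * ?b) * (LINT t:{0..1}|lborel. g t $ 1)))
      - (((1/2) * (LINT t:{0..1}|lborel. h t $ 2 * g t $ 1))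
        + ((LINT t:{0..1}|lborel. x t $ 2 * g t $ 1) + ((1/2) * ?a) * (LINT t:{0..1}|lborel. g t $ 2)))"
    unfolding f3_def
    apply (subst set_integral_diff(2)) apply (intro set_integral_add(1) mI I) apply (intro set_integral_add(1) mI I)
    apply (subst set_integral_add(2)) apply (intro set_integral_add(1) mI I) apply (intro set_integral_add(1) mI I)
    apply (subst set_integral_add(2), intro mI I, intro mI I)
    apply (subst set_integral_add(2), intro mI I, intro mI I)
    apply (subst set_integral_add(2), intro mI I, intro set_integral_add(1) mI I)
    apply (subst set_integral_add(2), intro mI I, intro mI I)
    by (simp only: mL)
  have area: "heis_area x h 1 =
      (LINT s:{0..1}|lborel. x s $ 1 * g s $ 2) - (LINT s:{0..1}|lborel. x s $ 2 * g s $ 1)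
    + (h 1 $ 1 * x 1 $ 2 - h 1 $ 2 * x 1 $ 1) / 2
    + ((LINT s:{0..1}|lborel. h s $ 1 * g s $ 2) - (LINT s:{0..1}|lborel. h s $ 2 * g s $ 1)) / 2"
    by (rule heis_area_ac(1)[OF cx gi gi]) (simp_all add: h0)
  have "\<gamma> 1 = heis_shift \<epsilon> h x 1"
    unfolding heis_shift_eq \<gamma>_def f3_total
    by (simp add: vec_eq_iff forall_3 area h_end field_simps)
  then have d_le: "d_heis \<epsilon> (x 1) (heis_shift \<epsilon> h x 1)
      \<le> (\<integral>\<^sup>+ t\<in>{0..1}. ennreal (heis_speed \<epsilon> (\<gamma> t) (\<gamma>' t)) \<partial>lborel)"
    unfolding d_heis_def using ac start by (intro INF_lower2[of "(\<gamma>, \<gamma>')"]) auto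
  have speed: "heis_speed \<epsilon> (\<gamma> t) (\<gamma>' t)
      \<le> norm (g t) * (1 + (\<bar>x t $ 1 - ?a\<bar> + \<bar>x t $ 2 - ?b\<bar>) / \<epsilon>)" for t
  proof -
    define c where "c = ((x t $ 1 - ?a) * g t $ 2 - (x t $ 2 - ?b) * g t $ 1) / \<epsilon>"
    have "heis_frame \<epsilon> (\<gamma> t) (\<gamma>' t) = g t + vector [0, 0, c]"
      using \<epsilon> by (simp add: heis_frame_def vec_eq_iff forall_3 \<gamma>_def \<gamma>'_def f3_def c_def field_simps)
    then have "heis_speed \<epsilon> (\<gamma> t) (\<gamma>' t) \<le> norm (g t) + \<bar>c\<bar>"
      unfolding heis_speed_eq_norm using norm_triangle_ineq[of "g t" "vector [0, 0, c]"]
      by (simp add: norm_vector3[of "vector [0, 0, c]"])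
    moreover have "\<bar>c\<bar> \<le> norm (g t) * ((\<bar>x t $ 1 - ?a\<bar> + \<bar>x t $ 2 - ?b\<bar>) / \<epsilon>)"
    proof -
      have "\<bar>(x t $ 1 - ?a) * g t $ 2 - (x t $ 2 - ?b) * g t $ 1\<bar>
          \<le> \<bar>x t $ 1 - ?a\<bar> * \<bar>g t $ 2\<bar> + \<bar>x t $ 2 - ?b\<bar> * \<bar>g t $ 1\<bar>"
        by (metis abs_mult abs_triangle_ineq4)
      also have "\<dots> \<le> \<bar>x t $ 1 - ?a\<bar> * norm (g t) + \<bar>x t $ 2 - ?b\<bar> * norm (g t)"
        using component_le_norm_cart[of "g t"] by (intro add_mono mult_left_mono) auto
      finally have "\<bar>(x t $ 1 - ?a) * g t $ 2 - (x t $ 2 - ?b) * g t $ 1\<bar> / \<epsilon>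
          \<le> (\<bar>x t $ 1 - ?a\<bar> * norm (g t) + \<bar>x t $ 2 - ?b\<bar> * norm (g t)) / \<epsilon>"
        using \<epsilon> by (intro divide_right_mono) auto
      then show ?thesis using \<epsilon> by (simp add: c_def abs_divide algebra_simps)
    qed
    ultimately show ?thesis by (simp add: algebra_simps)
  qed
  have "d_heis \<epsilon> (x 1) (heis_shift \<epsilon> h x 1) \<le> (\<integral>\<^sup>+ t\<in>{0..1}.
      ennreal (norm (g t)) * ennreal (1 + (\<bar>x t $ 1 - ?a\<bar> + \<bar>x t $ 2 - ?b\<bar>) / \<epsilon>) \<partial>lborel)"
  proof (rule order_trans[OF d_le], rule nn_integral_mono, rule mult_right_mono)
    fix t :: real
    have "ennreal (heis_speed \<epsilon> (\<gamma> t) (\<gamma>' t)) \<le> ennreal (norm (g t) * (1 + (\<bar>x t $ 1 - ?a\<bar> + \<bar>x t $ 2 - ?b\<bar>) / \<epsilon>))"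
      by (rule ennreal_leI) (rule speed)
    then show "ennreal (heis_speed \<epsilon> (\<gamma> t) (\<gamma>' t))
        \<le> ennreal (norm (g t)) * ennreal (1 + (\<bar>x t $ 1 - ?a\<bar> + \<bar>x t $ 2 - ?b\<bar>) / \<epsilon>)"
      using \<epsilon> by (simp add: ennreal_mult)
  qed simp
  moreover have "(\<lambda>t. ennreal (norm (g t)) * indicator {0..1} t) \<in> borel_measurable lborel"
  proof -
    have "(\<lambda>t. ennreal (norm (indicat_real {0..1} t *\<^sub>R g t))) \<in> borel_measurable lborel"
      using set_integrable_indicator_measurable[OF ac_derivativeD(1)[OF g]] by measurable
    moreover have "ennreal (norm (indicat_real {0..1} t *\<^sub>R g t)) = ennreal (norm (g t)) * indicator {0..1} t" for t :: real
      by (simp add: indicator_def)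
    ultimately show ?thesis by (simp only:)
  qed
  moreover have "(\<integral>\<^sup>+ t\<in>{0..1}. (ennreal (norm (g t)))\<^sup>2 \<partial>lborel) = ennreal ((cm_norm h)\<^sup>2)"
  proof -
    have "(\<integral>\<^sup>+ t\<in>{0..1}. (ennreal (norm (g t)))\<^sup>2 \<partial>lborel) = (\<integral>\<^sup>+ t. ennreal (indicat_real {0..1} t *\<^sub>R (norm (g t))\<^sup>2) \<partial>lborel)"
      by (intro nn_integral_cong) (auto simp: indicator_def ennreal_power)
    also have "\<dots> = ennreal (LINT t:{0..1}|lborel. (norm (g t))\<^sup>2)"
      unfolding set_lebesgue_integral_def
      using g2[unfolded set_integrable_def] by (intro nn_integral_eq_integral) (auto simp: indicator_def)
    also have "(LINT t:{0..1}|lborel. (norm (g t))\<^sup>2) = (cm_norm h)\<^sup>2"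
    proof -
      have "0 \<le> (LINT t:{0..1}|lborel. (norm (g t))\<^sup>2)"
        unfolding set_lebesgue_integral_def by (intro integral_nonneg_AE) auto
      then show ?thesis by (simp add: norm)
    qed
    finally show ?thesis .
  qed
  ultimately show ?thesis by - (intro exI[of _ g] conjI; assumption)
qed

section \<open>Contraction weights for the evaluation at time 1\<close>

lemma time1_measurable: "time1 \<in> borel_of path_space \<rightarrow>\<^sub>M (borel :: 'v::euclidean_space measure)"
  using measurable_path_eval[of 1, where 'v='v] by (simp add: time1_def[abs_def])

lemma contraction_setting_time1:
  fixes \<eta> :: "(real \<Rightarrow> 'v::euclidean_space) measure"
  assumes "prob_space \<eta>" "sets \<eta> = sets (borel_of path_space)"
    "(\<lambda>(x, y). c x y) \<in> borel_measurable (borel_of path_space \<Otimes>\<^sub>M borel_of path_space)"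
    "(\<lambda>(x, y). c' x y) \<in> borel_measurable (borel_of euclidean \<Otimes>\<^sub>M borel_of euclidean)"
  shows "contraction_setting path_space c (euclidean :: 'v topology) c' \<eta> time1"
proof -
  have "(time1 :: (real \<Rightarrow> 'v) \<Rightarrow> 'v) \<in> borel_of path_space \<rightarrow>\<^sub>M borel_of euclidean"
    using time1_measurable by (simp add: measurable_cong_sets[OF refl sets_borel_of_euclidean])
  moreover have "metrizable_space (euclidean :: 'v topology)"
    by (rule completely_metrizable_imp_metrizable_space[OF completely_metrizable_space_euclidean])
  ultimately show ?thesis
    using assms polish_path_space unfolding contraction_setting_def by blast
qed

lemma path_law_prob:
  fixes X :: "real \<Rightarrow> 'w \<Rightarrow> 'v::euclidean_space"
  assumes "prob_space M" "\<And>t. t \<in> {0..1} \<Longrightarrow> X t \<in> borel_measurable M"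
    and "\<And>\<omega>. \<omega> \<in> space M \<Longrightarrow> X 0 \<omega> = 0 \<and> continuous_on {0..1} (\<lambda>t. X t \<omega>)"
  shows "prob_space (path_law M X)" "sets (path_law M X) = sets (borel_of path_space)"
    "space (path_law M X) = topspace path_space"
  using prob_space.prob_space_distr[OF assms(1) path_law_measurable[OF assms(2,3)]]
  by (simp_all add: path_law_def)

lemma transport_ineq_time1:
  fixes \<eta> :: "(real \<Rightarrow> 'v::euclidean_space) measure"
  assumes "contraction_gives path_space c (euclidean :: 'v topology) c' \<eta> time1 p \<kappa>"
    "1 \<le> p" "p \<le> 2" "0 < \<alpha>" "transport_ineq path_space c 2 \<alpha> \<eta>"
  shows "transport_ineq euclidean c' p (\<alpha> * \<kappa>) (distr \<eta> borel time1)"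
proof -
  have "distr \<eta> (borel_of euclidean) time1 = distr \<eta> (borel :: 'v measure) time1"
    by (rule distr_cong) simp_all
  then show ?thesis using contraction_principle[OF assms] by simp
qed

subsection \<open>Wiener measure\<close>

lemma standard_BM_D:
  fixes B :: "real \<Rightarrow> 'w \<Rightarrow> real ^ 'm"
  assumes "standard_BM M B"
  shows "prob_space M" "\<And>t. t \<in> {0..1} \<Longrightarrow> B t \<in> borel_measurable M"
    "\<And>\<omega>. \<omega> \<in> space M \<Longrightarrow> B 0 \<omega> = 0 \<and> continuous_on {0..1} (\<lambda>t. B t \<omega>)"
    "\<And>s t i. 0 \<le> s \<Longrightarrow> s < t \<Longrightarrow> t \<le> 1 \<Longrightarrow>
        distributed M lborel (\<lambda>\<omega>. B t \<omega> $ i - B s \<omega> $ i) (normal_density 0 (sqrt (t - s)))"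
    "\<And>n (t :: nat \<Rightarrow> real). 0 \<le> t 0 \<Longrightarrow> (\<And>k. k < n \<Longrightarrow> t k < t (Suc k)) \<Longrightarrow> t n \<le> 1 \<Longrightarrow>
        prob_space.indep_vars M (\<lambda>_. borel)
          (\<lambda>(k, i) \<omega>. B (t (Suc k)) \<omega> $ i - B (t k) \<omega> $ i) ({..<n} \<times> UNIV)"
proof -
  note D = assms[unfolded standard_BM_def]
  note D2 = D[THEN conjunct2] and D3 = D[THEN conjunct2, THEN conjunct2]
  note D4 = D3[THEN conjunct2]
  show "prob_space M" by (rule D[THEN conjunct1])
  show "B t \<in> borel_measurable M" if "t \<in> {0..1}" for t
    by (rule D2[THEN conjunct1, rule_format, OF that])
  show "B 0 \<omega> = 0 \<and> continuous_on {0..1} (\<lambda>t. B t \<omega>)" if "\<omega> \<in> space M" for \<omega>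
    by (rule D3[THEN conjunct1, rule_format, OF that])
  show "distributed M lborel (\<lambda>\<omega>. B t \<omega> $ i - B s \<omega> $ i) (normal_density 0 (sqrt (t - s)))"
    if "0 \<le> s" "s < t" "t \<le> 1" for s t i
    by (rule D4[THEN conjunct1, rule_format]) (intro conjI that)
  show "prob_space.indep_vars M (\<lambda>_. borel)
      (\<lambda>(k, i) \<omega>. B (t (Suc k)) \<omega> $ i - B (t k) \<omega> $ i) ({..<n} \<times> UNIV)"
    if "0 \<le> t 0" "\<And>k. k < n \<Longrightarrow> t k < t (Suc k)" "t n \<le> 1" for n and t :: "nat \<Rightarrow> real"
    by (rule D4[THEN conjunct2, rule_format]) (intro conjI allI impI that)
qed

lemma Wiener_contraction_gives:
  fixes B :: "real \<Rightarrow> 'w \<Rightarrow> real ^ 'd"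
  assumes BM: "standard_BM M B"
  shows "contraction_gives path_space cm_cost euclidean (\<lambda>x y. ennreal (dist x y)) (path_law M B) time1 2 1"
proof -
  note B = standard_BM_D(1-3)[OF BM]
  have law: "prob_space (path_law M B)" "sets (path_law M B) = sets (borel_of path_space)"
    "space (path_law M B) = topspace path_space"
    by (rule path_law_prob[OF B]; assumption)+
  interpret \<eta>: prob_space "path_law M B" by (rule law)
  have sets: "sets (borel_of euclidean \<Otimes>\<^sub>M borel_of euclidean :: ((real ^ 'd) \<times> (real ^ 'd)) measure) = sets borel"
    unfolding borel_prod[symmetric] by (intro sets_pair_measure_cong) auto
  have "(\<lambda>(x, y). ennreal (dist x y)) \<in> borel_measurable (borel_of euclidean \<Otimes>\<^sub>M borel_of (euclidean :: (real ^ 'd) topology))"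
    unfolding case_prod_unfold measurable_cong_sets[OF sets refl]
    by (intro measurable_compose[OF _ measurable_ennreal] borel_measurable_continuous_onI continuous_intros)
  then have cset: "contraction_setting path_space cm_cost euclidean (\<lambda>x y. ennreal (dist x y)) (path_law M B) time1"
    by (intro contraction_setting_time1 law measurable_cm_cost)
  have exponent: "contraction_exponent 2 = \<infinity>"
    by (simp add: contraction_exponent_def ennreal_divide_zero)
  have norm: "Lq_norm (path_law M B) (contraction_exponent 2) (\<lambda>_. 1) = 1"
    unfolding exponent Lq_norm_def by (simp add: esssup_const \<eta>.emeasure_space_1)
  have "ennreal (dist (time1 x) (time1 y)) \<le> 1 * cm_cost x y"
    if "x \<in> space (path_law M B)" "y \<in> space (path_law M B)" for x y
  proof -
    have "ennreal (norm (y 1 - x 1)) \<le> cm_ext (\<lambda>t. y t - x t)"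
      using that unfolding law(3) topspace_path_space
      by (intro norm_endpoint_le_cm_ext) (auto intro!: continuous_intros)
    then show ?thesis by (simp add: cm_cost_eq time1_def dist_norm norm_minus_commute)
  qed
  then have "contraction_weight cm_cost (\<lambda>x y. ennreal (dist x y)) (path_law M B) time1 2 (\<lambda>_. 1)"
    unfolding contraction_weight_def norm
    by (intro conjI bexI[of _ "space (path_law M B)"]) (auto simp: \<eta>.emeasure_space_1)
  then show ?thesis
    unfolding contraction_gives_def using cset norm by (intro conjI exI[of _ "\<lambda>_. 1"]) auto
qed

subsection \<open>The weight for the Riemannian approximations\<close>

text \<open>A bound for the \<open>2 * m\<close>-th power of the factor in \<open>d_heis_shift_le\<close>. It is a polynomial in the increments of \<open>x\<close>,
  so that its mean is given by Gaussian moments.\<close>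

definition heis_density :: "nat \<Rightarrow> real \<Rightarrow> (real \<Rightarrow> real ^ 3) \<Rightarrow> real \<Rightarrow> real" where
  "heis_density m \<epsilon> x t =
     9 ^ m * (1 + ((x 1 $ 1 - x t $ 1) / \<epsilon>) ^ (2 * m) + ((x 1 $ 2 - x t $ 2) / \<epsilon>) ^ (2 * m))"

definition heis_weight :: "nat \<Rightarrow> real \<Rightarrow> (real \<Rightarrow> real ^ 3) \<Rightarrow> ennreal" where
  "heis_weight m \<epsilon> x = (\<integral>\<^sup>+ t\<in>{0..1}. ennreal (heis_density m \<epsilon> x t) \<partial>lborel)"

lemma heis_density_ge_1: "1 \<le> heis_density m \<epsilon> x t"
proof -
  have "1 * 1 \<le> heis_density m \<epsilon> x t"
    unfolding heis_density_def power_mult by (intro mult_mono) (auto simp: add_nonneg_nonneg)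
  then show ?thesis by simp
qed

text \<open>A sum of three numbers is at most three times their maximum, which explains the factor \<open>9 ^ m = 3 ^ (2 * m)\<close>.\<close>

lemma heis_density_ge_power:
  assumes \<epsilon>: "0 < \<epsilon>"
  shows "(1 + (\<bar>x t $ 1 - x 1 $ 1\<bar> + \<bar>x t $ 2 - x 1 $ 2\<bar>) / \<epsilon>) ^ (2 * m) \<le> heis_density m \<epsilon> x t"
proof -
  define a where "a = \<bar>x t $ 1 - x 1 $ 1\<bar> / \<epsilon>"
  define b where "b = \<bar>x t $ 2 - x 1 $ 2\<bar> / \<epsilon>"
  have ab: "0 \<le> a" "0 \<le> b" using \<epsilon> by (auto simp: a_def b_def)
  define s where "s = max 1 (max a b)"
  have s: "1 \<le> s" "a \<le> s" "b \<le> s" "0 \<le> s" by (auto simp: s_def)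
  have "s ^ (2 * m) \<le> 1 + a ^ (2 * m) + b ^ (2 * m)"
  proof -
    have "0 \<le> a ^ (2 * m)" "0 \<le> b ^ (2 * m)" using ab by simp_all
    moreover have "s = 1 \<or> s = a \<or> s = b" by (auto simp: s_def max_def)
    ultimately show ?thesis by auto
  qed
  moreover have "(1 + (a + b)) ^ (2 * m) \<le> (3 * s) ^ (2 * m)"
    using ab s by (intro power_mono) auto
  moreover have "(3 * s) ^ (2 * m) = 9 ^ m * s ^ (2 * m)"
    by (simp add: power_mult_distrib power_mult)
  ultimately have "(1 + (a + b)) ^ (2 * m) \<le> 9 ^ m * (1 + a ^ (2 * m) + b ^ (2 * m))"
    by (smt (verit) mult_left_mono zero_le_power)
  also have "a ^ (2 * m) = ((x 1 $ 1 - x t $ 1) / \<epsilon>) ^ (2 * m)"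
    using \<epsilon> by (simp add: a_def power_mult power_divide power2_commute)
  also have "b ^ (2 * m) = ((x 1 $ 2 - x t $ 2) / \<epsilon>) ^ (2 * m)"
    using \<epsilon> by (simp add: b_def power_mult power_divide power2_commute)
  finally show ?thesis by (simp add: a_def b_def heis_density_def add_divide_distrib)
qed

lemma heis_weight_ge_1: "1 \<le> heis_weight m \<epsilon> x"
proof -
  have "(1 :: ennreal) = (\<integral>\<^sup>+ t\<in>{0..1::real}. 1 \<partial>lborel)" by simp
  also have "\<dots> \<le> heis_weight m \<epsilon> x"
    unfolding heis_weight_def
    using ennreal_leI[OF heis_density_ge_1] by (intro nn_integral_mono mult_right_mono) auto
  finally show ?thesis .
qed

text \<open>The Cauchy--Schwarz inequality in time bounds the distance by \<open>cm_norm h\<close> times the \<open>L\<^sup>2\<close>-norm of \<open>\<phi>\<close>, and the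
  latter is at most the \<open>L\<close>-norm of \<open>\<phi>\<close> with exponent \<open>2 * m\<close>. Since the weight is at least \<open>1\<close>, the exponent
  \<open>1 / (2 * m)\<close> may be increased to \<open>1 / q\<close>. This choice makes the \<open>L\<^sup>q\<close>-norm of the factor a power of the mean
  of \<open>heis_weight m \<epsilon>\<close>, which can be computed.\<close>

lemma heis_weight_bound:
  assumes \<epsilon>: "0 < \<epsilon>" and m: "2 \<le> m" and q: "0 < q" "q \<le> 2 * real m"
    and x: "x \<in> topspace path_space"
  shows "d_heis \<epsilon> (x 1) (y 1) \<le> epowr (heis_weight m \<epsilon> x) (1 / q) * shift_cost (heis_shift \<epsilon>) x y"
proof (cases "\<exists>h\<in>cameron_martin. y = heis_shift \<epsilon> h x")
  case False
  have "epowr (heis_weight m \<epsilon> x) (1 / q) \<noteq> 0"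
    using heis_weight_ge_1[of m \<epsilon> x] by auto
  then show ?thesis using False by (simp add: shift_cost_def ennreal_mult_top)
next
  case True
  define h where "h = (SOME h. h \<in> cameron_martin \<and> y = heis_shift \<epsilon> h x)"
  have h: "h \<in> cameron_martin" "y = heis_shift \<epsilon> h x"
    using someI_ex[of "\<lambda>h. h \<in> cameron_martin \<and> y = heis_shift \<epsilon> h x"] True unfolding h_def by blast+
  have cost: "shift_cost (heis_shift \<epsilon>) x y = ennreal (cm_norm h)"
    using True by (simp add: shift_cost_def h_def)
  define \<phi> where "\<phi> t = 1 + (\<bar>x t $ 1 - x 1 $ 1\<bar> + \<bar>x t $ 2 - x 1 $ 2\<bar>) / \<epsilon>" for t
  have \<phi>: "0 \<le> \<phi> t" for t using \<epsilon> by (simp add: \<phi>_def)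
  have cx: "continuous_on {0..1} x" using x by (simp add: topspace_path_space)
  have \<phi>_meas: "(\<lambda>t. ennreal (\<phi> t) * indicator {0..1} t) \<in> borel_measurable lborel"
  proof -
    have "continuous_on {0..1} \<phi>"
      unfolding \<phi>_def divide_inverse by (intro continuous_intros cx)
    from continuous_indicator_measurable[OF this]
    have "(\<lambda>t. ennreal (indicat_real {0..1} t *\<^sub>R \<phi> t)) \<in> borel_measurable lborel" by measurable
    moreover have "ennreal (indicat_real {0..1} t *\<^sub>R \<phi> t) = ennreal (\<phi> t) * indicator {0..1} t" for t :: real
      by (simp add: indicator_def)
    ultimately show ?thesis by simp
  qed
  obtain g :: "real \<Rightarrow> real ^ 3" where g: "(\<lambda>t. ennreal (norm (g t)) * indicator {0..1} t) \<in> borel_measurable lborel"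
    and g2: "(\<integral>\<^sup>+ t\<in>{0..1}. (ennreal (norm (g t)))\<^sup>2 \<partial>lborel) = ennreal ((cm_norm h)\<^sup>2)"
    and d: "d_heis \<epsilon> (x 1) (y 1) \<le> (\<integral>\<^sup>+ t\<in>{0..1}. ennreal (norm (g t)) * ennreal (\<phi> t) \<partial>lborel)"
    using d_heis_shift_le[OF \<epsilon> x h(1)] unfolding h(2)[symmetric] \<phi>_def by blast
  define A where "A = (\<integral>\<^sup>+ t\<in>{0..1}. ennreal (norm (g t)) * ennreal (\<phi> t) \<partial>lborel)"
  define S where "S = (\<integral>\<^sup>+ t\<in>{0..1}. (ennreal (\<phi> t))\<^sup>2 \<partial>lborel)"
  have ind_sq: "(u * indicator {0..1} t)\<^sup>2 = u\<^sup>2 * indicator {0..1} t" for u :: ennreal and t :: real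
    by (simp add: indicator_def power2_eq_square)
  have "A\<^sup>2 = (\<integral>\<^sup>+ t. (ennreal (norm (g t)) * indicator {0..1} t) * (ennreal (\<phi> t) * indicator {0..1} t) \<partial>lborel)\<^sup>2"
    unfolding A_def by (intro arg_cong[of _ _ "\<lambda>u. u\<^sup>2"] nn_integral_cong) (simp add: indicator_def)
  also have "\<dots> \<le> (\<integral>\<^sup>+ t. (ennreal (norm (g t)) * indicator {0..1} t)\<^sup>2 \<partial>lborel)
      * (\<integral>\<^sup>+ t. (ennreal (\<phi> t) * indicator {0..1} t)\<^sup>2 \<partial>lborel)"
    using g \<phi>_meas by (rule Cauchy_Schwarz_nn_integral)
  also have "\<dots> = ennreal ((cm_norm h)\<^sup>2) * S"
    unfolding ind_sq g2 S_def ..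
  finally have A2: "A\<^sup>2 \<le> ennreal ((cm_norm h)\<^sup>2) * S" .
  have "S \<le> epowr (heis_weight m \<epsilon> x) (1 / real m)"
  proof -
    have m1: "0 < 1 / real m" "0 < 1 - 1 / real m" using m by auto
    have ind: "(indicator {0..1} :: real \<Rightarrow> ennreal) \<in> borel_measurable lborel" by simp
    have pow: "(\<lambda>t. (ennreal (\<phi> t)) ^ (2 * m) * indicator {0..1} t) \<in> borel_measurable lborel"
    proof -
      have "(\<lambda>t. (ennreal (\<phi> t) * indicator {0..1} t) ^ (2 * m)) \<in> borel_measurable lborel"
        using \<phi>_meas by measurable
      moreover have "(ennreal (\<phi> t) * indicator {0..1} t) ^ (2 * m) = (ennreal (\<phi> t)) ^ (2 * m) * indicator {0..1} t" for t :: real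
        using m by (simp add: indicator_def power_0_left)
      ultimately show ?thesis by simp
    qed
    have "(ennreal (\<phi> t))\<^sup>2 * indicator {0..1} t
        = epowr ((ennreal (\<phi> t)) ^ (2 * m) * indicator {0..1} t) (1 / real m) * epowr (indicator {0..1} t) (1 - 1 / real m)" for t :: real
    proof (cases "t \<in> {0..1}")
      case True
      have "epowr ((ennreal (\<phi> t)) ^ (2 * m)) (1 / real m) = epowr (epowr (ennreal (\<phi> t)) (real (2 * m))) (1 / real m)"
        using m by (subst epowr_of_nat) auto
      also have "\<dots> = epowr (ennreal (\<phi> t)) 2" using m by (simp add: epowr_epowr)
      finally show ?thesis using True by (simp add: epowr_numeral)
    qed simp
    then have "S = (\<integral>\<^sup>+ t. epowr ((ennreal (\<phi> t)) ^ (2 * m) * indicator {0..1} t) (1 / real m)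
        * epowr (indicator {0..1} t) (1 - 1 / real m) \<partial>lborel)"
      unfolding S_def by simp
    also have "\<dots> \<le> epowr (\<integral>\<^sup>+ t. (ennreal (\<phi> t)) ^ (2 * m) * indicator {0..1} t \<partial>lborel) (1 / real m)
        * epowr (\<integral>\<^sup>+ t. indicator {0..1::real} t \<partial>lborel) (1 - 1 / real m)"
      by (rule nn_integral_Hoelder[OF pow ind m1]) simp
    also have "\<dots> = epowr (\<integral>\<^sup>+ t. (ennreal (\<phi> t)) ^ (2 * m) * indicator {0..1} t \<partial>lborel) (1 / real m)"
      by simp
    also have "\<dots> \<le> epowr (heis_weight m \<epsilon> x) (1 / real m)"
    proof (rule epowr_mono)
      show "(\<integral>\<^sup>+ t. (ennreal (\<phi> t)) ^ (2 * m) * indicator {0..1} t \<partial>lborel) \<le> heis_weight m \<epsilon> x"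
        unfolding heis_weight_def
      proof (intro nn_integral_mono mult_right_mono)
        fix t
        have "ennreal (\<phi> t) ^ (2 * m) = ennreal (\<phi> t ^ (2 * m))"
          using \<phi> by (simp add: ennreal_power)
        also have "\<dots> \<le> ennreal (heis_density m \<epsilon> x t)"
          unfolding \<phi>_def by (rule ennreal_leI) (rule heis_density_ge_power[OF \<epsilon>])
        finally show "ennreal (\<phi> t) ^ (2 * m) \<le> ennreal (heis_density m \<epsilon> x t)" .
      qed simp
    qed simp
    finally show ?thesis .
  qed
  have "A = epowr (A\<^sup>2) (1 / 2)"
    using epowr_epowr[of A 2 "1 / 2"] by (simp add: epowr_numeral)
  also have "\<dots> \<le> epowr (ennreal ((cm_norm h)\<^sup>2) * S) (1 / 2)"
    using A2 by (rule epowr_mono) simp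
  also have "\<dots> = ennreal (cm_norm h) * epowr S (1 / 2)"
    using cm_norm_nonneg[of h] by (simp add: epowr_mult epowr_ennreal powr_half_sqrt)
  also have "\<dots> \<le> ennreal (cm_norm h) * epowr (epowr (heis_weight m \<epsilon> x) (1 / real m)) (1 / 2)"
    using \<open>S \<le> _\<close> by (intro mult_left_mono epowr_mono) auto
  also have "\<dots> = ennreal (cm_norm h) * epowr (heis_weight m \<epsilon> x) (1 / (2 * real m))"
    by (simp add: epowr_epowr mult.commute)
  also have "\<dots> \<le> ennreal (cm_norm h) * epowr (heis_weight m \<epsilon> x) (1 / q)"
    using q m by (intro mult_left_mono epowr_mono_exponent heis_weight_ge_1 divide_left_mono) auto
  finally show ?thesis
    using d unfolding A_def[symmetric] cost by (simp add: mult.commute)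
qed

subsection \<open>The moments of the weight\<close>

text \<open>The moment of order \<open>2 * m\<close> of a centred Gaussian variable with variance \<open>1 - t\<close>, divided by \<open>\<epsilon> ^ (2 * m)\<close>.\<close>

definition heis_moment :: "nat \<Rightarrow> real \<Rightarrow> real \<Rightarrow> real" where
  "heis_moment m \<epsilon> t = fact (2 * m) / ((2 / (sqrt (1 - t))\<^sup>2) ^ m * fact m) / \<epsilon> ^ (2 * m)"

definition heis_const :: "nat \<Rightarrow> real \<Rightarrow> ennreal" where
  "heis_const m \<epsilon> = (\<integral>\<^sup>+ t\<in>{0..1}. ennreal (9 ^ m) * (1 + 2 * ennreal (heis_moment m \<epsilon> t)) \<partial>lborel)"

lemma heis_density_measurable:
  "(\<lambda>z. ennreal (heis_density m \<epsilon> (fst z) (snd z)) * indicator {0..1} (snd z))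
     \<in> borel_measurable (borel_of path_space \<Otimes>\<^sub>M borel)"
proof -
  have ev1: "(\<lambda>z. fst z 1 :: real ^ 3) \<in> borel_measurable (borel_of path_space \<Otimes>\<^sub>M borel)"
    by (rule path_pair_eval_measurable(1)) simp
  note c = measurable_compose[OF path_eval_jointly_measurable measurable_vec_nth]
    and c1 = measurable_compose[OF ev1 measurable_vec_nth]
  have "(\<lambda>z :: (real \<Rightarrow> real ^ 3) \<times> real. ennreal (9 ^ m * (1 + ((fst z 1 $ 1 - fst z (max 0 (min 1 (snd z))) $ 1) / \<epsilon>) ^ (2 * m)
        + ((fst z 1 $ 2 - fst z (max 0 (min 1 (snd z))) $ 2) / \<epsilon>) ^ (2 * m))) * indicator {0..1} (snd z))
     \<in> borel_measurable (borel_of path_space \<Otimes>\<^sub>M borel)"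
    using c[of 1] c[of 2] c1[of 1] c1[of 2] by measurable
  moreover have "ennreal (9 ^ m * (1 + ((x 1 $ 1 - x (max 0 (min 1 t)) $ 1) / \<epsilon>) ^ (2 * m)
        + ((x 1 $ 2 - x (max 0 (min 1 t)) $ 2) / \<epsilon>) ^ (2 * m))) * indicator {0..1} t
      = ennreal (heis_density m \<epsilon> x t) * indicator {0..1} t" for x :: "real \<Rightarrow> real ^ 3" and t :: real
  proof (cases "t \<in> {0..1}")
    case True
    then have "max 0 (min 1 t) = t" by auto
    then show ?thesis by (simp add: heis_density_def)
  qed simp
  ultimately show ?thesis by (simp only:)
qed

lemma heis_weight_measurable: "heis_weight m \<epsilon> \<in> borel_measurable (borel_of path_space)"
proof -
  have "(\<lambda>(x, t). ennreal (heis_density m \<epsilon> x t) * indicator {0..1} t) \<in> borel_measurable (borel_of path_space \<Otimes>\<^sub>M lborel)"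
    using heis_density_measurable[of m \<epsilon>]
    by (simp add: case_prod_unfold measurable_cong_sets[OF sets_pair_measure_cong[OF refl sets_lborel] refl])
  from lborel.borel_measurable_nn_integral[OF this] show ?thesis
    unfolding heis_weight_def[abs_def] .
qed

lemma normal_moment_nn_integral:
  assumes d: "distributed M lborel Y (normal_density 0 \<sigma>)" and \<sigma>: "0 < \<sigma>"
  shows "(\<integral>\<^sup>+\<omega>. ennreal ((Y \<omega> / \<epsilon>) ^ (2 * m)) \<partial>M)
    = ennreal (fact (2 * m) / ((2 / \<sigma>\<^sup>2) ^ m * fact m) / \<epsilon> ^ (2 * m))"
proof -
  have b: "has_bochner_integral lborel (\<lambda>y. normal_density 0 \<sigma> y * y ^ (2 * m))
      (fact (2 * m) / ((2 / \<sigma>\<^sup>2) ^ m * fact m))"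
    using normal_moment_even[OF \<sigma>, of 0 m] by simp
  have b': "has_bochner_integral lborel (\<lambda>y. normal_density 0 \<sigma> y * y ^ (2 * m) / \<epsilon> ^ (2 * m))
      (fact (2 * m) / ((2 / \<sigma>\<^sup>2) ^ m * fact m) / \<epsilon> ^ (2 * m))"
    using b by (rule has_bochner_integral_divide_zero)
  have "(\<integral>\<^sup>+\<omega>. ennreal ((Y \<omega> / \<epsilon>) ^ (2 * m)) \<partial>M)
      = (\<integral>\<^sup>+y. ennreal (normal_density 0 \<sigma> y) * ennreal ((y / \<epsilon>) ^ (2 * m)) \<partial>lborel)"
    using d by (intro distributed_nn_integral[symmetric]) auto
  also have "\<dots> = (\<integral>\<^sup>+y. ennreal (normal_density 0 \<sigma> y * y ^ (2 * m) / \<epsilon> ^ (2 * m)) \<partial>lborel)"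
    by (intro nn_integral_cong) (simp add: ennreal_mult''[symmetric] power_divide power_mult)
  also have "\<dots> = ennreal (fact (2 * m) / ((2 / \<sigma>\<^sup>2) ^ m * fact m) / \<epsilon> ^ (2 * m))"
  proof (subst nn_integral_eq_integral)
    show "integrable lborel (\<lambda>y. normal_density 0 \<sigma> y * y ^ (2 * m) / \<epsilon> ^ (2 * m))"
      using b' by (simp add: has_bochner_integral_iff)
    show "AE y in lborel. 0 \<le> normal_density 0 \<sigma> y * y ^ (2 * m) / \<epsilon> ^ (2 * m)"
      by (intro AE_I2) (simp add: power_mult)
  qed (use b' in \<open>simp add: has_bochner_integral_iff\<close>)
  finally show ?thesis .
qed

lemma heis_BM_D:
  assumes "heis_BM \<epsilon> M B X"
  shows "standard_BM M B" "\<And>t. t \<in> {0..1} \<Longrightarrow> X t \<in> borel_measurable M"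
    "\<And>\<omega>. \<omega> \<in> space M \<Longrightarrow> X 0 \<omega> = 0 \<and> continuous_on {0..1} (\<lambda>t. X t \<omega>)"
    "\<And>t \<omega>. t \<in> {0..1} \<Longrightarrow> \<omega> \<in> space M \<Longrightarrow> X t \<omega> $ 1 = B t \<omega> $ 1 \<and> X t \<omega> $ 2 = B t \<omega> $ 2"
proof -
  note D = assms[unfolded heis_BM_def]
  note D2 = D[THEN conjunct2] and D3 = D[THEN conjunct2, THEN conjunct2]
  note D4 = D3[THEN conjunct2]
  show "standard_BM M B" by (rule D[THEN conjunct1])
  show "X t \<in> borel_measurable M" if "t \<in> {0..1}" for t
    by (rule D2[THEN conjunct1, rule_format, OF that])
  show "X 0 \<omega> = 0 \<and> continuous_on {0..1} (\<lambda>t. X t \<omega>)" if "\<omega> \<in> space M" for \<omega>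
    by (rule D3[THEN conjunct1, rule_format, OF that])
  show "X t \<omega> $ 1 = B t \<omega> $ 1 \<and> X t \<omega> $ 2 = B t \<omega> $ 2" if "t \<in> {0..1}" "\<omega> \<in> space M" for t \<omega>
    by (rule D4[THEN conjunct1, rule_format, OF that])
qed

text \<open>Tonelli's theorem. The time \<open>1\<close>, where the increment degenerates, is a null set.\<close>

lemma heis_weight_mean:
  assumes BM: "heis_BM \<epsilon> M B X"
  shows "(\<integral>\<^sup>+x. heis_weight m \<epsilon> x \<partial>path_law M X) = heis_const m \<epsilon>"
proof -
  note Xm = heis_BM_D(2)[OF BM] and Xc = heis_BM_D(3)[OF BM] and XB = heis_BM_D(4)[OF BM]
  note M = standard_BM_D(1)[OF heis_BM_D(1)[OF BM]] and norm = standard_BM_D(4)[OF heis_BM_D(1)[OF BM]]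
  interpret M: prob_space M by (rule M)
  have law: "prob_space (path_law M X)" "sets (path_law M X) = sets (borel_of path_space)"
    "space (path_law M X) = topspace path_space"
    by (rule path_law_prob[OF M Xm Xc]; assumption)+
  interpret \<eta>: prob_space "path_law M X" by (rule law)
  interpret pair_sigma_finite "path_law M X" lborel ..
  have meas: "(\<lambda>(x, t). ennreal (heis_density m \<epsilon> x t) * indicator {0..1} t) \<in> borel_measurable (path_law M X \<Otimes>\<^sub>M lborel)"
    using heis_density_measurable[of m \<epsilon>]
    unfolding case_prod_unfold measurable_cong_sets[OF sets_pair_measure_cong[OF law(2) sets_lborel] refl] .
  have inner: "(\<integral>\<^sup>+x. ennreal (heis_density m \<epsilon> x t) * indicator {0..1} t \<partial>path_law M X)
      = ennreal (9 ^ m) * (1 + 2 * ennreal (heis_moment m \<epsilon> t)) * indicator {0..1} t" if t: "t \<noteq> 1" for t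
  proof (cases "t \<in> {0..1}")
    case True
    then have t01: "0 \<le> t" "t < 1" using t by auto
    have [measurable]: "(\<lambda>x. x t $ i) \<in> borel_measurable (path_law M X)"
        "(\<lambda>x. x 1 $ i) \<in> borel_measurable (path_law M X)" for i
      unfolding measurable_cong_sets[OF law(2) refl]
      using measurable_compose[OF measurable_path_eval[OF True] measurable_vec_nth]
        measurable_compose[OF measurable_path_eval[of 1] measurable_vec_nth] by simp_all
    have mom: "(\<integral>\<^sup>+x. ennreal (((x 1 $ i - x t $ i) / \<epsilon>) ^ (2 * m)) \<partial>path_law M X) = ennreal (heis_moment m \<epsilon> t)"
      if i: "i = 1 \<or> i = 2" for i
    proof -
      have "(\<integral>\<^sup>+x. ennreal (((x 1 $ i - x t $ i) / \<epsilon>) ^ (2 * m)) \<partial>path_law M X)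
          = (\<integral>\<^sup>+\<omega>. ennreal (((X 1 \<omega> $ i - X t \<omega> $ i) / \<epsilon>) ^ (2 * m)) \<partial>M)"
      proof -
        have "(\<lambda>x. ennreal (((x 1 $ i - x t $ i) / \<epsilon>) ^ (2 * m))) \<in> borel_measurable (path_law M X)"
          by measurable
        then have "(\<lambda>x. ennreal (((x 1 $ i - x t $ i) / \<epsilon>) ^ (2 * m))) \<in> borel_measurable (borel_of path_space)"
          unfolding measurable_cong_sets[OF law(2) refl] .
        then show ?thesis
          unfolding path_law_def using True
          by (subst nn_integral_distr[OF path_law_measurable]) (use Xm Xc in auto)
      qed
      also have "\<dots> = (\<integral>\<^sup>+\<omega>. ennreal (((B 1 \<omega> $ i - B t \<omega> $ i) / \<epsilon>) ^ (2 * m)) \<partial>M)"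
        using XB[of 1] XB[OF True] i by (intro nn_integral_cong) auto
      also have "\<dots> = ennreal (heis_moment m \<epsilon> t)"
        unfolding heis_moment_def using norm[of t 1 i] t01
        by (intro normal_moment_nn_integral) auto
      finally show ?thesis .
    qed
    have "(\<integral>\<^sup>+x. ennreal (heis_density m \<epsilon> x t) \<partial>path_law M X)
        = (\<integral>\<^sup>+x. ennreal (9 ^ m) * (1 + (ennreal (((x 1 $ 1 - x t $ 1) / \<epsilon>) ^ (2 * m))
            + ennreal (((x 1 $ 2 - x t $ 2) / \<epsilon>) ^ (2 * m)))) \<partial>path_law M X)"
    proof (rule nn_integral_cong)
      fix x :: "real \<Rightarrow> real ^ 3"
      have nn: "0 \<le> ((x 1 $ i - x t $ i) / \<epsilon>) ^ (2 * m)" for i by (simp add: power_mult)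
      show "ennreal (heis_density m \<epsilon> x t) = ennreal (9 ^ m) * (1 + (ennreal (((x 1 $ 1 - x t $ 1) / \<epsilon>) ^ (2 * m))
            + ennreal (((x 1 $ 2 - x t $ 2) / \<epsilon>) ^ (2 * m))))"
        unfolding heis_density_def using nn[of 1] nn[of 2]
        by (simp add: ennreal_mult ennreal_plus ennreal_1[symmetric] add.assoc del: ennreal_1)
    qed
    also have "\<dots> = ennreal (9 ^ m) * (1 + (ennreal (heis_moment m \<epsilon> t) + ennreal (heis_moment m \<epsilon> t)))"
      by (simp add: nn_integral_cmult nn_integral_add mom \<eta>.emeasure_space_1)
    also have "\<dots> = ennreal (9 ^ m) * (1 + 2 * ennreal (heis_moment m \<epsilon> t))"
      by (simp add: mult_2)
    finally show ?thesis using True by simp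
  qed simp
  have "(\<integral>\<^sup>+x. heis_weight m \<epsilon> x \<partial>path_law M X)
      = (\<integral>\<^sup>+t. (\<integral>\<^sup>+x. ennreal (heis_density m \<epsilon> x t) * indicator {0..1} t \<partial>path_law M X) \<partial>lborel)"
    unfolding heis_weight_def by (rule Fubini'[OF meas, symmetric])
  also have "\<dots> = heis_const m \<epsilon>"
    unfolding heis_const_def
  proof (rule nn_integral_cong_AE)
    show "AE t in lborel. (\<integral>\<^sup>+x. ennreal (heis_density m \<epsilon> x t) * indicator {0..1} t \<partial>path_law M X)
        = ennreal (9 ^ m) * (1 + 2 * ennreal (heis_moment m \<epsilon> t)) * indicator {0..1} t"
      using AE_lborel_singleton[of 1] by eventually_elim (rule inner)
  qed
  finally show ?thesis .
qed

lemma heis_const_bounds: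
  assumes \<epsilon>: "0 < \<epsilon>"
  shows "1 \<le> heis_const m \<epsilon>" "heis_const m \<epsilon> < \<top>"
proof -
  have "(1 :: ennreal) = (\<integral>\<^sup>+ t\<in>{0..1::real}. 1 \<partial>lborel)" by simp
  also have "\<dots> \<le> heis_const m \<epsilon>"
    unfolding heis_const_def
  proof (intro nn_integral_mono mult_right_mono)
    fix t :: real
    have "(1 :: ennreal) * 1 \<le> ennreal (9 ^ m) * (1 + 2 * ennreal (heis_moment m \<epsilon> t))"
      by (intro mult_mono) (auto simp: ennreal_1[symmetric] ennreal_le_iff2 simp del: ennreal_1)
    then show "(1 :: ennreal) \<le> ennreal (9 ^ m) * (1 + 2 * ennreal (heis_moment m \<epsilon> t))" by simp
  qed simp
  finally show "1 \<le> heis_const m \<epsilon>" .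
  have mom: "heis_moment m \<epsilon> t \<le> fact (2 * m) / \<epsilon> ^ (2 * m)" if t: "t \<in> {0..1}" for t
  proof (cases "t = 1")
    case True
    then show ?thesis
      using \<epsilon> by (cases "m = 0") (auto simp: heis_moment_def power_0_left)
  next
    case False
    then have s: "0 < 1 - t" "1 - t \<le> 1" using t by auto
    have "1 \<le> 2 / (1 - t)" using s by (simp add: le_divide_eq)
    then have "1 \<le> (2 / (1 - t)) ^ m" by (rule one_le_power)
    then have "1 * 1 \<le> (2 / (1 - t)) ^ m * (fact m :: real)" by (intro mult_mono) auto
    then have "fact (2 * m) / ((2 / (1 - t)) ^ m * fact m) \<le> (fact (2 * m) / 1 :: real)"
      by (intro divide_left_mono) auto
    then show ?thesis
      unfolding heis_moment_def using s \<epsilon> by (intro divide_right_mono) auto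
  qed
  have "heis_const m \<epsilon> \<le> (\<integral>\<^sup>+ t\<in>{0..1::real}. ennreal (9 ^ m) * (1 + 2 * ennreal (fact (2 * m) / \<epsilon> ^ (2 * m))) \<partial>lborel)"
    unfolding heis_const_def
  proof (rule nn_integral_mono)
    fix t :: real
    show "ennreal (9 ^ m) * (1 + 2 * ennreal (heis_moment m \<epsilon> t)) * indicator {0..1} t
        \<le> ennreal (9 ^ m) * (1 + 2 * ennreal (fact (2 * m) / \<epsilon> ^ (2 * m))) * indicator {0..1} t"
      by (cases "t \<in> {0..1}") (auto intro!: mult_left_mono add_left_mono ennreal_leI mom)
  qed
  also have "\<dots> = ennreal (9 ^ m) * (1 + 2 * ennreal (fact (2 * m) / \<epsilon> ^ (2 * m)))"
    by (subst nn_integral_cmult_indicator) auto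
  also have "\<dots> < \<top>" by (simp add: ennreal_mult_less_top)
  finally show "heis_const m \<epsilon> < \<top>" .
qed

text \<open>The constant is a function of \<open>\<epsilon>\<close> and \<open>p\<close> because the mean of the weight is the same for all Brownian motions.\<close>

theorem heis_contraction_gives:
  assumes \<epsilon>: "0 < \<epsilon>" and p: "1 \<le> p" "p < 2"
  shows "\<exists>\<kappa>>0. \<forall>(M :: 'w measure) B X. heis_BM \<epsilon> M B X \<longrightarrow>
    contraction_gives path_space (shift_cost (heis_shift \<epsilon>)) euclidean (d_heis \<epsilon>) (path_law M X) time1 p \<kappa>"
proof -
  define q where "q = 2 * p / (2 - p)"
  have q: "0 < q" using p by (simp add: q_def)
  have ce: "contraction_exponent p = ennreal q"
    using p by (simp add: contraction_exponent_def q_def divide_ennreal)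
  \<comment> \<open>\<open>m > 1\<close> is required for Hoelder's inequality with the exponents \<open>m\<close> and \<open>m / (m - 1)\<close> in time\<close>
  define m where "m = max 2 (nat \<lceil>q\<rceil>)"
  have m: "2 \<le> m" "q \<le> 2 * real m"
  proof -
    show "2 \<le> m" by (simp add: m_def)
    have "q \<le> real (nat \<lceil>q\<rceil>)" by (rule real_nat_ceiling_ge)
    also have "\<dots> \<le> real m" by (simp add: m_def)
    finally show "q \<le> 2 * real m" by simp
  qed
  define N where "N = epowr (heis_const m \<epsilon>) (1 / q)"
  have "N \<noteq> 0" "N \<noteq> \<top>"
    unfolding N_def using heis_const_bounds[OF \<epsilon>, of m] by auto
  then obtain n where n: "N = ennreal n" "0 < n"
    by (cases N) (auto simp: less_le)
  show ?thesis
  proof (intro exI[of _ "1 / n\<^sup>2"] conjI allI impI)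
    show "0 < 1 / n\<^sup>2" using n by simp
    fix M :: "'w measure" and B X assume BM: "heis_BM \<epsilon> M B X"
    have law: "prob_space (path_law M X)" "sets (path_law M X) = sets (borel_of path_space)"
      "space (path_law M X) = topspace path_space"
      by (rule path_law_prob[OF standard_BM_D(1)[OF heis_BM_D(1)[OF BM]] heis_BM_D(2,3)[OF BM]]; assumption)+
    interpret \<eta>: prob_space "path_law M X" by (rule law)
    define L where "L x = epowr (heis_weight m \<epsilon> x) (1 / q)" for x
    have L_meas: "L \<in> borel_measurable (path_law M X)"
      unfolding measurable_cong_sets[OF law(2) refl] L_def[abs_def]
      by (intro measurable_epowr heis_weight_measurable)
    have "Lq_norm (path_law M X) (contraction_exponent p) L
        = epowr (\<integral>\<^sup>+x. heis_weight m \<epsilon> x \<partial>path_law M X) (1 / q)"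
      unfolding ce Lq_norm_def L_def using q by (simp add: epowr_epowr)
    then have norm: "Lq_norm (path_law M X) (contraction_exponent p) L = ennreal n"
      by (simp add: heis_weight_mean[OF BM] N_def[symmetric] n)
    have "d_heis \<epsilon> (time1 x) (time1 y) \<le> L x * shift_cost (heis_shift \<epsilon>) x y"
      if "x \<in> space (path_law M X)" for x y
      unfolding time1_def L_def using that law(3) by (intro heis_weight_bound[OF \<epsilon> m(1) q m(2)]) simp
    then have "contraction_weight (shift_cost (heis_shift \<epsilon>)) (d_heis \<epsilon>) (path_law M X) time1 p L"
      unfolding contraction_weight_def norm
      by (intro conjI bexI[of _ "space (path_law M X)"] L_meas) (auto simp: \<eta>.emeasure_space_1)
    moreover have "ennreal (1 / n\<^sup>2) = inverse ((Lq_norm (path_law M X) (contraction_exponent p) L)\<^sup>2)"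
      using n by (simp add: norm ennreal_power inverse_ennreal inverse_eq_divide)
    moreover have "contraction_setting path_space (shift_cost (heis_shift \<epsilon>)) euclidean (d_heis \<epsilon>) (path_law M X) time1"
      by (intro contraction_setting_time1 law measurable_heis_shift_cost measurable_d_heis \<epsilon>)
    ultimately show "contraction_gives path_space (shift_cost (heis_shift \<epsilon>)) euclidean (d_heis \<epsilon>) (path_law M X) time1 p (1 / n\<^sup>2)"
      unfolding contraction_gives_def using n by (intro conjI exI[of _ L]) auto
  qed
qed

section \<open>Shifts of Brownian motion along straight lines\<close>

text \<open>Completing the square in the exponent.\<close>

lemma normal_shift:
  fixes f :: "real \<Rightarrow> ennreal"
  assumes d: "distributed M lborel Y (normal_density 0 \<sigma>)" and \<sigma>: "0 < \<sigma>"
    and [measurable]: "f \<in> borel_measurable borel"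
  shows "(\<integral>\<^sup>+\<omega>. f (Y \<omega> + \<sigma>\<^sup>2 * a) \<partial>M) = (\<integral>\<^sup>+\<omega>. f (Y \<omega>) * ennreal (exp (a * Y \<omega> - a\<^sup>2 * \<sigma>\<^sup>2 / 2)) \<partial>M)"
proof -
  define F where "F y = ennreal (normal_density 0 \<sigma> y) * (f y * ennreal (exp (a * y - a\<^sup>2 * \<sigma>\<^sup>2 / 2)))" for y
  have [measurable]: "F \<in> borel_measurable borel" unfolding F_def[abs_def] by measurable
  have "normal_density 0 \<sigma> (\<sigma>\<^sup>2 * a + 1 * y) * exp (a * (\<sigma>\<^sup>2 * a + 1 * y) - a\<^sup>2 * \<sigma>\<^sup>2 / 2) = normal_density 0 \<sigma> y" for y
  proof -
    have "- (\<sigma>\<^sup>2 * a + 1 * y - 0)\<^sup>2 / (2 * \<sigma>\<^sup>2) + (a * (\<sigma>\<^sup>2 * a + 1 * y) - a\<^sup>2 * \<sigma>\<^sup>2 / 2) = - (y - 0)\<^sup>2 / (2 * \<sigma>\<^sup>2)"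
      using \<sigma> by (simp add: field_simps power2_eq_square)
    then show ?thesis by (simp add: normal_density_def mult.assoc flip: exp_add)
  qed
  then have F_shift: "F (\<sigma>\<^sup>2 * a + 1 * y) = ennreal (normal_density 0 \<sigma> y) * f (y + \<sigma>\<^sup>2 * a)" for y
    unfolding F_def by (simp add: mult.left_commute[of "ennreal _" "f _"] add.commute flip: ennreal_mult') (simp add: mult.commute)
  have "(\<integral>\<^sup>+\<omega>. f (Y \<omega> + \<sigma>\<^sup>2 * a) \<partial>M) = (\<integral>\<^sup>+y. ennreal (normal_density 0 \<sigma> y) * f (y + \<sigma>\<^sup>2 * a) \<partial>lborel)"
    using distributed_nn_integral[OF d, of "\<lambda>y. f (y + \<sigma>\<^sup>2 * a)"] by simp
  also have "\<dots> = (\<integral>\<^sup>+y. F y \<partial>lborel)"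
    using nn_integral_real_affine[of F 1 "\<sigma>\<^sup>2 * a"] unfolding F_shift by simp
  also have "\<dots> = (\<integral>\<^sup>+\<omega>. f (Y \<omega>) * ennreal (exp (a * Y \<omega> - a\<^sup>2 * \<sigma>\<^sup>2 / 2)) \<partial>M)"
    unfolding F_def by (rule distributed_nn_integral[OF d]) measurable
  finally show ?thesis .
qed

text \<open>Under the measure with this density, \<open>B\<close> has the law that \<open>\<lambda>t \<omega>. B t \<omega> + t *\<^sub>R v\<close> has under the original one.\<close>

definition girsanov :: "(real \<Rightarrow> 'w \<Rightarrow> real ^ 'm) \<Rightarrow> real ^ 'm \<Rightarrow> 'w \<Rightarrow> real" where
  "girsanov B v \<omega> = exp (v \<bullet> B 1 \<omega> - (norm v)\<^sup>2 / 2)"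

definition dyadic_increment :: "(real \<Rightarrow> 'w \<Rightarrow> real ^ 'm) \<Rightarrow> nat \<Rightarrow> nat \<times> 'm \<Rightarrow> 'w \<Rightarrow> real" where
  "dyadic_increment B n = (\<lambda>(k, i) \<omega>. B (real (Suc k) / 2 ^ n) \<omega> $ i - B (real k / 2 ^ n) \<omega> $ i)"

text \<open>The increments over the dyadic intervals are independent and each of them is shifted by a constant, so the
  densities of \<open>normal_shift\<close> multiply. In the product the increments telescope to \<open>B 1\<close>, hence the
  density does not depend on \<open>n\<close>.\<close>

lemma increments_shift:
  fixes B :: "real \<Rightarrow> 'w \<Rightarrow> real ^ 'm" and n :: nat
  assumes BM: "standard_BM M B"
  defines "I \<equiv> {..<2 ^ n :: nat} \<times> (UNIV :: 'm set)"
  shows "distr M (PiM I (\<lambda>_. borel)) (\<lambda>\<omega>. \<lambda>p\<in>I. dyadic_increment B n p \<omega> + v $ snd p / 2 ^ n)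
    = distr (density M (\<lambda>\<omega>. ennreal (girsanov B v \<omega>))) (PiM I (\<lambda>_. borel)) (\<lambda>\<omega>. \<lambda>p\<in>I. dyadic_increment B n p \<omega>)"
proof -
  note BMD = standard_BM_D[OF BM]
  interpret prob_space M by (rule BMD(1))
  let ?\<xi> = "dyadic_increment B n" and ?c = "\<lambda>p :: nat \<times> 'm. v $ snd p / 2 ^ n"
  have fin: "finite I" by (simp add: I_def)
  have dy: "real k / 2 ^ n \<in> {0..1}" "real (Suc k) / 2 ^ n \<in> {0..1}" "real k / 2 ^ n < real (Suc k) / 2 ^ n" if "k < 2 ^ n" for k
    using that by (intro dyadic_point divide_strict_right_mono; simp)+
  have indep: "indep_vars (\<lambda>_. borel) ?\<xi> I"
    unfolding I_def dyadic_increment_def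
    by (rule BMD(5)[of "\<lambda>k. real k / 2 ^ n" "2 ^ n"]) (use dy in auto)
  have B1[measurable]: "B 1 \<in> borel_measurable M" by (rule BMD(2)) simp
  have G_meas[measurable]: "girsanov B v \<in> borel_measurable M"
    unfolding girsanov_def[abs_def] by measurable
  have \<xi>_dist: "distributed M lborel (?\<xi> p) (normal_density 0 (sqrt (1 / 2 ^ n)))" if p: "p \<in> I" for p
  proof -
    obtain k i where ki: "p = (k, i)" "k < 2 ^ n" using p by (auto simp: I_def)
    have "real (Suc k) / 2 ^ n - real k / 2 ^ n = 1 / 2 ^ n" by (simp add: add_divide_distrib)
    then show ?thesis
      using BMD(4)[of "real k / 2 ^ n" "real (Suc k) / 2 ^ n" i] dy[OF ki(2)]
      by (simp add: ki dyadic_increment_def)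
  qed
  have \<xi>_meas[measurable]: "?\<xi> p \<in> borel_measurable M" if "p \<in> I" for p
    using distributed_measurable[OF \<xi>_dist[OF that]] by simp
  define e where "e p x = exp (v $ snd p * x - (v $ snd p)\<^sup>2 * (1 / 2 ^ n) / 2)" for p :: "nat \<times> 'm" and x :: real
  have G_prod: "girsanov B v \<omega> = (\<Prod>p\<in>I. e p (?\<xi> p \<omega>))" if \<omega>: "\<omega> \<in> space M" for \<omega>
  proof -
    have "(\<Sum>p\<in>I. v $ snd p * ?\<xi> p \<omega>) = (\<Sum>i\<in>UNIV. v $ i * (\<Sum>k<2 ^ n. B (real (Suc k) / 2 ^ n) \<omega> $ i - B (real k / 2 ^ n) \<omega> $ i))"
      unfolding I_def sum.cartesian_product' dyadic_increment_def
      by (subst sum.swap) (simp add: sum_distrib_left)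
    also have "\<dots> = (\<Sum>i\<in>UNIV. v $ i * B 1 \<omega> $ i)"
    proof (rule sum.cong[OF refl])
      fix i
      have "(\<Sum>k<2 ^ n. B (real (Suc k) / 2 ^ n) \<omega> $ i - B (real k / 2 ^ n) \<omega> $ i) = B 1 \<omega> $ i"
        using sum_lessThan_telescope[of "\<lambda>k. B (real k / 2 ^ n) \<omega> $ i" "2 ^ n"] BMD(3)[OF \<omega>] by simp
      then show "v $ i * (\<Sum>k<2 ^ n. B (real (Suc k) / 2 ^ n) \<omega> $ i - B (real k / 2 ^ n) \<omega> $ i) = v $ i * B 1 \<omega> $ i"
        by simp
    qed
    also have "\<dots> = v \<bullet> B 1 \<omega>" by (simp add: inner_vec_def)
    finally have 1: "(\<Sum>p\<in>I. v $ snd p * ?\<xi> p \<omega>) = v \<bullet> B 1 \<omega>" .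
    have "(\<Sum>p\<in>I. (v $ snd p)\<^sup>2 * (1 / 2 ^ n) / 2) = (\<Sum>k<2 ^ n :: nat. \<Sum>i\<in>UNIV. (v $ i)\<^sup>2 * (1 / 2 ^ n) / 2)"
      unfolding I_def sum.cartesian_product' by simp
    also have "\<dots> = (\<Sum>i\<in>UNIV. (v $ i)\<^sup>2) / 2"
      by (simp add: sum_divide_distrib[symmetric] sum_distrib_right[symmetric])
    also have "(\<Sum>i\<in>UNIV. (v $ i)\<^sup>2) = (norm v)\<^sup>2"
      unfolding power2_norm_eq_inner inner_vec_def by (simp add: power2_eq_square)
    finally have 2: "(\<Sum>p\<in>I. (v $ snd p)\<^sup>2 * (1 / 2 ^ n) / 2) = (norm v)\<^sup>2 / 2" .
    have "(\<Prod>p\<in>I. e p (?\<xi> p \<omega>)) = exp (\<Sum>p\<in>I. v $ snd p * ?\<xi> p \<omega> - (v $ snd p)\<^sup>2 * (1 / 2 ^ n) / 2)"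
      unfolding e_def by (rule exp_sum[OF fin, symmetric])
    also have "\<dots> = girsanov B v \<omega>"
      unfolding sum_subtractf 1 2 girsanov_def ..
    finally show ?thesis ..
  qed
  let ?X = "\<lambda>\<omega>. \<lambda>p\<in>I. ?\<xi> p \<omega> + ?c p" and ?Y = "\<lambda>\<omega>. \<lambda>p\<in>I. ?\<xi> p \<omega>"
  have X[measurable]: "?X \<in> M \<rightarrow>\<^sub>M PiM I (\<lambda>_. borel)" by (intro measurable_restrict) measurable
  have Y[measurable]: "?Y \<in> M \<rightarrow>\<^sub>M PiM I (\<lambda>_. borel)" by (intro measurable_restrict) measurable
  show ?thesis
  proof (rule measure_eqI_PiM_finite[OF fin, where A="\<lambda>_. \<Pi>\<^sub>E p\<in>I. UNIV"])
    show "range (\<lambda>_ :: nat. \<Pi>\<^sub>E p\<in>I. UNIV) \<subseteq> prod_algebra I (\<lambda>_. borel :: real measure)"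
      using prod_algebraI_finite[OF fin, of "\<lambda>_. UNIV" "\<lambda>_. borel :: real measure"] by auto
    show "(\<Union>i :: nat. \<Pi>\<^sub>E p\<in>I. UNIV) = space (PiM I (\<lambda>_. borel :: real measure))"
      by (simp add: space_PiM)
    show "emeasure (distr M (PiM I (\<lambda>_. borel)) ?X) (\<Pi>\<^sub>E p\<in>I. UNIV) \<noteq> \<infinity>" for i :: nat
      using finite_measure.emeasure_finite[OF prob_space.finite_measure[OF prob_space_distr[OF X]]] by simp
    fix A :: "nat \<times> 'm \<Rightarrow> real set" assume A: "\<And>p. p \<in> I \<Longrightarrow> A p \<in> sets borel"
    have A'[measurable]: "Pi\<^sub>E I A \<in> sets (PiM I (\<lambda>_. borel))"
      using A fin by (intro sets_PiM_I_finite) auto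
    have ind: "(indicator (A p) :: real \<Rightarrow> ennreal) \<in> borel_measurable borel" if "p \<in> I" for p
      using A[OF that] by simp
    have "emeasure (distr M (PiM I (\<lambda>_. borel)) ?X) (Pi\<^sub>E I A) = (\<integral>\<^sup>+y. indicator (Pi\<^sub>E I A) y \<partial>distr M (PiM I (\<lambda>_. borel)) ?X)"
      by simp
    also have "\<dots> = (\<integral>\<^sup>+\<omega>. indicator (Pi\<^sub>E I A) (?X \<omega>) \<partial>M)"
      by (rule nn_integral_distr[OF X]) measurable
    also have "\<dots> = (\<integral>\<^sup>+\<omega>. (\<Prod>p\<in>I. indicator (A p) (?\<xi> p \<omega> + ?c p)) \<partial>M)"
    proof (rule nn_integral_cong)
      fix \<omega>
      show "indicator (Pi\<^sub>E I A) (?X \<omega>) = (\<Prod>p\<in>I. indicator (A p) (?\<xi> p \<omega> + ?c p) :: ennreal)"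
        using fin by (auto simp: indicator_def PiE_iff prod.neutral intro!: prod_zero)
    qed
    also have "\<dots> = (\<Prod>p\<in>I. \<integral>\<^sup>+\<omega>. indicator (A p) (?\<xi> p \<omega> + ?c p) \<partial>M)"
    proof (rule indep_vars_nn_integral[OF fin])
      show "indep_vars (\<lambda>_. borel) (\<lambda>p \<omega>. indicator (A p) (?\<xi> p \<omega> + ?c p) :: ennreal) I"
        using indep_vars_compose2[OF indep, of "\<lambda>p x. indicator (A p) (x + ?c p) :: ennreal" "\<lambda>_. borel"] ind
        by (simp add: measurable_compose[of "\<lambda>x. x + _"])
    qed simp
    also have "\<dots> = (\<Prod>p\<in>I. \<integral>\<^sup>+\<omega>. indicator (A p) (?\<xi> p \<omega>) * ennreal (e p (?\<xi> p \<omega>)) \<partial>M)"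
    proof (rule prod.cong[OF refl])
      fix p assume p: "p \<in> I"
      show "(\<integral>\<^sup>+\<omega>. indicator (A p) (?\<xi> p \<omega> + ?c p) \<partial>M) = (\<integral>\<^sup>+\<omega>. indicator (A p) (?\<xi> p \<omega>) * ennreal (e p (?\<xi> p \<omega>)) \<partial>M)"
        using normal_shift[OF \<xi>_dist[OF p] _ ind[OF p], of "v $ snd p"] by (simp add: e_def)
    qed
    also have "\<dots> = (\<integral>\<^sup>+\<omega>. (\<Prod>p\<in>I. indicator (A p) (?\<xi> p \<omega>) * ennreal (e p (?\<xi> p \<omega>))) \<partial>M)"
    proof (rule indep_vars_nn_integral[OF fin, symmetric])
      have "(\<lambda>x. indicator (A p) x * ennreal (e p x)) \<in> borel_measurable borel" if "p \<in> I" for p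
        using ind[OF that] unfolding e_def by measurable
      then show "indep_vars (\<lambda>_. borel) (\<lambda>p \<omega>. indicator (A p) (?\<xi> p \<omega>) * ennreal (e p (?\<xi> p \<omega>))) I"
        using indep_vars_compose2[OF indep, of "\<lambda>p x. indicator (A p) x * ennreal (e p x)" "\<lambda>_. borel"] by simp
    qed simp
    also have "\<dots> = (\<integral>\<^sup>+\<omega>. ennreal (girsanov B v \<omega>) * indicator (Pi\<^sub>E I A) (?Y \<omega>) \<partial>M)"
    proof (rule nn_integral_cong)
      fix \<omega> assume "\<omega> \<in> space M"
      have "indicator (Pi\<^sub>E I A) (?Y \<omega>) = (\<Prod>p\<in>I. indicator (A p) (?\<xi> p \<omega>) :: ennreal)"
        using fin by (auto simp: indicator_def PiE_iff prod.neutral intro!: prod_zero)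
      moreover have "ennreal (girsanov B v \<omega>) = (\<Prod>p\<in>I. ennreal (e p (?\<xi> p \<omega>)))"
        unfolding G_prod[OF \<open>\<omega> \<in> space M\<close>] by (rule prod_ennreal[symmetric]) (simp add: e_def)
      ultimately show "(\<Prod>p\<in>I. indicator (A p) (?\<xi> p \<omega>) * ennreal (e p (?\<xi> p \<omega>)))
          = ennreal (girsanov B v \<omega>) * indicator (Pi\<^sub>E I A) (?Y \<omega>)"
        by (simp add: prod.distrib mult.commute)
    qed
    also have "\<dots> = (\<integral>\<^sup>+\<omega>. indicator (Pi\<^sub>E I A) (?Y \<omega>) \<partial>density M (\<lambda>\<omega>. ennreal (girsanov B v \<omega>)))"
      by (subst nn_integral_density) measurable
    also have "\<dots> = (\<integral>\<^sup>+y. indicator (Pi\<^sub>E I A) y \<partial>distr (density M (\<lambda>\<omega>. ennreal (girsanov B v \<omega>))) (PiM I (\<lambda>_. borel)) ?Y)"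
    proof (rule nn_integral_distr[symmetric])
      show "?Y \<in> density M (\<lambda>\<omega>. ennreal (girsanov B v \<omega>)) \<rightarrow>\<^sub>M PiM I (\<lambda>_. borel)"
        using Y by simp
    qed measurable
    also have "\<dots> = emeasure (distr (density M (\<lambda>\<omega>. ennreal (girsanov B v \<omega>))) (PiM I (\<lambda>_. borel)) ?Y) (Pi\<^sub>E I A)"
      by simp
    finally show "emeasure (distr M (PiM I (\<lambda>_. borel)) ?X) (Pi\<^sub>E I A)
      = emeasure (distr (density M (\<lambda>\<omega>. ennreal (girsanov B v \<omega>))) (PiM I (\<lambda>_. borel)) ?Y) (Pi\<^sub>E I A)" .
  qed simp_all
qed

subsection \<open>Quasi-invariance of Brownian motion on the dyadic times\<close>

definition dyadics :: "real set" where
  "dyadics = (\<Union>n. \<Union>k\<in>{..2 ^ n :: nat}. {real k / 2 ^ n})"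

lemma dyadics_iff: "t \<in> dyadics \<longleftrightarrow> (\<exists>n k. k \<le> 2 ^ n \<and> t = real k / 2 ^ n)"
  by (auto simp: dyadics_def)

lemma countable_dyadics: "countable dyadics"
  unfolding dyadics_def by (intro countable_UN) auto

lemma dyadics_unit: "t \<in> dyadics \<Longrightarrow> t \<in> {0..1}"
  using dyadic_point by (auto simp: dyadics_iff)

lemma dyadics_mult:
  assumes "s \<in> dyadics" "t \<in> dyadics"
  shows "s * t \<in> dyadics"
proof -
  obtain n k m l where s: "k \<le> 2 ^ n" "s = real k / 2 ^ n" and t: "l \<le> 2 ^ m" "t = real l / 2 ^ m"
    using assms by (auto simp: dyadics_iff)
  have "k * l \<le> 2 ^ (n + m)" using s t by (simp add: power_add mult_le_mono)
  moreover have "s * t = real (k * l) / 2 ^ (n + m)" using s t by (simp add: power_add)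
  ultimately show ?thesis unfolding dyadics_iff by blast
qed

lemma finite_dyadics_common_level:
  assumes "finite J" "J \<subseteq> dyadics"
  shows "\<exists>n. \<forall>t\<in>J. \<exists>k\<le>2 ^ n. t = real k / 2 ^ n"
  using assms
proof (induction J)
  case (insert t J)
  then obtain n where n: "\<forall>t\<in>J. \<exists>k\<le>2 ^ n. t = real k / 2 ^ n" by auto
  obtain m l where t: "l \<le> 2 ^ m" "t = real l / 2 ^ m" using insert.prems by (auto simp: dyadics_iff)
  have up: "\<exists>k\<le>2 ^ (n' + d). s = real k / 2 ^ (n' + d)" if "k \<le> 2 ^ n'" "s = real k / 2 ^ n'" for s k n' d
    using that by (intro exI[of _ "k * 2 ^ d"]) (simp add: power_add)
  have "\<exists>k\<le>2 ^ (n + m). s = real k / 2 ^ (n + m)" if "s \<in> insert t J" for s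
  proof (cases "s = t")
    case True
    then show ?thesis using up[OF t, of n] by (simp add: add.commute)
  next
    case False
    then show ?thesis using n that up by blast
  qed
  then show ?case by blast
qed auto

text \<open>A cylinder set involves finitely many dyadic times. These are multiples of a common \<open>1 / 2 ^ n\<close>, and the
  values there are partial sums of the increments of level \<open>n\<close>.\<close>

lemma dyadic_law_shift:
  fixes B :: "real \<Rightarrow> 'w \<Rightarrow> real ^ 'm"
  assumes BM: "standard_BM M B"
  shows "distr M (PiM dyadics (\<lambda>_. borel)) (\<lambda>\<omega>. \<lambda>t\<in>dyadics. B t \<omega> + t *\<^sub>R v)
    = distr (density M (\<lambda>\<omega>. ennreal (girsanov B v \<omega>))) (PiM dyadics (\<lambda>_. borel)) (\<lambda>\<omega>. \<lambda>t\<in>dyadics. B t \<omega>)"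
proof -
  note BMD = standard_BM_D[OF BM]
  interpret prob_space M by (rule BMD(1))
  have B_meas[measurable]: "B t \<in> borel_measurable M" if "t \<in> dyadics" for t
    using BMD(2) dyadics_unit[OF that] by blast
  let ?X = "\<lambda>\<omega>. \<lambda>t\<in>dyadics. B t \<omega> + t *\<^sub>R v" and ?Y = "\<lambda>\<omega>. \<lambda>t\<in>dyadics. B t \<omega>"
  have X: "?X \<in> M \<rightarrow>\<^sub>M PiM dyadics (\<lambda>_. borel)" by (intro measurable_restrict) measurable
  have Y: "?Y \<in> M \<rightarrow>\<^sub>M PiM dyadics (\<lambda>_. borel)" by (intro measurable_restrict) measurable
  let ?D = "density M (\<lambda>\<omega>. ennreal (girsanov B v \<omega>))"
  have Y': "?Y \<in> ?D \<rightarrow>\<^sub>M PiM dyadics (\<lambda>_. borel)" using Y by simp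
  show ?thesis
  proof (rule measure_eqI_PiM_infinite)
    show "finite_measure (distr M (PiM dyadics (\<lambda>_. borel)) ?X)"
      by (rule prob_space.finite_measure[OF prob_space_distr[OF X]])
    fix A :: "real \<Rightarrow> (real ^ 'm) set" and J
    assume J: "finite J" "J \<subseteq> dyadics" and A: "\<And>t. t \<in> J \<Longrightarrow> A t \<in> sets borel"
    obtain n where "\<forall>t\<in>J. \<exists>k\<le>2 ^ n. t = real k / 2 ^ n"
      using finite_dyadics_common_level[OF J] by blast
    then obtain k where k: "\<And>t. t \<in> J \<Longrightarrow> k t \<le> 2 ^ n \<and> t = real (k t) / 2 ^ n" by metis
    define I where "I = {..<2 ^ n :: nat} \<times> (UNIV :: 'm set)"
    \<comment> \<open>the value of the path at the \<open>l\<close>-th time of level \<open>n\<close>, as a function of the increments\<close>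
  define cum where "cum l y = (\<Sum>i\<in>UNIV. (\<Sum>k<l. y (k, i)) *\<^sub>R axis i 1 :: real ^ 'm)" for l :: nat and y :: "nat \<times> 'm \<Rightarrow> real"
    have cum_nth: "cum l y $ i = (\<Sum>k<l. y (k, i))" for l y i
      by (simp add: cum_def axis_def if_distrib[of "\<lambda>x. _ * x"] sum.delta cong: if_cong)
    have cum_meas: "cum (k t) \<in> borel_measurable (PiM I (\<lambda>_. borel))" if "t \<in> J" for t
      unfolding cum_def[abs_def]
    proof (intro borel_measurable_sum borel_measurable_scaleR borel_measurable_const)
      fix l i assume "l \<in> {..<k t}"
      then have "(l, i) \<in> I" using k[OF that] by (auto simp: I_def)
      then show "(\<lambda>y. y (l, i)) \<in> borel_measurable (PiM I (\<lambda>_. borel))"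
        by (rule measurable_component_singleton)
    qed
    define C where "C = (\<Inter>t\<in>J. cum (k t) -` A t \<inter> space (PiM I (\<lambda>_. borel))) \<inter> space (PiM I (\<lambda>_. borel))"
    have C: "C \<in> sets (PiM I (\<lambda>_. borel))"
    proof (cases "J = {}")
      case False
      have sets_t: "cum (k t) -` A t \<inter> space (PiM I (\<lambda>_. borel)) \<in> sets (PiM I (\<lambda>_. borel))" if "t \<in> J" for t
        by (rule measurable_sets[OF cum_meas[OF that] A[OF that]])
      show ?thesis
        unfolding C_def by (rule sets.Int[OF sets.finite_INT[OF J(1) False sets_t] sets.top])
    qed (simp add: C_def)
    let ?\<xi> = "\<lambda>\<omega>. \<lambda>p\<in>I. dyadic_increment B n p \<omega>" and ?\<xi>v = "\<lambda>\<omega>. \<lambda>p\<in>I. dyadic_increment B n p \<omega> + v $ snd p / 2 ^ n"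
    have incr_meas: "dyadic_increment B n p \<in> borel_measurable M" if p: "p \<in> I" for p
    proof -
      obtain l i where li: "p = (l, i)" "l < 2 ^ n" using p by (auto simp: I_def)
      have "real l / 2 ^ n \<in> {0..1}" "real (Suc l) / 2 ^ n \<in> {0..1}"
        using li by (intro dyadic_point; simp)+
      from BMD(2)[OF this(1)] BMD(2)[OF this(2)]
      show ?thesis
        unfolding li dyadic_increment_def case_prod_conv
        by (intro borel_measurable_diff measurable_compose[OF _ measurable_vec_nth])
    qed
    have \<xi>: "?\<xi> \<in> M \<rightarrow>\<^sub>M PiM I (\<lambda>_. borel)" by (intro measurable_restrict incr_meas)
    have \<xi>v: "?\<xi>v \<in> M \<rightarrow>\<^sub>M PiM I (\<lambda>_. borel)"
      by (intro measurable_restrict borel_measurable_add incr_meas borel_measurable_const)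
    have cum_incr: "cum (k t) (\<lambda>p\<in>I. dyadic_increment B n p \<omega> + u $ snd p / 2 ^ n) = B t \<omega> + t *\<^sub>R u"
      if t: "t \<in> J" and \<omega>: "\<omega> \<in> space M" for t \<omega> u
    proof -
      have "cum (k t) (\<lambda>p\<in>I. dyadic_increment B n p \<omega> + u $ snd p / 2 ^ n) $ i = (B t \<omega> + t *\<^sub>R u) $ i" for i
      proof -
        have "cum (k t) (\<lambda>p\<in>I. dyadic_increment B n p \<omega> + u $ snd p / 2 ^ n) $ i
            = (\<Sum>l<k t. (B (real (Suc l) / 2 ^ n) \<omega> $ i - B (real l / 2 ^ n) \<omega> $ i) + u $ i / 2 ^ n)"
          unfolding cum_nth using k[OF t] by (intro sum.cong) (auto simp: I_def dyadic_increment_def)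
        also have "\<dots> = (B (real (k t) / 2 ^ n) \<omega> $ i - B 0 \<omega> $ i) + real (k t) * (u $ i / 2 ^ n)"
          using sum_lessThan_telescope[of "\<lambda>l. B (real l / 2 ^ n) \<omega> $ i" "k t"] by (simp add: sum.distrib)
        also have "\<dots> = B t \<omega> $ i + t * u $ i"
        proof -
          have tk: "real (k t) / 2 ^ n = t" using k[OF t] by simp
          have "real (k t) * (u $ i / 2 ^ n) = real (k t) / 2 ^ n * u $ i" by simp
          then show ?thesis unfolding tk using BMD(3)[OF \<omega>] by simp
        qed
        finally show ?thesis by simp
      qed
      then show ?thesis by (simp add: vec_eq_iff)
    qed
    have space_I: "(\<lambda>p\<in>I. f p) \<in> space (PiM I (\<lambda>_. borel :: real measure))" for f
      by (simp add: space_PiM)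
    have setX: "?X -` prod_emb dyadics (\<lambda>_. borel) J (Pi\<^sub>E J A) \<inter> space M = ?\<xi>v -` C \<inter> space M"
    proof (rule set_eqI)
      fix \<omega>
      have "(?X \<omega> \<in> prod_emb dyadics (\<lambda>_. borel) J (Pi\<^sub>E J A)) \<longleftrightarrow> (\<forall>t\<in>J. B t \<omega> + t *\<^sub>R v \<in> A t)"
        using J by (auto simp: prod_emb_def PiE_iff subset_eq)
      moreover have "?\<xi>v \<omega> \<in> C \<longleftrightarrow> (\<forall>t\<in>J. B t \<omega> + t *\<^sub>R v \<in> A t)" if "\<omega> \<in> space M"
        using cum_incr[OF _ that, of _ v] space_I unfolding C_def by auto
      ultimately show "\<omega> \<in> ?X -` prod_emb dyadics (\<lambda>_. borel) J (Pi\<^sub>E J A) \<inter> space M \<longleftrightarrow> \<omega> \<in> ?\<xi>v -` C \<inter> space M"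
        by auto
    qed
    have setY: "?Y -` prod_emb dyadics (\<lambda>_. borel) J (Pi\<^sub>E J A) \<inter> space M = ?\<xi> -` C \<inter> space M"
    proof (rule set_eqI)
      fix \<omega>
      have "(?Y \<omega> \<in> prod_emb dyadics (\<lambda>_. borel) J (Pi\<^sub>E J A)) \<longleftrightarrow> (\<forall>t\<in>J. B t \<omega> \<in> A t)"
        using J by (auto simp: prod_emb_def PiE_iff subset_eq)
      moreover have "?\<xi> \<omega> \<in> C \<longleftrightarrow> (\<forall>t\<in>J. B t \<omega> \<in> A t)" if "\<omega> \<in> space M"
        using cum_incr[OF _ that, of _ 0] space_I unfolding C_def by auto
      ultimately show "\<omega> \<in> ?Y -` prod_emb dyadics (\<lambda>_. borel) J (Pi\<^sub>E J A) \<inter> space M \<longleftrightarrow> \<omega> \<in> ?\<xi> -` C \<inter> space M"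
        by auto
    qed
    have emb: "prod_emb dyadics (\<lambda>_. borel) J (Pi\<^sub>E J A) \<in> sets (PiM dyadics (\<lambda>_. borel))"
      using J A by (intro sets_PiM_I) auto
    have "emeasure (distr M (PiM dyadics (\<lambda>_. borel)) ?X) (prod_emb dyadics (\<lambda>_. borel) J (Pi\<^sub>E J A))
        = emeasure (distr M (PiM I (\<lambda>_. borel)) ?\<xi>v) C"
      by (simp only: emeasure_distr[OF X emb] emeasure_distr[OF \<xi>v C] setX)
    also have "\<dots> = emeasure (distr ?D (PiM I (\<lambda>_. borel)) ?\<xi>) C"
      unfolding I_def by (simp only: increments_shift[OF BM])
    also have "\<dots> = emeasure (distr ?D (PiM dyadics (\<lambda>_. borel)) ?Y) (prod_emb dyadics (\<lambda>_. borel) J (Pi\<^sub>E J A))"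
    proof -
      have \<xi>': "?\<xi> \<in> ?D \<rightarrow>\<^sub>M PiM I (\<lambda>_. borel)" using \<xi> by simp
      show ?thesis
        by (simp only: emeasure_distr[OF Y' emb] emeasure_distr[OF \<xi>' C] space_density setY)
    qed
    finally show "emeasure (distr M (PiM dyadics (\<lambda>_. borel)) ?X) (prod_emb dyadics (\<lambda>_. borel) J (Pi\<^sub>E J A))
        = emeasure (distr ?D (PiM dyadics (\<lambda>_. borel)) ?Y) (prod_emb dyadics (\<lambda>_. borel) J (Pi\<^sub>E J A))" .
  qed simp_all
qed

text \<open>A measure with a density with respect to \<open>M\<close> does not charge the null sets of \<open>M\<close>.\<close>

lemma dyadic_quasi_invariance:
  fixes B :: "real \<Rightarrow> 'w \<Rightarrow> real ^ 'm"
  assumes BM: "standard_BM M B" and S: "S \<in> sets (PiM dyadics (\<lambda>_. borel))"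
    and ae: "AE \<omega> in M. (\<lambda>t\<in>dyadics. B t \<omega>) \<in> S"
  shows "AE \<omega> in M. (\<lambda>t\<in>dyadics. B t \<omega> + t *\<^sub>R v) \<in> S"
proof -
  note BMD = standard_BM_D[OF BM]
  have B_meas[measurable]: "B t \<in> borel_measurable M" if "t \<in> dyadics" for t
    using BMD(2) dyadics_unit[OF that] by blast
  have B1[measurable]: "B 1 \<in> borel_measurable M" by (rule BMD(2)) simp
  have G_meas: "girsanov B v \<in> borel_measurable M"
    unfolding girsanov_def[abs_def] by measurable
  let ?X = "\<lambda>\<omega>. \<lambda>t\<in>dyadics. B t \<omega> + t *\<^sub>R v" and ?Y = "\<lambda>\<omega>. \<lambda>t\<in>dyadics. B t \<omega>"
  have X: "?X \<in> M \<rightarrow>\<^sub>M PiM dyadics (\<lambda>_. borel)" by (intro measurable_restrict) measurable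
  have Y: "?Y \<in> M \<rightarrow>\<^sub>M PiM dyadics (\<lambda>_. borel)" by (intro measurable_restrict) measurable
  let ?D = "density M (\<lambda>\<omega>. ennreal (girsanov B v \<omega>))"
  have "AE \<omega> in ?D. ?Y \<omega> \<in> S"
    using ae G_meas by (subst AE_density) (auto elim: eventually_mono)
  moreover have Y': "?Y \<in> ?D \<rightarrow>\<^sub>M PiM dyadics (\<lambda>_. borel)" using Y by simp
  have "{y \<in> space (PiM dyadics (\<lambda>_. borel)). y \<in> S} \<in> sets (PiM dyadics (\<lambda>_. borel))"
    using S sets.sets_into_space[OF S] by (simp add: Collect_conj_eq Int_absorb1 Collect_mem_eq inf_commute)
  ultimately have "AE y in distr ?D (PiM dyadics (\<lambda>_. borel)) ?Y. y \<in> S"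
    by (subst AE_distr_iff[OF Y']) auto
  then have "AE y in distr M (PiM dyadics (\<lambda>_. borel)) ?X. y \<in> S"
    by (simp only: dyadic_law_shift[OF BM])
  then show ?thesis by (rule AE_distrD[OF X])
qed

section \<open>Paths in a step-2 Carnot group\<close>

text \<open>The Borel--Cantelli lemma; one subsequence serves the finitely many sequences together.\<close>

lemma AE_subsequence_of_tendsto_in_measure:
  fixes f :: "'k::finite \<Rightarrow> nat \<Rightarrow> 'w \<Rightarrow> real"
  assumes M: "prob_space M" and [measurable]: "\<And>k n. f k n \<in> borel_measurable M" "\<And>k. g k \<in> borel_measurable M"
    and conv: "\<And>k e. 0 < e \<Longrightarrow> (\<lambda>n. measure M {\<omega> \<in> space M. e < \<bar>f k n \<omega> - g k \<omega>\<bar>}) \<longlonglongrightarrow> 0"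
  shows "\<exists>r. (\<forall>n. n \<le> r n) \<and> (AE \<omega> in M. \<forall>k. (\<lambda>n. f k (r n) \<omega>) \<longlonglongrightarrow> g k \<omega>)"
proof -
  interpret prob_space M by (rule M)
  have "\<exists>N\<ge>n. \<forall>k. measure M {\<omega> \<in> space M. (1 / 2) ^ n < \<bar>f k N \<omega> - g k \<omega>\<bar>} < (1 / 2) ^ n" for n :: nat
  proof -
    have "\<forall>\<^sub>F N in sequentially. \<forall>k\<in>UNIV. measure M {\<omega> \<in> space M. (1 / 2) ^ n < \<bar>f k N \<omega> - g k \<omega>\<bar>} < (1 / 2) ^ n"
      by (intro eventually_ball_finite ballI order_tendstoD(2)[OF conv]) auto
    then have "\<forall>\<^sub>F N in sequentially. n \<le> N \<and> (\<forall>k. measure M {\<omega> \<in> space M. (1 / 2) ^ n < \<bar>f k N \<omega> - g k \<omega>\<bar>} < (1 / 2) ^ n)"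
      using eventually_ge_at_top[of n] by eventually_elim auto
    then show ?thesis by (auto dest: eventually_happens)
  qed
  then have "\<exists>r. \<forall>n. n \<le> r n \<and> (\<forall>k. measure M {\<omega> \<in> space M. (1 / 2) ^ n < \<bar>f k (r n) \<omega> - g k \<omega>\<bar>} < (1 / 2) ^ n)"
    by (intro choice allI)
  then obtain r where R: "\<forall>n. n \<le> r n \<and> (\<forall>k. measure M {\<omega> \<in> space M. (1 / 2) ^ n < \<bar>f k (r n) \<omega> - g k \<omega>\<bar>} < (1 / 2) ^ n)"
    by (rule exE)
  have r: "n \<le> r n" "measure M {\<omega> \<in> space M. (1 / 2) ^ n < \<bar>f k (r n) \<omega> - g k \<omega>\<bar>} < (1 / 2) ^ n" for n k
    using R by blast+
  have "AE \<omega> in M. (\<lambda>n. f k (r n) \<omega>) \<longlonglongrightarrow> g k \<omega>" for k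
  proof -
    define A where "A n = {\<omega> \<in> space M. (1 / 2) ^ n < \<bar>f k (r n) \<omega> - g k \<omega>\<bar>}" for n
    have [measurable]: "A n \<in> sets M" for n unfolding A_def by measurable
    have "summable (\<lambda>n. measure M (A n))"
    proof (rule summable_comparison_test'[of "\<lambda>n. (1 / 2) ^ n" 0])
      show "summable (\<lambda>n. (1 / 2 :: real) ^ n)" by (rule summable_geometric) simp
      show "norm (measure M (A n)) \<le> (1 / 2) ^ n" for n
        using r(2)[of n k] by (simp add: A_def)
    qed
    then have "AE \<omega> in M. \<forall>\<^sub>F n in sequentially. \<omega> \<in> space M - A n"
      by (intro borel_cantelli_AE1) (auto simp: emeasure_eq_measure)
    then show ?thesis
    proof eventually_elim
      case (elim \<omega>)
      have "(\<lambda>n. f k (r n) \<omega> - g k \<omega>) \<longlonglongrightarrow> 0"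
      proof (rule Lim_null_comparison)
        show "\<forall>\<^sub>F n in sequentially. norm (f k (r n) \<omega> - g k \<omega>) \<le> (1 / 2) ^ n"
          using elim by eventually_elim (auto simp: A_def)
        show "(\<lambda>n. (1 / 2 :: real) ^ n) \<longlonglongrightarrow> 0" by (rule LIMSEQ_power_zero) simp
      qed
      then show ?case by (simp add: LIM_zero_iff)
    qed
  qed
  then have "AE \<omega> in M. \<forall>k. (\<lambda>n. f k (r n) \<omega>) \<longlonglongrightarrow> g k \<omega>"
    by (simp add: AE_all_countable)
  then show ?thesis using r(1) by blast
qed

subsection \<open>The Borel sets of path space are determined by the dyadic times\<close>

text \<open>By continuity the evaluations at dyadic times determine all evaluations, measurably.\<close>

lemma borel_path_space_dyadic:
  fixes A :: "(real \<Rightarrow> 'v::euclidean_space) set"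
  assumes A: "A \<in> sets (borel_of path_space)"
  shows "\<exists>A'\<in>sets (PiM dyadics (\<lambda>_. borel)). \<forall>x\<in>topspace path_space. x \<in> A \<longleftrightarrow> restrict x dyadics \<in> A'"
proof -
  define P where "P = PiM dyadics (\<lambda>_. borel :: 'v measure)"
  define N where "N = vimage_algebra (topspace path_space) (\<lambda>x. restrict x dyadics) P"
  have sp: "(\<lambda>x. restrict x dyadics) \<in> topspace path_space \<rightarrow> space P"
    by (auto simp: P_def space_PiM)
  have space_N: "space N = topspace path_space" by (simp add: N_def)
  have dy: "(\<lambda>x. x t :: 'v) \<in> borel_measurable N" if t: "t \<in> dyadics" for t
  proof -
    have 1: "(\<lambda>x. restrict x dyadics) \<in> N \<rightarrow>\<^sub>M P"
      unfolding N_def by (rule measurable_vimage_algebra1[OF sp])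
    have 2: "(\<lambda>y. y t) \<in> borel_measurable P"
      unfolding P_def by (rule measurable_component_singleton[OF t])
    from measurable_compose[OF 1 2] t show ?thesis by simp
  qed
  have "(\<lambda>x. x) \<in> N \<rightarrow>\<^sub>M borel_of path_space"
  proof (rule measurable_into_path_space)
    show "x \<in> topspace path_space" if "x \<in> space N" for x using that by (simp add: space_N)
    fix t :: real assume t: "t \<in> {0..1}"
    define s where "s n = real_of_int \<lfloor>2 ^ n * t\<rfloor> / 2 ^ n" for n
    have s: "s n \<in> dyadics" for n
      using floor_dyadic_point[OF t, of n] unfolding dyadics_iff s_def by blast
    show "(\<lambda>x. x t :: 'v) \<in> borel_measurable N"
    proof (rule borel_measurable_LIMSEQ_metric)
      show "(\<lambda>x. x (s n) :: 'v) \<in> borel_measurable N" for n by (rule dy[OF s])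
      fix x assume "x \<in> space N"
      then have "continuous_on {0..1} x" by (simp add: space_N topspace_path_space)
      moreover have "s \<longlonglongrightarrow> t" unfolding s_def[abs_def] by (rule floor_dyadic_tendsto)
      ultimately show "(\<lambda>n. x (s n)) \<longlonglongrightarrow> x t"
        by (rule continuous_on_tendsto_compose[OF _ _ t]) (rule always_eventually, rule allI, rule dyadics_unit[OF s])
    qed
  qed
  from measurable_sets[OF this A] have "A \<inter> topspace path_space \<in> sets N"
    by (simp add: space_N)
  then obtain A' where A': "A' \<in> sets P" "A \<inter> topspace path_space = (\<lambda>x. restrict x dyadics) -` A' \<inter> topspace path_space"
    unfolding N_def sets_vimage_algebra2[OF sp] by blast
  then have "\<forall>x\<in>topspace path_space. x \<in> A \<longleftrightarrow> restrict x dyadics \<in> A'" by blast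
  then show ?thesis using A'(1) by (auto simp: P_def)
qed

subsection \<open>The bracket of a step-2 Carnot group\<close>

definition carnot_bracket :: "('m::finite \<Rightarrow> 'm \<Rightarrow> real ^ 'n) \<Rightarrow> real ^ 'm \<Rightarrow> real ^ 'm \<Rightarrow> real ^ 'n" where
  "carnot_bracket w a b = carnot_W w (\<lambda>i j. a $ i * b $ j)"

lemma carnot_W_add: "carnot_W w (\<lambda>i j. A i j + A' i j) = carnot_W w A + carnot_W w A'"
  by (simp add: carnot_W_def scaleR_add_left sum.distrib)

lemma carnot_W_scale: "carnot_W w (\<lambda>i j. c * A i j) = c *\<^sub>R carnot_W w A"
  by (simp add: carnot_W_def scaleR_sum_right)

lemma carnot_W_diff: "carnot_W w (\<lambda>i j. A i j - A' i j) = carnot_W w A - carnot_W w A'"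
  by (simp add: carnot_W_def scaleR_diff_left sum_subtractf)

lemma carnot_W_tendsto:
  assumes "\<And>i j. (\<lambda>n. A n i j) \<longlonglongrightarrow> A' i j"
  shows "(\<lambda>n. carnot_W w (A n)) \<longlonglongrightarrow> carnot_W w A'"
  unfolding carnot_W_def by (intro tendsto_sum tendsto_scaleR assms tendsto_const)

lemma carnot_bracket_antisym:
  assumes "carnot_constants w"
  shows "carnot_bracket w b a = - carnot_bracket w a b"
proof -
  have w: "w i j = - w j i" for i j using assms unfolding carnot_constants_def by blast
  have "carnot_bracket w b a = (\<Sum>j\<in>UNIV. \<Sum>i\<in>UNIV. (b $ i * a $ j) *\<^sub>R w i j)"
    unfolding carnot_bracket_def carnot_W_def by (rule sum.swap)
  also have "\<dots> = (\<Sum>j\<in>UNIV. \<Sum>i\<in>UNIV. - ((a $ j * b $ i) *\<^sub>R w j i))"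
    by (intro sum.cong refl) (subst w, simp add: mult.commute)
  finally show ?thesis
    by (simp add: carnot_bracket_def carnot_W_def sum_negf)
qed

lemma carnot_bracket_self: "carnot_constants w \<Longrightarrow> carnot_bracket w a a = 0"
  using carnot_bracket_antisym[of w a a] by (simp add: vec_eq_iff)

lemma carnot_bracket_linear:
  "carnot_bracket w (a + a') b = carnot_bracket w a b + carnot_bracket w a' b"
  "carnot_bracket w (a - a') b = carnot_bracket w a b - carnot_bracket w a' b"
  "carnot_bracket w (c *\<^sub>R a) b = c *\<^sub>R carnot_bracket w a b"
  "carnot_bracket w a (c *\<^sub>R b) = c *\<^sub>R carnot_bracket w a b"
  by (simp_all add: carnot_bracket_def carnot_W_def algebra_simps sum.distrib sum_subtractf scaleR_sum_right)

lemma carnot_bracket_bounded_linear: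
  "bounded_linear (carnot_bracket w a)" "bounded_linear (\<lambda>a. carnot_bracket w a b)"
  by (intro linear_conv_bounded_linear[THEN iffD1] linearI;
      simp add: carnot_bracket_def carnot_W_def algebra_simps sum.distrib scaleR_sum_right)+

lemma carnot_bracket_axis: "carnot_bracket w (axis i 1) (axis j 1) = w i j"
proof -
  have "carnot_bracket w (axis i 1) (axis j 1) = (\<Sum>k\<in>UNIV. \<Sum>l\<in>UNIV. if k = i then if l = j then w k l else 0 else 0)"
    unfolding carnot_bracket_def carnot_W_def by (intro sum.cong refl) (auto simp: axis_def)
  also have "\<dots> = (\<Sum>k\<in>UNIV. if k = i then w k j else 0)"
    by (intro sum.cong refl) (auto simp: sum.delta)
  also have "\<dots> = w i j" by simp
  finally show ?thesis .
qed

subsection \<open>Shifts by straight lines\<close>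

definition carnot_line_shift ::
    "('m::finite \<Rightarrow> 'm \<Rightarrow> real ^ 'n) \<Rightarrow> real ^ 'm \<Rightarrow> (real \<Rightarrow> (real ^ 'm) \<times> (real ^ 'n)) \<Rightarrow>
     (real \<Rightarrow> (real ^ 'm) \<times> (real ^ 'n))" where
  "carnot_line_shift w v = carnot_shift w (\<lambda>t. t *\<^sub>R v)"

text \<open>The bracket of this vector with \<open>v\<close> is the effect of the shift by \<open>\<lambda>t. t *\<^sub>R v\<close> on the second layer, up to a
  boundary term.\<close>

definition first_layer_integral :: "(real \<Rightarrow> (real ^ 'm) \<times> (real ^ 'n)) \<Rightarrow> real \<Rightarrow> real ^ 'm" where
  "first_layer_integral x t = (\<chi> i. LINT s:{0..t}|lborel. fst (x s) $ i)"

lemma line_ac: "has_ac_derivative (\<lambda>t. (t *\<^sub>R v) $ i) (\<lambda>t. v $ i)" for v :: "real ^ 'm"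
  unfolding has_ac_derivative_def
  by (auto simp: set_integrable_def set_lebesgue_integral_def emeasure_lborel_Icc_eq)

lemma carnot_line_shift_terms:
  fixes x :: "real \<Rightarrow> (real ^ 'm) \<times> (real ^ 'n)"
  assumes x: "continuous_on {0..1} x" and t: "t \<in> {0..1}"
  shows "rs_integral (\<lambda>s. fst (x s) $ i) (\<lambda>s. (s *\<^sub>R v) $ j) 0 t = first_layer_integral x t $ i * v $ j"
    and "rs_integral (\<lambda>s. (s *\<^sub>R v) $ i) (\<lambda>s. fst (x s) $ j) 0 t = t * (v $ i * fst (x t) $ j) - v $ i * first_layer_integral x t $ j"
    and "rs_integral (\<lambda>s. (s *\<^sub>R v) $ i) (\<lambda>s. (s *\<^sub>R v) $ j) 0 t = (LINT s:{0..t}|lborel. s) * (v $ i * v $ j)"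
    and "(\<lambda>n. Riemann_sum n (\<lambda>s. fst (x s) $ i) (\<lambda>s. (s *\<^sub>R v) $ j) t)
      \<longlonglongrightarrow> rs_integral (\<lambda>s. fst (x s) $ i) (\<lambda>s. (s *\<^sub>R v) $ j) 0 t"
    and "(\<lambda>n. Riemann_sum n (\<lambda>s. (s *\<^sub>R v) $ i) (\<lambda>s. fst (x s) $ j) t)
      \<longlonglongrightarrow> rs_integral (\<lambda>s. (s *\<^sub>R v) $ i) (\<lambda>s. fst (x s) $ j) 0 t"
    and "(\<lambda>n. Riemann_sum n (\<lambda>s. (s *\<^sub>R v) $ i) (\<lambda>s. (s *\<^sub>R v) $ j) t)
      \<longlonglongrightarrow> rs_integral (\<lambda>s. (s *\<^sub>R v) $ i) (\<lambda>s. (s *\<^sub>R v) $ j) 0 t"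
proof -
  have c: "continuous_on {0..1} (\<lambda>s. fst (x s) $ i)" for i using x by (intro continuous_intros)
  have cl: "continuous_on {0..1} (\<lambda>s. (s *\<^sub>R v) $ i)" for i by (intro continuous_intros)
  have z: "(0 *\<^sub>R v) $ i = 0" for i by simp
  note a = rs_integral_ac[OF c line_ac t, of i v j] and b = rs_integral_by_parts[OF c line_ac t z, of i j]
    and d = rs_integral_ac[OF cl line_ac t, of i v j]
  show "rs_integral (\<lambda>s. fst (x s) $ i) (\<lambda>s. (s *\<^sub>R v) $ j) 0 t = first_layer_integral x t $ i * v $ j"
    unfolding a(1) by (simp add: first_layer_integral_def)
  show "rs_integral (\<lambda>s. (s *\<^sub>R v) $ i) (\<lambda>s. fst (x s) $ j) 0 t = t * (v $ i * fst (x t) $ j) - v $ i * first_layer_integral x t $ j"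
    unfolding b(1) by (simp add: first_layer_integral_def)
  show "rs_integral (\<lambda>s. (s *\<^sub>R v) $ i) (\<lambda>s. (s *\<^sub>R v) $ j) 0 t = (LINT s:{0..t}|lborel. s) * (v $ i * v $ j)"
  proof -
    have "(LINT s:{0..t}|lborel. (s *\<^sub>R v) $ i * v $ j) = (LINT s:{0..t}|lborel. s * (v $ i * v $ j))"
      by (simp add: mult.assoc)
    also have "\<dots> = (LINT s:{0..t}|lborel. s) * (v $ i * v $ j)" by (rule set_integral_mult_left)
    finally show ?thesis unfolding d(1) .
  qed
  show "(\<lambda>n. Riemann_sum n (\<lambda>s. fst (x s) $ i) (\<lambda>s. (s *\<^sub>R v) $ j) t)
      \<longlonglongrightarrow> rs_integral (\<lambda>s. fst (x s) $ i) (\<lambda>s. (s *\<^sub>R v) $ j) 0 t"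
    by (rule a(2))
  show "(\<lambda>n. Riemann_sum n (\<lambda>s. (s *\<^sub>R v) $ i) (\<lambda>s. fst (x s) $ j) t)
      \<longlonglongrightarrow> rs_integral (\<lambda>s. (s *\<^sub>R v) $ i) (\<lambda>s. fst (x s) $ j) 0 t"
    by (rule b(2))
  show "(\<lambda>n. Riemann_sum n (\<lambda>s. (s *\<^sub>R v) $ i) (\<lambda>s. (s *\<^sub>R v) $ j) t)
      \<longlonglongrightarrow> rs_integral (\<lambda>s. (s *\<^sub>R v) $ i) (\<lambda>s. (s *\<^sub>R v) $ j) 0 t"
    by (rule d(2))
qed

text \<open>After integration by parts the two mixed integrals agree up to a boundary term, by antisymmetry of the structure
  constants; the quadratic term is symmetric and vanishes.\<close>

lemma carnot_line_shift_eq: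
  fixes x :: "real \<Rightarrow> (real ^ 'm) \<times> (real ^ 'n)"
  assumes w: "carnot_constants w" and x: "continuous_on {0..1} x" and t: "t \<in> {0..1}"
  shows "carnot_line_shift w v x t = (fst (x t) + t *\<^sub>R v,
     snd (x t) + (carnot_bracket w (first_layer_integral x t) v - (t / 2) *\<^sub>R carnot_bracket w (fst (x t)) v))"
proof -
  let ?m = "first_layer_integral x t" and ?q = "LINT s:{0..t}|lborel. s"
  have "carnot_W w (\<lambda>i j. rs_integral (\<lambda>s. fst (x s) $ i) (\<lambda>s. (s *\<^sub>R v) $ j) 0 t
        + rs_integral (\<lambda>s. (s *\<^sub>R v) $ i) (\<lambda>s. fst (x s) $ j) 0 t
        + rs_integral (\<lambda>s. (s *\<^sub>R v) $ i) (\<lambda>s. (s *\<^sub>R v) $ j) 0 t)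
      = carnot_W w (\<lambda>i j. ?m $ i * v $ j + (t * (v $ i * fst (x t) $ j) - v $ i * ?m $ j) + ?q * (v $ i * v $ j))"
    unfolding carnot_line_shift_terms(1-3)[OF x t] ..
  also have "\<dots> = carnot_bracket w ?m v + (t *\<^sub>R carnot_bracket w v (fst (x t)) - carnot_bracket w v ?m)
      + ?q *\<^sub>R carnot_bracket w v v"
    unfolding carnot_W_add carnot_W_diff carnot_W_scale carnot_bracket_def ..
  also have "\<dots> = 2 *\<^sub>R carnot_bracket w ?m v - t *\<^sub>R carnot_bracket w (fst (x t)) v"
    using carnot_bracket_antisym[OF w, of v ?m] carnot_bracket_antisym[OF w, of v "fst (x t)"]
    by (simp add: carnot_bracket_self[OF w] scaleR_2)
  finally have "(1 / 2) *\<^sub>R carnot_W w (\<lambda>i j. rs_integral (\<lambda>s. fst (x s) $ i) (\<lambda>s. (s *\<^sub>R v) $ j) 0 t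
        + rs_integral (\<lambda>s. (s *\<^sub>R v) $ i) (\<lambda>s. fst (x s) $ j) 0 t
        + rs_integral (\<lambda>s. (s *\<^sub>R v) $ i) (\<lambda>s. (s *\<^sub>R v) $ j) 0 t)
      = carnot_bracket w ?m v - (t / 2) *\<^sub>R carnot_bracket w (fst (x t)) v"
    by (simp add: scaleR_diff_right)
  then show ?thesis
    using t unfolding carnot_line_shift_def carnot_shift_def by simp
qed

lemma first_layer_integral_continuous:
  assumes x: "continuous_on {0..1} x"
  shows "continuous_on {0..1} (first_layer_integral x)"
proof -
  have "set_integrable lborel {0..1} (\<lambda>s. fst (x s) $ i)" for i
    unfolding set_integrable_def
    by (intro borel_integrable_compact compact_Icc continuous_intros x)
  then show ?thesis
    unfolding first_layer_integral_def[abs_def] by (intro continuous_on_vec_lambda continuous_on_LINT)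
qed

lemma carnot_line_shift_path:
  assumes w: "carnot_constants w" and x: "x \<in> topspace path_space"
  shows "carnot_line_shift w v x \<in> topspace path_space"
proof -
  have cx: "continuous_on {0..1} x" and x0: "x 0 = 0" using x by (auto simp: topspace_path_space)
  have "continuous_on {0..1} (\<lambda>t. (fst (x t) + t *\<^sub>R v,
     snd (x t) + (carnot_bracket w (first_layer_integral x t) v - (t / 2) *\<^sub>R carnot_bracket w (fst (x t)) v)))"
    by (intro continuous_intros cx bounded_linear.continuous_on[OF carnot_bracket_bounded_linear(2)] first_layer_integral_continuous[OF cx]) auto
  then have "continuous_on {0..1} (carnot_line_shift w v x)"
    by (rule continuous_on_eq) (rule carnot_line_shift_eq[OF w cx, symmetric])
  moreover have "carnot_line_shift w v x \<in> extensional {0..1}"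
    by (simp add: carnot_line_shift_def carnot_shift_def)
  moreover have "carnot_line_shift w v x 0 = 0"
  proof -
    have "first_layer_integral x 0 = 0" using LINT_point[of 0, where 'v=real] by (simp add: first_layer_integral_def vec_eq_iff)
    moreover have "carnot_bracket w 0 v = 0" using carnot_bracket_linear(3)[of w 0 0 v] by simp
    ultimately show ?thesis
      using carnot_line_shift_eq[OF w cx, of 0 v] x0 by (simp add: zero_prod_def)
  qed
  ultimately show ?thesis by (simp add: topspace_path_space)
qed

lemma first_layer_integral_measurable:
  assumes t: "t \<in> {0..1}"
  shows "(\<lambda>y. first_layer_integral y t :: real ^ 'm)
    \<in> borel_measurable (borel_of (path_space :: (real \<Rightarrow> (real ^ 'm) \<times> (real ^ 'n)) topology))"
proof -
  let ?P = "borel_of (path_space :: (real \<Rightarrow> (real ^ 'm) \<times> (real ^ 'n)) topology)"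
  have "(\<lambda>y. LINT s:{0..t}|lborel. fst (y s) $ i) \<in> borel_measurable ?P" for i
  proof -
    have "(\<lambda>z. fst (fst z (max 0 (min 1 (snd z))))) \<in> borel_measurable (?P \<Otimes>\<^sub>M borel)"
      by (rule borel_measurable_continuous_on[OF continuous_on_fst[OF continuous_on_id] path_eval_jointly_measurable])
    from measurable_compose[OF this measurable_vec_nth]
    have "(\<lambda>z. indicat_real {0..t} (snd z) *\<^sub>R fst (fst z (max 0 (min 1 (snd z)))) $ i) \<in> borel_measurable (?P \<Otimes>\<^sub>M borel)"
      by measurable
    then have "(\<lambda>(y, s). indicat_real {0..t} s *\<^sub>R fst (y (max 0 (min 1 s))) $ i) \<in> borel_measurable (?P \<Otimes>\<^sub>M lborel)"
      by (simp add: case_prod_unfold measurable_cong_sets[OF sets_pair_measure_cong[OF refl sets_lborel] refl])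
    then have "(\<lambda>y. \<integral>s. indicat_real {0..t} s *\<^sub>R fst (y (max 0 (min 1 s))) $ i \<partial>lborel) \<in> borel_measurable ?P"
      by (rule lborel.borel_measurable_lebesgue_integral)
    moreover have "indicat_real {0..t} s *\<^sub>R fst (y (max 0 (min 1 s))) $ i = indicat_real {0..t} s *\<^sub>R fst (y s) $ i"
      for y :: "real \<Rightarrow> (real ^ 'm) \<times> (real ^ 'n)" and s
    proof (cases "s \<in> {0..t}")
      case True
      then have "max 0 (min 1 s) = s" using t by auto
      then show ?thesis by simp
    qed simp
    ultimately show ?thesis by (simp only: set_lebesgue_integral_def)
  qed
  then have "(\<lambda>y. \<Sum>i\<in>UNIV. (LINT s:{0..t}|lborel. fst (y s) $ i) *\<^sub>R axis i 1 :: real ^ 'm) \<in> borel_measurable ?P"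
    by (intro borel_measurable_sum borel_measurable_scaleR borel_measurable_const)
  moreover have "(\<Sum>i\<in>UNIV. (LINT s:{0..t}|lborel. fst (y s) $ i) *\<^sub>R axis i 1 :: real ^ 'm) = first_layer_integral y t"
    for y :: "real \<Rightarrow> (real ^ 'm) \<times> (real ^ 'n)"
    by (simp add: first_layer_integral_def vec_eq_iff axis_def if_distrib[of "\<lambda>x. _ * x"] sum.delta cong: if_cong)
  ultimately show ?thesis by (simp only:)
qed

lemma carnot_bracket_measurable:
  assumes "f \<in> borel_measurable M"
  shows "(\<lambda>y. carnot_bracket w (f y) v) \<in> borel_measurable M"
  unfolding carnot_bracket_def carnot_W_def
  by (intro borel_measurable_sum borel_measurable_scaleR borel_measurable_times borel_measurable_const
      measurable_compose[OF assms measurable_vec_nth])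

lemma carnot_line_shift_measurable:
  assumes w: "carnot_constants w" and t: "t \<in> {0..1}"
  shows "(\<lambda>y. carnot_line_shift w v y t) \<in> borel_measurable (borel_of path_space)"
proof -
  have f: "(\<lambda>y. fst (y t)) \<in> borel_measurable (borel_of path_space)"
    by (rule borel_measurable_continuous_on[OF continuous_on_fst[OF continuous_on_id] measurable_path_eval[OF t]])
  have s: "(\<lambda>y. snd (y t)) \<in> borel_measurable (borel_of path_space)"
    by (rule borel_measurable_continuous_on[OF continuous_on_snd[OF continuous_on_id] measurable_path_eval[OF t]])
  have "(\<lambda>y. (fst (y t) + t *\<^sub>R v,
      snd (y t) + (carnot_bracket w (first_layer_integral y t) v - (t / 2) *\<^sub>R carnot_bracket w (fst (y t)) v)))
    \<in> borel_measurable (borel_of path_space)"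
    by (intro borel_measurable_Pair borel_measurable_add borel_measurable_diff borel_measurable_scaleR
        borel_measurable_const carnot_bracket_measurable first_layer_integral_measurable f s t)
  then show ?thesis
    by (subst measurable_cong[of _ _ "\<lambda>y. (fst (y t) + t *\<^sub>R v,
      snd (y t) + (carnot_bracket w (first_layer_integral y t) v - (t / 2) *\<^sub>R carnot_bracket w (fst (y t)) v))"])
       (simp_all add: carnot_line_shift_eq[OF w _ t] topspace_path_space)
qed

section \<open>Quasi-invariance of Brownian motion on a Carnot group\<close>

lemma ito_integral_Riemann_sums:
  assumes ito: "ito_integral M X Y t I" and t: "t \<in> {0..1}" and e: "0 < e"
  shows "(\<lambda>n. measure M {\<omega> \<in> space M. e < \<bar>Riemann_sum n (\<lambda>s. X s \<omega>) (\<lambda>s. Y s \<omega>) t - I \<omega>\<bar>}) \<longlonglongrightarrow> 0"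
proof -
  define \<tau> where "\<tau> j k = t * (real k / 2 ^ j)" for j k :: nat
  have t: "0 \<le> t" "t \<le> 1" using t by auto
  have 1: "\<forall>j. \<tau> j 0 = 0 \<and> \<tau> j (2 ^ j) = t \<and> (\<forall>k<2 ^ j. \<tau> j k \<le> \<tau> j (Suc k))"
    using t by (auto simp: \<tau>_def intro!: mult_left_mono divide_right_mono)
  have 2: "\<forall>\<delta>>0. \<forall>\<^sub>F j in sequentially. \<forall>k<2 ^ j. \<tau> j (Suc k) - \<tau> j k < \<delta>"
  proof (intro allI impI)
    fix \<delta> :: real assume "0 < \<delta>"
    have "(\<lambda>j. (1 / 2 :: real) ^ j) \<longlonglongrightarrow> 0" by (rule LIMSEQ_power_zero) simp
    then have "\<forall>\<^sub>F j in sequentially. (1 / 2 :: real) ^ j < \<delta>" using \<open>0 < \<delta>\<close> by (rule order_tendstoD)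
    then show "\<forall>\<^sub>F j in sequentially. \<forall>k<2 ^ j. \<tau> j (Suc k) - \<tau> j k < \<delta>"
    proof eventually_elim
      case (elim j)
      have "\<tau> j (Suc k) - \<tau> j k = t * (1 / 2) ^ j" for k
        by (simp add: \<tau>_def power_one_over algebra_simps add_divide_distrib)
      moreover have "t * (1 / 2) ^ j \<le> 1 * (1 / 2) ^ j" using t by (intro mult_right_mono) auto
      then have "t * (1 / 2) ^ j < \<delta>" using elim by linarith
      ultimately show ?case by simp
    qed
  qed
  note P = ito[unfolded ito_integral_def, THEN conjunct2, THEN spec, THEN spec, THEN mp]
  from P[OF conjI[OF 1 2], THEN spec, THEN mp, OF e]
  show ?thesis by (simp only: Riemann_sum_def \<tau>_def)
qed

lemma carnot_BM_D:
  fixes X :: "real \<Rightarrow> 'w \<Rightarrow> (real ^ 'm) \<times> (real ^ 'n)"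
  assumes "carnot_BM w M X"
  shows "standard_BM M (\<lambda>t \<omega>. fst (X t \<omega>))" "prob_space M"
    "\<And>t. t \<in> {0..1} \<Longrightarrow> X t \<in> borel_measurable M"
    "\<And>\<omega>. \<omega> \<in> space M \<Longrightarrow> X 0 \<omega> = 0 \<and> continuous_on {0..1} (\<lambda>t. X t \<omega>)"
    "\<And>t. t \<in> {0..1} \<Longrightarrow> \<exists>A.
        (\<forall>i j. ito_integral M (\<lambda>s \<omega>. fst (X s \<omega>) $ i) (\<lambda>s \<omega>. fst (X s \<omega>) $ j) t (A i j)) \<and>
        (AE \<omega> in M. snd (X t \<omega>) = (1/2) *\<^sub>R carnot_W w (\<lambda>i j. A i j \<omega>))"
proof -
  note D = assms[unfolded carnot_BM_def]
  note D2 = D[THEN conjunct2] and D3 = D[THEN conjunct2, THEN conjunct2]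
  show BM: "standard_BM M (\<lambda>t \<omega>. fst (X t \<omega>))" by (rule D[THEN conjunct1])
  show "prob_space M" by (rule standard_BM_D(1)[OF BM])
  show "X t \<in> borel_measurable M" if "t \<in> {0..1}" for t
    by (rule D2[THEN conjunct1, rule_format, OF that])
  show "X 0 \<omega> = 0 \<and> continuous_on {0..1} (\<lambda>t. X t \<omega>)" if "\<omega> \<in> space M" for \<omega>
    by (rule D3[THEN conjunct1, rule_format, OF that])
  show "\<exists>A.
        (\<forall>i j. ito_integral M (\<lambda>s \<omega>. fst (X s \<omega>) $ i) (\<lambda>s \<omega>. fst (X s \<omega>) $ j) t (A i j)) \<and>
        (AE \<omega> in M. snd (X t \<omega>) = (1/2) *\<^sub>R carnot_W w (\<lambda>i j. A i j \<omega>))" if "t \<in> {0..1}" for t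
    by (rule D3[THEN conjunct2, rule_format, OF that])
qed

text \<open>The stochastic integrals are limits in probability; almost sure limits are available along a subsequence
  that depends on \<open>t\<close>.\<close>

lemma carnot_area_Riemann_sums:
  fixes X :: "real \<Rightarrow> 'w \<Rightarrow> (real ^ 'm) \<times> (real ^ 'n)"
  assumes BM: "carnot_BM w M X" and t: "t \<in> {0..1}"
  shows "\<exists>r. (\<forall>n. n \<le> r n) \<and> (AE \<omega> in M. \<exists>a. (\<forall>i j. (\<lambda>n. Riemann_sum (r n) (\<lambda>s. fst (X s \<omega>) $ i) (\<lambda>s. fst (X s \<omega>) $ j) t)
      \<longlonglongrightarrow> a i j) \<and> snd (X t \<omega>) = (1 / 2) *\<^sub>R carnot_W w a)"
proof -
  note BMD = carnot_BM_D[OF BM]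
  obtain A where A: "\<And>i j. ito_integral M (\<lambda>s \<omega>. fst (X s \<omega>) $ i) (\<lambda>s \<omega>. fst (X s \<omega>) $ j) t (A i j)"
    and snd: "AE \<omega> in M. snd (X t \<omega>) = (1/2) *\<^sub>R carnot_W w (\<lambda>i j. A i j \<omega>)"
    using BMD(5)[OF t] by blast
  let ?f = "\<lambda>(i, j) n \<omega>. Riemann_sum n (\<lambda>s. fst (X s \<omega>) $ i) (\<lambda>s. fst (X s \<omega>) $ j) t"
  have Xi: "(\<lambda>\<omega>. fst (X (t * (real k / 2 ^ n)) \<omega>) $ i) \<in> borel_measurable M" if "k \<le> 2 ^ n" for k n i
  proof -
    from BMD(3)[OF dyadic_point_mult[OF t that]]
    have "(\<lambda>\<omega>. fst (X (t * (real k / 2 ^ n)) \<omega>)) \<in> borel_measurable M"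
      by (rule borel_measurable_continuous_on[OF continuous_on_fst[OF continuous_on_id]])
    from measurable_compose[OF this measurable_vec_nth] show ?thesis .
  qed
  have f_meas: "?f p n \<in> borel_measurable M" for p n
    unfolding Riemann_sum_def case_prod_unfold
    by (intro borel_measurable_sum borel_measurable_times borel_measurable_diff Xi) auto
  have A_meas: "(case p of (i, j) \<Rightarrow> A i j) \<in> borel_measurable M" for p
    using A[of "fst p" "snd p"] unfolding ito_integral_def by (simp add: case_prod_unfold)
  have "\<exists>r. (\<forall>n. n \<le> r n) \<and> (AE \<omega> in M. \<forall>p. (\<lambda>n. ?f p (r n) \<omega>) \<longlonglongrightarrow> (case p of (i, j) \<Rightarrow> A i j) \<omega>)"
  proof (rule AE_subsequence_of_tendsto_in_measure[OF BMD(2) f_meas A_meas])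
    fix p :: "'m \<times> 'm" and e :: real assume "0 < e"
    then show "(\<lambda>n. measure M {\<omega> \<in> space M. e < \<bar>?f p n \<omega> - (case p of (i, j) \<Rightarrow> A i j) \<omega>\<bar>}) \<longlonglongrightarrow> 0"
      using ito_integral_Riemann_sums[OF A t, of e "fst p" "snd p"] by (simp add: case_prod_unfold)
  qed
  then obtain r where r: "\<forall>n. n \<le> r n" and ae: "AE \<omega> in M. \<forall>p. (\<lambda>n. ?f p (r n) \<omega>) \<longlonglongrightarrow> (case p of (i, j) \<Rightarrow> A i j) \<omega>"
    by blast
  have "AE \<omega> in M. \<exists>a. (\<forall>i j. (\<lambda>n. Riemann_sum (r n) (\<lambda>s. fst (X s \<omega>) $ i) (\<lambda>s. fst (X s \<omega>) $ j) t)
      \<longlonglongrightarrow> a i j) \<and> snd (X t \<omega>) = (1 / 2) *\<^sub>R carnot_W w a"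
    using ae snd
  proof eventually_elim
    case (elim \<omega>)
    have "(\<lambda>n. Riemann_sum (r n) (\<lambda>s. fst (X s \<omega>) $ i) (\<lambda>s. fst (X s \<omega>) $ j) t) \<longlonglongrightarrow> A i j \<omega>" for i j
      using elim(1)[rule_format, of "(i, j)"] by simp
    then show ?case using elim(2) by (intro exI[of _ "\<lambda>i j. A i j \<omega>"]) blast
  qed
  then show ?thesis using r by blast
qed

text \<open>The second layer of Brownian motion on the group is almost surely a function of the first layer at dyadic
  times, namely a limit of Riemann sums along the subsequences \<open>r t\<close>.\<close>

definition carnot_lift ::
    "('m::finite \<Rightarrow> 'm \<Rightarrow> real ^ 'n) \<Rightarrow> (real \<Rightarrow> nat \<Rightarrow> nat) \<Rightarrow> (real \<Rightarrow> real ^ 'm) \<Rightarrow> real \<Rightarrow> (real ^ 'm) \<times> (real ^ 'n)" where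
  "carnot_lift w r b = (\<lambda>t\<in>dyadics. (b t, lim (\<lambda>n. (1 / 2) *\<^sub>R carnot_W w (\<lambda>i j. Riemann_sum (r t n) (\<lambda>s. b s $ i) (\<lambda>s. b s $ j) t))))"

lemma dyadics_grid: "t \<in> dyadics \<Longrightarrow> k \<le> 2 ^ n \<Longrightarrow> t * (real k / 2 ^ n) \<in> dyadics"
  by (rule dyadics_mult) (auto simp: dyadics_iff)

lemma carnot_lift_measurable:
  "carnot_lift w r \<in> PiM dyadics (\<lambda>_. borel) \<rightarrow>\<^sub>M PiM dyadics (\<lambda>_. borel)"
  unfolding carnot_lift_def
proof (rule measurable_restrict)
  fix t assume t: "t \<in> dyadics"
  have comp: "(\<lambda>b. b s :: real ^ 'a) \<in> borel_measurable (PiM dyadics (\<lambda>_. borel))" if "s \<in> dyadics" for s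
    using that by (rule measurable_component_singleton)
  have "(\<lambda>b. Riemann_sum n (\<lambda>s. b s $ i) (\<lambda>s. b s $ j) t) \<in> borel_measurable (PiM dyadics (\<lambda>_. borel))"
    for n and i j :: 'a
    unfolding Riemann_sum_def
    by (intro borel_measurable_sum borel_measurable_times borel_measurable_diff
        measurable_compose[OF comp measurable_vec_nth] dyadics_grid t) auto
  then have "(\<lambda>b. (1 / 2) *\<^sub>R carnot_W w (\<lambda>i j. Riemann_sum (r t n) (\<lambda>s. b s $ i) (\<lambda>s. b s $ j) t))
      \<in> borel_measurable (PiM dyadics (\<lambda>_. borel))" for n
    unfolding carnot_W_def
    by (intro borel_measurable_scaleR borel_measurable_const borel_measurable_sum) auto
  then show "(\<lambda>b. (b t, lim (\<lambda>n. (1 / 2) *\<^sub>R carnot_W w (\<lambda>i j. Riemann_sum (r t n) (\<lambda>s. b s $ i) (\<lambda>s. b s $ j) t))))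
      \<in> borel_measurable (PiM dyadics (\<lambda>_. borel))"
    by (intro borel_measurable_Pair comp t borel_measurable_lim_metric)
qed

lemma carnot_lift_restrict: "carnot_lift w r (restrict b dyadics) = carnot_lift w r b"
  unfolding carnot_lift_def
proof (rule restrict_ext)
  fix t assume t: "t \<in> dyadics"
  have "Riemann_sum n (\<lambda>s. restrict b dyadics s $ i) (\<lambda>s. restrict b dyadics s $ j) t
      = Riemann_sum n (\<lambda>s. b s $ i) (\<lambda>s. b s $ j) t" for n i j
    by (rule Riemann_sum_cong) (simp_all only: restrict_apply dyadics_grid[OF t] if_True)
  then show "(restrict b dyadics t, lim (\<lambda>n. (1 / 2) *\<^sub>R carnot_W w (\<lambda>i j. Riemann_sum (r t n) (\<lambda>s. restrict b dyadics s $ i) (\<lambda>s. restrict b dyadics s $ j) t)))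
    = (b t, lim (\<lambda>n. (1 / 2) *\<^sub>R carnot_W w (\<lambda>i j. Riemann_sum (r t n) (\<lambda>s. b s $ i) (\<lambda>s. b s $ j) t)))"
    using t by simp
qed

text \<open>Riemann sums are bilinear. The terms that involve the straight line converge along the full sequence, by
  Riemann--Stieltjes integration, so the subsequences chosen for \<open>x\<close> also serve for the shifted path.\<close>

lemma carnot_lift_shift:
  fixes x :: "real \<Rightarrow> (real ^ 'm) \<times> (real ^ 'n)"
  assumes x: "x \<in> topspace path_space" and r: "\<And>t n. t \<in> dyadics \<Longrightarrow> n \<le> r t n"
    and conv: "\<And>t. t \<in> dyadics \<Longrightarrow> \<exists>a. (\<forall>i j. (\<lambda>n. Riemann_sum (r t n) (\<lambda>s. fst (x s) $ i) (\<lambda>s. fst (x s) $ j) t)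
      \<longlonglongrightarrow> a i j) \<and> snd (x t) = (1 / 2) *\<^sub>R carnot_W w a"
  shows "carnot_lift w r (\<lambda>t. fst (x t) + t *\<^sub>R v) = restrict (carnot_line_shift w v x) dyadics"
  unfolding carnot_lift_def
proof (rule restrict_ext)
  fix t assume t: "t \<in> dyadics"
  have cx: "continuous_on {0..1} x" using x by (simp add: topspace_path_space)
  have t01: "t \<in> {0..1}" by (rule dyadics_unit[OF t])
  obtain a where a: "\<And>i j. (\<lambda>n. Riemann_sum (r t n) (\<lambda>s. fst (x s) $ i) (\<lambda>s. fst (x s) $ j) t) \<longlonglongrightarrow> a i j"
    and snd: "snd (x t) = (1 / 2) *\<^sub>R carnot_W w a"
    using conv[OF t] by blast
  have rt: "filterlim (r t) at_top sequentially"
    by (rule filterlim_at_top_mono[OF filterlim_ident]) (use r[OF t] in auto)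
  define c where "c i j = rs_integral (\<lambda>s. fst (x s) $ i) (\<lambda>s. (s *\<^sub>R v) $ j) 0 t
        + rs_integral (\<lambda>s. (s *\<^sub>R v) $ i) (\<lambda>s. fst (x s) $ j) 0 t
        + rs_integral (\<lambda>s. (s *\<^sub>R v) $ i) (\<lambda>s. (s *\<^sub>R v) $ j) 0 t" for i j
  have "(\<lambda>n. Riemann_sum (r t n) (\<lambda>s. (fst (x s) + s *\<^sub>R v) $ i) (\<lambda>s. (fst (x s) + s *\<^sub>R v) $ j) t) \<longlonglongrightarrow> a i j + c i j" for i j
  proof -
    have "(\<lambda>n. Riemann_sum (r t n) (\<lambda>s. fst (x s) $ i) (\<lambda>s. fst (x s) $ j) t
        + Riemann_sum (r t n) (\<lambda>s. fst (x s) $ i) (\<lambda>s. (s *\<^sub>R v) $ j) t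
        + Riemann_sum (r t n) (\<lambda>s. (s *\<^sub>R v) $ i) (\<lambda>s. fst (x s) $ j) t
        + Riemann_sum (r t n) (\<lambda>s. (s *\<^sub>R v) $ i) (\<lambda>s. (s *\<^sub>R v) $ j) t)
      \<longlonglongrightarrow> a i j + rs_integral (\<lambda>s. fst (x s) $ i) (\<lambda>s. (s *\<^sub>R v) $ j) 0 t
        + rs_integral (\<lambda>s. (s *\<^sub>R v) $ i) (\<lambda>s. fst (x s) $ j) 0 t
        + rs_integral (\<lambda>s. (s *\<^sub>R v) $ i) (\<lambda>s. (s *\<^sub>R v) $ j) 0 t"
      by (intro tendsto_add a filterlim_compose[OF carnot_line_shift_terms(4)[OF cx t01] rt]
          filterlim_compose[OF carnot_line_shift_terms(5)[OF cx t01] rt]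
          filterlim_compose[OF carnot_line_shift_terms(6)[OF cx t01] rt])
    then show ?thesis
      unfolding vector_add_component Riemann_sum_add c_def by (simp only: add.assoc)
  qed
  from tendsto_scaleR[OF tendsto_const carnot_W_tendsto[OF this]]
  have "(\<lambda>n. (1 / 2) *\<^sub>R carnot_W w (\<lambda>i j. Riemann_sum (r t n) (\<lambda>s. (fst (x s) + s *\<^sub>R v) $ i) (\<lambda>s. (fst (x s) + s *\<^sub>R v) $ j) t))
      \<longlonglongrightarrow> (1 / 2) *\<^sub>R carnot_W w (\<lambda>i j. a i j + c i j)" .
  then have lim_eq: "lim (\<lambda>n. (1 / 2) *\<^sub>R carnot_W w (\<lambda>i j. Riemann_sum (r t n) (\<lambda>s. (fst (x s) + s *\<^sub>R v) $ i) (\<lambda>s. (fst (x s) + s *\<^sub>R v) $ j) t))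
      = (1 / 2) *\<^sub>R carnot_W w (\<lambda>i j. a i j + c i j)"
    by (rule limI)
  have "(1 / 2) *\<^sub>R carnot_W w (\<lambda>i j. a i j + c i j) = snd (x t) + (1 / 2) *\<^sub>R carnot_W w c"
    unfolding carnot_W_add snd scaleR_add_right ..
  then show "(fst (x t) + t *\<^sub>R v, lim (\<lambda>n. (1 / 2) *\<^sub>R carnot_W w (\<lambda>i j. Riemann_sum (r t n) (\<lambda>s. (fst (x s) + s *\<^sub>R v) $ i) (\<lambda>s. (fst (x s) + s *\<^sub>R v) $ j) t)))
      = carnot_line_shift w v x t"
    unfolding lim_eq carnot_line_shift_def carnot_shift_def c_def using t01 by simp
qed

text \<open>On the dyadic times, a path of the process and its shift are images of the first layer and of its shift under the
  same measurable map \<open>carnot_lift w r\<close>. So the statement follows from the one for Brownian motion on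
  the dyadic times, which determine the Borel sets of path space.\<close>

theorem carnot_quasi_invariance:
  fixes X :: "real \<Rightarrow> 'w \<Rightarrow> (real ^ 'm) \<times> (real ^ 'n)"
  assumes w: "carnot_constants w" and BM: "carnot_BM w M X" and A: "A \<in> sets (borel_of path_space)"
    and ae: "AE x in path_law M X. x \<in> A"
  shows "AE x in path_law M X. carnot_line_shift w v x \<in> A"
proof -
  note BMD = carnot_BM_D[OF BM]
  interpret prob_space M by (rule BMD(2))
  define x where "x \<omega> = (\<lambda>t\<in>{0..1}. X t \<omega>)" for \<omega>
  have x_meas: "x \<in> M \<rightarrow>\<^sub>M borel_of path_space"
    unfolding x_def[abs_def] by (rule path_law_measurable[OF BMD(3,4)]; assumption)
  have law: "path_law M X = distr M (borel_of path_space) x"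
    by (simp add: path_law_def x_def[abs_def])
  have x_path: "x \<omega> \<in> topspace path_space" if "\<omega> \<in> space M" for \<omega>
    using measurable_space[OF x_meas that] by simp
  have ae_x: "AE \<omega> in M. x \<omega> \<in> A"
    using ae unfolding law by (rule AE_distrD[OF x_meas])
  obtain A' where A': "A' \<in> sets (PiM dyadics (\<lambda>_. borel))"
    and A_iff: "\<And>x. x \<in> topspace path_space \<Longrightarrow> x \<in> A \<longleftrightarrow> restrict x dyadics \<in> A'"
    using borel_path_space_dyadic[OF A] by blast
  have "\<forall>t\<in>dyadics. \<exists>r. (\<forall>n. n \<le> r n) \<and> (AE \<omega> in M. \<exists>a. (\<forall>i j. (\<lambda>n. Riemann_sum (r n) (\<lambda>s. fst (X s \<omega>) $ i) (\<lambda>s. fst (X s \<omega>) $ j) t)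
      \<longlonglongrightarrow> a i j) \<and> snd (X t \<omega>) = (1 / 2) *\<^sub>R carnot_W w a)"
    using carnot_area_Riemann_sums[OF BM] dyadics_unit by blast
  from bchoice[OF this] obtain r where R: "\<forall>t\<in>dyadics. (\<forall>n. n \<le> r t n) \<and> (AE \<omega> in M. \<exists>a. (\<forall>i j. (\<lambda>n. Riemann_sum (r t n) (\<lambda>s. fst (X s \<omega>) $ i) (\<lambda>s. fst (X s \<omega>) $ j) t)
      \<longlonglongrightarrow> a i j) \<and> snd (X t \<omega>) = (1 / 2) *\<^sub>R carnot_W w a)"
    by (rule exE)
  have r: "\<And>t n. t \<in> dyadics \<Longrightarrow> n \<le> r t n"
    and r_ae: "\<And>t. t \<in> dyadics \<Longrightarrow> AE \<omega> in M. \<exists>a. (\<forall>i j. (\<lambda>n. Riemann_sum (r t n) (\<lambda>s. fst (X s \<omega>) $ i) (\<lambda>s. fst (X s \<omega>) $ j) t)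
      \<longlonglongrightarrow> a i j) \<and> snd (X t \<omega>) = (1 / 2) *\<^sub>R carnot_W w a"
    using R by blast+
  have conv: "AE \<omega> in M. \<forall>t\<in>dyadics. \<exists>a. (\<forall>i j. (\<lambda>n. Riemann_sum (r t n) (\<lambda>s. fst (x \<omega> s) $ i) (\<lambda>s. fst (x \<omega> s) $ j) t)
      \<longlonglongrightarrow> a i j) \<and> snd (x \<omega> t) = (1 / 2) *\<^sub>R carnot_W w a"
  proof (subst AE_ball_countable[OF countable_dyadics], rule ballI)
    fix t assume t: "t \<in> dyadics"
    have "Riemann_sum n (\<lambda>s. fst (x \<omega> s) $ i) (\<lambda>s. fst (x \<omega> s) $ j) t
        = Riemann_sum n (\<lambda>s. fst (X s \<omega>) $ i) (\<lambda>s. fst (X s \<omega>) $ j) t" for n i j \<omega>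
      unfolding x_def using dyadics_unit[OF dyadics_grid[OF t]]
      by (intro Riemann_sum_cong) (simp_all only: restrict_apply if_True)
    moreover have "x \<omega> t = X t \<omega>" for \<omega> using dyadics_unit[OF t] by (simp add: x_def)
    ultimately show "AE \<omega> in M. \<exists>a. (\<forall>i j. (\<lambda>n. Riemann_sum (r t n) (\<lambda>s. fst (x \<omega> s) $ i) (\<lambda>s. fst (x \<omega> s) $ j) t)
      \<longlonglongrightarrow> a i j) \<and> snd (x \<omega> t) = (1 / 2) *\<^sub>R carnot_W w a"
      using r_ae[OF t] by (simp only:)
  qed
  have lift: "AE \<omega> in M. \<forall>u. carnot_lift w r (\<lambda>t\<in>dyadics. fst (X t \<omega>) + t *\<^sub>R u) = restrict (carnot_line_shift w u (x \<omega>)) dyadics"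
    using conv AE_space
  proof eventually_elim
    case (elim \<omega>)
    have "carnot_lift w r (\<lambda>t\<in>dyadics. fst (X t \<omega>) + t *\<^sub>R u) = restrict (carnot_line_shift w u (x \<omega>)) dyadics" for u
    proof -
      have "(\<lambda>t\<in>dyadics. fst (X t \<omega>) + t *\<^sub>R u) = restrict (\<lambda>t. fst (x \<omega> t) + t *\<^sub>R u) dyadics"
        using dyadics_unit by (intro restrict_ext) (simp add: x_def)
      then show ?thesis
        using carnot_lift_shift[OF x_path[OF elim(2)] r elim(1)[rule_format]]
        by (simp only: carnot_lift_restrict)
    qed
    then show ?case by blast
  qed
  define S where "S = carnot_lift w r -` A' \<inter> space (PiM dyadics (\<lambda>_. borel))"
  have S: "S \<in> sets (PiM dyadics (\<lambda>_. borel))"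
    unfolding S_def by (rule measurable_sets[OF carnot_lift_measurable A'])
  have space: "(\<lambda>t\<in>dyadics. f t) \<in> space (PiM dyadics (\<lambda>_. borel))" for f :: "real \<Rightarrow> real ^ 'm"
    by (simp add: space_PiM)
  have line0: "restrict (carnot_line_shift w 0 y) dyadics = restrict y dyadics" if y: "y \<in> topspace path_space" for y
  proof (rule restrict_ext)
    fix t assume "t \<in> dyadics"
    then have t: "t \<in> {0..1}" by (rule dyadics_unit)
    have cy: "continuous_on {0..1} y" using y by (simp add: topspace_path_space)
    have "carnot_bracket w a 0 = 0" for a using carnot_bracket_linear(4)[of w a 0 0] by simp
    then show "carnot_line_shift w 0 y t = y t" by (simp add: carnot_line_shift_eq[OF w cy t])
  qed
  have "AE \<omega> in M. (\<lambda>t\<in>dyadics. fst (X t \<omega>)) \<in> S"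
    using lift ae_x AE_space
  proof eventually_elim
    case (elim \<omega>)
    have "carnot_lift w r (\<lambda>t\<in>dyadics. fst (X t \<omega>)) = restrict (x \<omega>) dyadics"
      using elim(1)[rule_format, of 0] line0[OF x_path[OF elim(3)]] by simp
    then show ?case
      unfolding S_def using A_iff[OF x_path[OF elim(3)]] elim(2) space by simp
  qed
  from dyadic_quasi_invariance[OF BMD(1) S this, of v]
  have "AE \<omega> in M. carnot_line_shift w v (x \<omega>) \<in> A"
    using lift AE_space
  proof eventually_elim
    case (elim \<omega>)
    have "restrict (carnot_line_shift w v (x \<omega>)) dyadics \<in> A'"
      using elim(1) elim(2)[rule_format, of v] by (simp add: S_def)
    then show ?case
      using A_iff[OF carnot_line_shift_path[OF w x_path[OF elim(3)]]] by blast
  qed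
  moreover have "{y \<in> space (borel_of path_space). carnot_line_shift w v y \<in> A} \<in> sets (borel_of path_space)"
  proof -
    have "carnot_line_shift w v \<in> borel_of path_space \<rightarrow>\<^sub>M borel_of path_space"
    proof (rule measurable_into_path_space)
      show "carnot_line_shift w v y \<in> topspace path_space" if "y \<in> space (borel_of path_space)" for y
        using that by (intro carnot_line_shift_path[OF w]) simp
      show "(\<lambda>y. carnot_line_shift w v y t) \<in> borel_measurable (borel_of path_space)" if t: "t \<in> {0..1}" for t
        by (rule carnot_line_shift_measurable[OF w t])
    qed
    from measurable_sets[OF this A]
    have "carnot_line_shift w v -` A \<inter> space (borel_of path_space) \<in> sets (borel_of path_space)" .
    also have "carnot_line_shift w v -` A \<inter> space (borel_of path_space)
        = {y \<in> space (borel_of path_space). carnot_line_shift w v y \<in> A}" by blast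
    finally show ?thesis .
  qed
  ultimately show ?thesis
    unfolding law by (subst AE_distr_iff[OF x_meas])
qed

section \<open>No weight for the Carnot--Caratheodory distance\<close>

lemma carnot_bracket_norm_le:
  "norm (carnot_bracket w a b) \<le> (\<Sum>i\<in>UNIV. \<Sum>j\<in>UNIV. norm (w i j)) * (norm a * norm b)"
proof -
  have "norm (carnot_bracket w a b) \<le> (\<Sum>i\<in>UNIV. \<Sum>j\<in>UNIV. norm ((a $ i * b $ j) *\<^sub>R w i j))"
    unfolding carnot_bracket_def carnot_W_def
    by (rule order_trans[OF norm_sum sum_mono]) (rule norm_sum)
  also have "\<dots> \<le> (\<Sum>i\<in>UNIV. \<Sum>j\<in>UNIV. norm (w i j) * (norm a * norm b))"
  proof (intro sum_mono)
    fix i j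
    have "\<bar>a $ i\<bar> * \<bar>b $ j\<bar> \<le> norm a * norm b"
      by (intro mult_mono component_le_norm_cart) auto
    then show "norm ((a $ i * b $ j) *\<^sub>R w i j) \<le> norm (w i j) * (norm a * norm b)"
      by (simp add: abs_mult mult.commute mult_left_mono)
  qed
  finally show ?thesis by (simp add: sum_distrib_right)
qed

text \<open>Along a horizontal curve of length \<open>l\<close> the first layer stays within distance \<open>l\<close> of its starting point. The
  second layer, seen from the starting point, is the integral of half the bracket of that displacement with the
  velocity and hence of order \<open>l\<^sup>2\<close>. The summand \<open>1\<close> in \<open>C\<close> keeps the divisor positive.\<close>

lemma d_cc_lower_bound:
  fixes w :: "'m::finite \<Rightarrow> 'm \<Rightarrow> real ^ 'n"
  defines "C \<equiv> (\<Sum>i\<in>UNIV. \<Sum>j\<in>UNIV. norm (w i j)) + 1"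
  shows "ennreal (sqrt (norm (snd y - snd x - (1 / 2) *\<^sub>R carnot_bracket w (fst x) (fst y - fst x)) / C)) \<le> d_cc w x y"
  unfolding d_cc_def
proof (rule INF_greatest, clarify)
  fix \<gamma> g assume h: "horizontal w \<gamma> g" and ends: "x = \<gamma> 0" "y = \<gamma> 1"
  let ?p = "\<lambda>t. fst (\<gamma> t)" and ?q = "\<lambda>t. fst (g t)"
  have \<gamma>: "has_ac_derivative \<gamma> g"
    and ae: "AE t in lborel. t \<in> {0..1} \<longrightarrow> snd (g t) = (1/2) *\<^sub>R carnot_bracket w (?p t) (?q t)"
    using h by (auto simp: horizontal_def carnot_bracket_def)
  have pq: "has_ac_derivative ?p ?q" by (rule ac_derivative_bounded_linear[OF bounded_linear_fst \<gamma>])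
  have sq: "has_ac_derivative (\<lambda>t. snd (\<gamma> t)) (\<lambda>t. snd (g t))"
    by (rule ac_derivative_bounded_linear[OF bounded_linear_snd \<gamma>])
  have q: "set_integrable lborel {0..1} ?q" and s: "set_integrable lborel {0..1} (\<lambda>t. snd (g t))"
    by (rule ac_derivativeD(1)[OF pq], rule ac_derivativeD(1)[OF sq])
  have nq: "set_integrable lborel {0..1} (\<lambda>t. norm (?q t))" using q by (rule set_integrable_norm)
  define l where "l = (LINT t:{0..1}|lborel. norm (?q t))"
  have l: "0 \<le> l" unfolding l_def set_lebesgue_integral_def by (intro integral_nonneg_AE) auto
  have len: "(\<integral>\<^sup>+ t\<in>{0..1}. ennreal (norm (?q t)) \<partial>lborel) = ennreal l"
  proof -
    have "(\<integral>\<^sup>+ t\<in>{0..1}. ennreal (norm (?q t)) \<partial>lborel) = (\<integral>\<^sup>+ t. ennreal (indicat_real {0..1} t *\<^sub>R norm (?q t)) \<partial>lborel)"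
      by (intro nn_integral_cong) (auto simp: indicator_def)
    also have "\<dots> = ennreal l"
      unfolding l_def set_lebesgue_integral_def
      using nq[unfolded set_integrable_def] by (intro nn_integral_eq_integral) auto
    finally show ?thesis .
  qed
  have dist_p: "norm (?p t - fst x) \<le> l" if t: "t \<in> {0..1}" for t
  proof -
    have qt: "set_integrable lborel {0..t} ?q" using t by (intro set_integrable_subset[OF q]) auto
    have nqt: "set_integrable lborel {0..t} (\<lambda>t. norm (?q t))" using qt by (rule set_integrable_norm)
    have "?p t - fst x = (LINT s:{0..t}|lborel. ?q s)"
      using ac_derivativeD(2)[OF pq t] ends(1) by (simp only: add_diff_cancel_left')
    then have "norm (?p t - fst x) \<le> (LINT s:{0..t}|lborel. norm (?q s))"
      using set_integral_norm_bound[OF qt] by (simp only:)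
    also have "\<dots> \<le> l"
      unfolding l_def set_lebesgue_integral_def
      using t nq nqt by (intro integral_mono) (auto simp: set_integrable_def indicator_def)
    finally show ?thesis .
  qed
  define F where "F t = snd (g t) - (1/2) *\<^sub>R carnot_bracket w (fst x) (?q t)" for t
  note br = LINT_bounded_linear[OF carnot_bracket_bounded_linear(1)[of w "fst x"] q]
  have br': "set_integrable lborel {0..1} (\<lambda>t. (1/2) *\<^sub>R carnot_bracket w (fst x) (?q t))"
    "(LINT t:{0..1}|lborel. (1/2) *\<^sub>R carnot_bracket w (fst x) (?q t)) = (1/2) *\<^sub>R carnot_bracket w (fst x) (LINT t:{0..1}|lborel. ?q t)"
    using LINT_bounded_linear[OF bounded_linear_scaleR_right[of "1/2"] br(1)] by (simp_all only: br(2))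
  have F: "set_integrable lborel {0..1} F" unfolding F_def by (rule set_integral_diff(1)[OF s br'(1)])
  have "(LINT t:{0..1}|lborel. F t) = (LINT t:{0..1}|lborel. snd (g t)) - (1/2) *\<^sub>R carnot_bracket w (fst x) (LINT t:{0..1}|lborel. ?q t)"
    unfolding F_def set_integral_diff(2)[OF s br'(1)] br'(2) ..
  also have "(LINT t:{0..1}|lborel. snd (g t)) = snd y - snd x"
    using ac_derivativeD(2)[OF sq, of 1] ends by simp
  also have "(LINT t:{0..1}|lborel. ?q t) = fst y - fst x"
    using ac_derivativeD(2)[OF pq, of 1] ends by simp
  finally have LF: "(LINT t:{0..1}|lborel. F t) = snd y - snd x - (1/2) *\<^sub>R carnot_bracket w (fst x) (fst y - fst x)" .
  have C1: "1 \<le> C" unfolding C_def by (simp add: sum_nonneg)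
  have F_le: "AE t in lborel. indicat_real {0..1} t *\<^sub>R norm (F t) \<le> indicat_real {0..1} t *\<^sub>R (C * l * norm (?q t))"
    using ae
  proof eventually_elim
    case (elim t)
    show ?case
    proof (cases "t \<in> {0..1}")
      case True
      have "F t = (1/2) *\<^sub>R carnot_bracket w (?p t - fst x) (?q t)"
        using elim True by (simp add: F_def carnot_bracket_linear scaleR_diff_right)
      then have "norm (F t) \<le> norm (carnot_bracket w (?p t - fst x) (?q t))" by simp
      also have "\<dots> \<le> (\<Sum>i\<in>UNIV. \<Sum>j\<in>UNIV. norm (w i j)) * (norm (?p t - fst x) * norm (?q t))"
        by (rule carnot_bracket_norm_le)
      also have "\<dots> \<le> C * (l * norm (?q t))"
        using dist_p[OF True] l C1 by (intro mult_mono mult_right_mono) (auto simp: C_def)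
      finally show ?thesis using True by (simp add: mult.assoc)
    qed simp
  qed
  have "norm (LINT t:{0..1}|lborel. F t) \<le> (LINT t:{0..1}|lborel. norm (F t))"
    by (rule set_integral_norm_bound[OF F])
  also have "\<dots> \<le> (LINT t:{0..1}|lborel. C * l * norm (?q t))"
    unfolding set_lebesgue_integral_def
    using set_integrable_norm[OF F] set_integrable_mult_right[of "C * l" lborel "{0..1}" "\<lambda>t. norm (?q t)"] nq
    by (intro integral_mono_AE F_le) (auto simp: set_integrable_def)
  also have "\<dots> = C * l\<^sup>2" by (simp add: l_def power2_eq_square)
  finally have "norm (LINT t:{0..1}|lborel. F t) / C \<le> l\<^sup>2"
    using C1 by (simp add: divide_le_eq mult.commute)
  then have "sqrt (norm (LINT t:{0..1}|lborel. F t) / C) \<le> l"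
    using l by (intro real_le_lsqrt) auto
  then show "ennreal (sqrt (norm (snd (\<gamma> 1) - snd (\<gamma> 0) - (1 / 2) *\<^sub>R carnot_bracket w (fst (\<gamma> 0)) (fst (\<gamma> 1) - fst (\<gamma> 0))) / C))
      \<le> (\<integral>\<^sup>+ t\<in>{0..1}. ennreal (norm (?q t)) \<partial>lborel)"
    unfolding len using LF ends by (intro ennreal_leI) simp
qed

lemma cm_norm_line: "(\<lambda>t. t *\<^sub>R v) \<in> cameron_martin" "cm_norm (\<lambda>t. t *\<^sub>R v) = norm v"
proof -
  have ac: "has_ac_derivative (\<lambda>t. t *\<^sub>R v) (\<lambda>t. v)"
    using ac_derivative_affine[of 0 v] by simp
  have v2: "set_integrable lborel {0..1::real} (\<lambda>t. (norm v)\<^sup>2)"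
    by (rule borel_integrable_atLeastAtMost') (rule continuous_on_const)
  show cm: "(\<lambda>t. t *\<^sub>R v) \<in> cameron_martin"
    unfolding cameron_martin_def using ac v2 by auto
  obtain g where g: "has_ac_derivative (\<lambda>t. t *\<^sub>R v) g" "set_integrable lborel {0..1} (\<lambda>t. (norm (g t))\<^sup>2)"
    and norm: "cm_norm (\<lambda>t. t *\<^sub>R v) = sqrt (LINT t:{0..1}|lborel. (norm (g t))\<^sup>2)"
    using cameron_martin_obtain[OF cm] by blast
  have "(LINT t:{0..1}|lborel. (norm (g t))\<^sup>2) = (LINT t:{0..1::real}|lborel. (norm v)\<^sup>2)"
    unfolding set_lebesgue_integral_def
  proof (rule Bochner_Integration.integral_cong_AE)
    show "AE t in lborel. indicat_real {0..1} t *\<^sub>R (norm (g t))\<^sup>2 = indicat_real {0..1} t *\<^sub>R (norm v)\<^sup>2"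
      using ac_derivative_unique[OF g(1) ac] by eventually_elim (auto simp: indicator_def)
  qed (rule borel_measurable_integrable[OF g(2)[unfolded set_integrable_def]],
      rule borel_measurable_integrable[OF v2[unfolded set_integrable_def]])
  also have "\<dots> = (norm v)\<^sup>2" by (simp add: set_lebesgue_integral_def)
  finally show "cm_norm (\<lambda>t. t *\<^sub>R v) = norm v" by (simp add: norm)
qed

text \<open>The first layer determines the shift on the unit interval.\<close>

lemma carnot_line_shift_cost: "shift_cost (carnot_shift w) x (carnot_line_shift w v x) = ennreal (norm v)"
proof -
  let ?P = "\<lambda>h. h \<in> cameron_martin \<and> carnot_line_shift w v x = carnot_shift w h x"
  have P: "?P (\<lambda>t. t *\<^sub>R v)" by (simp add: cm_norm_line carnot_line_shift_def)
  have h: "?P (SOME h. ?P h)" by (rule someI[of ?P, OF P])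
  have "(SOME h. ?P h) t = t *\<^sub>R v" if t: "t \<in> {0..1}" for t
  proof -
    have "carnot_shift w (SOME h. ?P h) x = carnot_shift w (\<lambda>t. t *\<^sub>R v) x"
      by (rule trans[OF h[THEN conjunct2, symmetric] P[THEN conjunct2]])
    then have "fst (carnot_shift w (SOME h. ?P h) x t) = fst (carnot_shift w (\<lambda>t. t *\<^sub>R v) x t)"
      by (rule arg_cong)
    then show ?thesis using t unfolding carnot_shift_def by simp
  qed
  then have "cm_norm (SOME h. ?P h) = norm v"
    unfolding cm_norm_line(2)[symmetric] by (rule cm_norm_cong)
  then show ?thesis
    using P unfolding shift_cost_def by auto
qed

lemma first_layer_integral_line_shift:
  assumes w: "carnot_constants w" and x: "x \<in> topspace path_space"
  shows "first_layer_integral (carnot_line_shift w v x) 1 = first_layer_integral x 1 + (1 / 2) *\<^sub>R v"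
proof -
  have cx: "continuous_on {0..1} x" using x by (simp add: topspace_path_space)
  have id: "(LINT s:{0..1}|lborel. s) = (1 / 2 :: real)"
    using integral_power[of 0 1 1] by (simp add: set_lebesgue_integral_def mult.commute)
  have i1: "set_integrable lborel {0..1} (\<lambda>s. fst (x s) $ i)" for i
    unfolding set_integrable_def by (intro borel_integrable_compact compact_Icc continuous_intros cx)
  have i2: "set_integrable lborel {0..1} (\<lambda>s. s * v $ i)" for i
    unfolding set_integrable_def by (intro borel_integrable_compact compact_Icc continuous_intros)
  have "(LINT s:{0..1}|lborel. fst (carnot_line_shift w v x s) $ i) = (LINT s:{0..1}|lborel. fst (x s) $ i) + (1 / 2) * v $ i" for i
  proof -
    have "(LINT s:{0..1}|lborel. fst (carnot_line_shift w v x s) $ i) = (LINT s:{0..1}|lborel. fst (x s) $ i + s * v $ i)"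
      by (intro set_lebesgue_integral_cong) (auto simp: carnot_line_shift_eq[OF w cx])
    also have "\<dots> = (LINT s:{0..1}|lborel. fst (x s) $ i) + (LINT s:{0..1}|lborel. s * v $ i)"
      by (rule set_integral_add(2)[OF i1 i2])
    also have "(LINT s:{0..1}|lborel. s * v $ i) = (LINT s:{0..1}|lborel. s) * v $ i"
      by (rule set_integral_mult_left)
    finally show ?thesis by (simp only: id)
  qed
  then show ?thesis by (simp add: first_layer_integral_def vec_eq_iff)
qed

text \<open>A weight is almost surely bounded by a constant \<open>K\<close>, as the exponent for \<open>p = 2\<close> is infinite. Compare a path
  \<open>x\<close> with its shift by \<open>\<lambda>t. t *\<^sub>R v\<close>, which also lies in the set where the weight is effective because the shift
  is quasi-invariant. Seen from \<open>x 1\<close>, the shifted end point has the second layer \<open>carnot_bracket w (a x) v\<close>, and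
  its distance to \<open>x 1\<close> is at least of order of the square root of the norm of this vector. So that norm is bounded by a
  multiple of \<open>K\<^sup>2 * (norm v)\<^sup>2\<close>. The bracket is linear in \<open>v\<close>, and letting \<open>v\<close> tend to \<open>0\<close> along an axis
  shows that it vanishes on the axes. Shifting once more by a
  coordinate line changes \<open>a x\<close> by half a unit vector and turns this into \<open>w i j = 0\<close> for all \<open>i\<close> and \<open>j\<close>.\<close>

theorem no_carnot_contraction_weight:
  fixes X :: "real \<Rightarrow> 'w \<Rightarrow> (real ^ 'm::finite) \<times> (real ^ 'n)"
  assumes w: "carnot_constants w" and BM: "carnot_BM w M X"
  shows "\<not> (\<exists>L. contraction_weight (shift_cost (carnot_shift w)) (d_cc w) (path_law M X) time1 2 L)"
proof
  assume "\<exists>L. contraction_weight (shift_cost (carnot_shift w)) (d_cc w) (path_law M X) time1 2 L"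
  then obtain L where L: "contraction_weight (shift_cost (carnot_shift w)) (d_cc w) (path_law M X) time1 2 L" ..
  define \<eta> where "\<eta> = path_law M X"
  note BMD = carnot_BM_D[OF BM]
  have law: "prob_space \<eta>" "sets \<eta> = sets (borel_of path_space)" "space \<eta> = topspace path_space"
    unfolding \<eta>_def by (rule path_law_prob[OF BMD(2-4)]; assumption)+
  interpret \<eta>: prob_space \<eta> by (rule law)
  have L_meas[measurable]: "L \<in> borel_measurable \<eta>" using L by (simp add: contraction_weight_def \<eta>_def)
  obtain E0 where E0: "E0 \<in> sets \<eta>" "emeasure \<eta> E0 = 1"
    and le: "\<And>x y. x \<in> E0 \<Longrightarrow> y \<in> E0 \<Longrightarrow> d_cc w (time1 x) (time1 y) \<le> L x * shift_cost (carnot_shift w) x y"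
    using L unfolding contraction_weight_def \<eta>_def by blast
  have "contraction_exponent 2 = \<infinity>" by (simp add: contraction_exponent_def ennreal_divide_zero)
  then have "esssup \<eta> L < \<infinity>" using L by (simp add: contraction_weight_def Lq_norm_def \<eta>_def)
  then obtain K where K: "esssup \<eta> L = ennreal K" "0 \<le> K" by (cases "esssup \<eta> L") auto
  have L_le: "AE x in \<eta>. L x \<le> ennreal K" using esssup_AE[of L \<eta>] K by simp
  have ae0: "AE x in \<eta>. x \<in> E0" using E0 by (intro \<eta>.AE_prob_1) (auto simp: \<eta>.emeasure_eq_measure)
  have E0': "E0 \<in> sets (borel_of path_space)" using E0 law by simp
  define C where "C = (\<Sum>i\<in>UNIV. \<Sum>j\<in>UNIV. norm (w i j)) + 1"
  have C: "0 < C" unfolding C_def by (intro add_nonneg_pos sum_nonneg) auto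
  \<comment> \<open>the boundary terms of the shift and of the left translation by \<open>x 1\<close> add up to \<open>- fst (x 1)\<close>\<close>
  define a where "a x = first_layer_integral x 1 - fst (x 1)" for x :: "real \<Rightarrow> (real ^ 'm) \<times> (real ^ 'n)"
  have key: "AE x in \<eta>. norm (carnot_bracket w (a x) v) \<le> C * K\<^sup>2 * (norm v)\<^sup>2" for v
  proof -
    have "AE x in \<eta>. carnot_line_shift w v x \<in> E0"
      unfolding \<eta>_def by (rule carnot_quasi_invariance[OF w BM E0' ae0[unfolded \<eta>_def]])
    with ae0 L_le AE_space show ?thesis
    proof eventually_elim
      case (elim x)
      have x: "x \<in> topspace path_space" using elim law by simp
      have cx: "continuous_on {0..1} x" using x by (simp add: topspace_path_space)
      let ?y = "carnot_line_shift w v x"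
      have "d_cc w (x 1) (?y 1) \<le> L x * ennreal (norm v)"
        using le[OF elim(1) elim(4)] by (simp add: time1_def carnot_line_shift_cost)
      also have "\<dots> \<le> ennreal K * ennreal (norm v)" using elim by (intro mult_right_mono) auto
      also have "\<dots> = ennreal (K * norm v)" using K by (simp add: ennreal_mult)
      finally have d_le: "d_cc w (x 1) (?y 1) \<le> ennreal (K * norm v)" .
      have y1: "?y 1 = (fst (x 1) + v, snd (x 1) + (carnot_bracket w (first_layer_integral x 1) v - (1 / 2) *\<^sub>R carnot_bracket w (fst (x 1)) v))"
        using carnot_line_shift_eq[OF w cx, of 1 v] by simp
      have "snd (?y 1) - snd (x 1) - (1 / 2) *\<^sub>R carnot_bracket w (fst (x 1)) (fst (?y 1) - fst (x 1)) = carnot_bracket w (a x) v"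
        unfolding y1 a_def carnot_bracket_linear by (simp add: scaleR_add_left[symmetric])
      then have "ennreal (sqrt (norm (carnot_bracket w (a x) v) / C)) \<le> d_cc w (x 1) (?y 1)"
        using d_cc_lower_bound[of "?y 1" "x 1" w] by (simp add: C_def)
      then have "ennreal (sqrt (norm (carnot_bracket w (a x) v) / C)) \<le> ennreal (K * norm v)"
        using d_le by (rule order_trans)
      then have "sqrt (norm (carnot_bracket w (a x) v) / C) \<le> K * norm v"
        using K by (subst (asm) ennreal_le_iff) auto
      then have "norm (carnot_bracket w (a x) v) / C \<le> (K * norm v)\<^sup>2"
        by (rule sqrt_le_D)
      then show ?case using C by (simp add: divide_le_eq power_mult_distrib mult_ac)
    qed
  qed
  have zero: "AE x in \<eta>. carnot_bracket w (a x) (axis j 1) = 0" for j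
  proof -
    have "AE x in \<eta>. \<forall>n. norm (carnot_bracket w (a x) ((1 / real (Suc n)) *\<^sub>R axis j 1))
        \<le> C * K\<^sup>2 * (norm ((1 / real (Suc n)) *\<^sub>R axis j 1 :: real ^ 'm))\<^sup>2"
      by (subst AE_all_countable) (intro allI key)
    then show ?thesis
    proof eventually_elim
      case (elim x)
      have le: "norm (carnot_bracket w (a x) (axis j 1)) \<le> C * K\<^sup>2 * inverse (real (Suc n))" for n
      proof -
        define c where "c = 1 / real (Suc n)"
        have c: "0 < c" by (simp add: c_def)
        have "c * norm (carnot_bracket w (a x) (axis j 1)) \<le> c * (C * K\<^sup>2 * c)"
          using elim[rule_format, of n] c unfolding c_def[symmetric] carnot_bracket_linear
          by (simp add: power2_eq_square mult_ac)
        then have "norm (carnot_bracket w (a x) (axis j 1)) \<le> C * K\<^sup>2 * c"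
          using c by (simp only: mult_le_cancel_left_pos)
        then show ?thesis by (simp add: c_def inverse_eq_divide)
      qed
      have "(\<lambda>n. C * K\<^sup>2 * inverse (real (Suc n))) \<longlonglongrightarrow> C * K\<^sup>2 * 0"
        by (intro tendsto_mult tendsto_const LIMSEQ_inverse_real_of_nat)
      then have "norm (carnot_bracket w (a x) (axis j 1)) \<le> C * K\<^sup>2 * 0"
        by (rule LIMSEQ_le_const) (use le in auto)
      then show ?case by simp
    qed
  qed
  have "w i j = 0" for i j
  proof -
    define Z where "Z = {x \<in> space (borel_of path_space). carnot_bracket w (a x) (axis j 1) = 0}"
    have a_meas: "a \<in> borel_measurable (borel_of path_space)"
      unfolding a_def[abs_def]
      by (intro borel_measurable_diff first_layer_integral_measurable
          borel_measurable_continuous_on[OF continuous_on_fst[OF continuous_on_id] measurable_path_eval]) auto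
    have Z: "Z \<in> sets (borel_of path_space)"
      unfolding Z_def using carnot_bracket_measurable[OF a_meas, of w "axis j 1"] by measurable
    have "AE x in \<eta>. x \<in> Z"
      using zero[of j] AE_space by eventually_elim (use law in \<open>simp add: Z_def\<close>)
    then have "AE x in \<eta>. carnot_line_shift w (axis i 1) x \<in> Z"
      unfolding \<eta>_def by (rule carnot_quasi_invariance[OF w BM Z])
    then have "AE x in \<eta>. w i j = 0"
      using zero[of j] AE_space
    proof eventually_elim
      case (elim x)
      have x: "x \<in> topspace path_space" using elim law by simp
      have cx: "continuous_on {0..1} x" using x by (simp add: topspace_path_space)
      have "a (carnot_line_shift w (axis i 1) x) = a x - (1 / 2) *\<^sub>R axis i 1"
        unfolding a_def first_layer_integral_line_shift[OF w x]
        using carnot_line_shift_eq[OF w cx, of 1 "axis i 1"] by (simp add: vec_eq_iff)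
      then have "carnot_bracket w (a x - (1 / 2) *\<^sub>R axis i 1) (axis j 1) = 0"
        using elim(1) by (simp add: Z_def)
      then show ?case
        using elim(2) by (simp add: carnot_bracket_linear carnot_bracket_axis)
    qed
    then show ?thesis using \<eta>.AE_const by simp
  qed
  then have "range (\<lambda>(i, j). w i j) = {0}" by auto
  then have "span {0 :: real ^ 'n} = UNIV" using w by (simp add: carnot_constants_def)
  moreover have "(axis undefined 1 :: real ^ 'n) \<noteq> 0" by (simp add: axis_eq_0_iff)
  moreover have "span {0 :: real ^ 'n} = {0}" by simp
  ultimately show False by blast
qed

section \<open>The three implications\<close>

theorem theorem1p6:
  shows
    "(\<forall>(M :: 'w measure) (B :: real \<Rightarrow> 'w \<Rightarrow> real ^ 'd). standard_BM M B \<longrightarrow>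
        contraction_gives path_space cm_cost euclidean (\<lambda>x y. ennreal (dist x y))
          (path_law M B) time1 2 1 \<and>
        (\<forall>\<alpha>>0. transport_ineq path_space cm_cost 2 \<alpha> (path_law M B) \<longrightarrow>
          transport_ineq euclidean (\<lambda>x y. ennreal (dist x y)) 2 \<alpha> (distr (path_law M B) borel time1)))
   \<and> (\<forall>(w :: 'm::finite \<Rightarrow> 'm \<Rightarrow> real ^ 'n) (M :: 'w measure) X.
        carnot_constants w \<and> carnot_BM w M X \<longrightarrow>
        \<not> (\<exists>L. contraction_weight (shift_cost (carnot_shift w)) (d_cc w) (path_law M X) time1 2 L))
   \<and> (\<forall>\<epsilon>::real. 0 < \<epsilon> \<longrightarrow>
        (\<forall>p\<in>{1..<2}. \<exists>\<kappa>>0. \<forall>(M :: 'w measure) B X. heis_BM \<epsilon> M B X \<longrightarrow>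
           contraction_gives path_space (shift_cost (heis_shift \<epsilon>)) euclidean (d_heis \<epsilon>)
             (path_law M X) time1 p \<kappa> \<and>
           (\<forall>\<alpha>>0. transport_ineq path_space (shift_cost (heis_shift \<epsilon>)) 2 \<alpha> (path_law M X) \<longrightarrow>
              transport_ineq euclidean (d_heis \<epsilon>) p (\<alpha> * \<kappa>) (distr (path_law M X) borel time1))))"
proof (intro conjI allI impI ballI)
  fix M :: "'w measure" and B :: "real \<Rightarrow> 'w \<Rightarrow> real ^ 'd"
  assume BM: "standard_BM M B"
  show gives: "contraction_gives path_space cm_cost euclidean (\<lambda>x y. ennreal (dist x y)) (path_law M B) time1 2 1"
    by (rule Wiener_contraction_gives[OF BM])
  fix \<alpha> :: real assume "0 < \<alpha>" "transport_ineq path_space cm_cost 2 \<alpha> (path_law M B)"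
  from transport_ineq_time1[OF Wiener_contraction_gives[OF BM] _ _ this]
  show "transport_ineq euclidean (\<lambda>x y. ennreal (dist x y)) 2 \<alpha> (distr (path_law M B) borel time1)"
    by simp
next
  fix w :: "'m \<Rightarrow> 'm \<Rightarrow> real ^ 'n" and M :: "'w measure" and X
  assume "carnot_constants w \<and> carnot_BM w M X"
  then show "\<not> (\<exists>L. contraction_weight (shift_cost (carnot_shift w)) (d_cc w) (path_law M X) time1 2 L)"
    using no_carnot_contraction_weight by blast
next
  fix \<epsilon> p :: real assume \<epsilon>: "0 < \<epsilon>" and p: "p \<in> {1..<2}"
  then have p': "1 \<le> p" "p < 2" by auto
  obtain \<kappa> where \<kappa>: "0 < \<kappa>" and gives: "\<And>(M :: 'w measure) B X. heis_BM \<epsilon> M B X \<Longrightarrow>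
      contraction_gives path_space (shift_cost (heis_shift \<epsilon>)) euclidean (d_heis \<epsilon>) (path_law M X) time1 p \<kappa>"
    using heis_contraction_gives[OF \<epsilon> p', where 'w='w] by blast
  show "\<exists>\<kappa>>0. \<forall>(M :: 'w measure) B X. heis_BM \<epsilon> M B X \<longrightarrow>
           contraction_gives path_space (shift_cost (heis_shift \<epsilon>)) euclidean (d_heis \<epsilon>)
             (path_law M X) time1 p \<kappa> \<and>
           (\<forall>\<alpha>>0. transport_ineq path_space (shift_cost (heis_shift \<epsilon>)) 2 \<alpha> (path_law M X) \<longrightarrow>
              transport_ineq euclidean (d_heis \<epsilon>) p (\<alpha> * \<kappa>) (distr (path_law M X) borel time1))"
  proof (intro exI[of _ \<kappa>] conjI allI impI \<kappa>)
    fix M :: "'w measure" and B X assume BM: "heis_BM \<epsilon> M B X"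
    show "contraction_gives path_space (shift_cost (heis_shift \<epsilon>)) euclidean (d_heis \<epsilon>) (path_law M X) time1 p \<kappa>"
      by (rule gives[OF BM])
    fix \<alpha> :: real
    assume "0 < \<alpha>" "transport_ineq path_space (shift_cost (heis_shift \<epsilon>)) 2 \<alpha> (path_law M X)"
    then show "transport_ineq euclidean (d_heis \<epsilon>) p (\<alpha> * \<kappa>) (distr (path_law M X) borel time1)"
      using p' by (intro transport_ineq_time1[OF gives[OF BM]]) auto
  qed
qed

end
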